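(* Let $Z=\operatorname{Spec}(A)\subseteq\mathbb{A}^n$ be a finite subscheme of degree $d$ supported only at the origin, where $A$ is local with maximal ideal $\mathfrak{m}$, and let $s=\max\{i\colon\mathfrak{m}^i\neq0\}$. Let $q\colon\omega_Z\to\mathcal{O}_Z$ be an orientation. For $\delta\ge0$ let $$I_\delta=\bigoplus_{i\ge0}\frac{\mathfrak{m}^i\cap(0:\mathfrak{m}^{s+1-i-\delta})+\mathfrak{m}^{i+1}}{\mathfrak{m}^{i+1}}\simeq\bigoplus_{i\ge0}\frac{\mathfrak{m}^i\cap(0:\mathfrak{m}^{s+1-i-\delta})}{\mathfrak{m}^{i+1}\cap(0:\mathfrak{m}^{s+1-i-\delta})},$$ which are ideals of $\operatorname{gr}(A)$ with $\operatorname{gr}(A)=I_0\supseteq I_1\supseteq\ldots\supseteq I_{s+1}=0$. Then the limit $\lim_{t\to\infty}t\cdot([Z],[q])$ in $\operatorname{Iar}_d(\mathbb{A}^n)$ is given by $(Z_\bullet,[q_\bullet])$, where $Z_\bullet$ is a flag of subschemes $\mathbb{A}^n\supseteq Z_0\supsetneq Z_1\supsetneq\ldots$ with $Z_0\simeq\operatorname{Spec}(\operatorname{gr}(A))$, which is obtained from the chain of closed subschemes of $\operatorname{Spec}(\operatorname{gr}(A))$ $$\operatorname{Spec}(\operatorname{gr}(A))=V(I_{s+1})\supseteq V(I_s)\supseteq\ldots\supseteq V(I_1)\supseteq V(I_0)=\emptyset$$ by removing repetitions (and the final empty scheme); and the members of $[q_\bullet]$, listed in decreasing order of those $\delta$ for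 which $I_\delta\neq I_{\delta+1}$, are classes of symmetric $\operatorname{gr}(A)$-module isomorphisms $$\left(\frac{I_\delta}{I_{\delta+1}}\right)^\vee\to\frac{I_\delta}{I_{\delta+1}}$$ which prove that the subquotient $$\frac{I_\delta}{I_{\delta+1}}\simeq\bigoplus_{i\ge0}\frac{\mathfrak{m}^i\cap(0:\mathfrak{m}^{s+1-i-\delta})}{\mathfrak{m}^{i+1}\cap(0:\mathfrak{m}^{s+1-i-\delta})+\mathfrak{m}^i\cap(0:\mathfrak{m}^{s-i-\delta})}=\mathcal{Q}(\delta)$$ is self-dual.
   Context: Throughout, $\Bbbk$ is a field of characteristic different from $2$ and $d\ge1$. $\omega_Z=\mathcal{O}_Z^\vee=\operatorname{Hom}_\Bbbk(\mathcal{O}_Z,\Bbbk)$ is the dualising module; an orientation is an isomorphism of $\mathcal{O}_Z$-modules $q\colon\omega_Z\to\mathcal{O}_Z$ (it is automatically symmetric, and exists exactly when $Z$ is Gorenstein). $(0:J)$ is the annihilator in $A$ of the ideal $J$; $\mathfrak{m}^j=A$ for $j\le0$. $\operatorname{gr}(A)=\bigoplus_i\mathfrak{m}^i/\mathfrak{m}^{i+1}$. $\mathcal{Q}(\delta)$ denotes the graded $\operatorname{gr}(A)$-module displayed in the claim (the $\delta$-th piece of Iarrobino's symmetric decomposition). For a finite-length module $M$, $M^\vee=\operatorname{Hom}_\Bbbk(M,\Bbbk)$ with the contraction action; $M$ is self-dual if $M\simeq M^\vee$ as modules. Completed quadrics. Let $V$ be a $\Bbbk$-vector space of dimension $d$.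 An element $q\in\operatorname{Sym}^2V$ is identified with a linear map $q\colon V^\vee\to V$ with $q^\top=q$. $\mathbb{P}(\operatorname{Sym}^2V)$ parameterises nonzero quadrics $[q]$ up to scalars and $\mathbb{P}(\operatorname{Sym}^2V)^{\mathrm{full\,rk}}$ is its open subset of quadrics of rank $d$. The variety of completed quadrics $\operatorname{CQ}(V)$ is the closure of the image of the embedding $\mathbb{P}(\operatorname{Sym}^2V)^{\mathrm{full\,rk}}\to\prod_{i=1}^d\mathbb{P}(\operatorname{Sym}^2\Lambda^iV)$, $[q]\mapsto([q],[\Lambda^2q],\ldots,[\Lambda^dq])$. It is smooth and projective. For a field $K\supseteq\Bbbk$ its $K$-points are the broken quadrics $[q_\bullet]=([q_0],\ldots,[q_k])$ on $V_K$: here $q_0\colon V_K^\vee\to V_K$ and $q_i\colon\ker q_{i-1}\to\operatorname{coker}q_{i-1}=(\ker q_{i-1})^\vee$ for $i\ge1$ are nonzero symmetric maps, each up to scalar, and $q_k$ (and only it) has full rank. It corresponds to the point $([q_0],\ldots,[\det q_0],[\det q_0\wedge q_1],\ldots,[\det q_0\wedge\det q_1],[\det q_0\wedge\det q_1\wedge q_2],\ldots)$, where $\det q=\Lambda^{\operatorname{rk}q}q$. The associated flag is $F_0=V^\vee$, $F_i=\ker q_{i-1}$; $q_i$ induces a full rank quadric on $F_i/F_{i+1}$. For a locally free sheaf $\mathcal{V}$ of rank $d$ on a scheme $B$, $\operatorname{CQ}(\mathcal{V})\to B$ is the analogous relative construction; it commutes with base change. Compatibility. $x\in\operatorname{End}(V)$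 is compatible with $[q_\bullet]$ if $x^\top(F_i)\subseteq F_i$ for all $i\ge0$ and, for every $i$, the induced endomorphism $\bar x=x^\top|_{F_i/F_{i+1}}$ satisfies $\bar q(\bar x(-),-)=\bar q(-,\bar x(-))$ for the full rank quadric $\bar q=q_i|_{F_i/F_{i+1}}$. The compatible bundle $\mathcal{C}\subseteq\operatorname{End}(V)\times\operatorname{CQ}(V)$ is the unique vector subbundle (of rank $\binom{d+1}{2}$) whose fibre over every (geometric) point $[q_\bullet]$ is the space of endomorphisms compatible with $[q_\bullet]$; it globalises to $\mathcal{C}\subseteq\operatorname{End}(\mathcal{V})\times_B\operatorname{CQ}(\mathcal{V})$. Iarrobino scheme of $X=\mathbb{A}^n=\operatorname{Spec}S$. Let $\mathcal{U}$ be the pushforward to $\operatorname{Hilb}_d(X)$ of the structure sheaf of the universal family. $\operatorname{Iar}_d(X)\subseteq\operatorname{CQ}(\mathcal{U})$ is the closed subscheme where the multiplication morphism $S\times\operatorname{CQ}(\mathcal{U})\to\operatorname{End}(\mathcal{U})\times_{\operatorname{Hilb}_d(X)}\operatorname{CQ}(\mathcal{U})$ becomes zero modulo $\mathcal{C}$. Its $\Bbbk$-points correspond bijectively to pairs $(Z_\bullet,[q_\bullet])$, where $X\supseteq Z_0\supsetneq Z_1\supsetneq\ldots\supsetneq Z_k$ are zero-dimensional subschemes, $\deg Z_0=d$, $Z_{k+1}:=\emptyset$, and $[q_i]$, $0\le i\le k$, are classes up to scalar of $\mathcal{O}_X$-module isomorphisms $q_i\colon(I_{Z_{i+1}}/I_{Z_i})^\vee\to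 I_{Z_{i+1}}/I_{Z_i}$ with $q_i^\top=q_i$: given a compatible broken quadric $[q_\bullet]$ on $V=\mathcal{O}_{Z_0}$, the subscheme $Z_i$ ($i\ge1$) is defined by the quotient $\mathcal{O}_{Z_0}\twoheadrightarrow\operatorname{coker}q_{i-1}$. A pair $([Z],[q])$ with $q$ an orientation is a point with $k=0$. The torus $\mathbb{G}_{\mathrm m}$ acts on $\mathbb{A}^n$ by $t\cdot(x_1,\ldots,x_n)=(tx_1,\ldots,tx_n)$ and hence on $\operatorname{Iar}_d(\mathbb{A}^n)$. *)

theory Defs
  imports
    "HOL-Library.Poly_Mapping"
    "HOL-Library.FuncSet"
    "HOL-Algebra.Module"
    "HOL-Algebra.QuotRing"
    "HOL-Algebra.Ideal_Product"
    "HOL-Algebra.Algebraic_Closure_Type"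
    "Jordan_Normal_Form.Determinant"
begin

section \<open>Modules over rings with a structure map from a field\<close>

definition module_iso ::
  "('a, 'm) ring_scheme \<Rightarrow> ('a, 'b) module \<Rightarrow> ('a, 'c) module \<Rightarrow> ('b \<Rightarrow> 'c) \<Rightarrow> bool" where
  "module_iso R M N f \<longleftrightarrow>
     bij_betw f (carrier M) (carrier N) \<and>
     (\<forall>x\<in>carrier M. \<forall>y\<in>carrier M. f (x \<oplus>\<^bsub>M\<^esub> y) = f x \<oplus>\<^bsub>N\<^esub> f y) \<and>
     (\<forall>r\<in>carrier R. \<forall>x\<in>carrier M. f (r \<odot>\<^bsub>M\<^esub> x) = r \<odot>\<^bsub>N\<^esub> f x)"

definition self_module :: "('a, 'm) ring_scheme \<Rightarrow> ('a, 'a) module" where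
  "self_module R = \<lparr>carrier = carrier R, monoid.mult = monoid.mult R, one = one R,
     zero = zero R, add = add R, module.smult = monoid.mult R\<rparr>"

text \<open>The fields \<open>mult\<close> and \<open>one\<close> of the record \<^typ>\<open>('a, 'b) module\<close> play no role for a module;
  they are left undefined below.\<close>

definition restrict_scalars ::
  "('r \<Rightarrow> 'a) \<Rightarrow> ('a, 'b) module \<Rightarrow> ('r, 'b) module" where
  "restrict_scalars h M = \<lparr>carrier = carrier M, monoid.mult = monoid.mult M, one = one M,
     zero = zero M, add = add M, module.smult = (\<lambda>r. module.smult M (h r))\<rparr>"

text \<open>\<open>K / J\<close> for ideals \<open>J \<subseteq> K\<close> of \<open>R\<close>; its elements are the cosets of \<open>J\<close>.\<close>

definition subquotient :: "('a, 'm) ring_scheme \<Rightarrow> 'a set \<Rightarrow> 'a set \<Rightarrow> ('a, 'a set) module" where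
  "subquotient R K J = \<lparr>carrier = {J +>\<^bsub>R\<^esub> x | x. x \<in> K}, monoid.mult = undefined, one = undefined,
     zero = J, add = set_add R, module.smult = (\<lambda>r Y. \<Union>x\<in>Y. J +>\<^bsub>R\<^esub> (r \<otimes>\<^bsub>R\<^esub> x))\<rparr>"

text \<open>The dual \<open>Hom(M, k)\<close> with the contraction action. The map \<open>\<iota>\<close> from \<open>k\<close> to the ring makes \<open>M\<close>
  a vector space.\<close>

definition dual_module ::
  "('k::field \<Rightarrow> 'a) \<Rightarrow> ('a, 'b) module \<Rightarrow> ('a, 'b \<Rightarrow> 'k) module" where
  "dual_module \<iota> M = \<lparr>carrier = {\<phi> \<in> extensional (carrier M).
        (\<forall>x\<in>carrier M. \<forall>y\<in>carrier M. \<phi> (x \<oplus>\<^bsub>M\<^esub> y) = \<phi> x + \<phi> y) \<and>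
        (\<forall>c. \<forall>x\<in>carrier M. \<phi> (\<iota> c \<odot>\<^bsub>M\<^esub> x) = c * \<phi> x)},
     monoid.mult = undefined, one = undefined,
     zero = (\<lambda>x\<in>carrier M. 0),
     add = (\<lambda>\<phi> \<psi>. \<lambda>x\<in>carrier M. \<phi> x + \<psi> x),
     module.smult = (\<lambda>r \<phi>. \<lambda>x\<in>carrier M. \<phi> (r \<odot>\<^bsub>M\<^esub> x))\<rparr>"

text \<open>\<open>q\<^sup>T = q\<close> under the identification of \<open>M\<close> with its double dual.\<close>

definition symmetric_map ::
  "('k::field \<Rightarrow> 'a) \<Rightarrow> ('a, 'b) module \<Rightarrow> (('b \<Rightarrow> 'k) \<Rightarrow> 'b) \<Rightarrow> bool" where
  "symmetric_map \<iota> M q \<longleftrightarrow>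
     (\<forall>\<phi>\<in>carrier (dual_module \<iota> M). \<forall>\<psi>\<in>carrier (dual_module \<iota> M). \<psi> (q \<phi>) = \<phi> (q \<psi>))"

definition self_dual ::
  "('a, 'm) ring_scheme \<Rightarrow> ('k::field \<Rightarrow> 'a) \<Rightarrow> ('a, 'b) module \<Rightarrow> bool" where
  "self_dual R \<iota> M \<longleftrightarrow> (\<exists>f. module_iso R (dual_module \<iota> M) M f)"


section \<open>The associated graded ring and graded modules over it\<close>

definition ideal_pow :: "('a, 'm) ring_scheme \<Rightarrow> 'a set \<Rightarrow> nat \<Rightarrow> 'a set" where
  "ideal_pow A J i = J [^]\<^bsub>ideals_set A\<^esub> i"

definition annihilator :: "('a, 'm) ring_scheme \<Rightarrow> 'a set \<Rightarrow> 'a set" where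
  "annihilator A J = {a \<in> carrier A. \<forall>x\<in>J. a \<otimes>\<^bsub>A\<^esub> x = \<zero>\<^bsub>A\<^esub>}"

text \<open>For families with \<open>D i \<subseteq> N i\<close>, the direct sum of the quotients \<open>N i / D i\<close>: an element is a
  family of cosets. The product of a family \<open>h\<close> of cosets with a family \<open>g\<close> of cosets is the family
  whose \<open>i\<close>-th member is the class mod \<open>D i\<close> of the sum of the products of representatives (in the
  style of \<^const>\<open>rcoset_mult\<close>). It gives both the multiplication of the associated graded ring and
  its action on all graded modules considered here.\<close>

definition graded_mult ::
  "('a, 'm) ring_scheme \<Rightarrow> (nat \<Rightarrow> 'a set) \<Rightarrow> (nat \<Rightarrow> 'a set) \<Rightarrow> (nat \<Rightarrow> 'a set) \<Rightarrow> (nat \<Rightarrow> 'a set)"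
  where
  "graded_mult A D h g = (\<lambda>i. \<Union>{D i +>\<^bsub>A\<^esub> (\<Oplus>\<^bsub>A\<^esub>j\<in>{..i}. x j \<otimes>\<^bsub>A\<^esub> y (i - j)) | x y.
      (\<forall>j. x j \<in> h j) \<and> (\<forall>j. y j \<in> g j)})"

definition graded_module ::
  "('a, 'm) ring_scheme \<Rightarrow> (nat \<Rightarrow> 'a set) \<Rightarrow> (nat \<Rightarrow> 'a set) \<Rightarrow> (nat \<Rightarrow> 'a set, nat \<Rightarrow> 'a set) module"
  where
  "graded_module A N D = \<lparr>carrier = {g. (\<forall>i. \<exists>x\<in>N i. g i = D i +>\<^bsub>A\<^esub> x) \<and> finite {i. g i \<noteq> D i}},
     monoid.mult = undefined, one = undefined, zero = D,
     add = (\<lambda>g h i. g i <+>\<^bsub>A\<^esub> h i),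
     module.smult = graded_mult A D\<rparr>"

definition gr :: "('a, 'm) ring_scheme \<Rightarrow> 'a set \<Rightarrow> (nat \<Rightarrow> 'a set) ring" where
  "gr A \<mm> = (let D = (\<lambda>i. ideal_pow A \<mm> (i + 1)) in
     \<lparr>carrier = carrier (graded_module A (ideal_pow A \<mm>) D),
      monoid.mult = graded_mult A D,
      one = (\<lambda>i. if i = 0 then D 0 +>\<^bsub>A\<^esub> \<one>\<^bsub>A\<^esub> else D i),
      zero = D,
      add = (\<lambda>g h i. g i <+>\<^bsub>A\<^esub> h i)\<rparr>)"

definition max_power :: "('a, 'm) ring_scheme \<Rightarrow> 'a set \<Rightarrow> nat" where
  "max_power A \<mm> = Max {i. ideal_pow A \<mm> i \<noteq> {\<zero>\<^bsub>A\<^esub>}}"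

text \<open>\<open>(0 : \<mm>\<^sup>e)\<close> with \<open>e = s + 1 - i - \<delta>\<close>. Truncated subtraction is intended: for \<open>e \<le> 0\<close> the power
  \<open>\<mm>\<^sup>e\<close> is the whole ring.\<close>

definition loewy :: "('a, 'm) ring_scheme \<Rightarrow> 'a set \<Rightarrow> nat \<Rightarrow> nat \<Rightarrow> 'a set" where
  "loewy A \<mm> \<delta> i = annihilator A (ideal_pow A \<mm> (max_power A \<mm> + 1 - i - \<delta>))"

definition numer :: "('a, 'm) ring_scheme \<Rightarrow> 'a set \<Rightarrow> nat \<Rightarrow> nat \<Rightarrow> 'a set" where
  "numer A \<mm> \<delta> i = ideal_pow A \<mm> i \<inter> loewy A \<mm> \<delta> i"

definition I_module :: "('a, 'm) ring_scheme \<Rightarrow> 'a set \<Rightarrow> nat \<Rightarrow> (nat \<Rightarrow> 'a set, nat \<Rightarrow> 'a set) module"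
  where
  "I_module A \<mm> \<delta> = graded_module A
     (\<lambda>i. numer A \<mm> \<delta> i <+>\<^bsub>A\<^esub> ideal_pow A \<mm> (i + 1)) (\<lambda>i. ideal_pow A \<mm> (i + 1))"

definition I_delta :: "('a, 'm) ring_scheme \<Rightarrow> 'a set \<Rightarrow> nat \<Rightarrow> (nat \<Rightarrow> 'a set) set" where
  "I_delta A \<mm> \<delta> = carrier (I_module A \<mm> \<delta>)"

definition I_denom :: "('a, 'm) ring_scheme \<Rightarrow> 'a set \<Rightarrow> nat \<Rightarrow> nat \<Rightarrow> 'a set" where
  "I_denom A \<mm> \<delta> i = ideal_pow A \<mm> (i + 1) \<inter> loewy A \<mm> \<delta> i"

definition Q_denom :: "('a, 'm) ring_scheme \<Rightarrow> 'a set \<Rightarrow> nat \<Rightarrow> nat \<Rightarrow> 'a set" where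
  "Q_denom A \<mm> \<delta> i = (ideal_pow A \<mm> (i + 1) \<inter> loewy A \<mm> \<delta> i) <+>\<^bsub>A\<^esub>
     (ideal_pow A \<mm> i \<inter> annihilator A (ideal_pow A \<mm> (max_power A \<mm> - i - \<delta>)))"

text \<open>Iarrobino's \<open>\<Q>(\<delta>)\<close>.\<close>

definition Q_module :: "('a, 'm) ring_scheme \<Rightarrow> 'a set \<Rightarrow> nat \<Rightarrow> (nat \<Rightarrow> 'a set, nat \<Rightarrow> 'a set) module"
  where
  "Q_module A \<mm> \<delta> = graded_module A (numer A \<mm> \<delta>) (Q_denom A \<mm> \<delta>)"


section \<open>Closed subschemes of affine space\<close>

text \<open>The coordinate ring of affine \<open>n\<close>-space over \<open>R\<close>, with variables indexed by a finite type.
  A closed subscheme is given by its ideal; the empty scheme by \<^term>\<open>UNIV\<close>.\<close>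

type_synonym ('n, 'r) mpoly = "('n \<Rightarrow>\<^sub>0 nat) \<Rightarrow>\<^sub>0 'r"

abbreviation \<S> :: "('n::finite, 'r::comm_ring_1) mpoly ring" where
  "\<S> \<equiv> ring_of_type_algebra"

definition cst :: "'r::comm_ring_1 \<Rightarrow> ('n::finite, 'r) mpoly" where
  "cst c = Poly_Mapping.single 0 c"

definition mvar :: "'n::finite \<Rightarrow> ('n, 'r::comm_ring_1) mpoly" where
  "mvar i = Poly_Mapping.single (Poly_Mapping.single i 1) 1"

definition origin_ideal :: "('n::finite, 'r::comm_ring_1) mpoly set" where
  "origin_ideal = Idl\<^bsub>\<S>\<^esub> (range mvar)"

definition mdeg :: "('n::finite \<Rightarrow>\<^sub>0 nat) \<Rightarrow> nat" where
  "mdeg a = (\<Sum>i\<in>UNIV. Poly_Mapping.lookup a i)"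

definition hom_comp :: "nat \<Rightarrow> ('n::finite, 'r::comm_ring_1) mpoly \<Rightarrow> ('n, 'r) mpoly" where
  "hom_comp i f = Poly_Mapping.mapp (\<lambda>a c. if mdeg a = i then c else 0) f"

text \<open>\<open>f \<mapsto> f(t x)\<close>\<close>

definition scale_vars ::
  "'r::comm_ring_1 \<Rightarrow> ('n::finite, 'r) mpoly \<Rightarrow> ('n, 'r) mpoly" where
  "scale_vars t f = Poly_Mapping.mapp (\<lambda>a c. t ^ mdeg a * c) f"

text \<open>The quotient by \<open>J\<close> is a free module of rank \<open>d\<close>. For a principal ideal domain \<open>R\<close> (the only
  case used) this is the same as locally free of rank \<open>d\<close>, so that \<open>J\<close> is an \<open>R\<close>-point of the
  Hilbert scheme of \<open>d\<close> points.\<close>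

definition free_of_rank :: "nat \<Rightarrow> ('n::finite, 'r::comm_ring_1) mpoly set \<Rightarrow> bool" where
  "free_of_rank d J \<longleftrightarrow> (\<exists>e :: nat \<Rightarrow> ('n, 'r) mpoly.
     (\<forall>f. \<exists>c. f - (\<Sum>i<d. cst (c i) * e i) \<in> J) \<and>
     (\<forall>c. (\<Sum>i<d. cst (c i) * e i) \<in> J \<longrightarrow> (\<forall>i<d. c i = 0)))"

definition colength :: "('n::finite, 'k::field) mpoly set \<Rightarrow> nat" where
  "colength J = (THE d. free_of_rank d J)"

definition coord_ring :: "('n::finite, 'k::field) mpoly set \<Rightarrow> ('n, 'k) mpoly set ring" where
  "coord_ring I = \<S> Quot I"

definition coord_cst :: "('n::finite, 'k::field) mpoly set \<Rightarrow> 'k \<Rightarrow> ('n, 'k) mpoly set" where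
  "coord_cst I c = I +>\<^bsub>\<S>\<^esub> cst c"

definition orientation ::
  "('n::finite, 'k::field) mpoly set \<Rightarrow> ((('n, 'k) mpoly set \<Rightarrow> 'k) \<Rightarrow> ('n, 'k) mpoly set) \<Rightarrow> bool" where
  "orientation I q \<longleftrightarrow> module_iso (coord_ring I)
     (dual_module (coord_cst I) (self_module (coord_ring I))) (self_module (coord_ring I)) q"

text \<open>The embedding of \<open>Spec(gr(A))\<close> into affine space: the map from polynomials to \<open>gr(A)\<close> sending a
  form of degree \<open>i\<close> to its class in \<open>\<mm>\<^sup>i / \<mm>\<^sup>i\<^sup>+\<^sup>1\<close>.\<close>

definition gr_proj ::
  "('n::finite, 'k::field) mpoly set \<Rightarrow> ('n, 'k) mpoly set set \<Rightarrow> ('n, 'k) mpoly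
     \<Rightarrow> (nat \<Rightarrow> ('n, 'k) mpoly set set)" where
  "gr_proj I \<mm> f = (\<lambda>i. ideal_pow (coord_ring I) \<mm> (i + 1) +>\<^bsub>coord_ring I\<^esub> (I +>\<^bsub>\<S>\<^esub> hom_comp i f))"

definition gr_cst ::
  "('n::finite, 'k::field) mpoly set \<Rightarrow> ('n, 'k) mpoly set set \<Rightarrow> 'k
     \<Rightarrow> (nat \<Rightarrow> ('n, 'k) mpoly set set)" where
  "gr_cst I \<mm> c = gr_proj I \<mm> (cst c)"


section \<open>Quadrics on \<open>U = \<S> / J\<close> and their exterior powers\<close>

text \<open>\<open>U\<^sup>\<or>\<close>, realised as the \<open>R\<close>-linear functionals on polynomials that vanish on \<open>J\<close>.\<close>

definition dual_space :: "('n::finite, 'r::comm_ring_1) mpoly set \<Rightarrow> (('n, 'r) mpoly \<Rightarrow> 'r) set" where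
  "dual_space J = {\<phi>. (\<forall>f g. \<phi> (f + g) = \<phi> f + \<phi> g) \<and> (\<forall>c f. \<phi> (cst c * f) = c * \<phi> f) \<and>
     (\<forall>f\<in>J. \<phi> f = 0)}"

definition tuples :: "nat \<Rightarrow> 'a set \<Rightarrow> 'a list set" where
  "tuples i Y = {xs. length xs = i \<and> set xs \<subseteq> Y}"

text \<open>For \<open>U\<close> free, \<open>\<Lambda>\<^sup>i U\<close> is the module of alternating \<open>i\<close>-linear forms on \<open>U\<^sup>\<or>\<close>. So elements of
  \<open>\<Lambda>\<^sup>i U \<otimes> \<Lambda>\<^sup>i U\<close> are functions of two \<open>i\<close>-tuples of functionals, alternating multilinear in each;
  those of \<open>Sym\<^sup>2 \<Lambda>\<^sup>i U\<close> (2 being invertible) are the symmetric ones.\<close>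

type_synonym ('n, 'r) form =
  "(('n, 'r) mpoly \<Rightarrow> 'r) list \<Rightarrow> (('n, 'r) mpoly \<Rightarrow> 'r) list \<Rightarrow> 'r"

definition sym_form :: "('n::finite, 'r::comm_ring_1) mpoly set \<Rightarrow> nat \<Rightarrow> ('n, 'r) form \<Rightarrow> bool" where
  "sym_form J i w \<longleftrightarrow>
     (\<forall>\<phi>s\<in>tuples i (dual_space J). \<forall>\<psi>s\<in>tuples i (dual_space J).
        w \<phi>s \<psi>s = w \<psi>s \<phi>s \<and>
        (\<forall>k<i. \<forall>\<phi>\<in>dual_space J. \<forall>\<phi>'\<in>dual_space J. \<forall>c.
           w (\<phi>s[k := (\<lambda>f. \<phi> f + c * \<phi>' f)]) \<psi>s = w (\<phi>s[k := \<phi>]) \<psi>s + c * w (\<phi>s[k := \<phi>']) \<psi>s) \<and>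
        (\<forall>a<i. \<forall>b<i. a \<noteq> b \<and> \<phi>s ! a = \<phi>s ! b \<longrightarrow> w \<phi>s \<psi>s = 0))"

text \<open>A representative of an \<open>R\<close>-point of \<open>\<P>(Sym\<^sup>2 \<Lambda>\<^sup>i U)\<close>: an element that vanishes at no point of
  \<open>Spec R\<close>, considered up to units (\<open>R\<close> being a principal ideal domain).\<close>

definition proj_point :: "('n::finite, 'r::comm_ring_1) mpoly set \<Rightarrow> nat \<Rightarrow> ('n, 'r) form \<Rightarrow> bool" where
  "proj_point J i w \<longleftrightarrow> sym_form J i w \<and>
     Idl\<^bsub>ring_of_type_algebra\<^esub>
       {w \<phi>s \<psi>s | \<phi>s \<psi>s. \<phi>s \<in> tuples i (dual_space J) \<and> \<psi>s \<in> tuples i (dual_space J)} = UNIV"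

text \<open>\<open>\<Lambda>\<^sup>i b\<close> for a bilinear form \<open>b\<close> on \<open>U\<^sup>\<or>\<close>, that is, for \<open>b \<phi> \<psi> = \<psi> (q \<phi>)\<close> with \<open>q : U\<^sup>\<or> \<rightarrow> U\<close>.\<close>

definition ext_pow ::
  "nat \<Rightarrow> ((('n, 'r) mpoly \<Rightarrow> 'r) \<Rightarrow> (('n, 'r) mpoly \<Rightarrow> 'r) \<Rightarrow> 'r::comm_ring_1) \<Rightarrow> ('n::finite, 'r) form"
  where
  "ext_pow i b \<phi>s \<psi>s = det (mat i i (\<lambda>(k, l). b (\<phi>s ! k) (\<psi>s ! l)))"

text \<open>The product of \<open>\<alpha> \<in> \<Lambda>\<^sup>a U \<otimes> \<Lambda>\<^sup>a U\<close> with \<open>\<beta> \<in> \<Lambda>\<^sup>c U \<otimes> \<Lambda>\<^sup>c U\<close> in \<open>\<Lambda> U \<otimes> \<Lambda> U\<close>, evaluated on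
  \<open>(a + c)\<close>-tuples by summing over shuffles in both arguments. The sign of the shuffle given by an
  \<open>a\<close>-element set \<open>P\<close> is \<open>-1\<close> to the power \<open>\<Sum>P - a (a - 1) / 2\<close>; the constants cancel.\<close>

definition wedge ::
  "nat \<Rightarrow> ('n::finite, 'r::comm_ring_1) form \<Rightarrow> ('n, 'r) form \<Rightarrow> ('n, 'r) form" where
  "wedge a \<alpha> \<beta> \<phi>s \<psi>s =
     (\<Sum>P\<in>{P. P \<subseteq> {..<length \<phi>s} \<and> card P = a}. \<Sum>Q\<in>{Q. Q \<subseteq> {..<length \<psi>s} \<and> card Q = a}.
        (- 1) ^ (\<Sum>P + \<Sum>Q) * \<alpha> (nths \<phi>s P) (nths \<psi>s Q) * \<beta> (nths \<phi>s (- P)) (nths \<psi>s (- Q)))"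

text \<open>For forms \<open>b\<^sub>0, b\<^sub>1, \<dots>\<close> and ranks \<open>r\<^sub>0, r\<^sub>1, \<dots>\<close> this is
  \<open>\<Lambda>\<^bsup>r\<^sub>0\<^esup> b\<^sub>0 \<and> \<Lambda>\<^bsup>r\<^sub>1\<^esup> b\<^sub>1 \<and> \<dots> \<and> \<Lambda>\<^sup>m b\<^sub>j\<close> where \<open>i = r\<^sub>0 + \<dots> + r\<^sub>j\<^sub>-\<^sub>1 + m\<close> and \<open>m \<le> r\<^sub>j\<close>.\<close>

fun broken_wedge ::
  "(nat \<times> ((('n, 'r) mpoly \<Rightarrow> 'r) \<Rightarrow> (('n, 'r) mpoly \<Rightarrow> 'r) \<Rightarrow> 'r)) list \<Rightarrow> nat
     \<Rightarrow> ('n::finite, 'r::comm_ring_1) form" where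
  "broken_wedge [] i = (\<lambda>_ _. 0)"
| "broken_wedge ((r, b) # rbs) i =
     (if i \<le> r then ext_pow i b else wedge r (ext_pow r b) (broken_wedge rbs (i - r)))"


section \<open>Points of the Iarrobino scheme\<close>

text \<open>A \<open>k\<close>-point \<open>(Z\<^sub>\<bullet>, [q\<^sub>\<bullet>])\<close> is represented by the list of ideals of the \<open>Z\<^sub>j\<close> and the list of the
  maps \<open>q\<^sub>j : (J\<^sub>j\<^sub>+\<^sub>1 / J\<^sub>j)\<^sup>\<or> \<rightarrow> J\<^sub>j\<^sub>+\<^sub>1 / J\<^sub>j\<close>, where the last ideal \<open>J\<^sub>k\<^sub>+\<^sub>1\<close> is the unit ideal. A map
  stands for its class up to scalars: everything below depends only on these classes.\<close>

type_synonym ('n, 'k) quad = "(('n, 'k) mpoly set \<Rightarrow> 'k) \<Rightarrow> ('n, 'k) mpoly set"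

definition next_ideal :: "('n::finite, 'k::field) mpoly set list \<Rightarrow> nat \<Rightarrow> ('n, 'k) mpoly set" where
  "next_ideal Js j = (Js @ [UNIV]) ! (j + 1)"

definition piece ::
  "('n::finite, 'k::field) mpoly set list \<Rightarrow> nat \<Rightarrow> (('n, 'k) mpoly, ('n, 'k) mpoly set) module" where
  "piece Js j = subquotient \<S> (next_ideal Js j) (Js ! j)"

definition iar_point ::
  "nat \<Rightarrow> ('n::finite, 'k::field) mpoly set list \<Rightarrow> ('n, 'k) quad list \<Rightarrow> bool" where
  "iar_point d Js qs \<longleftrightarrow> Js \<noteq> [] \<and> length qs = length Js \<and>
     (\<forall>J\<in>set Js. ideal J \<S>) \<and> free_of_rank d (hd Js) \<and>
     (\<forall>j<length Js. Js ! j \<subset> next_ideal Js j \<and>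
        module_iso \<S> (dual_module cst (piece Js j)) (piece Js j) (qs ! j) \<and>
        symmetric_map cst (piece Js j) (qs ! j))"

text \<open>The quadric on \<open>F\<^sub>j = (\<S> / J\<^sub>j)\<^sup>\<or>\<close> given by the composite
  \<open>(\<S> / J\<^sub>j)\<^sup>\<or> \<rightarrow> (J\<^sub>j\<^sub>+\<^sub>1 / J\<^sub>j)\<^sup>\<or> \<rightarrow> J\<^sub>j\<^sub>+\<^sub>1 / J\<^sub>j \<rightarrow> \<S> / J\<^sub>j\<close>; its kernel is \<open>F\<^sub>j\<^sub>+\<^sub>1\<close>.\<close>

definition on_cosets ::
  "('a, 'b set) module \<Rightarrow> ('b \<Rightarrow> 'k) \<Rightarrow> ('b set \<Rightarrow> 'k)" where
  "on_cosets M \<phi> = (\<lambda>Y\<in>carrier M. \<phi> (SOME x. x \<in> Y))"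

definition quad_form ::
  "('n::finite, 'k::field) mpoly set list \<Rightarrow> ('n, 'k) quad list \<Rightarrow> nat
     \<Rightarrow> (('n, 'k) mpoly \<Rightarrow> 'k) \<Rightarrow> (('n, 'k) mpoly \<Rightarrow> 'k) \<Rightarrow> 'k" where
  "quad_form Js qs j \<phi> \<psi> = on_cosets (piece Js j) \<psi> ((qs ! j) (on_cosets (piece Js j) \<phi>))"

text \<open>The family \<open>w\<close> represents the point of \<open>\<Prod>\<^sub>i \<P>(Sym\<^sup>2 \<Lambda>\<^sup>i U)\<close>, \<open>U = \<S> / J\<^sub>0\<close>, that corresponds to
  the broken quadric. In the expressions \<open>det q\<^sub>0 \<and> \<dots> \<and> \<Lambda>\<^sup>m q\<^sub>j\<close> the quadric \<open>q\<^sub>j\<close> has to be lifted from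
  \<open>F\<^sub>j\<close> to \<open>U\<^sup>\<or>\<close> (to a form \<open>B j\<close>); the product does not depend on the lift.\<close>

definition iar_coords ::
  "nat \<Rightarrow> ('n::finite, 'k::field) mpoly set list \<Rightarrow> ('n, 'k) quad list \<Rightarrow> (nat \<Rightarrow> ('n, 'k) form) \<Rightarrow> bool"
  where
  "iar_coords d Js qs w \<longleftrightarrow> (\<exists>B.
     (\<forall>j<length Js.
        sym_form (hd Js) 1 (\<lambda>\<phi>s \<psi>s. B j (hd \<phi>s) (hd \<psi>s)) \<and>
        (\<forall>\<phi>\<in>dual_space (Js ! j). \<forall>\<psi>\<in>dual_space (Js ! j). B j \<phi> \<psi> = quad_form Js qs j \<phi> \<psi>)) \<and>
     (\<forall>i\<in>{1..d}. \<exists>c. c \<noteq> 0 \<and>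
        (\<forall>\<phi>s\<in>tuples i (dual_space (hd Js)). \<forall>\<psi>s\<in>tuples i (dual_space (hd Js)).
           w i \<phi>s \<psi>s = c * broken_wedge
             (map (\<lambda>j. (colength (Js ! j) - colength (next_ideal Js j), B j)) [0..<length Js])
             i \<phi>s \<psi>s)))"

text \<open>The \<open>R\<close>-points, for a principal ideal domain \<open>R\<close>, of the Iarrobino scheme whose generic point
  is a pair \<open>([Z], [q])\<close> with \<open>q\<close> of full rank. The first line says that \<open>(J, w)\<close> is a point of the
  product of the bundles \<open>\<P>(Sym\<^sup>2 \<Lambda>\<^sup>i \<U>)\<close> over the Hilbert scheme. As \<open>R\<close> is a domain and the
  Iarrobino scheme is closed in this product, the remaining conditions concern the generic point
  only: there \<open>w\<close> has to be \<open>([q], [\<Lambda>\<^sup>2 q], \<dots>, [\<Lambda>\<^sup>d q])\<close> with \<open>\<Lambda>\<^sup>d q \<noteq> 0\<close>, and multiplication by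
  every polynomial has to be compatible with \<open>q\<close>.\<close>

definition iar_family ::
  "nat \<Rightarrow> ('n::finite, 'r::idom) mpoly set \<Rightarrow> (nat \<Rightarrow> ('n, 'r) form) \<Rightarrow> bool" where
  "iar_family d J w \<longleftrightarrow>
     ideal J \<S> \<and> free_of_rank d J \<and> (\<forall>i\<in>{1..d}. proj_point J i (w i)) \<and>
     (\<forall>i\<in>{1..d}. \<exists>a b. a \<noteq> 0 \<and> b \<noteq> 0 \<and>
        (\<forall>\<phi>s\<in>tuples i (dual_space J). \<forall>\<psi>s\<in>tuples i (dual_space J).
           a * w i \<phi>s \<psi>s = b * ext_pow i (\<lambda>\<phi> \<psi>. w 1 [\<phi>] [\<psi>]) \<phi>s \<psi>s)) \<and>
     (\<forall>f. \<forall>\<phi>\<in>dual_space J. \<forall>\<psi>\<in>dual_space J.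
        w 1 [\<lambda>g. \<phi> (f * g)] [\<psi>] = w 1 [\<phi>] [\<lambda>g. \<psi> (f * g)])"


section \<open>Limits under the torus action\<close>

text \<open>Extension of functionals along a ring homomorphism \<open>h\<close>.\<close>

definition extend_functional ::
  "('r::comm_ring_1 \<Rightarrow> 's::comm_ring_1) \<Rightarrow> (('n::finite, 'r) mpoly \<Rightarrow> 'r) \<Rightarrow> (('n, 's) mpoly \<Rightarrow> 's)" where
  "extend_functional h \<phi> g =
     (\<Sum>a\<in>Poly_Mapping.keys g. Poly_Mapping.lookup g a * h (\<phi> (Poly_Mapping.single a 1)))"

text \<open>\<open>(J', w')\<close> is the pullback of the point \<open>(J, w)\<close> along \<open>Spec(h)\<close>. This determines \<open>w' i\<close> up to a
  unit, because the extended functionals span the dual space of \<open>J'\<close>.\<close>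

definition base_change ::
  "nat \<Rightarrow> ('r::comm_ring_1 \<Rightarrow> 's::comm_ring_1) \<Rightarrow>
     ('n::finite, 'r) mpoly set \<times> (nat \<Rightarrow> ('n, 'r) form) \<Rightarrow>
     ('n, 's) mpoly set \<times> (nat \<Rightarrow> ('n, 's) form) \<Rightarrow> bool" where
  "base_change d h = (\<lambda>(J, w) (J', w').
     J' = Idl\<^bsub>\<S>\<^esub> (Poly_Mapping.map h ` J) \<and>
     (\<forall>i\<in>{1..d}. sym_form J' i (w' i) \<and> (\<exists>c. c dvd 1 \<and>
        (\<forall>\<phi>s\<in>tuples i (dual_space J). \<forall>\<psi>s\<in>tuples i (dual_space J).
           w' i (map (extend_functional h) \<phi>s) (map (extend_functional h) \<psi>s) = c * h (w i \<phi>s \<psi>s)))))"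

text \<open>The translate \<open>t \<cdot> (J, w)\<close>, as a function of \<open>v = t\<^sup>-\<^sup>1\<close>. The isomorphism from \<open>Z\<close> to \<open>t \<cdot> Z\<close>
  induces the isomorphism \<open>f(x) \<mapsto> f(t\<^sup>-\<^sup>1 x)\<close> from the coordinate ring of \<open>Z\<close> to that of \<open>t \<cdot> Z\<close>, along
  which quadrics are transported.\<close>

definition torus_translate ::
  "'r::comm_ring_1 \<Rightarrow> ('n::finite, 'r) mpoly set \<times> (nat \<Rightarrow> ('n, 'r) form) \<Rightarrow>
     ('n, 'r) mpoly set \<times> (nat \<Rightarrow> ('n, 'r) form)" where
  "torus_translate v = (\<lambda>(J, w). (scale_vars v ` J,
     (\<lambda>i \<phi>s \<psi>s. w i (map (\<lambda>\<phi>. \<phi> \<circ> scale_vars v) \<phi>s) (map (\<lambda>\<psi>. \<psi> \<circ> scale_vars v) \<psi>s))))"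

text \<open>Laurent polynomials \<open>k[u, u\<^sup>-\<^sup>1]\<close>, the coordinate ring of the torus, where \<open>u = t\<^sup>-\<^sup>1\<close>.\<close>

type_synonym 'k laurent = "int \<Rightarrow>\<^sub>0 'k"

definition poly_to_laurent :: "'k::field poly \<Rightarrow> 'k laurent" where
  "poly_to_laurent p =
     (\<Sum>i\<le>Polynomial.degree p. Poly_Mapping.single (int i) (Polynomial.coeff p i))"

text \<open>\<open>lim\<^bsub>t\<rightarrow>\<infinity>\<^esub> t \<cdot> (Z\<^sub>\<bullet>, [q\<^sub>\<bullet>]) = (Z'\<^sub>\<bullet>, [q'\<^sub>\<bullet>])\<close> for a point with \<open>q\<^sub>0\<close> of full rank: the orbit map from
  \<open>Spec k[u, u\<^sup>-\<^sup>1]\<close> to the Iarrobino scheme extends to a morphism \<open>(J, W)\<close> from \<open>Spec k[u]\<close>, whose value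
  at \<open>u = 0\<close> is \<open>(Z'\<^sub>\<bullet>, [q'\<^sub>\<bullet>])\<close>. The orbit map is the translate by \<open>t = u\<^sup>-\<^sup>1\<close> of the constant family
  \<open>(JG, wG)\<close>.\<close>

definition is_torus_limit ::
  "nat \<Rightarrow> ('n::finite, 'k::field) mpoly set list \<Rightarrow> ('n, 'k) quad list \<Rightarrow>
     ('n, 'k) mpoly set list \<Rightarrow> ('n, 'k) quad list \<Rightarrow> bool" where
  "is_torus_limit d Js qs Js' qs' \<longleftrightarrow>
     iar_point d Js qs \<and> iar_point d Js' qs' \<and>
     (\<exists>w w' JG wG (J :: ('n, 'k poly) mpoly set) W.
        iar_coords d Js qs w \<and> iar_coords d Js' qs' w' \<and>
        base_change d (Poly_Mapping.single (0 :: int)) (hd Js, w) (JG, wG) \<and>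
        iar_family d J W \<and>
        base_change d poly_to_laurent (J, W)
          (torus_translate (Poly_Mapping.single 1 1) (JG, wG)) \<and>
        base_change d (\<lambda>p. poly p 0) (J, W) (hd Js', w'))"

end

theory Submission
  imports Defs
begin

text \<open>Write \<open>S\<close> for the polynomial ring. The orientation is given by a functional \<open>\<eta>\<close> on \<open>S\<close> such that \<open>I\<close> is the
radical of the symmetric pairing \<open>(f, g) \<mapsto> \<eta> (f * g)\<close>; multiplications are self-adjoint for it. Everything
is read off from one basis \<open>E\<close> of \<open>A = S / I\<close>, indexed by \<open>a < d\<close>, that is adapted to the pairing and to the
powers of the maximal ideal \<open>\<mm>\<close> simultaneously: \<open>E a\<close> has order \<open>n a\<close>, there is an involution \<open>\<sigma>\<close> with
\<open>\<eta> (E a * E b) \<noteq> 0\<close> exactly if \<open>b = \<sigma> a\<close>, and the \<open>a\<close>-th coordinate vanishes on \<open>\<mm>\<^sup>l\<close> for \<open>l > n a\<close>.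
It comes from a Gram-Schmidt process (\<open>adapted_system_exists\<close>): pick vectors of the largest possible
orders with nonzero product, split them off, and continue in the complement. Characteristic different
from 2 is used to diagonalise, or to make a pair hyperbolic. In such a basis both \<open>\<mm>\<^sup>i\<close> and \<open>(0 : \<mm>\<^sup>e)\<close> are
coordinate subspaces (\<open>Fl_\<kappa>\<close>, \<open>L_\<kappa>\<close>), and the classes of the \<open>E a\<close> of weight \<open>n a + n (\<sigma> a) = s - \<delta>\<close> form a
basis of \<open>I\<^sub>\<delta> / I\<^sub>\<delta>\<^sub>+\<^sub>1\<close>.

The degeneration is explicit. Multiplying the part of degree \<open>i\<close> of \<open>E a\<close> by \<open>v\<close> to the power \<open>i - n a\<close>, and
dually the \<open>a\<close>-th coordinate of a monomial of degree \<open>i\<close> by \<open>v\<close> to the power \<open>n a - i\<close>, defines an ideal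
\<open>degeneration h v\<close> with free quotient over every ring that receives \<open>k\<close> by \<open>h\<close> and contains \<open>v\<close>. These
ideals are compatible with base change. For \<open>v = 1\<close> the ideal is \<open>I\<close>, for a unit \<open>v\<close> it is the translate of \<open>I\<close>
by the torus, and for \<open>v = 0\<close> it is the kernel of \<open>S \<rightarrow> gr(A)\<close>. So the orbit, its closure and the limit are the
instances over \<open>k[u, u\<^sup>-\<^sup>1]\<close>, \<open>k[u]\<close> and \<open>k\<close> with \<open>v = u\<close>, \<open>u\<close> and \<open>0\<close>.

In the dual basis the translated quadric is diagonal up to \<open>\<sigma>\<close>, with coefficients \<open>v\<close> to the powers
\<open>n a + n (\<sigma> a)\<close>. By the expansion of minors (\<open>gram_det_expand\<close>) its \<open>i\<close>-th exterior power is a sum over lists of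
\<open>i\<close> distinct indices, weighted by \<open>v\<close> to the total weight. Dividing by the smallest power that occurs gives
\<open>family_form\<close>, which represents a point of projective space for every value of \<open>v\<close>, because the minimum is
attained by a term with unit coefficient. At \<open>v = 0\<close> exactly the terms of minimal total weight survive: the
index lists that exhaust the indices of least weight, then those of the next weight, and so on. By Laplace
expansion (\<open>broken_wedge_expand\<close>) their sum is the product \<open>det q\<^sub>0 \<and> det q\<^sub>1 \<and> \<dots> \<and> \<Lambda>\<^sup>m q\<^sub>j\<close>, where \<open>q\<^sub>j\<close> pairs the
basis elements of the \<open>j\<close>-th weight. Small weight means large \<open>\<delta>\<close>, so the \<open>q\<^sub>j\<close> live on \<open>I\<^sub>\<delta> / I\<^sub>\<delta>\<^sub>+\<^sub>1\<close> for
decreasing \<open>\<delta>\<close>. They are module isomorphisms because the structure constants of \<open>A\<close> in an adapted basis are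
symmetric (\<open>structure_constant_sym\<close>).\<close>

section \<open>Bases adapted to a symmetric form and a filtration\<close>

text \<open>The last clause says that the dual basis respects the filtration: up to the factor \<open>p a\<close>, pairing with
\<open>e (\<sigma> a)\<close> is the \<open>a\<close>-th coordinate, and it must vanish on the steps of the filtration beyond \<open>n a\<close>.\<close>

definition adapted_system ::
  "('v \<Rightarrow> 'v \<Rightarrow> 'k::field) \<Rightarrow> (nat \<Rightarrow> 'v set) \<Rightarrow> nat \<Rightarrow> (nat \<Rightarrow> 'v) \<Rightarrow> (nat \<Rightarrow> nat) \<Rightarrow> (nat \<Rightarrow> nat) \<Rightarrow> (nat \<Rightarrow> 'k) \<Rightarrow> bool"
  where "adapted_system \<beta> F m e n \<sigma> p \<longleftrightarrow>
    (\<forall>a<m. \<sigma> a < m \<and> \<sigma> (\<sigma> a) = a \<and> p a \<noteq> 0 \<and> p (\<sigma> a) = p a \<and> e a \<in> F (n a)) \<and>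
    (\<forall>a<m. \<forall>b<m. \<beta> (e a) (e b) = (if b = \<sigma> a then p a else 0)) \<and>
    (\<forall>x l. \<forall>a<m. x \<in> F l \<longrightarrow> \<beta> x (e (\<sigma> a)) \<noteq> 0 \<longrightarrow> l \<le> n a)"

context vector_space
begin

text \<open>A system of maximal size spans modulo the radical. Otherwise its orthogonal complement \<open>V\<close> contains a
vector outside the radical, and one or two further vectors can be split off: \<open>x\<close> and \<open>y\<close> in \<open>V\<close> with
\<open>\<beta> x y \<noteq> 0\<close>, where the step \<open>i\<close> of the filtration that contains \<open>x\<close> is chosen as large as possible, and then
the step \<open>j\<close> that contains \<open>y\<close>. The maximality of \<open>i\<close> and \<open>j\<close> is what the filtration clause requires for the
new vectors. The projection \<open>\<pi>\<close> to \<open>V\<close> preserves the filtration because of the same clause for the old ones.\<close>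

lemma adapted_system_exists:
  fixes d :: nat and \<beta> :: "'b \<Rightarrow> 'b \<Rightarrow> 'a" and F :: "nat \<Rightarrow> 'b set"
  assumes two: "(2 :: 'a) \<noteq> 0"
    and sym: "\<And>x y. \<beta> x y = \<beta> y x"
    and add: "\<And>x y z. \<beta> (x + y) z = \<beta> x z + \<beta> y z"
    and scl: "\<And>c x z. \<beta> (c *s x) z = c * \<beta> x z"
    and subsp: "\<And>i. subspace (F i)"
    and F0: "F 0 = UNIV"
    and dec: "\<And>i. F (Suc i) \<subseteq> F i"
    and FN: "\<And>x y. x \<in> F N \<Longrightarrow> \<beta> x y = 0"
    and bound: "\<And>m e f. (\<And>a b. a < m \<Longrightarrow> b < m \<Longrightarrow> \<beta> (e a) (f b) = (if a = b then 1 else 0)) \<Longrightarrow> m \<le> d"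
  obtains m e n \<sigma> p where "adapted_system \<beta> F m e n \<sigma> p"
    and "\<And>x y. (\<And>a. a < m \<Longrightarrow> \<beta> x (e a) = 0) \<Longrightarrow> \<beta> x y = 0"
proof -
  have addr: "\<beta> z (x + y) = \<beta> z x + \<beta> z y" for x y z by (metis sym add)
  have sclr: "\<beta> z (c *s x) = c * \<beta> z x" for c x z by (metis sym scl)
  have zero: "\<beta> 0 z = 0" for z using scl[of 0 0 z] by simp
  have diff: "\<beta> (x - y) z = \<beta> x z - \<beta> y z" for x y z
    using add[of "x - y" y z] by simp
  have diffr: "\<beta> z (x - y) = \<beta> z x - \<beta> z y" for x y z by (metis sym diff)
  have sumb: "\<beta> (\<Sum>a\<in>B. f a) z = (\<Sum>a\<in>B. \<beta> (f a) z)" if "finite B" for f :: "nat \<Rightarrow> 'b" and B z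
    using that by (induction B) (auto simp: zero add)
  have anti: "F j \<subseteq> F i" if "i \<le> j" for i j
    using lift_Suc_antimono_le[of F, OF _ that] dec by blast
  define P where "P m \<longleftrightarrow> (\<exists>e n \<sigma> p. adapted_system \<beta> F m e n \<sigma> p)" for m
  have P0: "P 0" by (simp add: P_def adapted_system_def)
  have Pd: "m \<le> d" if "P m" for m
  proof -
    from that obtain e n \<sigma> p where s: "adapted_system \<beta> F m e n \<sigma> p" unfolding P_def by blast
    show ?thesis
      by (rule bound[of m e "\<lambda>b. (1 / p b) *s e (\<sigma> b)"])
        (use s in \<open>auto simp: adapted_system_def sclr, metis\<close>)
  qed
  define m where "m = Greatest P"
  have "P m" unfolding m_def using GreatestI_nat[of P 0 d] P0 Pd by blast
  have mmax: "m' \<le> m" if "P m'" for m'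
    unfolding m_def using Greatest_le_nat[of P m' d] that Pd by blast
  from \<open>P m\<close> obtain e n \<sigma> p where s: "adapted_system \<beta> F m e n \<sigma> p" unfolding P_def by blast
  have \<sigma>: "\<sigma> a < m" "\<sigma> (\<sigma> a) = a" and p: "p a \<noteq> 0" "p (\<sigma> a) = p a" and eF: "e a \<in> F (n a)"
    if "a < m" for a using s that by (auto simp: adapted_system_def)
  have gram: "\<beta> (e a) (e b) = (if b = \<sigma> a then p a else 0)" if "a < m" "b < m" for a b
    using s that by (auto simp: adapted_system_def)
  have filt: "l \<le> n a" if "a < m" "x \<in> F l" "\<beta> x (e (\<sigma> a)) \<noteq> 0" for a x l
    using s that by (auto simp: adapted_system_def)
  define V where "V = {x. \<forall>a<m. \<beta> x (e a) = 0}"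
  define \<pi> where "\<pi> x = x - (\<Sum>a<m. (\<beta> x (e (\<sigma> a)) / p a) *s e a)" for x
  have \<pi>V: "\<pi> x \<in> V" for x
  proof -
    have "\<beta> (\<pi> x) (e b) = 0" if "b < m" for b
    proof -
      have "\<beta> (\<pi> x) (e b) = \<beta> x (e b) - (\<Sum>a<m. (\<beta> x (e (\<sigma> a)) / p a) * \<beta> (e a) (e b))"
        by (simp add: \<pi>_def diff sumb scl)
      also have "(\<Sum>a<m. (\<beta> x (e (\<sigma> a)) / p a) * \<beta> (e a) (e b)) =
        (\<Sum>a<m. if a = \<sigma> b then \<beta> x (e b) else 0)"
        by (rule sum.cong) (use that \<sigma> p gram in \<open>auto simp: \<sigma>(2)\<close>)
      also have "\<dots> = \<beta> x (e b)" using \<sigma>[OF that] by simp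
      finally show ?thesis by simp
    qed
    then show ?thesis by (simp add: V_def)
  qed
  have \<pi>F: "\<pi> x \<in> F l" if "x \<in> F l" for x l
  proof -
    have "(\<beta> x (e (\<sigma> a)) / p a) *s e a \<in> F l" if a: "a < m" for a
    proof (cases "\<beta> x (e (\<sigma> a)) = 0")
      case True then show ?thesis using subspace_0[OF subsp] by simp
    next
      case False
      then have "l \<le> n a" using filt[OF a \<open>x \<in> F l\<close>] by blast
      then show ?thesis using eF[OF a] anti subspace_scale[OF subsp] by blast
    qed
    then show ?thesis unfolding \<pi>_def
      by (intro subspace_diff[OF subsp] that subspace_sum[OF subsp]) auto
  qed
  have \<pi>\<beta>: "\<beta> v (\<pi> x) = \<beta> v x" if "v \<in> V" for v x
  proof -
    have "\<beta> (\<Sum>a<m. (\<beta> x (e (\<sigma> a)) / p a) *s e a) v = 0"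
      using that by (simp add: sumb scl V_def) (simp add: sym)
    then show ?thesis by (simp add: \<pi>_def diffr sym)
  qed
  have "\<beta> x y = 0" if "x \<in> V" for x y
  proof (rule ccontr)
    assume xy: "\<beta> x y \<noteq> 0"
    \<comment> \<open>the deepest step of the filtration with a vector of \<open>V\<close> outside the radical\<close>
    define R where "R i \<longleftrightarrow> (\<exists>x\<in>F i \<inter> V. \<exists>y. \<beta> x y \<noteq> 0)" for i
    have R0: "R 0" using xy \<open>x \<in> V\<close> F0 by (auto simp: R_def)
    have RN: "i \<le> N" if "R i" for i
      using that FN anti[of N i] unfolding R_def by (meson IntD1 nle_le subset_iff)
    define i where "i = Greatest R"
    have "R i" unfolding i_def using GreatestI_nat[of R 0 N] R0 RN by blast
    have imax: "l \<le> i" if "R l" for l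
      unfolding i_def using Greatest_le_nat[of R l N] that RN by blast
    have i_top: "\<beta> x z = 0" if "x \<in> F l" "z \<in> V" "i < l" for x z l
    proof -
      have "\<pi> x \<in> F l \<inter> V" using \<pi>F \<pi>V that by blast
      then have "\<beta> (\<pi> x) z = 0" using imax[of l] that unfolding R_def by force
      then show ?thesis using \<pi>\<beta>[OF \<open>z \<in> V\<close>, of x] by (simp add: sym)
    qed
    \<comment> \<open>the deepest step with a partner for a vector in step \<open>i\<close>; it is not deeper than \<open>i\<close> by symmetry\<close>
    define Q where "Q j \<longleftrightarrow> (\<exists>x\<in>F i \<inter> V. \<exists>y\<in>F j \<inter> V. \<beta> x y \<noteq> 0)" for j
    have Q0: "Q 0"
    proof -
      obtain x y where "x \<in> F i \<inter> V" "\<beta> x y \<noteq> 0" using \<open>R i\<close> by (auto simp: R_def)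
      then show ?thesis unfolding Q_def using \<pi>\<beta>[of x y] \<pi>V F0 by (metis IntI IntD1 IntD2 UNIV_I)
    qed
    have Qi: "j \<le> i" if "Q j" for j
      using that i_top[of _ j] sym unfolding Q_def by (metis IntD1 IntD2 not_le)
    define j where "j = Greatest Q"
    have "Q j" unfolding j_def using GreatestI_nat[of Q 0 i] Q0 Qi by blast
    have jmax: "l \<le> j" if "Q l" for l
      unfolding j_def using Greatest_le_nat[of Q l i] that Qi by blast
    have ji: "j \<le> i" using Qi \<open>Q j\<close> by blast
    have j_top: "\<beta> x z = 0" if "x \<in> F l" "z \<in> F i \<inter> V" "j < l" for x z l
    proof -
      have "\<pi> x \<in> F l \<inter> V" using \<pi>F \<pi>V that by blast
      then have "\<beta> z (\<pi> x) = 0" using jmax[of l] that unfolding Q_def by force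
      then show ?thesis using \<pi>\<beta>[of z x] that by (simp add: sym)
    qed
    obtain x y where x: "x \<in> F i" "x \<in> V" and y: "y \<in> F j" "y \<in> V" and xy: "\<beta> x y \<noteq> 0"
      using \<open>Q j\<close> by (auto simp: Q_def)
    show False
    proof (cases "j = i")
      case True
      \<comment> \<open>polarisation: one of \<open>x\<close>, \<open>y\<close>, \<open>x + y\<close> is not isotropic\<close>
      have "\<exists>z\<in>F i \<inter> V. \<beta> z z \<noteq> 0"
      proof (rule ccontr)
        assume *: "\<not> (\<exists>z\<in>F i \<inter> V. \<beta> z z \<noteq> 0)"
        have "x + y \<in> F i \<inter> V" using x y True subspace_add[OF subsp]
          by (auto simp: V_def add)
        with * have "\<beta> (x + y) (x + y) = 0" by blast
        moreover have "\<beta> x x = 0" "\<beta> y y = 0" using * x y True by auto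
        ultimately have "2 * \<beta> x y = 0" using sym[of y x] by (simp add: add addr)
        then show False using two xy by simp
      qed
      then obtain z where z: "z \<in> F i" "z \<in> V" "\<beta> z z \<noteq> 0" by blast
      have "adapted_system \<beta> F (Suc m) (e(m := z)) (n(m := i)) (\<sigma>(m := m)) (p(m := \<beta> z z))"
        unfolding adapted_system_def
      proof (intro conjI allI impI)
        fix a b assume "a < Suc m" "b < Suc m"
        then show "\<beta> ((e(m := z)) a) ((e(m := z)) b) =
          (if b = (\<sigma>(m := m)) a then (p(m := \<beta> z z)) a else 0)"
          using z gram[of a b] \<sigma>[of a] sym[of "e a" z]
          by (cases "a = m"; cases "b = m") (auto simp: V_def)
      next
        fix x l a assume a: "a < Suc m" and xl: "x \<in> F l"
          and ne: "\<beta> x ((e(m := z)) ((\<sigma>(m := m)) a)) \<noteq> 0"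
        show "l \<le> (n(m := i)) a"
        proof (cases "a = m")
          case True
          then have "l \<le> i" using i_top[OF xl \<open>z \<in> V\<close>] ne not_le by auto
          then show ?thesis using True by simp
        next
          case False
          then have "a < m" using a by simp
          then show ?thesis using filt[of a x l] xl ne \<sigma>[of a] by simp
        qed
      qed (use \<sigma> p eF z in \<open>auto simp: less_Suc_eq\<close>)
      then have "P (Suc m)" unfolding P_def by blast
      then show False using mmax by force
    next
      case False
      then have jlt: "j < i" using ji by simp
      have xx: "\<beta> x x = 0" using j_top[OF x(1) _ jlt] x by blast
      \<comment> \<open>\<open>x\<close> is isotropic already; this makes its partner isotropic without leaving step \<open>j\<close>\<close>
      define z where "z = y - (\<beta> y y / (2 * \<beta> x y)) *s x"
      have z: "z \<in> F j" "z \<in> V"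
        using x y anti[OF ji] subspace_diff[OF subsp] subspace_scale[OF subsp]
        by (auto simp: z_def V_def diff scl)
      have xz: "\<beta> x z = \<beta> x y" by (simp add: z_def diffr sclr xx)
      have zz: "\<beta> z z = 0"
        using two xy sym[of y x] by (simp add: z_def diff diffr scl sclr xx field_simps)
      define e' where "e' = e(m := x, Suc m := z)"
      define \<sigma>' where "\<sigma>' = \<sigma>(m := Suc m, Suc m := m)"
      define p' where "p' = p(m := \<beta> x y, Suc m := \<beta> x y)"
      define n' where "n' = n(m := i, Suc m := j)"
      have lt: "a < m \<or> a = m \<or> a = Suc m" if "a < Suc (Suc m)" for a using that by auto
      have "adapted_system \<beta> F (Suc (Suc m)) e' n' \<sigma>' p'"
        unfolding adapted_system_def
      proof (intro conjI allI impI)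
        fix a b assume "a < Suc (Suc m)" "b < Suc (Suc m)"
        then have "(a < m \<or> a = m \<or> a = Suc m) \<and> (b < m \<or> b = m \<or> b = Suc m)" using lt by blast
        then show "\<beta> (e' a) (e' b) = (if b = \<sigma>' a then p' a else 0)"
          using gram[of a b] \<sigma>[of a] x z xz zz xx sym[of z x] sym[of "e a" x] sym[of "e a" z]
          by (auto simp: e'_def \<sigma>'_def p'_def V_def)
      next
        fix x' l a assume a: "a < Suc (Suc m)" and xl: "x' \<in> F l"
          and ne: "\<beta> x' (e' (\<sigma>' a)) \<noteq> 0"
        consider "a < m" | "a = m" | "a = Suc m" using lt[OF a] by blast
        then show "l \<le> n' a"
        proof cases
          case 1
          then show ?thesis using filt[of a x' l] xl ne \<sigma>[of a] by (auto simp: e'_def \<sigma>'_def n'_def)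
        next
          case 2
          then have "\<beta> x' z \<noteq> 0" using ne by (simp add: e'_def \<sigma>'_def)
          then have "l \<le> i" using i_top[OF xl \<open>z \<in> V\<close>] not_le by blast
          then show ?thesis using 2 by (simp add: n'_def)
        next
          case 3
          then have "\<beta> x' x \<noteq> 0" using ne by (simp add: e'_def \<sigma>'_def)
          then have "l \<le> j" using j_top[OF xl, of x] x not_le by blast
          then show ?thesis using 3 by (simp add: n'_def)
        qed
      next
        fix a assume "a < Suc (Suc m)"
        then have "a < m \<or> a = m \<or> a = Suc m" by (rule lt)
        moreover have "\<sigma> a \<noteq> m" "\<sigma> a \<noteq> Suc m" if "a < m" using \<sigma>(1)[OF that] by auto
        ultimately show "\<sigma>' a < Suc (Suc m)" "\<sigma>' (\<sigma>' a) = a" "p' a \<noteq> 0" "p' (\<sigma>' a) = p' a" "e' a \<in> F (n' a)"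
          using \<sigma>[of a] p[of a] eF[of a] x z xy
          by (elim disjE; simp add: e'_def \<sigma>'_def p'_def n'_def)+
      qed
      then have "P (Suc (Suc m))" unfolding P_def by blast
      then show False using mmax by force
    qed
  qed
  then show thesis using that[of m e n \<sigma> p] s unfolding V_def by blast
qed

end

section \<open>Gram determinants and Laplace expansion\<close>

definition rank_in :: "nat set \<Rightarrow> nat \<Rightarrow> nat" where
  "rank_in Q q = card {q' \<in> Q. q' < q}"

text \<open>Expansion along the first row, with the columns indexed by a finite set of numbers. Deleting a column
needs no renumbering, which makes induction on the rows possible.\<close>

fun row_det :: "('a \<Rightarrow> nat \<Rightarrow> 'r::comm_ring_1) \<Rightarrow> 'a list \<Rightarrow> nat set \<Rightarrow> 'r" where
  "row_det M [] Q = 1"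
| "row_det M (x # xs) Q = (\<Sum>q\<in>Q. (- 1) ^ rank_in Q q * M x q * row_det M xs (Q - {q}))"

definition gram_det :: "('a \<Rightarrow> 'b \<Rightarrow> 'r::comm_ring_1) \<Rightarrow> 'a list \<Rightarrow> 'b list \<Rightarrow> 'r" where
  "gram_det M xs ys = det (mat (length xs) (length xs) (\<lambda>(k, l). M (xs ! k) (ys ! l)))"

lemma ext_pow_gram_det: "length \<phi>s = i \<Longrightarrow> ext_pow i b \<phi>s \<psi>s = gram_det b \<phi>s \<psi>s"
  by (simp add: ext_pow_def gram_det_def)

lemma gram_det_Cons:
  assumes "length ys = Suc (length xs)"
  shows "gram_det M (x # xs) ys =
    (\<Sum>t<length ys. (- 1) ^ t * M x (ys ! t) * gram_det M xs (take t ys @ drop (Suc t) ys))"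
proof -
  let ?A = "mat (length (x # xs)) (length (x # xs)) (\<lambda>(k, l). M ((x # xs) ! k) (ys ! l))"
  have "det ?A = (\<Sum>t<length (x # xs). ?A $$ (0, t) * cofactor ?A 0 t)"
    by (rule laplace_expansion_row) auto
  also have "\<dots> = (\<Sum>t<length ys. (- 1) ^ t * M x (ys ! t) * gram_det M xs (take t ys @ drop (Suc t) ys))"
  proof (rule sum.cong)
    fix t assume t: "t \<in> {..<length ys}"
    have "mat_delete ?A 0 t =
      mat (length xs) (length xs) (\<lambda>(k, l). M (xs ! k) ((take t ys @ drop (Suc t) ys) ! l))"
      by (rule eq_matI) (use t assms in \<open>auto simp: mat_delete_def nth_append min_def\<close>)
    then show "?A $$ (0, t) * cofactor ?A 0 t =
      (- 1) ^ t * M x (ys ! t) * gram_det M xs (take t ys @ drop (Suc t) ys)"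
      using t assms by (simp add: cofactor_def gram_det_def mult_ac)
  qed (use assms in auto)
  finally show ?thesis by (simp add: gram_det_def)
qed

lemma nths_split_at:
  assumes "q < length ys"
  shows "nths ys Q = nths (take q ys) Q @ (if q \<in> Q then [ys ! q] else []) @
    nths (drop (Suc q) ys) {j. j + Suc q \<in> Q}"
proof -
  have "nths ys Q = nths (take q ys @ ys ! q # drop (Suc q) ys) Q"
    using id_take_nth_drop[OF assms] by simp
  then show ?thesis using assms by (simp add: nths_append nths_Cons min_def)
qed

lemma nths_take_cong: "Q \<inter> {..<q} = Q' \<inter> {..<q} \<Longrightarrow> nths (take q ys) Q = nths (take q ys) Q'"
proof -
  assume *: "Q \<inter> {..<q} = Q' \<inter> {..<q}"
  have "nths (take q ys) Q = nths (take q ys) (Q \<inter> {..<q})" for Q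
    unfolding nths_def by (intro arg_cong[where f = "map fst"] filter_cong) (auto simp: set_zip)
  then show ?thesis using * by metis
qed

lemma length_nths_take:
  assumes "q \<le> length ys"
  shows "length (nths (take q ys) Q) = rank_in Q q"
  using assms by (auto simp: length_nths rank_in_def min_def intro!: arg_cong[where f = card])

lemma row_det_eq_gram_det:
  assumes "Q \<subseteq> {..<length ys}" and "card Q = length xs"
  shows "row_det (\<lambda>x q. M x (ys ! q)) xs Q = gram_det M xs (nths ys Q)"
  using assms
proof (induction xs arbitrary: Q)
  case Nil
  then show ?case by (simp add: gram_det_def)
next
  case (Cons x xs)
  let ?zs = "nths ys Q"
  have finQ: "finite Q" using Cons.prems finite_subset by blast
  have len: "length ?zs = Suc (length xs)"
    using Cons.prems by (simp add: length_nths)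
      (metis Collect_conj_eq Collect_mem_eq inf.absorb2 lessThan_def)
  have at: "?zs ! rank_in Q q = ys ! q \<and>
      take (rank_in Q q) ?zs @ drop (Suc (rank_in Q q)) ?zs = nths ys (Q - {q})"
    if "q \<in> Q" for q
  proof -
    have q: "q < length ys" using that Cons.prems by auto
    have l: "length (nths (take q ys) Q) = rank_in Q q" using length_nths_take[of q ys Q] q by simp
    have s: "?zs = nths (take q ys) Q @ ys ! q # nths (drop (Suc q) ys) {j. j + Suc q \<in> Q}"
      using nths_split_at[OF q, of Q] that by simp
    have "nths (take q ys) (Q - {q}) = nths (take q ys) Q" by (rule nths_take_cong) auto
    moreover have "{j. j + Suc q \<in> Q - {q}} = {j. j + Suc q \<in> Q}" by auto
    ultimately have "nths ys (Q - {q}) = nths (take q ys) Q @ nths (drop (Suc q) ys) {j. j + Suc q \<in> Q}"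
      using nths_split_at[OF q, of "Q - {q}"] by simp
    then show ?thesis unfolding s using l by (simp add: nth_append)
  qed
  have bij: "bij_betw (rank_in Q) Q {..<length ?zs}"
  proof -
    have mono: "rank_in Q a < rank_in Q b" if "a \<in> Q" "a < b" for a b
      unfolding rank_in_def by (rule psubset_card_mono) (use that finQ in auto)
    then have "inj_on (rank_in Q) Q" by (metis linorder_inj_onI' nat_neq_iff)
    moreover have "rank_in Q ` Q \<subseteq> {..<length ?zs}"
    proof -
      have "rank_in Q a < card Q" if "a \<in> Q" for a
        unfolding rank_in_def by (rule psubset_card_mono) (use that finQ in auto)
      then show ?thesis using len Cons.prems by auto
    qed
    ultimately show ?thesis using len Cons.prems
      by (simp add: bij_betw_def card_image card_subset_eq)
  qed
  have "row_det (\<lambda>x q. M x (ys ! q)) (x # xs) Q =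
    (\<Sum>q\<in>Q. (- 1) ^ rank_in Q q * M x (?zs ! rank_in Q q) *
       gram_det M xs (take (rank_in Q q) ?zs @ drop (Suc (rank_in Q q)) ?zs))"
    unfolding row_det.simps
  proof (rule sum.cong[OF refl])
    fix q assume q: "q \<in> Q"
    have "row_det (\<lambda>x q. M x (ys ! q)) xs (Q - {q}) = gram_det M xs (nths ys (Q - {q}))"
      by (rule Cons.IH) (use Cons.prems q finQ in auto)
    then show "(- 1) ^ rank_in Q q * M x (ys ! q) * row_det (\<lambda>x q. M x (ys ! q)) xs (Q - {q}) =
      (- 1) ^ rank_in Q q * M x (?zs ! rank_in Q q) *
       gram_det M xs (take (rank_in Q q) ?zs @ drop (Suc (rank_in Q q)) ?zs)"
      using at[OF q] by simp
  qed
  also have "\<dots> = (\<Sum>t<length ?zs. (- 1) ^ t * M x (?zs ! t) * gram_det M xs (take t ?zs @ drop (Suc t) ?zs))"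
    by (rule sum.reindex_bij_betw[OF bij])
  also have "\<dots> = gram_det M (x # xs) ?zs" by (rule gram_det_Cons[OF len, symmetric])
  finally show ?case .
qed

lemma gram_det_eq_row_det:
  "length ys = length xs \<Longrightarrow> gram_det M xs ys = row_det (\<lambda>x q. M x (ys ! q)) xs {..<length xs}"
  using row_det_eq_gram_det[of "{..<length xs}" ys xs M] by (simp add: nths_all)

text \<open>Induction on the number of rows. The first row belongs either to \<open>P\<close> or to its complement; correspondingly
its column \<open>q\<close> is added to the set \<open>R\<close> of columns or to its complement. What has to be checked is the sign:
removing \<open>q\<close> lowers the rank of the columns to its right by one.\<close>

lemma row_det_laplace:
  assumes "finite Q" "card Q = length xs" "P \<subseteq> {..<length xs}"
  shows "row_det M xs Q = (\<Sum>R | R \<subseteq> Q \<and> card R = card P.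
    (- 1) ^ (\<Sum>P + (\<Sum>r\<in>R. rank_in Q r)) * row_det M (nths xs P) R * row_det M (nths xs (- P)) (Q - R))"
  using assms
proof (induction xs arbitrary: Q P)
  case Nil
  then have "{R. R \<subseteq> Q \<and> card R = card P} = {{}}" by auto
  then show ?case using Nil by simp
next
  case (Cons x xs)
  define P' where "P' = {j. Suc j \<in> P}"
  have finP: "finite P" using Cons.prems finite_subset by blast
  have P'fin: "finite P'" "P' \<subseteq> {..<length xs}" using Cons.prems by (auto simp: P'_def intro: finite_subset[of _ "{..<length xs}"])
  have PS: "P - {0} = Suc ` P'" by (auto simp: P'_def image_iff) (metis not0_implies_Suc)
  have SP: "\<Sum>P = \<Sum>P' + card P'"
  proof -
    have "\<Sum>P = \<Sum>(P - {0})" using finP by (cases "0 \<in> P") (auto simp: sum.remove)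
    also have "\<dots> = (\<Sum>j\<in>P'. Suc j)" unfolding PS by (subst sum.reindex) auto
    finally show ?thesis by (simp add: sum_Suc)
  qed
  have n1: "nths (x # xs) P = (if 0 \<in> P then [x] else []) @ nths xs P'"
    by (simp add: nths_Cons P'_def)
  have n2: "nths (x # xs) (- P) = (if 0 \<in> P then [] else [x]) @ nths xs (- P')"
    by (simp add: nths_Cons P'_def Compl_eq)
  let ?A = "\<lambda>R. row_det M (nths xs P') R" and ?B = "\<lambda>R. row_det M (nths xs (- P')) R"
  have IH: "row_det M xs (Q - {q}) = (\<Sum>R | R \<subseteq> Q - {q} \<and> card R = card P'.
      (- 1) ^ (\<Sum>P' + (\<Sum>r\<in>R. rank_in (Q - {q}) r)) * ?A R * ?B (Q - {q} - R))" if "q \<in> Q" for q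
    by (rule Cons.IH) (use Cons.prems that P'fin in auto)
  have rk: "rank_in Q r = rank_in (Q - {q}) r + (if q < r then 1 else 0)" if "q \<in> Q" for q r
  proof -
    have "{q' \<in> Q. q' < r} = {q' \<in> Q - {q}. q' < r} \<union> (if q < r then {q} else {})" using that by auto
    then show ?thesis using Cons.prems(1) by (simp add: rank_in_def card_insert_if)
  qed
  \<comment> \<open>the ranks change by the number of columns in \<open>R\<close> to the right of \<open>q\<close>\<close>
  have rks: "(\<Sum>r\<in>R. rank_in Q r) = (\<Sum>r\<in>R. rank_in (Q - {q}) r) + card {r\<in>R. q < r}"
    if "q \<in> Q" "R \<subseteq> Q" for q R
  proof -
    have fR: "finite R" using that Cons.prems finite_subset by blast
    have "(\<Sum>r\<in>R. if q < r then 1 else 0::nat) = card {r\<in>R. q < r}"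
      using fR by (simp add: sum.If_cases Int_def)
    then show ?thesis by (simp add: rk[OF that(1)] sum.distrib)
  qed
  have split: "card R = rank_in R q + card {r\<in>R. q < r}" if "R \<subseteq> Q - {q}" for R q
  proof -
    have fR: "finite R" using that Cons.prems finite_subset by blast
    have "R = {r\<in>R. r < q} \<union> {r\<in>R. q < r}" using that by force
    then have "card R = card ({r\<in>R. r < q} \<union> {r\<in>R. q < r})" by simp
    also have "\<dots> = card {r\<in>R. r < q} + card {r\<in>R. q < r}"
      using fR by (intro card_Un_disjoint) auto
    finally show ?thesis by (simp add: rank_in_def)
  qed
  have fin: "finite {R. R \<subseteq> Q - {q} \<and> card R = m}" "finite {R. R \<subseteq> Q \<and> card R = m}" for q m
    using Cons.prems by (auto intro: finite_subset[of _ "Pow Q"])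
  let ?t = "\<lambda>q R. (- 1) ^ (rank_in Q q + (\<Sum>P' + (\<Sum>r\<in>R. rank_in (Q - {q}) r))) * M x q * ?A R * ?B (Q - {q} - R)"
  have L: "row_det M (x # xs) Q = (\<Sum>(q, R)\<in>(SIGMA q:Q. {R. R \<subseteq> Q - {q} \<and> card R = card P'}). ?t q R)"
    using Cons.prems(1) fin
    by (simp add: IH sum_distrib_left sum.Sigma power_add mult_ac)
  have sign1: "C * m * a * b = A * (B * m * a) * b" and sign2: "C * m * a * b = A * a * (B * m * b)"
    if "A * B = C" for A B C m a b :: 'b
    using that by (auto simp: mult_ac)
  show ?case
  proof (cases "0 \<in> P")
    case True
    have cP: "card P = Suc (card P')"
    proof -
      have "card P = Suc (card (P - {0}))" using True finP by (metis card_Suc_Diff1)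
      also have "card (P - {0}) = card P'" unfolding PS by (rule card_image) simp
      finally show ?thesis .
    qed
    let ?u = "\<lambda>R q. (- 1) ^ (\<Sum>P + (\<Sum>r\<in>R. rank_in Q r)) * ((- 1) ^ rank_in R q * M x q * ?A (R - {q})) * ?B (Q - R)"
    have "(\<Sum>R | R \<subseteq> Q \<and> card R = card P. (- 1) ^ (\<Sum>P + (\<Sum>r\<in>R. rank_in Q r)) *
        row_det M (nths (x # xs) P) R * row_det M (nths (x # xs) (- P)) (Q - R)) =
      (\<Sum>R | R \<subseteq> Q \<and> card R = card P. \<Sum>q\<in>R. ?u R q)"
      unfolding n1 n2 using True by (simp add: sum_distrib_left sum_distrib_right)
    also have "\<dots> = (\<Sum>(R, q)\<in>(SIGMA R:{R. R \<subseteq> Q \<and> card R = card P}. R). ?u R q)"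
      using fin Cons.prems(1) by (intro sum.Sigma) (auto intro: finite_subset)
    also have "\<dots> = (\<Sum>(q, R)\<in>(SIGMA q:Q. {R. R \<subseteq> Q - {q} \<and> card R = card P'}). ?t q R)"
    proof (rule sum.reindex_bij_witness[of _ "\<lambda>(q, R). (insert q R, q)" "\<lambda>(R, q). (q, R - {q})"])
      fix z assume z: "z \<in> (SIGMA R:{R. R \<subseteq> Q \<and> card R = card P}. R)"
      obtain R q where zz: "z = (R, q)" by (cases z)
      have R: "R \<subseteq> Q" "card R = Suc (card P')" "q \<in> R" using z zz cP by auto
      have fR: "finite R" using R Cons.prems finite_subset by blast
      let ?R = "R - {q}"
      have cR: "card ?R = card P'" using R fR by simp
      have e1: "(\<Sum>r\<in>R. rank_in Q r) = rank_in Q q + (\<Sum>r\<in>?R. rank_in (Q - {q}) r) + card {r\<in>?R. q < r}"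
        using rks[of q ?R] R fR by (subst sum.remove[of R q]) auto
      have e2: "card P' = rank_in ?R q + card {r\<in>?R. q < r}" using split[of ?R q] R cR by auto
      have e3: "rank_in R q = rank_in ?R q"
        unfolding rank_in_def by (rule arg_cong[where f = card]) auto
      have QR: "Q - {q} - ?R = Q - R" using R by auto
      have ev: "\<Sum>P + (\<Sum>r\<in>R. rank_in Q r) + rank_in R q =
          rank_in Q q + (\<Sum>P' + (\<Sum>r\<in>?R. rank_in (Q - {q}) r)) + 2 * (card {r\<in>?R. q < r} + rank_in ?R q)"
        unfolding SP e1 e3 using e2 by simp
      have "(- 1 :: 'b) ^ (\<Sum>P + (\<Sum>r\<in>R. rank_in Q r)) * (- 1) ^ rank_in R q =
          (- 1) ^ (rank_in Q q + (\<Sum>P' + (\<Sum>r\<in>?R. rank_in (Q - {q}) r)))"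
        unfolding power_add[symmetric] ev by (simp add: power_add)
      then show "(case (case z of (R, q) \<Rightarrow> (q, R - {q})) of (q, R) \<Rightarrow> ?t q R) = (case z of (R, q) \<Rightarrow> ?u R q)"
        unfolding zz prod.case QR by (rule sign1)
    next
      fix z assume z: "z \<in> (SIGMA q:Q. {R. R \<subseteq> Q - {q} \<and> card R = card P'})"
      then have "finite (snd z)" using Cons.prems(1) finite_subset[OF _ finite_Diff] by fastforce
      then show "(case z of (q, R) \<Rightarrow> (insert q R, q)) \<in> (SIGMA R:{R. R \<subseteq> Q \<and> card R = card P}. R)"
        using z cP by (auto simp: card_insert_if)
    qed (use cP Cons.prems(1) in \<open>auto intro: finite_subset\<close>)
    finally show ?thesis using L by simp
  next
    case False
    have cP: "card P = card P'"
    proof -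
      have "P = Suc ` P'" using PS False by auto
      then show ?thesis by (simp add: card_image)
    qed
    let ?u = "\<lambda>R q. (- 1) ^ (\<Sum>P + (\<Sum>r\<in>R. rank_in Q r)) * ?A R * ((- 1) ^ rank_in (Q - R) q * M x q * ?B (Q - R - {q}))"
    have "(\<Sum>R | R \<subseteq> Q \<and> card R = card P. (- 1) ^ (\<Sum>P + (\<Sum>r\<in>R. rank_in Q r)) *
        row_det M (nths (x # xs) P) R * row_det M (nths (x # xs) (- P)) (Q - R)) =
      (\<Sum>R | R \<subseteq> Q \<and> card R = card P. \<Sum>q\<in>Q - R. ?u R q)"
      unfolding n1 n2 using False by (simp add: sum_distrib_left sum_distrib_right)
    also have "\<dots> = (\<Sum>(R, q)\<in>(SIGMA R:{R. R \<subseteq> Q \<and> card R = card P}. Q - R). ?u R q)"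
      using fin Cons.prems(1) by (intro sum.Sigma) (auto intro: finite_subset)
    also have "\<dots> = (\<Sum>(q, R)\<in>(SIGMA q:Q. {R. R \<subseteq> Q - {q} \<and> card R = card P'}). ?t q R)"
    proof (rule sum.reindex_bij_witness[of _ "\<lambda>(q, R). (R, q)" "\<lambda>(R, q). (q, R)"])
      fix z assume z: "z \<in> (SIGMA R:{R. R \<subseteq> Q \<and> card R = card P}. Q - R)"
      obtain R q where zz: "z = (R, q)" by (cases z)
      have R: "R \<subseteq> Q" "card R = card P'" "q \<in> Q" "q \<notin> R" using z zz cP by auto
      have fR: "finite R" using R Cons.prems finite_subset by blast
      have e1: "(\<Sum>r\<in>R. rank_in Q r) = (\<Sum>r\<in>R. rank_in (Q - {q}) r) + card {r\<in>R. q < r}"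
        using rks[of q R] R by auto
      have e2: "card P' = rank_in R q + card {r\<in>R. q < r}" using split[of R q] R by auto
      have e3: "rank_in Q q = rank_in (Q - R) q + rank_in R q"
      proof -
        have "{q' \<in> Q. q' < q} = {q' \<in> Q - R. q' < q} \<union> {q' \<in> R. q' < q}" using R by auto
        then show ?thesis unfolding rank_in_def
          using card_Un_disjoint[of "{q' \<in> Q - R. q' < q}" "{q' \<in> R. q' < q}"] fR Cons.prems(1) by auto
      qed
      have QR: "Q - {q} - R = Q - R - {q}" by auto
      have ev: "\<Sum>P + (\<Sum>r\<in>R. rank_in Q r) + rank_in (Q - R) q + 2 * rank_in R q =
          rank_in Q q + (\<Sum>P' + (\<Sum>r\<in>R. rank_in (Q - {q}) r)) + 2 * (card {r\<in>R. q < r} + rank_in R q)"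
        unfolding SP e1 e3 using e2 by simp
      have "(- 1 :: 'b) ^ (\<Sum>P + (\<Sum>r\<in>R. rank_in Q r)) * (- 1) ^ rank_in (Q - R) q =
          (- 1) ^ (rank_in Q q + (\<Sum>P' + (\<Sum>r\<in>R. rank_in (Q - {q}) r)))"
        using arg_cong[OF ev, of "\<lambda>n. (- 1 :: 'b) ^ n"] by (simp add: power_add)
      then show "(case (case z of (R, q) \<Rightarrow> (q, R)) of (q, R) \<Rightarrow> ?t q R) = (case z of (R, q) \<Rightarrow> ?u R q)"
        unfolding zz prod.case QR by (rule sign2)
    qed (use cP in auto)
    finally show ?thesis using L by simp
  qed
qed

text \<open>The form in which the definition of \<open>wedge\<close> states the product of exterior powers.\<close>

lemma gram_det_laplace:
  assumes "length ys = length xs" "P \<subseteq> {..<length xs}"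
  shows "gram_det M xs ys = (\<Sum>Q | Q \<subseteq> {..<length ys} \<and> card Q = card P.
    (- 1) ^ (\<Sum>P + \<Sum>Q) * gram_det M (nths xs P) (nths ys Q) * gram_det M (nths xs (- P)) (nths ys (- Q)))"
proof -
  let ?n = "length xs"
  have "gram_det M xs ys = row_det (\<lambda>x q. M x (ys ! q)) xs {..<?n}"
    using gram_det_eq_row_det assms by blast
  also have "\<dots> = (\<Sum>R | R \<subseteq> {..<?n} \<and> card R = card P.
    (- 1) ^ (\<Sum>P + (\<Sum>r\<in>R. rank_in {..<?n} r)) * row_det (\<lambda>x q. M x (ys ! q)) (nths xs P) R *
      row_det (\<lambda>x q. M x (ys ! q)) (nths xs (- P)) ({..<?n} - R))"
    by (rule row_det_laplace) (use assms in auto)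
  also have "\<dots> = (\<Sum>Q | Q \<subseteq> {..<length ys} \<and> card Q = card P.
    (- 1) ^ (\<Sum>P + \<Sum>Q) * gram_det M (nths xs P) (nths ys Q) * gram_det M (nths xs (- P)) (nths ys (- Q)))"
  proof (rule sum.cong)
    fix Q assume Q: "Q \<in> {R. R \<subseteq> {..<length ys} \<and> card R = card P}"
    have "rank_in {..<?n} r = r" if "r \<in> Q" for r
    proof -
      have "{q' \<in> {..<?n}. q' < r} = {..<r}" using that Q assms by auto
      then show ?thesis by (simp add: rank_in_def)
    qed
    then have 1: "(\<Sum>r\<in>Q. rank_in {..<?n} r) = \<Sum>Q" by simp
    have fP: "finite P" "finite Q" using assms Q finite_subset by blast+
    have "{i. i < ?n \<and> i \<in> P} = P" "{i. i < ?n \<and> i \<in> - P} = {..<?n} - P" using assms by auto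
    then have l: "length (nths xs P) = card P" "length (nths xs (- P)) = ?n - card P"
      using assms fP by (simp_all add: length_nths card_Diff_subset)
    have 2: "row_det (\<lambda>x q. M x (ys ! q)) (nths xs P) Q = gram_det M (nths xs P) (nths ys Q)"
      by (rule row_det_eq_gram_det) (use Q l in auto)
    have "nths ys ({..<?n} - Q) = nths ys (- Q)"
      unfolding nths_def by (intro arg_cong[where f = "map fst"] filter_cong) (auto simp: set_zip assms)
    then have 3: "row_det (\<lambda>x q. M x (ys ! q)) (nths xs (- P)) ({..<?n} - Q) =
        gram_det M (nths xs (- P)) (nths ys (- Q))"
      using row_det_eq_gram_det[of "{..<?n} - Q" ys "nths xs (- P)" M] Q l assms fP
      by (simp add: card_Diff_subset)
    show "(- 1) ^ (\<Sum>P + (\<Sum>r\<in>Q. rank_in {..<?n} r)) * row_det (\<lambda>x q. M x (ys ! q)) (nths xs P) Q *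
      row_det (\<lambda>x q. M x (ys ! q)) (nths xs (- P)) ({..<?n} - Q) =
      (- 1) ^ (\<Sum>P + \<Sum>Q) * gram_det M (nths xs P) (nths ys Q) * gram_det M (nths xs (- P)) (nths ys (- Q))"
      unfolding 1 2 3 ..
  qed (use assms in auto)
  finally show ?thesis .
qed

section \<open>Exterior powers of sums of rank one forms\<close>

lemma gram_det_cong:
  assumes "\<And>x y. x \<in> set xs \<Longrightarrow> y \<in> set ys \<Longrightarrow> M x y = M' x y" and "length ys = length xs"
  shows "gram_det M xs ys = gram_det M' xs ys"
  unfolding gram_det_def
  by (rule arg_cong[where f = det]) (auto intro!: eq_matI simp: assms)

lemma gram_det_map:
  "length ys = length xs \<Longrightarrow> gram_det M (map f xs) (map g ys) = gram_det (\<lambda>x y. M (f x) (g y)) xs ys"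
  unfolding gram_det_def by (rule arg_cong[where f = det]) (auto intro!: eq_matI)

lemma gram_det_transpose:
  assumes "length ys = length xs"
  shows "gram_det M xs ys = gram_det (\<lambda>y x. M x y) ys xs"
proof -
  let ?A = "mat (length xs) (length xs) (\<lambda>(k, l). M (xs ! k) (ys ! l))"
  have "transpose_mat ?A = mat (length ys) (length ys) (\<lambda>(k, l). M (xs ! l) (ys ! k))"
    using assms by (auto intro!: eq_matI)
  moreover have "det (transpose_mat ?A) = det ?A" by (rule det_transpose) auto
  ultimately show ?thesis by (simp add: gram_det_def)
qed

lemma gram_det_hom:
  assumes "comm_ring_hom h"
  shows "h (gram_det M xs ys) = gram_det (\<lambda>x y. h (M x y)) xs ys"
proof -
  interpret comm_ring_hom h by fact
  have "map_mat h (mat (length xs) (length xs) (\<lambda>(k, l). M (xs ! k) (ys ! l))) =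
    mat (length xs) (length xs) (\<lambda>(k, l). h (M (xs ! k) (ys ! l)))"
    by (auto intro!: eq_matI)
  then show ?thesis unfolding gram_det_def by (metis hom_det)
qed

lemma gram_det_repeated:
  assumes "a < length xs" "b < length xs" "a \<noteq> b" "xs ! a = xs ! b"
  shows "gram_det M xs ys = 0"
  unfolding gram_det_def
  by (rule det_identical_rows[of _ "length xs" a b]) (use assms in \<open>auto intro!: eq_vecI\<close>)

lemma gram_det_not_distinct: "\<not> distinct xs \<Longrightarrow> gram_det M xs ys = 0"
  using gram_det_repeated unfolding distinct_conv_nth by metis

definition pair_prod :: "('x \<Rightarrow> 'a \<Rightarrow> 'r::comm_ring_1) \<Rightarrow> 'x list \<Rightarrow> 'a list \<Rightarrow> 'r" where
  "pair_prod U \<phi>s xs = prod_list (map2 U \<phi>s xs)"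

lemma pair_prod_simps [simp]:
  "pair_prod U [] xs = 1" "pair_prod U (\<phi> # \<phi>s) (x # xs) = U \<phi> x * pair_prod U \<phi>s xs"
  by (simp_all add: pair_prod_def)

lemma pair_prod_nths:
  "length \<phi>s = length xs \<Longrightarrow>
    pair_prod U \<phi>s xs = pair_prod U (nths \<phi>s P) (nths xs P) * pair_prod U (nths \<phi>s (- P)) (nths xs (- P))"
proof (induction \<phi>s xs arbitrary: P rule: list_induct2)
  case (Cons \<phi> \<phi>s x xs)
  have "{j. Suc j \<in> - P} = - {j. Suc j \<in> P}" by auto
  then show ?case using Cons.IH[of "{j. Suc j \<in> P}"] by (simp add: nths_Cons mult_ac)
qed simp

lemma lists_of_Suc_length:
  "{xs. length xs = Suc i \<and> set xs \<subseteq> A} = (\<lambda>(a, xs). a # xs) ` (A \<times> {xs. length xs = i \<and> set xs \<subseteq> A})"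
  by (auto simp: length_Suc_conv image_iff) 

lemma row_det_expand:
  assumes "finite A"
  shows "row_det (\<lambda>\<phi> q. \<Sum>a\<in>A. U \<phi> a * Y a q) \<phi>s Q =
    (\<Sum>xs | length xs = length \<phi>s \<and> set xs \<subseteq> A. pair_prod U \<phi>s xs * row_det Y xs Q)"
proof (induction \<phi>s arbitrary: Q)
  case (Cons \<phi> \<phi>s)
  let ?L = "{xs. length xs = length \<phi>s \<and> set xs \<subseteq> A}"
  let ?M = "\<lambda>\<phi> q. \<Sum>a\<in>A. U \<phi> a * Y a q"
  have "row_det ?M (\<phi> # \<phi>s) Q = (\<Sum>q\<in>Q. \<Sum>a\<in>A. \<Sum>xs\<in>?L.
      (- 1) ^ rank_in Q q * (U \<phi> a * Y a q) * (pair_prod U \<phi>s xs * row_det Y xs (Q - {q})))"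
    unfolding row_det.simps Cons.IH sum_distrib_left sum_distrib_right
    by (rule sum.cong[OF refl]) (rule sum.swap)
  also have "\<dots> = (\<Sum>a\<in>A. \<Sum>xs\<in>?L. \<Sum>q\<in>Q.
      (- 1) ^ rank_in Q q * (U \<phi> a * Y a q) * (pair_prod U \<phi>s xs * row_det Y xs (Q - {q})))"
    by (subst sum.swap) (intro sum.cong refl sum.swap)
  also have "\<dots> = (\<Sum>a\<in>A. \<Sum>xs\<in>?L. pair_prod U (\<phi> # \<phi>s) (a # xs) * row_det Y (a # xs) Q)"
    by (simp add: sum_distrib_left mult_ac)
  also have "\<dots> = (\<Sum>(a, xs)\<in>A \<times> ?L. pair_prod U (\<phi> # \<phi>s) (a # xs) * row_det Y (a # xs) Q)"
    by (rule sum.cartesian_product)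
  also have "\<dots> = (\<Sum>xs | length xs = length (\<phi> # \<phi>s) \<and> set xs \<subseteq> A.
      pair_prod U (\<phi> # \<phi>s) xs * row_det Y xs Q)"
    unfolding list.size(4) add_Suc_right add_0_right lists_of_Suc_length
    by (subst sum.reindex) (auto simp: inj_on_def intro!: sum.cong simp del: pair_prod_simps row_det.simps)
  finally show ?case .
next
  case Nil
  have "{xs. length xs = length [] \<and> set xs \<subseteq> A} = {[]}" by auto
  then show ?case by (simp add: pair_prod_def)
qed

text \<open>The Cauchy-Binet formula before the terms with the same index set are collected. Leaving the lists
unsorted avoids all signs.\<close>

lemma gram_det_expand:
  assumes "finite A" "length \<psi>s = length \<phi>s"
  shows "gram_det (\<lambda>\<phi> \<psi>. \<Sum>a\<in>A. U \<phi> a * Y a \<psi>) \<phi>s \<psi>s =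
    (\<Sum>xs | length xs = length \<phi>s \<and> set xs \<subseteq> A \<and> distinct xs. pair_prod U \<phi>s xs * gram_det Y xs \<psi>s)"
proof -
  let ?L = "{xs. length xs = length \<phi>s \<and> set xs \<subseteq> A}"
  have fin: "finite ?L" using finite_lists_length_eq[OF assms(1), of "length \<phi>s"]
    by (rule rev_finite_subset) auto
  have "gram_det (\<lambda>\<phi> \<psi>. \<Sum>a\<in>A. U \<phi> a * Y a \<psi>) \<phi>s \<psi>s = (\<Sum>xs\<in>?L. pair_prod U \<phi>s xs * gram_det Y xs \<psi>s)"
    using assms row_det_expand[OF assms(1), where U = U and Y = "\<lambda>a q. Y a (\<psi>s ! q)" and \<phi>s = \<phi>s]
    by (simp add: gram_det_eq_row_det)
  also have "\<dots> = (\<Sum>xs | length xs = length \<phi>s \<and> set xs \<subseteq> A \<and> distinct xs. pair_prod U \<phi>s xs * gram_det Y xs \<psi>s)"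
    by (rule sum.mono_neutral_right[OF fin]) (auto simp: gram_det_not_distinct)
  finally show ?thesis .
qed

text \<open>The inverse of \<open>xs \<mapsto> (nths xs P, nths xs (- P))\<close>.\<close>

fun merge_at :: "nat \<Rightarrow> nat set \<Rightarrow> 'a list \<Rightarrow> 'a list \<Rightarrow> 'a list" where
  "merge_at 0 P ys zs = []"
| "merge_at (Suc n) P ys zs = (if 0 \<in> P then hd ys # merge_at n {j. Suc j \<in> P} (tl ys) zs
     else hd zs # merge_at n {j. Suc j \<in> P} ys (tl zs))"

lemma card_shift:
  assumes "P \<subseteq> {..<Suc n}"
  shows "card P = (if 0 \<in> P then 1 else 0) + card {j. Suc j \<in> P}" "{j. Suc j \<in> P} \<subseteq> {..<n}"
proof -
  have "finite P" using assms finite_subset by blast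
  have "P - {0} = Suc ` {j. Suc j \<in> P}" by (auto simp: image_iff) (metis not0_implies_Suc)
  then have "card (P - {0}) = card {j. Suc j \<in> P}" by (simp add: card_image)
  then show "card P = (if 0 \<in> P then 1 else 0) + card {j. Suc j \<in> P}"
    using \<open>finite P\<close> card_Suc_Diff1[of P 0] by auto
qed (use assms in auto)

lemma merge_at:
  assumes "P \<subseteq> {..<n}" "card P = length ys" "n = length ys + length zs"
  shows "length (merge_at n P ys zs) = n" "nths (merge_at n P ys zs) P = ys" "nths (merge_at n P ys zs) (- P) = zs"
proof -
  have "length (merge_at n P ys zs) = n \<and> nths (merge_at n P ys zs) P = ys \<and> nths (merge_at n P ys zs) (- P) = zs"
    using assms
  proof (induction n arbitrary: P ys zs)
    case (Suc n)
    let ?P = "{j. Suc j \<in> P}"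
    have c: "card P = (if 0 \<in> P then 1 else 0) + card ?P" "?P \<subseteq> {..<n}" using card_shift[OF Suc.prems(1)] by auto
    have neg: "{j. Suc j \<notin> P} = - ?P" by auto
    show ?case
    proof (cases "0 \<in> P")
      case True
      then obtain y ys' where y: "ys = y # ys'" using c Suc.prems by (cases ys) auto
      have "length (merge_at n ?P ys' zs) = n \<and> nths (merge_at n ?P ys' zs) ?P = ys' \<and>
          nths (merge_at n ?P ys' zs) (- ?P) = zs"
        by (rule Suc.IH) (use c Suc.prems True y in simp_all)
      then show ?thesis using True y by (simp add: nths_Cons neg)
    next
      case False
      have "card ?P \<le> n" using card_mono[OF _ c(2)] by simp
      then obtain z zs' where z: "zs = z # zs'" using c(1) Suc.prems(2,3) False by (cases zs) simp_all
      have "length (merge_at n ?P ys zs') = n \<and> nths (merge_at n ?P ys zs') ?P = ys \<and>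
          nths (merge_at n ?P ys zs') (- ?P) = zs'"
        by (rule Suc.IH) (use c Suc.prems False z in simp_all)
      then show ?thesis using False z by (simp add: nths_Cons neg)
    qed
  qed auto
  then show "length (merge_at n P ys zs) = n" "nths (merge_at n P ys zs) P = ys" "nths (merge_at n P ys zs) (- P) = zs"
    by auto
qed

lemma merge_at_nths: "merge_at (length xs) P (nths xs P) (nths xs (- P)) = xs"
proof (induction xs arbitrary: P)
  case (Cons x xs)
  have neg: "{j. Suc j \<notin> P} = - {j. Suc j \<in> P}" by auto
  show ?case using Cons.IH[of "{j. Suc j \<in> P}"] by (auto simp: nths_Cons neg)
qed simp

lemma positions_eq:
  assumes "P \<subseteq> {..<length xs}" "set (nths xs P) \<subseteq> C" "set (nths xs (- P)) \<inter> C = {}"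
  shows "{k. k < length xs \<and> xs ! k \<in> C} = P"
  using assms by (auto simp: set_nths)

lemma filter_not_eq_nths: "filter (\<lambda>x. x \<notin> C) xs = nths xs (- {k. k < length xs \<and> xs ! k \<in> C})"
proof -
  have "nths xs (- {k. k < length xs \<and> xs ! k \<in> C}) = nths xs {k. k < length xs \<and> xs ! k \<notin> C}"
    unfolding nths_def by (intro arg_cong[where f = "map fst"] filter_cong) (auto simp: set_zip)
  then show ?thesis by (simp add: filter_eq_nths)
qed

text \<open>The lists of indices that take each block completely before they touch the next one. These index the
terms of \<open>det q\<^sub>0 \<and> \<dots> \<and> \<Lambda>\<^sup>m q\<^sub>j\<close>. The order of the entries is arbitrary, in accordance with
\<open>gram_det_expand\<close>.\<close>

fun greedy :: "'a set list \<Rightarrow> 'a list \<Rightarrow> bool" where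
  "greedy [] xs \<longleftrightarrow> xs = []"
| "greedy (C # Cs) xs \<longleftrightarrow> (if length xs \<le> card C then set xs \<subseteq> C \<and> distinct xs
     else distinct (filter (\<lambda>x. x \<in> C) xs) \<and> length (filter (\<lambda>x. x \<in> C) xs) = card C \<and>
       greedy Cs (filter (\<lambda>x. x \<notin> C) xs))"

lemma greedy_subset:
  "greedy Cs xs \<Longrightarrow> set xs \<subseteq> \<Union>(set Cs)"
proof (induction Cs arbitrary: xs)
  case (Cons C Cs)
  show ?case
  proof (cases "length xs \<le> card C")
    case False
    then have "set (filter (\<lambda>x. x \<notin> C) xs) \<subseteq> \<Union>(set Cs)" using Cons by (metis greedy.simps(2))
    then show ?thesis by auto
  qed (use Cons in auto)
qed simp

lemma greedy_distinct:
  "greedy Cs xs \<Longrightarrow> distinct xs"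
proof (induction Cs arbitrary: xs)
  case (Cons C Cs)
  show ?case
  proof (cases "length xs \<le> card C")
    case False
    then have "distinct (filter (\<lambda>x. x \<in> C) xs)" "distinct (filter (\<lambda>x. x \<notin> C) xs)"
      using Cons.IH Cons.prems by (auto split: if_splits)
    then show ?thesis by (induction xs) (auto split: if_splits)
  qed (use Cons in auto)
qed simp

text \<open>Induction on the blocks. A greedy list for \<open>C # Cs\<close> amounts to the set \<open>P\<close> of positions of its entries
from \<open>C\<close>, the list of these entries, and a greedy list for \<open>Cs\<close>. The sum over \<open>P\<close> is the sum over shuffles of
the first argument in \<open>wedge\<close>; the one over shuffles of the second argument is absorbed by Laplace expansion.\<close>

lemma broken_wedge_expand:
  fixes U :: "(('n::finite, 'r::comm_ring_1) mpoly \<Rightarrow> 'r) \<Rightarrow> 'a \<Rightarrow> 'r"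
  assumes "\<forall>C\<in>set Cs. finite C" "pairwise disjnt (set Cs)" "distinct Cs"
    and "1 \<le> i" "i \<le> sum_list (map card Cs)" "length \<phi>s = i" "length \<psi>s = i"
  shows "broken_wedge (map (\<lambda>C. (card C, \<lambda>\<phi> \<psi>. \<Sum>a\<in>C. U \<phi> a * Y a \<psi>)) Cs) i \<phi>s \<psi>s =
    (\<Sum>xs | length xs = i \<and> greedy Cs xs. pair_prod U \<phi>s xs * gram_det Y xs \<psi>s)"
  using assms
proof (induction Cs arbitrary: i \<phi>s \<psi>s)
  case (Cons C Cs)
  let ?b = "\<lambda>C \<phi> \<psi>. \<Sum>a\<in>C. U \<phi> a * Y a \<psi>"
  have fC: "finite C" using Cons.prems by simp
  show ?case
  proof (cases "i \<le> card C")
    case True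
    have "ext_pow i (?b C) \<phi>s \<psi>s =
        (\<Sum>xs | length xs = i \<and> set xs \<subseteq> C \<and> distinct xs. pair_prod U \<phi>s xs * gram_det Y xs \<psi>s)"
      using Cons.prems fC by (simp add: ext_pow_gram_det gram_det_expand)
    moreover have "{xs. length xs = i \<and> greedy (C # Cs) xs} = {xs. length xs = i \<and> set xs \<subseteq> C \<and> distinct xs}"
      using True by auto
    ultimately show ?thesis using True by simp
  next
    case False
    define r where "r = card C"
    have ri: "r < i" "1 \<le> i - r" "i - r \<le> sum_list (map card Cs)" using False Cons.prems by (auto simp: r_def)
    let ?bw = "broken_wedge (map (\<lambda>C. (card C, ?b C)) Cs) (i - r)"
    let ?P = "{P. P \<subseteq> {..<i} \<and> card P = r}"
    let ?Y = "{ys. length ys = r \<and> set ys \<subseteq> C \<and> distinct ys}"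
    let ?Z = "{zs. length zs = i - r \<and> greedy Cs zs}"
    have finY: "finite ?Y" using finite_lists_length_eq[OF fC, of r] by (rule rev_finite_subset) auto
    have "finite (\<Union>(set Cs))" using Cons.prems by auto
    from finite_lists_length_eq[OF this, of "i - r"] have finZ: "finite ?Z"
      by (rule rev_finite_subset) (use greedy_subset in auto)
    have lenP: "length (nths xs P) = r" "length (nths xs (- P)) = i - r" if "P \<in> ?P" "length xs = i"
      for P and xs :: "'c list"
    proof -
      have fP: "finite P" using that finite_subset by blast
      have "{k. k < i \<and> k \<in> P} = P" "{k. k < i \<and> k \<in> - P} = {..<i} - P" using that by auto
      then show "length (nths xs P) = r" "length (nths xs (- P)) = i - r"
        using that fP by (simp_all add: length_nths card_Diff_subset)
    qed
    have lens: "length (nths \<phi>s P) = r" "length (nths \<phi>s (- P)) = i - r"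
      "length (nths \<psi>s P) = r" "length (nths \<psi>s (- P)) = i - r" if "P \<in> ?P" for P
    proof -
      have fP: "finite P" using that finite_subset by blast
      have "{k. k < i \<and> k \<in> P} = P" "{k. k < i \<and> k \<in> - P} = {..<i} - P" using that by auto
      then show "length (nths \<phi>s P) = r" "length (nths \<phi>s (- P)) = i - r"
        "length (nths \<psi>s P) = r" "length (nths \<psi>s (- P)) = i - r"
        using that fP Cons.prems by (simp_all add: length_nths card_Diff_subset)
    qed
    let ?h = "\<lambda>P ys zs. pair_prod U (nths \<phi>s P) ys * pair_prod U (nths \<phi>s (- P)) zs *
      (\<Sum>Q\<in>?P. (- 1) ^ (\<Sum>P + \<Sum>Q) * gram_det Y ys (nths \<psi>s Q) * gram_det Y zs (nths \<psi>s (- Q)))"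
    have "wedge r (ext_pow r (?b C)) ?bw \<phi>s \<psi>s =
      (\<Sum>P\<in>?P. \<Sum>Q\<in>?P. (- 1) ^ (\<Sum>P + \<Sum>Q) * ext_pow r (?b C) (nths \<phi>s P) (nths \<psi>s Q) *
        ?bw (nths \<phi>s (- P)) (nths \<psi>s (- Q)))"
      using Cons.prems by (simp add: wedge_def)
    also have "\<dots> = (\<Sum>P\<in>?P. \<Sum>Q\<in>?P. \<Sum>ys\<in>?Y. \<Sum>zs\<in>?Z. (- 1) ^ (\<Sum>P + \<Sum>Q) *
        (pair_prod U (nths \<phi>s P) ys * gram_det Y ys (nths \<psi>s Q)) *
        (pair_prod U (nths \<phi>s (- P)) zs * gram_det Y zs (nths \<psi>s (- Q))))"
    proof (intro sum.cong refl)
      fix P Q assume P: "P \<in> ?P" and Q: "Q \<in> ?P"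
      have 1: "ext_pow r (?b C) (nths \<phi>s P) (nths \<psi>s Q) =
        (\<Sum>ys\<in>?Y. pair_prod U (nths \<phi>s P) ys * gram_det Y ys (nths \<psi>s Q))"
        using lens[OF P] lens[OF Q] fC by (simp add: ext_pow_gram_det gram_det_expand)
      have 2: "?bw (nths \<phi>s (- P)) (nths \<psi>s (- Q)) =
        (\<Sum>zs\<in>?Z. pair_prod U (nths \<phi>s (- P)) zs * gram_det Y zs (nths \<psi>s (- Q)))"
        by (rule Cons.IH) (use Cons.prems ri lens[OF P] lens[OF Q] in \<open>auto simp: pairwise_insert\<close>)
      show "(- 1) ^ (\<Sum>P + \<Sum>Q) * ext_pow r (?b C) (nths \<phi>s P) (nths \<psi>s Q) *
        ?bw (nths \<phi>s (- P)) (nths \<psi>s (- Q)) = (\<Sum>ys\<in>?Y. \<Sum>zs\<in>?Z. (- 1) ^ (\<Sum>P + \<Sum>Q) *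
        (pair_prod U (nths \<phi>s P) ys * gram_det Y ys (nths \<psi>s Q)) *
        (pair_prod U (nths \<phi>s (- P)) zs * gram_det Y zs (nths \<psi>s (- Q))))"
        unfolding 1 2 by (simp only: sum_distrib_left sum_distrib_right) (rule sum.swap)
    qed
    also have "\<dots> = (\<Sum>P\<in>?P. \<Sum>ys\<in>?Y. \<Sum>zs\<in>?Z. ?h P ys zs)"
    proof (rule sum.cong[OF refl])
      fix P
      show "(\<Sum>Q\<in>?P. \<Sum>ys\<in>?Y. \<Sum>zs\<in>?Z. (- 1) ^ (\<Sum>P + \<Sum>Q) *
        (pair_prod U (nths \<phi>s P) ys * gram_det Y ys (nths \<psi>s Q)) *
        (pair_prod U (nths \<phi>s (- P)) zs * gram_det Y zs (nths \<psi>s (- Q)))) = (\<Sum>ys\<in>?Y. \<Sum>zs\<in>?Z. ?h P ys zs)"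
        by (subst sum.swap, rule sum.cong[OF refl], subst sum.swap)
          (simp add: sum_distrib_left mult_ac)
    qed
    also have "\<dots> = (\<Sum>(P, ys, zs)\<in>?P \<times> ?Y \<times> ?Z. ?h P ys zs)"
      by (simp add: sum.cartesian_product)
    also have "\<dots> = (\<Sum>xs | length xs = i \<and> greedy (C # Cs) xs. pair_prod U \<phi>s xs * gram_det Y xs \<psi>s)"
    proof (rule sum.reindex_bij_witness[of _
          "\<lambda>xs. ({k. k < length xs \<and> xs ! k \<in> C}, filter (\<lambda>x. x \<in> C) xs, filter (\<lambda>x. x \<notin> C) xs)"
          "\<lambda>(P, ys, zs). merge_at i P ys zs"])
      fix z assume "z \<in> ?P \<times> ?Y \<times> ?Z"
      then obtain P ys zs where z: "z = (P, ys, zs)" and P: "P \<subseteq> {..<i}" "card P = r"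
        and ys: "length ys = r" "set ys \<subseteq> C" "distinct ys" and zs: "length zs = i - r" "greedy Cs zs" by auto
      let ?xs = "merge_at i P ys zs"
      have cy: "card P = length ys" using P ys by simp
      have iy: "i = length ys + length zs" using ys(1) zs(1) ri(1) by linarith
      note m = merge_at[OF P(1) cy iy]
      have dj: "C \<inter> D = {}" if "D \<in> set Cs" for D
        using Cons.prems(2,3) that by (auto simp: pairwise_insert disjnt_def)
      then have zC: "set zs \<inter> C = {}" using greedy_subset[OF zs(2)] dj by blast
      have pos: "{k. k < length ?xs \<and> ?xs ! k \<in> C} = P"
        by (rule positions_eq) (use m P ys zC in auto)
      have f: "filter (\<lambda>x. x \<in> C) ?xs = ys" "filter (\<lambda>x. x \<notin> C) ?xs = zs"
        using m pos by (simp_all add: filter_eq_nths[of "\<lambda>x. x \<in> C"] filter_not_eq_nths)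
      show "(case (case z of (P, ys, zs) \<Rightarrow> merge_at i P ys zs) of xs \<Rightarrow>
          ({k. k < length xs \<and> xs ! k \<in> C}, filter (\<lambda>x. x \<in> C) xs, filter (\<lambda>x. x \<notin> C) xs)) = z"
        using z pos f by simp
      show "(case z of (P, ys, zs) \<Rightarrow> merge_at i P ys zs) \<in> {xs. length xs = i \<and> greedy (C # Cs) xs}"
        using z m f ys zs False r_def by simp
      have "gram_det Y ?xs \<psi>s = (\<Sum>Q\<in>?P. (- 1) ^ (\<Sum>P + \<Sum>Q) * gram_det Y ys (nths \<psi>s Q) * gram_det Y zs (nths \<psi>s (- Q)))"
        using gram_det_laplace[of \<psi>s ?xs P Y] Cons.prems m P by simp
      moreover have "pair_prod U \<phi>s ?xs = pair_prod U (nths \<phi>s P) ys * pair_prod U (nths \<phi>s (- P)) zs"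
        using pair_prod_nths[of \<phi>s ?xs U P] m Cons.prems by simp
      ultimately show "pair_prod U \<phi>s (case z of (P, ys, zs) \<Rightarrow> merge_at i P ys zs) *
          gram_det Y (case z of (P, ys, zs) \<Rightarrow> merge_at i P ys zs) \<psi>s = (case z of (P, ys, zs) \<Rightarrow> ?h P ys zs)"
        using z by simp
    next
      fix xs assume "xs \<in> {xs. length xs = i \<and> greedy (C # Cs) xs}"
      then have xs: "length xs = i" "distinct (filter (\<lambda>x. x \<in> C) xs)" "length (filter (\<lambda>x. x \<in> C) xs) = r"
        "greedy Cs (filter (\<lambda>x. x \<notin> C) xs)" using False r_def by auto
      let ?Q = "{k. k < length xs \<and> xs ! k \<in> C}"
      have f: "filter (\<lambda>x. x \<in> C) xs = nths xs ?Q" "filter (\<lambda>x. x \<notin> C) xs = nths xs (- ?Q)"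
        by (simp_all add: filter_eq_nths[of "\<lambda>x. x \<in> C"] filter_not_eq_nths)
      show "(case ({k. k < length xs \<and> xs ! k \<in> C}, filter (\<lambda>x. x \<in> C) xs, filter (\<lambda>x. x \<notin> C) xs) of
          (P, ys, zs) \<Rightarrow> merge_at i P ys zs) = xs"
        using merge_at_nths[of xs ?Q] f xs by simp
      have "card ?Q = r" using xs(3) by (simp add: length_filter_conv_card)
      moreover have "length (filter (\<lambda>x. x \<notin> C) xs) = i - r"
        using sum_length_filter_compl[of "\<lambda>x. x \<in> C" xs] xs by simp
      ultimately show "({k. k < length xs \<and> xs ! k \<in> C}, filter (\<lambda>x. x \<in> C) xs, filter (\<lambda>x. x \<notin> C) xs) \<in> ?P \<times> ?Y \<times> ?Z"
        using xs by auto
    qed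
    finally show ?thesis using False by (simp add: r_def)
  qed
qed simp

text \<open>The least total weight of \<open>i\<close> distinct indices, if the blocks are listed by increasing weight \<open>\<omega>\<close>.\<close>

fun greedy_sum :: "('a set \<Rightarrow> nat) \<Rightarrow> 'a set list \<Rightarrow> nat \<Rightarrow> nat" where
  "greedy_sum \<omega> [] i = 0"
| "greedy_sum \<omega> (C # Cs) i = (if i \<le> card C then i * \<omega> C else card C * \<omega> C + greedy_sum \<omega> Cs (i - card C))"

lemma greedy_sum_add:
  assumes "\<forall>C\<in>set Cs. v \<le> \<omega> C" "a + b \<le> sum_list (map card Cs)" "sorted (map \<omega> Cs)"
  shows "greedy_sum \<omega> Cs a + b * v \<le> greedy_sum \<omega> Cs (a + b)"
  using assms
proof (induction Cs arbitrary: a b v)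
  case (Cons C Cs)
  have le: "\<forall>C'\<in>set Cs. \<omega> C \<le> \<omega> C'" using Cons.prems by auto
  have vC: "v \<le> \<omega> C" using Cons.prems by auto
  consider "a + b \<le> card C" | "a \<le> card C" "card C < a + b" | "card C < a" by linarith
  then show ?case
  proof cases
    case 1
    then show ?thesis using vC by (simp add: add_mult_distrib)
  next
    case 2
    define b' where "b' = a + b - card C"
    have b: "b = (card C - a) + b'" using 2 b'_def by simp
    have "greedy_sum \<omega> Cs 0 + b' * v \<le> greedy_sum \<omega> Cs (0 + b')"
      by (rule Cons.IH) (use Cons.prems b'_def 2 le vC in auto)
    then have "b' * v \<le> greedy_sum \<omega> Cs b'" by simp
    moreover have "(card C - a) * v \<le> (card C - a) * \<omega> C" using vC by simp
    moreover have e1: "card C * \<omega> C = a * \<omega> C + (card C - a) * \<omega> C" using 2 by (simp flip: add_mult_distrib)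
    moreover have e2: "b * v = (card C - a) * v + b' * v" unfolding b by (simp add: add_mult_distrib)
    moreover have e3: "greedy_sum \<omega> (C # Cs) (a + b) = card C * \<omega> C + greedy_sum \<omega> Cs b'"
      using 2 by (simp add: b'_def)
    moreover have e4: "greedy_sum \<omega> (C # Cs) a = a * \<omega> C" using 2 by simp
    ultimately have "a * \<omega> C + ((card C - a) * v + b' * v) \<le> a * \<omega> C + ((card C - a) * \<omega> C + greedy_sum \<omega> Cs b')"
      by (intro add_mono order_refl)
    then show ?thesis unfolding e1 e2 e3 e4 by (simp only: add.assoc)
  next
    case 3
    have "greedy_sum \<omega> Cs (a - card C) + b * v \<le> greedy_sum \<omega> Cs ((a - card C) + b)"
      by (rule Cons.IH) (use Cons.prems 3 in auto)
    then show ?thesis using 3 by simp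
  qed
qed simp

lemma sum_list_filter_split:
  "sum_list (map f xs) = sum_list (map f (filter P xs)) + sum_list (map f (filter (\<lambda>x. \<not> P x) xs))" for f :: "'a \<Rightarrow> nat"
  by (induction xs) auto

text \<open>Replacing an index by one from an earlier block that has not been used lowers the total weight strictly, the
weights of the blocks being strictly increasing. So the minimum is attained by the greedy lists only.\<close>

lemma greedy_sum_le:
  assumes "\<forall>C\<in>set Cs. finite C" "\<forall>C\<in>set Cs. \<forall>a\<in>C. w a = \<omega> C" "sorted_wrt (<) (map \<omega> Cs)"
    and "distinct xs" "set xs \<subseteq> \<Union>(set Cs)"
  shows "greedy_sum \<omega> Cs (length xs) \<le> sum_list (map w xs) \<and>
    (greedy_sum \<omega> Cs (length xs) = sum_list (map w xs) \<longleftrightarrow> greedy Cs xs)"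
  using assms
proof (induction Cs arbitrary: xs)
  case (Cons C Cs)
  let ?ys = "filter (\<lambda>x. x \<in> C) xs" and ?zs = "filter (\<lambda>x. x \<notin> C) xs"
  have wC: "w a = \<omega> C" if "a \<in> C" for a using Cons.prems that by auto
  have fC: "finite C" using Cons.prems by auto
  have less: "\<forall>C'\<in>set Cs. \<omega> C < \<omega> C'" using Cons.prems by auto
  have zs: "distinct ?zs" "set ?zs \<subseteq> \<Union>(set Cs)" using Cons.prems by auto
  have IH: "greedy_sum \<omega> Cs (length ?zs) \<le> sum_list (map w ?zs)"
    "greedy_sum \<omega> Cs (length ?zs) = sum_list (map w ?zs) \<longleftrightarrow> greedy Cs ?zs"
    using Cons.IH[OF _ _ _ zs] Cons.prems by auto
  have len: "length xs = length ?ys + length ?zs" using sum_length_filter_compl[of "\<lambda>x. x \<in> C" xs] by simp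
  have wys: "sum_list (map w ?ys) = length ?ys * \<omega> C"
  proof -
    have "map w ?ys = map (\<lambda>_. \<omega> C) ?ys" using wC by (intro map_cong) auto
    then have "sum_list (map w ?ys) = sum_list (map (\<lambda>_. \<omega> C) ?ys)" by (rule arg_cong)
    then show ?thesis by (simp add: sum_list_triv)
  qed
  have w: "sum_list (map w xs) = length ?ys * \<omega> C + sum_list (map w ?zs)"
    using sum_list_filter_split[of w xs "\<lambda>x. x \<in> C"] wys by simp
  have yC: "length ?ys \<le> card C"
    using distinct_card[of ?ys] Cons.prems(4) card_mono[OF fC, of "set ?ys"] by auto
  have zlow: "length ?zs * Suc (\<omega> C) \<le> sum_list (map w ?zs)"
  proof -
    have "sum_list (map (\<lambda>_. Suc (\<omega> C)) ?zs) \<le> sum_list (map w ?zs)"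
      by (rule sum_list_mono) (use less zs(2) Cons.prems(2) in fastforce)
    then show ?thesis by (simp add: sum_list_triv)
  qed
  show ?case
  proof (cases "length xs \<le> card C")
    case True
    have "greedy (C # Cs) xs \<longleftrightarrow> ?zs = []" using True Cons.prems by (auto simp: filter_empty_conv)
    moreover have "length xs * \<omega> C = length ?ys * \<omega> C + length ?zs * \<omega> C" using len by (simp flip: add_mult_distrib)
    moreover have "length ?zs * Suc (\<omega> C) = length ?zs * \<omega> C + length ?zs" by simp
    ultimately show ?thesis using True w zlow by (cases "?zs = []") (auto simp del: greedy.simps)
  next
    case False
    define b where "b = card C - length ?ys"
    have zz: "length ?zs = (length xs - card C) + b" using len yC False b_def by linarith
    have cz: "length ?zs \<le> sum_list (map card Cs)"
    proof -
      have "length ?zs = card (set ?zs)" using zs distinct_card by metis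
      also have "\<dots> \<le> card (\<Union>(set Cs))" by (rule card_mono) (use Cons.prems zs in auto)
      also have "\<dots> \<le> sum card (set Cs)" using card_Union_le_sum_card by auto
      also have "\<dots> \<le> sum_list (map card Cs)" by (induction Cs) (auto simp: sum.insert_if)
      finally show ?thesis .
    qed
    have "greedy_sum \<omega> Cs (length xs - card C) + b * Suc (\<omega> C) \<le> greedy_sum \<omega> Cs (length xs - card C + b)"
      by (rule greedy_sum_add) (use less Cons.prems zz cz in \<open>auto simp: strict_sorted_iff\<close>)
    then have 1: "greedy_sum \<omega> Cs (length xs - card C) + b * \<omega> C + b \<le> greedy_sum \<omega> Cs (length ?zs)"
      using zz by simp
    have 2: "card C * \<omega> C = length ?ys * \<omega> C + b * \<omega> C" using yC by (simp add: b_def flip: add_mult_distrib)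
    have g: "greedy_sum \<omega> (C # Cs) (length xs) = card C * \<omega> C + greedy_sum \<omega> Cs (length xs - card C)"
      using False by simp
    have "greedy (C # Cs) xs \<longleftrightarrow> b = 0 \<and> greedy Cs ?zs"
      using False Cons.prems yC by (auto simp: b_def)
    moreover have "length xs - card C = length ?zs" if "b = 0" using zz that by simp
    ultimately show ?thesis using g 1 2 w IH by (cases "b = 0") auto
  qed
qed simp

lemma greedy_exists:
  assumes "\<forall>C\<in>set Cs. finite C" "pairwise disjnt (set Cs)" "distinct Cs" "i \<le> sum_list (map card Cs)"
  shows "\<exists>xs. length xs = i \<and> greedy Cs xs"
  using assms
proof (induction Cs arbitrary: i)
  case (Cons C Cs)
  have fC: "finite C" using Cons.prems by simp
  then obtain cs where cs: "set cs = C" "distinct cs" using finite_distinct_list by blast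
  then have lc: "length cs = card C" using distinct_card by metis
  show ?case
  proof (cases "i \<le> card C")
    case True
    then show ?thesis using cs lc by (intro exI[of _ "take i cs"]) (auto dest: in_set_takeD)
  next
    case False
    obtain zs where zs: "length zs = i - card C" "greedy Cs zs"
    proof -
      have "i - card C \<le> sum_list (map card Cs)" using Cons.prems(4) by simp
      then have "\<exists>xs. length xs = i - card C \<and> greedy Cs xs"
        using Cons.IH[of "i - card C"] Cons.prems(1-3) by (auto simp: pairwise_insert)
      then show thesis using that by blast
    qed
    have dj: "C \<inter> D = {}" if "D \<in> set Cs" for D
      using Cons.prems(2,3) that by (auto simp: pairwise_insert disjnt_def)
    then have zC: "set zs \<inter> C = {}" using greedy_subset[OF zs(2)] dj by blast
    have f: "filter (\<lambda>x. x \<in> C) zs = []" "filter (\<lambda>x. x \<notin> C) zs = zs" using zC by (auto simp: filter_empty_conv filter_id_conv)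
    have f': "filter (\<lambda>x. x \<in> C) cs = cs" "filter (\<lambda>x. x \<notin> C) cs = []" using cs by (auto simp: filter_empty_conv filter_id_conv)
    show ?thesis using False cs lc zs f f' by (intro exI[of _ "cs @ zs"]) auto
  qed
qed simp

section \<open>Polynomials and their homogeneous parts\<close>

lemma S_simps [simp]:
  "carrier \<S> = UNIV" "monoid.mult \<S> = (*)" "one \<S> = 1" "zero \<S> = 0" "add \<S> = (+)"
  by (simp_all add: ring_of_type_algebra_def)

interpretation S: cring "\<S> :: ('n::finite, 'r::comm_ring_1) mpoly ring"
  by (rule cring_from_type_algebra)

lemma S_a_inv [simp]: "a_inv \<S> f = - (f :: ('n::finite, 'r::comm_ring_1) mpoly)"
  by (rule S.minus_equality) auto

lemma ideal_S_iff:
  "ideal J \<S> \<longleftrightarrow> 0 \<in> J \<and> (\<forall>f\<in>J. \<forall>g\<in>J. f + g \<in> J) \<and> (\<forall>f\<in>J. \<forall>g. g * f \<in> J)"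
  for J :: "('n::finite, 'r::comm_ring_1) mpoly set"
proof
  assume "ideal J \<S>"
  then interpret ideal J \<S> .
  show "0 \<in> J \<and> (\<forall>f\<in>J. \<forall>g\<in>J. f + g \<in> J) \<and> (\<forall>f\<in>J. \<forall>g. g * f \<in> J)"
    using zero_closed a_closed I_l_closed by auto
next
  assume *: "0 \<in> J \<and> (\<forall>f\<in>J. \<forall>g\<in>J. f + g \<in> J) \<and> (\<forall>f\<in>J. \<forall>g. g * f \<in> J)"
  show "ideal J \<S>"
  proof (rule idealI)
    show "subgroup J (add_monoid \<S>)"
    proof (rule subgroup.intro)
      fix f assume "f \<in> J"
      then have "(- 1) * f \<in> J" using * by blast
      then show "inv\<^bsub>add_monoid \<S>\<^esub> f \<in> J" using S_a_inv[of f] by (simp add: a_inv_def)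
    qed (use * in auto)
  qed (use * S.ring_axioms in \<open>auto simp: mult.commute\<close>)
qed

definition mon :: "('n::finite \<Rightarrow>\<^sub>0 nat) \<Rightarrow> ('n, 'r::comm_ring_1) mpoly" where
  "mon \<alpha> = Poly_Mapping.single \<alpha> 1"

lemma mon_mult: "mon \<alpha> * mon \<beta> = mon (\<alpha> + \<beta>)"
  by (simp add: mon_def mult_single)

lemma mon_0: "mon 0 = 1" by (simp add: mon_def)

lemma cst_mult_single [simp]: "cst c * Poly_Mapping.single \<alpha> b = Poly_Mapping.single \<alpha> (c * b)"
  by (simp add: cst_def mult_single)

lemma lookup_cst_mult [simp]: "Poly_Mapping.lookup (cst c * f) \<alpha> = c * Poly_Mapping.lookup f \<alpha>"
proof -
  have "cst c * f = Poly_Mapping.map ((*) c) f"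
    by (simp add: cst_def mult_map_scale_conv_mult)
  then show ?thesis by (simp add: map.rep_eq when_def)
qed

lemma cst_simps [simp]: "cst 0 = 0" "cst 1 = 1" "cst (- c) = - cst c"
  by (simp_all add: cst_def single_uminus)
lemma cst_add: "cst (b + c) = cst b + cst c" by (simp add: cst_def single_add)
lemma cst_mult: "cst (b * c) = cst b * cst c" by (simp add: cst_def mult_single)

lemma cst_sum: "cst (\<Sum>x\<in>B. F x) = (\<Sum>x\<in>B. cst (F x))"
  by (induction B rule: infinite_finite_induct) (auto simp: cst_add)

lemma poly_as_sum:
  assumes "finite B" "Poly_Mapping.keys f \<subseteq> B"
  shows "f = (\<Sum>\<alpha>\<in>B. cst (Poly_Mapping.lookup f \<alpha>) * mon \<alpha>)"
proof (rule poly_mapping_eqI)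
  fix \<beta>
  have "Poly_Mapping.lookup (\<Sum>\<alpha>\<in>B. cst (Poly_Mapping.lookup f \<alpha>) * mon \<alpha>) \<beta> =
    (\<Sum>\<alpha>\<in>B. if \<alpha> = \<beta> then Poly_Mapping.lookup f \<beta> else 0)"
    unfolding lookup_sum by (rule sum.cong) (auto simp: mon_def lookup_single when_def)
  also have "\<dots> = Poly_Mapping.lookup f \<beta>"
    using assms by (auto simp: in_keys_iff)
  finally show "Poly_Mapping.lookup f \<beta> = Poly_Mapping.lookup (\<Sum>\<alpha>\<in>B. cst (Poly_Mapping.lookup f \<alpha>) * mon \<alpha>) \<beta>" ..
qed

lemma poly_induct [case_names zero add]:
  assumes "P 0" and "\<And>f c \<alpha>. P f \<Longrightarrow> P (f + cst c * mon \<alpha>)"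
  shows "P (f :: ('n::finite, 'r::comm_ring_1) mpoly)"
proof -
  have "P (\<Sum>\<alpha>\<in>B. cst (Poly_Mapping.lookup f \<alpha>) * mon \<alpha>)" if "finite B" for B
    using that
  proof (induction B)
    case (insert \<alpha> B)
    then show ?case using assms(2)[OF insert.IH] by (simp add: add.commute)
  qed (simp add: assms)
  from this[of "Poly_Mapping.keys f"] show ?thesis
    using poly_as_sum[of "Poly_Mapping.keys f" f] by simp
qed

definition linear_form :: "(('n::finite, 'r::comm_ring_1) mpoly \<Rightarrow> 'r) \<Rightarrow> bool" where
  "linear_form \<phi> \<longleftrightarrow> (\<forall>f g. \<phi> (f + g) = \<phi> f + \<phi> g) \<and> (\<forall>c f. \<phi> (cst c * f) = c * \<phi> f)"

lemma dual_space_iff: "\<phi> \<in> dual_space J \<longleftrightarrow> linear_form \<phi> \<and> (\<forall>f\<in>J. \<phi> f = 0)"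
  by (auto simp: dual_space_def linear_form_def)

lemma linear_form_simps:
  assumes "linear_form \<phi>"
  shows "\<phi> (f + g) = \<phi> f + \<phi> g" "\<phi> (cst c * f) = c * \<phi> f" "\<phi> 0 = 0" "\<phi> (- f) = - \<phi> f" "\<phi> (f - g) = \<phi> f - \<phi> g"
    "\<phi> (\<Sum>x\<in>B. F x) = (\<Sum>x\<in>B. \<phi> (F x))"
proof -
  show add: "\<phi> (f + g) = \<phi> f + \<phi> g" and scl: "\<phi> (cst c * f) = c * \<phi> f" for f g c
    using assms by (auto simp: linear_form_def)
  show z: "\<phi> 0 = 0" using scl[of 0 0] by simp
  show m: "\<phi> (- f) = - \<phi> f" for f using add[of "- f" f] z by (simp add: eq_neg_iff_add_eq_0)
  show "\<phi> (f - g) = \<phi> f - \<phi> g" using add[of f "- g"] m by simp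
  show "\<phi> (\<Sum>x\<in>B. F x) = (\<Sum>x\<in>B. \<phi> (F x))"
    by (induction B rule: infinite_finite_induct) (auto simp: z add)
qed

lemma linear_form_eqI:
  assumes "linear_form \<phi>" "linear_form \<psi>" "\<And>\<alpha>. \<phi> (mon \<alpha>) = \<psi> (mon \<alpha>)"
  shows "\<phi> f = \<psi> f"
  by (induction f rule: poly_induct) (simp_all add: linear_form_simps assms)

lemma linear_form_sum: "(\<And>x. x \<in> B \<Longrightarrow> linear_form (F x)) \<Longrightarrow> linear_form (\<lambda>f. \<Sum>x\<in>B. F x f)"
  by (auto simp: linear_form_def sum.distrib sum_distrib_left intro!: sum.cong)

lemma linear_form_scale: "linear_form \<phi> \<Longrightarrow> linear_form (\<lambda>f. c * \<phi> f)"
  by (auto simp: linear_form_def algebra_simps)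

lemma linear_form_plus: "linear_form \<phi> \<Longrightarrow> linear_form \<psi> \<Longrightarrow> linear_form (\<lambda>f. \<phi> f + c * \<psi> f)"
  by (auto simp: linear_form_def algebra_simps)

lemma linear_form_mult: "linear_form \<phi> \<Longrightarrow> linear_form (\<lambda>f. \<phi> (g * f))"
  unfolding linear_form_def by (simp add: distrib_left mult.left_commute[of g])

text \<open>The functional with prescribed values on monomials.\<close>

definition lin_ext :: "(('n::finite \<Rightarrow>\<^sub>0 nat) \<Rightarrow> 'r::comm_ring_1) \<Rightarrow> ('n, 'r) mpoly \<Rightarrow> 'r" where
  "lin_ext \<kappa> f = (\<Sum>\<alpha>\<in>Poly_Mapping.keys f. Poly_Mapping.lookup f \<alpha> * \<kappa> \<alpha>)"

lemma lin_ext_superset: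
  "finite B \<Longrightarrow> Poly_Mapping.keys f \<subseteq> B \<Longrightarrow> lin_ext \<kappa> f = (\<Sum>\<alpha>\<in>B. Poly_Mapping.lookup f \<alpha> * \<kappa> \<alpha>)"
  unfolding lin_ext_def by (rule sum.mono_neutral_left) (auto simp: in_keys_iff)

lemma linear_form_lin_ext [simp]: "linear_form (lin_ext \<kappa>)"
  unfolding linear_form_def
proof (intro conjI allI)
  fix f g :: "('a, 'b) mpoly" and c
  define B where "B = Poly_Mapping.keys f \<union> Poly_Mapping.keys g \<union> Poly_Mapping.keys (f + g) \<union> Poly_Mapping.keys (cst c * f)"
  have B: "finite B" "Poly_Mapping.keys f \<subseteq> B" "Poly_Mapping.keys g \<subseteq> B" "Poly_Mapping.keys (f + g) \<subseteq> B"
    "Poly_Mapping.keys (cst c * f) \<subseteq> B" by (auto simp: B_def)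
  note e = lin_ext_superset[OF B(1) B(2)] lin_ext_superset[OF B(1) B(3)] lin_ext_superset[OF B(1) B(4)]
    lin_ext_superset[OF B(1) B(5)]
  show "lin_ext \<kappa> (f + g) = lin_ext \<kappa> f + lin_ext \<kappa> g"
    by (simp add: e lookup_add distrib_right sum.distrib)
  show "lin_ext \<kappa> (cst c * f) = c * lin_ext \<kappa> f"
    by (simp add: e sum_distrib_left mult.assoc)
qed

lemma lin_ext_mon [simp]: "lin_ext \<kappa> (mon \<alpha>) = \<kappa> \<alpha>"
  by (subst lin_ext_superset[of "{\<alpha>}"]) (auto simp: mon_def lookup_single when_def in_keys_iff)

lemma extend_functional_eq: "extend_functional h \<phi> = lin_ext (\<lambda>\<alpha>. h (\<phi> (mon \<alpha>)))"
  by (rule ext) (simp add: extend_functional_def lin_ext_def mon_def)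

lemma mdeg_simps [simp]: "mdeg 0 = 0" "mdeg (\<alpha> + \<beta>) = mdeg \<alpha> + mdeg \<beta>"
  "mdeg (Poly_Mapping.single i c) = c"
  by (simp_all add: mdeg_def lookup_add sum.distrib lookup_single when_def)

lemma lookup_hom_comp: "Poly_Mapping.lookup (hom_comp i f) \<alpha> = (if mdeg \<alpha> = i then Poly_Mapping.lookup f \<alpha> else 0)"
  by (auto simp: hom_comp_def lookup_mapp when_def in_keys_iff)

lemma lookup_scale_vars: "Poly_Mapping.lookup (scale_vars t f) \<alpha> = t ^ mdeg \<alpha> * Poly_Mapping.lookup f \<alpha>"
  by (auto simp: scale_vars_def lookup_mapp when_def in_keys_iff)

lemma lookup_map: "h 0 = 0 \<Longrightarrow> Poly_Mapping.lookup (Poly_Mapping.map h f) \<alpha> = h (Poly_Mapping.lookup f \<alpha>)"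
  by (auto simp: map.rep_eq when_def)

lemma hom_comp_simps [simp]:
  "hom_comp i (f + g) = hom_comp i f + hom_comp i g" "hom_comp i (f - g) = hom_comp i f - hom_comp i g"
  "hom_comp i (cst c * f) = cst c * hom_comp i f" "hom_comp i 0 = 0"
  "hom_comp i (mon \<alpha>) = (if mdeg \<alpha> = i then mon \<alpha> else 0)"
  by (rule poly_mapping_eqI; auto simp: lookup_hom_comp lookup_add lookup_minus mon_def lookup_single when_def)+

lemma hom_comp_hom_comp: "hom_comp i (hom_comp j f) = (if i = j then hom_comp i f else 0)"
  by (rule poly_mapping_eqI) (auto simp: lookup_hom_comp)

lemma hom_comp_sum: "hom_comp i (\<Sum>x\<in>B. F x) = (\<Sum>x\<in>B. hom_comp i (F x))"
  by (induction B rule: infinite_finite_induct) auto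

lemma scale_vars_simps [simp]:
  "scale_vars t (f + g) = scale_vars t f + scale_vars t g"
  "scale_vars t (cst c * f) = cst c * scale_vars t f" "scale_vars t 0 = 0"
  "scale_vars t (mon \<alpha>) = cst (t ^ mdeg \<alpha>) * mon \<alpha>"
  by (rule poly_mapping_eqI;
      simp add: lookup_scale_vars lookup_add mon_def lookup_single when_def distrib_left mult.left_commute)+

lemma scale_vars_scale_vars: "scale_vars s (scale_vars t f) = scale_vars (s * t) f"
  by (rule poly_mapping_eqI) (simp add: lookup_scale_vars power_mult_distrib mult.assoc)

lemma scale_vars_1 [simp]: "scale_vars 1 f = f"
  by (rule poly_mapping_eqI) (simp add: lookup_scale_vars)

lemma map_hom_simps:
  assumes "comm_ring_hom h"
  shows "Poly_Mapping.map h (f + g) = Poly_Mapping.map h f + Poly_Mapping.map h g"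
    "Poly_Mapping.map h (cst c * f) = cst (h c) * Poly_Mapping.map h f" "Poly_Mapping.map h 0 = 0"
    "Poly_Mapping.map h (mon \<alpha>) = mon \<alpha>"
    "Poly_Mapping.map h (f - g) = Poly_Mapping.map h f - Poly_Mapping.map h g"
    "Poly_Mapping.map h (\<Sum>x\<in>B. F x) = (\<Sum>x\<in>B. Poly_Mapping.map h (F x))"
proof -
  interpret comm_ring_hom h by fact
  show "Poly_Mapping.map h (f + g) = Poly_Mapping.map h f + Poly_Mapping.map h g" for f g
    by (rule poly_mapping_eqI) (simp add: lookup_map lookup_add hom_distribs)
  note map_add = this
  show map_0: "Poly_Mapping.map h 0 = 0"
    by (rule poly_mapping_eqI) (simp add: lookup_map)
  show "Poly_Mapping.map h (\<Sum>x\<in>B. F x) = (\<Sum>x\<in>B. Poly_Mapping.map h (F x))"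
    by (induction B rule: infinite_finite_induct) (simp_all add: map_add map_0)
  show "Poly_Mapping.map h (f - g) = Poly_Mapping.map h f - Poly_Mapping.map h g"
    by (rule poly_mapping_eqI) (simp add: lookup_map lookup_minus hom_distribs)
  show "Poly_Mapping.map h (cst c * f) = cst (h c) * Poly_Mapping.map h f"
    by (rule poly_mapping_eqI) (simp add: lookup_map hom_distribs)
  show "Poly_Mapping.map h (mon \<alpha>) = mon \<alpha>"
    by (rule poly_mapping_eqI) (simp add: lookup_map mon_def lookup_single when_def)
qed

text \<open>The \<open>i\<close>-th power of the ideal of the origin.\<close>

definition ord_ge :: "nat \<Rightarrow> ('n::finite, 'r::comm_ring_1) mpoly set" where
  "ord_ge i = {f. \<forall>\<alpha>. mdeg \<alpha> < i \<longrightarrow> Poly_Mapping.lookup f \<alpha> = 0}"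

lemma ord_ge_simps [simp]: "0 \<in> ord_ge i" "ord_ge 0 = UNIV" "hom_comp i f \<in> ord_ge i"
  by (auto simp: ord_ge_def lookup_hom_comp)

lemma ord_ge_mon: "i \<le> mdeg \<alpha> \<Longrightarrow> mon \<alpha> \<in> ord_ge i"
  by (auto simp: ord_ge_def mon_def lookup_single when_def)

lemma ord_ge_closed:
  "f \<in> ord_ge i \<Longrightarrow> g \<in> ord_ge i \<Longrightarrow> f + g \<in> ord_ge i" "f \<in> ord_ge i \<Longrightarrow> g \<in> ord_ge i \<Longrightarrow> f - g \<in> ord_ge i"
  "f \<in> ord_ge i \<Longrightarrow> - f \<in> ord_ge i" "f \<in> ord_ge i \<Longrightarrow> cst c * f \<in> ord_ge i"
  by (auto simp: ord_ge_def lookup_add lookup_minus)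

lemma ord_ge_sum: "(\<And>x. x \<in> B \<Longrightarrow> F x \<in> ord_ge i) \<Longrightarrow> (\<Sum>x\<in>B. F x) \<in> ord_ge i"
  by (induction B rule: infinite_finite_induct) (auto intro: ord_ge_closed)

lemma ord_ge_antimono: "i \<le> j \<Longrightarrow> ord_ge j \<subseteq> ord_ge i"
  by (auto simp: ord_ge_def)

lemma ord_ge_mult: "f \<in> ord_ge i \<Longrightarrow> g \<in> ord_ge j \<Longrightarrow> f * g \<in> ord_ge (i + j)"
proof -
  assume f: "f \<in> ord_ge i" and g: "g \<in> ord_ge j"
  have "mdeg \<alpha> \<ge> i + j" if \<alpha>: "\<alpha> \<in> Poly_Mapping.keys (f * g)" for \<alpha>
  proof -
    obtain a b where "\<alpha> = a + b" "a \<in> Poly_Mapping.keys f" "b \<in> Poly_Mapping.keys g"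
      using keys_mult[of f g] \<alpha> by blast
    moreover have "i \<le> mdeg a" "j \<le> mdeg b"
      using f g calculation by (auto simp: ord_ge_def in_keys_iff not_less[symmetric])
    ultimately show ?thesis by simp
  qed
  then show ?thesis unfolding ord_ge_def in_keys_iff using leD by blast
qed

lemma diff_hom_comp_ord_ge: "f \<in> ord_ge i \<Longrightarrow> f - hom_comp i f \<in> ord_ge (Suc i)"
  by (auto simp: ord_ge_def lookup_hom_comp lookup_minus less_Suc_eq)

lemma hom_comp_mult: "hom_comp i (f * g) = (\<Sum>j\<le>i. hom_comp j f * hom_comp (i - j) g)"
proof (induction f rule: poly_induct)
  case (add f c \<alpha>)
  have "hom_comp i (cst c * mon \<alpha> * g) = (\<Sum>j\<le>i. hom_comp j (cst c * mon \<alpha>) * hom_comp (i - j) g)"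
  proof (induction g rule: poly_induct)
    case (add g b \<beta>)
    have "hom_comp i (mon \<alpha> * mon \<beta>) = (\<Sum>j\<le>i. hom_comp j (mon \<alpha>) * hom_comp (i - j) (mon \<beta>) :: ('a, 'b) mpoly)"
    proof (cases "mdeg \<alpha> \<le> i")
      case True
      have "(\<Sum>j\<le>i. hom_comp j (mon \<alpha>) * hom_comp (i - j) (mon \<beta>) :: ('a, 'b) mpoly) =
        (\<Sum>j\<le>i. if j = mdeg \<alpha> then mon \<alpha> * hom_comp (i - mdeg \<alpha>) (mon \<beta>) else 0)"
        by (rule sum.cong) auto
      then show ?thesis using True by (auto simp: mon_mult)
    next
      case False
      then have "(\<Sum>j\<le>i. hom_comp j (mon \<alpha>) * hom_comp (i - j) (mon \<beta>) :: ('a, 'b) mpoly) = 0"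
        by (intro sum.neutral) auto
      then show ?thesis using False by (simp add: mon_mult)
    qed
    then have "cst (c * b) * hom_comp i (mon \<alpha> * mon \<beta>) = (\<Sum>j\<le>i. cst (c * b) *
        (hom_comp j (mon \<alpha>) * hom_comp (i - j) (mon \<beta>)))"
      by (simp only: sum_distrib_left)
    moreover have "cst (c * b) * hom_comp i (mon \<alpha> * mon \<beta>) = hom_comp i ((cst c * mon \<alpha>) * (cst b * mon \<beta>))"
      unfolding hom_comp_simps(3)[symmetric] by (simp add: cst_mult mult_ac)
    moreover have "cst (c * b) * (hom_comp j (mon \<alpha>) * hom_comp (i - j) (mon \<beta>)) =
        hom_comp j (cst c * mon \<alpha>) * hom_comp (i - j) (cst b * mon \<beta>)" for j
      unfolding hom_comp_simps(3) by (simp only: cst_mult mult_ac)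
    ultimately have "hom_comp i ((cst c * mon \<alpha>) * (cst b * mon \<beta>)) =
        (\<Sum>j\<le>i. hom_comp j (cst c * mon \<alpha>) * hom_comp (i - j) (cst b * mon \<beta>))"
      by simp
    then show ?case using add by (simp del: hom_comp_simps(3,5) add: distrib_left sum.distrib)
  qed simp
  then show ?case using add by (simp del: hom_comp_simps(3,5) add: distrib_right sum.distrib)
qed simp

section \<open>The degeneration of an adapted basis\<close>

lemma comm_ring_hom_simps:
  assumes "comm_ring_hom h"
  shows "h 0 = 0" "h 1 = 1" "h (x + y) = h x + h y" "h (x * y) = h x * h y" "h (- x) = - h x" "h (x - y) = h x - h y"
    "h (x ^ m) = h x ^ m" "h (sum F B) = (\<Sum>b\<in>B. h (F b))" "h (prod F B) = (\<Prod>b\<in>B. h (F b))"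
proof -
  interpret comm_ring_hom h by fact
  show "h 0 = 0" "h 1 = 1" "h (x + y) = h x + h y" "h (x * y) = h x * h y" "h (- x) = - h x" "h (x - y) = h x - h y"
    "h (x ^ m) = h x ^ m" "h (sum F B) = (\<Sum>b\<in>B. h (F b))" "h (prod F B) = (\<Prod>b\<in>B. h (F b))"
    by (simp_all add: hom_distribs)
qed

lemma id_comm_ring_hom: "comm_ring_hom (\<lambda>c :: 'r::comm_ring_1. c)"
  by unfold_locales auto

text \<open>A basis of \<open>A\<close> that is adapted to the pairing \<open>(f, g) \<mapsto> \<eta> (f * g)\<close> and to the powers of the maximal ideal,
with representatives \<open>E a\<close> of order at least \<open>n a\<close>.\<close>

locale adapted_basis =
  fixes I :: "('n::finite, 'k::field) mpoly set" and \<eta> :: "('n, 'k) mpoly \<Rightarrow> 'k"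
    and d :: nat and E :: "nat \<Rightarrow> ('n, 'k) mpoly" and n \<sigma> :: "nat \<Rightarrow> nat" and p :: "nat \<Rightarrow> 'k"
  assumes \<eta>_linear: "linear_form \<eta>"
    and radical: "\<And>f. f \<in> I \<longleftrightarrow> (\<forall>g. \<eta> (f * g) = 0)"
    and E_ord: "\<And>a. a < d \<Longrightarrow> E a \<in> ord_ge (n a)"
    and \<sigma>: "\<And>a. a < d \<Longrightarrow> \<sigma> a < d" "\<And>a. a < d \<Longrightarrow> \<sigma> (\<sigma> a) = a"
    and p: "\<And>a. a < d \<Longrightarrow> p a \<noteq> 0" "\<And>a. a < d \<Longrightarrow> p (\<sigma> a) = p a"
    and gram: "\<And>a b. a < d \<Longrightarrow> b < d \<Longrightarrow> \<eta> (E a * E b) = (if b = \<sigma> a then p a else 0)"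
    and filt: "\<And>a f l. a < d \<Longrightarrow> f \<in> ord_ge l \<Longrightarrow> \<eta> (f * E (\<sigma> a)) \<noteq> 0 \<Longrightarrow> l \<le> n a"
    and spanning: "\<And>f. (\<And>a. a < d \<Longrightarrow> \<eta> (f * E a) = 0) \<Longrightarrow> f \<in> I"
begin

text \<open>The \<open>a\<close>-th coordinate modulo \<open>I\<close>.\<close>

definition \<kappa> where "\<kappa> a f = \<eta> (f * E (\<sigma> a)) / p a"

lemma \<kappa>_linear: "linear_form (\<kappa> a)"
  using \<eta>_linear unfolding linear_form_def \<kappa>_def
  by (auto simp: distrib_right mult.assoc add_divide_distrib)

lemmas \<kappa>_simps = linear_form_simps[OF \<kappa>_linear]

lemma \<kappa>_E: "a < d \<Longrightarrow> b < d \<Longrightarrow> \<kappa> a (E b) = (if a = b then 1 else 0)"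
proof -
  assume a: "a < d" and b: "b < d"
  have "\<sigma> a = \<sigma> b \<longleftrightarrow> a = b" using \<sigma>(2)[OF a] \<sigma>(2)[OF b] by metis
  then show ?thesis using gram[OF b \<sigma>(1)[OF a]] p(1)[OF a] by (auto simp: \<kappa>_def)
qed

lemma \<kappa>_ord: "a < d \<Longrightarrow> f \<in> ord_ge l \<Longrightarrow> n a < l \<Longrightarrow> \<kappa> a f = 0"
  using filt[of a f l] by (auto simp: \<kappa>_def)

lemma \<kappa>_mon: "a < d \<Longrightarrow> n a < mdeg \<alpha> \<Longrightarrow> \<kappa> a (mon \<alpha>) = 0"
  using \<kappa>_ord ord_ge_mon by blast

lemma I_iff: "f \<in> I \<longleftrightarrow> (\<forall>a<d. \<kappa> a f = 0)"
proof
  assume "f \<in> I" then show "\<forall>a<d. \<kappa> a f = 0" by (simp add: radical \<kappa>_def)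
next
  assume *: "\<forall>a<d. \<kappa> a f = 0"
  have "\<eta> (f * E a) = 0" if "a < d" for a
  proof -
    have "\<kappa> (\<sigma> a) f = 0" using * \<sigma> that by blast
    then show ?thesis using \<sigma> p that by (simp add: \<kappa>_def)
  qed
  then show "f \<in> I" by (rule spanning)
qed

lemma expand_mod_I: "f - (\<Sum>a<d. cst (\<kappa> a f) * E a) \<in> I"
proof -
  have "\<kappa> b (\<Sum>a<d. cst (\<kappa> a f) * E a) = \<kappa> b f" if "b < d" for b
  proof -
    have "\<kappa> b (\<Sum>a<d. cst (\<kappa> a f) * E a) = (\<Sum>a<d. if a = b then \<kappa> b f else 0)"
      unfolding \<kappa>_simps by (rule sum.cong) (use that \<kappa>_E in auto)
    then show ?thesis using that by simp
  qed
  then show ?thesis by (simp add: I_iff \<kappa>_simps(5))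
qed

lemma I_mult: "f \<in> I \<Longrightarrow> g * f \<in> I"
  by (simp add: radical) (metis mult.assoc mult.commute)

lemma \<kappa>_mult: "a < d \<Longrightarrow> \<kappa> a (g * f) = (\<Sum>b<d. \<kappa> b f * \<kappa> a (g * E b))"
proof -
  assume a: "a < d"
  have "g * (f - (\<Sum>b<d. cst (\<kappa> b f) * E b)) \<in> I" by (rule I_mult[OF expand_mod_I])
  then have "\<kappa> a (g * f) = \<kappa> a (g * (\<Sum>b<d. cst (\<kappa> b f) * E b))"
    using a by (simp add: I_iff right_diff_distrib \<kappa>_simps)
  also have "\<dots> = \<kappa> a (\<Sum>b<d. cst (\<kappa> b f) * (g * E b))"
    by (simp add: sum_distrib_left mult.left_commute)
  finally show ?thesis by (simp add: \<kappa>_simps)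
qed

text \<open>Here \<open>h\<close> makes the ring an algebra over \<open>k\<close> and \<open>v\<close> is the parameter of the degeneration. The coordinate
\<open>\<kappa> a\<close> vanishes on monomials of degree above \<open>n a\<close>, and \<open>E a\<close> has no monomials of degree below \<open>n a\<close>; so
truncated subtraction in the two exponents of \<open>v\<close> loses nothing, and \<open>v\<close> need not be invertible.\<close>

definition coordinate :: "('k \<Rightarrow> 'r::comm_ring_1) \<Rightarrow> 'r \<Rightarrow> nat \<Rightarrow> ('n, 'r) mpoly \<Rightarrow> 'r" where
  "coordinate h v a = lin_ext (\<lambda>\<alpha>. v ^ (n a - mdeg \<alpha>) * h (\<kappa> a (mon \<alpha>)))"

definition basis_elt :: "('k \<Rightarrow> 'r::comm_ring_1) \<Rightarrow> 'r \<Rightarrow> nat \<Rightarrow> ('n, 'r) mpoly" where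
  "basis_elt h v a = (\<Sum>\<alpha>\<in>Poly_Mapping.keys (E a). cst (v ^ (mdeg \<alpha> - n a) * h (Poly_Mapping.lookup (E a) \<alpha>)) * mon \<alpha>)"

definition degeneration :: "('k \<Rightarrow> 'r::comm_ring_1) \<Rightarrow> 'r \<Rightarrow> ('n, 'r) mpoly set" where
  "degeneration h v = {f. \<forall>a<d. coordinate h v a f = 0}"

lemma coordinate_linear [simp]: "linear_form (coordinate h v a)"
  by (simp add: coordinate_def)

lemmas coordinate_simps = linear_form_simps[OF coordinate_linear]

lemma coordinate_mon: "coordinate h v a (mon \<alpha>) = v ^ (n a - mdeg \<alpha>) * h (\<kappa> a (mon \<alpha>))"
  by (simp add: coordinate_def)

lemma E_as_sum: "E a = (\<Sum>\<alpha>\<in>Poly_Mapping.keys (E a). cst (Poly_Mapping.lookup (E a) \<alpha>) * mon \<alpha>)"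
  by (rule poly_as_sum) auto

lemma keys_E: "a < d \<Longrightarrow> \<alpha> \<in> Poly_Mapping.keys (E a) \<Longrightarrow> n a \<le> mdeg \<alpha>"
  using E_ord[of a] by (auto simp: ord_ge_def in_keys_iff not_less[symmetric])

text \<open>The exponents of \<open>v\<close> from the coordinate and from the basis element add up to the constant \<open>n a - n b\<close>, so
duality is inherited from \<open>\<kappa>\<close> and \<open>E\<close>.\<close>

lemma coordinate_basis_elt:
  assumes h: "comm_ring_hom h" and a: "a < d" and b: "b < d"
  shows "coordinate h v a (basis_elt h v b) = (if a = b then 1 else 0)"
proof -
  have "coordinate h v a (basis_elt h v b) = (\<Sum>\<alpha>\<in>Poly_Mapping.keys (E b).
      v ^ (mdeg \<alpha> - n b) * h (Poly_Mapping.lookup (E b) \<alpha>) * (v ^ (n a - mdeg \<alpha>) * h (\<kappa> a (mon \<alpha>))))"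
    by (simp add: basis_elt_def coordinate_simps coordinate_mon)
  also have "\<dots> = (\<Sum>\<alpha>\<in>Poly_Mapping.keys (E b). v ^ (n a - n b) * h (Poly_Mapping.lookup (E b) \<alpha> * \<kappa> a (mon \<alpha>)))"
  proof (rule sum.cong[OF refl])
    fix \<alpha> assume \<alpha>: "\<alpha> \<in> Poly_Mapping.keys (E b)"
    show "v ^ (mdeg \<alpha> - n b) * h (Poly_Mapping.lookup (E b) \<alpha>) * (v ^ (n a - mdeg \<alpha>) * h (\<kappa> a (mon \<alpha>))) =
      v ^ (n a - n b) * h (Poly_Mapping.lookup (E b) \<alpha> * \<kappa> a (mon \<alpha>))"
    proof (cases "\<kappa> a (mon \<alpha>) = 0")
      case False
      then have "n a - n b = (mdeg \<alpha> - n b) + (n a - mdeg \<alpha>)"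
        using \<kappa>_mon[OF a, of \<alpha>] keys_E[OF b \<alpha>] by force
      then show ?thesis by (simp add: power_add comm_ring_hom_simps[OF h] mult_ac)
    qed (simp add: comm_ring_hom_simps[OF h])
  qed
  also have "\<dots> = v ^ (n a - n b) * h (\<kappa> a (\<Sum>\<alpha>\<in>Poly_Mapping.keys (E b). cst (Poly_Mapping.lookup (E b) \<alpha>) * mon \<alpha>))"
    by (simp add: \<kappa>_simps comm_ring_hom_simps[OF h] sum_distrib_left)
  also have "\<dots> = (if a = b then 1 else 0)"
    using a b arg_cong[OF E_as_sum[of b, symmetric], of "\<kappa> a"] by (simp add: \<kappa>_E comm_ring_hom_simps[OF h])
  finally show ?thesis .
qed

text \<open>The structure constants of \<open>A\<close> respect orders, \<open>mdeg \<beta> + n b \<le> n a\<close> where they do not vanish. This is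
why they can be rescaled by nonnegative powers of \<open>v\<close>, and why the common kernel of the coordinates is an
ideal for every \<open>v\<close>.\<close>

lemma coordinate_mon_mult:
  assumes h: "comm_ring_hom h" and a: "a < d"
  shows "coordinate h v a (mon \<beta> * f) = (\<Sum>b<d. v ^ (n a - n b - mdeg \<beta>) * h (\<kappa> a (mon \<beta> * E b)) * coordinate h v b f)"
proof (rule linear_form_eqI)
  fix \<alpha>
  have "coordinate h v a (mon \<beta> * mon \<alpha>) = v ^ (n a - (mdeg \<beta> + mdeg \<alpha>)) * h (\<Sum>b<d. \<kappa> b (mon \<alpha>) * \<kappa> a (mon \<beta> * E b))"
    using \<kappa>_mult[OF a, of "mon \<beta>" "mon \<alpha>"] by (simp add: mon_mult coordinate_mon)
  also have "\<dots> = (\<Sum>b<d. v ^ (n a - n b - mdeg \<beta>) * h (\<kappa> a (mon \<beta> * E b)) * coordinate h v b (mon \<alpha>))"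
    unfolding comm_ring_hom_simps[OF h] sum_distrib_left
  proof (rule sum.cong[OF refl])
    fix b assume b: "b \<in> {..<d}"
    show "v ^ (n a - (mdeg \<beta> + mdeg \<alpha>)) * (h (\<kappa> b (mon \<alpha>)) * h (\<kappa> a (mon \<beta> * E b))) =
      v ^ (n a - n b - mdeg \<beta>) * h (\<kappa> a (mon \<beta> * E b)) * coordinate h v b (mon \<alpha>)"
    proof (cases "\<kappa> b (mon \<alpha>) = 0 \<or> \<kappa> a (mon \<beta> * E b) = 0")
      case False
      have "mdeg \<alpha> \<le> n b" using False \<kappa>_mon[of b \<alpha>] b by force
      moreover have "mdeg \<beta> + n b \<le> n a"
        using False \<kappa>_ord[OF a ord_ge_mult[OF ord_ge_mon[of "mdeg \<beta>" \<beta>] E_ord[of b]]] b by force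
      ultimately have "n a - (mdeg \<beta> + mdeg \<alpha>) = (n a - n b - mdeg \<beta>) + (n b - mdeg \<alpha>)" by simp
      then show ?thesis by (simp add: coordinate_mon power_add mult_ac)
    qed (auto simp: coordinate_mon comm_ring_hom_simps[OF h])
  qed
  finally show "coordinate h v a (mon \<beta> * mon \<alpha>) =
    (\<Sum>b<d. v ^ (n a - n b - mdeg \<beta>) * h (\<kappa> a (mon \<beta> * E b)) * coordinate h v b (mon \<alpha>))" .
qed (auto intro!: linear_form_mult linear_form_sum linear_form_scale)

lemma degeneration_subspace:
  "0 \<in> degeneration h v" "f \<in> degeneration h v \<Longrightarrow> g \<in> degeneration h v \<Longrightarrow> f + g \<in> degeneration h v" "f \<in> degeneration h v \<Longrightarrow> cst c * f \<in> degeneration h v"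
  by (auto simp: degeneration_def coordinate_simps)

lemma degeneration_ideal:
  assumes h: "comm_ring_hom h" shows "ideal (degeneration h v) \<S>"
  unfolding ideal_S_iff
proof (intro conjI ballI allI)
  fix f g assume f: "f \<in> degeneration h v"
  have m: "mon \<beta> * f \<in> degeneration h v" for \<beta> using f h by (simp add: degeneration_def coordinate_mon_mult)
  show "g * f \<in> degeneration h v"
  proof (induction g rule: poly_induct)
    case (add g c \<alpha>)
    have "cst c * (mon \<alpha> * f) \<in> degeneration h v" using m degeneration_subspace(3) by blast
    then show ?case using add degeneration_subspace(2) by (simp add: distrib_right mult.assoc)
  qed (simp add: degeneration_subspace)
qed (auto intro: degeneration_subspace)

lemma expand_mod_degeneration:
  assumes h: "comm_ring_hom h"
  shows "f - (\<Sum>a<d. cst (coordinate h v a f) * basis_elt h v a) \<in> degeneration h v"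
proof -
  have "coordinate h v b (\<Sum>a<d. cst (coordinate h v a f) * basis_elt h v a) = coordinate h v b f" if "b < d" for b
  proof -
    have "coordinate h v b (\<Sum>a<d. cst (coordinate h v a f) * basis_elt h v a) = (\<Sum>a<d. if a = b then coordinate h v b f else 0)"
      unfolding coordinate_simps by (rule sum.cong) (use that coordinate_basis_elt[OF h] in auto)
    then show ?thesis using that by simp
  qed
  then show ?thesis by (simp add: degeneration_def coordinate_simps(5))
qed

lemma coordinate_dual: "a < d \<Longrightarrow> coordinate h v a \<in> dual_space (degeneration h v)"
  by (simp add: dual_space_iff degeneration_def)

lemma dual_expand:
  assumes h: "comm_ring_hom h" and \<phi>: "\<phi> \<in> dual_space (degeneration h v)"
  shows "\<phi> f = (\<Sum>a<d. coordinate h v a f * \<phi> (basis_elt h v a))"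
proof -
  have l: "linear_form \<phi>" using \<phi> by (simp add: dual_space_iff)
  have "\<phi> (f - (\<Sum>a<d. cst (coordinate h v a f) * basis_elt h v a)) = 0"
    using \<phi> expand_mod_degeneration[OF h] by (auto simp: dual_space_iff)
  then show ?thesis by (simp add: linear_form_simps[OF l])
qed

lemma degeneration_free:
  assumes h: "comm_ring_hom h" shows "free_of_rank d (degeneration h v)"
  unfolding free_of_rank_def
proof (intro exI[of _ "basis_elt h v"] conjI allI impI)
  fix f show "\<exists>c. f - (\<Sum>i<d. cst (c i) * basis_elt h v i) \<in> degeneration h v"
    by (rule exI[of _ "\<lambda>i. coordinate h v i f"]) (rule expand_mod_degeneration[OF h])
next
  fix c i assume *: "(\<Sum>i<d. cst (c i) * basis_elt h v i) \<in> degeneration h v" and i: "i < d"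
  have "(\<Sum>j<d. c j * coordinate h v i (basis_elt h v j)) = 0" using * i by (simp add: degeneration_def coordinate_simps)
  moreover have "(\<Sum>j<d. c j * coordinate h v i (basis_elt h v j)) = (\<Sum>j<d. if j = i then c i else 0)"
    by (rule sum.cong) (use i coordinate_basis_elt[OF h] in auto)
  ultimately show "c i = 0" using i by simp
qed

lemma coordinate_base_change:
  assumes h: "comm_ring_hom h" and g: "comm_ring_hom g"
  shows "coordinate (\<lambda>c. g (h c)) (g v) a (Poly_Mapping.map g f) = g (coordinate h v a f)"
  by (induction f rule: poly_induct)
    (simp_all add: map_hom_simps[OF g] coordinate_simps comm_ring_hom_simps[OF g] coordinate_mon)

lemma basis_elt_base_change:
  assumes g: "comm_ring_hom g"
  shows "Poly_Mapping.map g (basis_elt h v a) = basis_elt (\<lambda>c. g (h c)) (g v) a"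
  by (simp add: basis_elt_def map_hom_simps[OF g] comm_ring_hom_simps[OF g])

lemma hom_comp_ring: "comm_ring_hom h \<Longrightarrow> comm_ring_hom g \<Longrightarrow> comm_ring_hom (\<lambda>c. g (h c))"
  by (unfold_locales) (simp_all add: comm_ring_hom_simps)

text \<open>Modulo the extended ideal every polynomial is a combination of the basis elements with the coordinates as
coefficients; it suffices to check this on monomials, which come from the smaller ring.\<close>

lemma degeneration_base_change:
  assumes h: "comm_ring_hom h" and g: "comm_ring_hom g"
  shows "Idl\<^bsub>\<S>\<^esub> (Poly_Mapping.map g ` degeneration h v) = degeneration (\<lambda>c. g (h c)) (g v)"
proof
  have gh: "comm_ring_hom (\<lambda>c. g (h c))" using hom_comp_ring h g .
  show "Idl\<^bsub>\<S>\<^esub> (Poly_Mapping.map g ` degeneration h v) \<subseteq> degeneration (\<lambda>c. g (h c)) (g v)"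
    by (rule S.genideal_minimal[OF degeneration_ideal[OF gh]])
      (auto simp: degeneration_def coordinate_base_change[OF h g] comm_ring_hom_simps[OF g])
  have "ideal (Idl\<^bsub>\<S>\<^esub> (Poly_Mapping.map g ` degeneration h v)) \<S>" by (rule S.genideal_ideal) auto
  then have id: "0 \<in> Idl\<^bsub>\<S>\<^esub> (Poly_Mapping.map g ` degeneration h v)"
    "\<And>x y. x \<in> Idl\<^bsub>\<S>\<^esub> (Poly_Mapping.map g ` degeneration h v) \<Longrightarrow> y \<in> Idl\<^bsub>\<S>\<^esub> (Poly_Mapping.map g ` degeneration h v) \<Longrightarrow> x + y \<in> Idl\<^bsub>\<S>\<^esub> (Poly_Mapping.map g ` degeneration h v)"
    "\<And>x y. x \<in> Idl\<^bsub>\<S>\<^esub> (Poly_Mapping.map g ` degeneration h v) \<Longrightarrow> y * x \<in> Idl\<^bsub>\<S>\<^esub> (Poly_Mapping.map g ` degeneration h v)"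
    unfolding ideal_S_iff by auto
  show "degeneration (\<lambda>c. g (h c)) (g v) \<subseteq> Idl\<^bsub>\<S>\<^esub> (Poly_Mapping.map g ` degeneration h v)"
  proof
    fix f assume f: "f \<in> degeneration (\<lambda>c. g (h c)) (g v)"
    let ?r = "\<lambda>f. f - (\<Sum>a<d. cst (coordinate (\<lambda>c. g (h c)) (g v) a f) * basis_elt (\<lambda>c. g (h c)) (g v) a)"
    have m: "?r (mon \<alpha>) \<in> Idl\<^bsub>\<S>\<^esub> (Poly_Mapping.map g ` degeneration h v)" for \<alpha>
    proof -
      have "?r (mon \<alpha>) = Poly_Mapping.map g (mon \<alpha> - (\<Sum>a<d. cst (coordinate h v a (mon \<alpha>)) * basis_elt h v a))"
        by (simp add: map_hom_simps[OF g] basis_elt_base_change[OF g] coordinate_mon comm_ring_hom_simps[OF g])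
      then have "?r (mon \<alpha>) \<in> Poly_Mapping.map g ` degeneration h v" using expand_mod_degeneration[OF h] by blast
      then show ?thesis using S.genideal_self[of "Poly_Mapping.map g ` degeneration h v"] by auto
    qed
    have "?r f' \<in> Idl\<^bsub>\<S>\<^esub> (Poly_Mapping.map g ` degeneration h v)" for f'
    proof (induction f' rule: poly_induct)
      case zero then show ?case using id by (simp add: coordinate_simps)
    next
      case (add f' c \<alpha>)
      have "?r (f' + cst c * mon \<alpha>) = ?r f' + cst c * ?r (mon \<alpha>)"
        by (simp add: coordinate_simps cst_add cst_mult sum.distrib sum_distrib_left algebra_simps)
      moreover have "?r f' + cst c * ?r (mon \<alpha>) \<in> Idl\<^bsub>\<S>\<^esub> (Poly_Mapping.map g ` degeneration h v)"
        by (rule id(2)[OF add id(3)[OF m]])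
      ultimately show ?case by (simp only:)
    qed
    from this[of f] show "f \<in> Idl\<^bsub>\<S>\<^esub> (Poly_Mapping.map g ` degeneration h v)" using f by (simp add: degeneration_def)
  qed
qed

lemma degeneration_id: "degeneration (\<lambda>c. c) 1 = I"
proof -
  have "coordinate (\<lambda>c. c) 1 a f = \<kappa> a f" for a f
    by (rule linear_form_eqI) (auto simp: \<kappa>_linear coordinate_mon)
  then show ?thesis by (auto simp: degeneration_def I_iff)
qed

lemma basis_elt_id: "basis_elt (\<lambda>c. c) 1 a = E a"
  using E_as_sum[of a] by (simp add: basis_elt_def)

text \<open>For invertible \<open>v\<close> the degeneration is a change of variables, up to the factors \<open>v\<close> to the power \<open>n a\<close> in
the basis and its dual.\<close>

lemma coordinate_scale:
  assumes h: "comm_ring_hom h" and a: "a < d"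
  shows "coordinate h v a (scale_vars v f) = v ^ n a * coordinate h 1 a f"
proof (induction f rule: poly_induct)
  case (add f c \<alpha>)
  have "v ^ mdeg \<alpha> * (v ^ (n a - mdeg \<alpha>) * h (\<kappa> a (mon \<alpha>))) = v ^ n a * h (\<kappa> a (mon \<alpha>))"
  proof (cases "mdeg \<alpha> \<le> n a")
    case True
    then show ?thesis by (simp flip: mult.assoc power_add)
  next
    case False then show ?thesis using \<kappa>_mon[OF a, of \<alpha>] by (simp add: comm_ring_hom_simps[OF h])
  qed
  then have "coordinate h v a (scale_vars v (mon \<alpha>)) = v ^ n a * coordinate h 1 a (mon \<alpha>)"
    by (simp add: coordinate_simps coordinate_mon)
  then show ?case using add
    by (simp add: coordinate_simps distrib_left mult.left_commute del: scale_vars_simps(4))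
qed (simp add: coordinate_simps)

lemma scale_vars_basis_elt:
  assumes a: "a < d"
  shows "scale_vars v (basis_elt h 1 a) = cst (v ^ n a) * basis_elt h v a"
proof -
  have "scale_vars v (\<Sum>x\<in>B. F x) = (\<Sum>x\<in>B. scale_vars v (F x))" for F :: "('n \<Rightarrow>\<^sub>0 nat) \<Rightarrow> ('n, 'a) mpoly" and B
    by (induction B rule: infinite_finite_induct) auto
  then have "scale_vars v (basis_elt h 1 a) = (\<Sum>\<alpha>\<in>Poly_Mapping.keys (E a). cst (h (Poly_Mapping.lookup (E a) \<alpha>)) * (cst (v ^ mdeg \<alpha>) * mon \<alpha>))"
    by (simp add: basis_elt_def)
  also have "\<dots> = cst (v ^ n a) * basis_elt h v a"
    unfolding basis_elt_def sum_distrib_left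
  proof (rule sum.cong[OF refl])
    fix \<alpha> assume "\<alpha> \<in> Poly_Mapping.keys (E a)"
    then have "v ^ mdeg \<alpha> = v ^ n a * v ^ (mdeg \<alpha> - n a)" using keys_E[OF a] by (simp flip: power_add)
    then show "cst (h (Poly_Mapping.lookup (E a) \<alpha>)) * (cst (v ^ mdeg \<alpha>) * mon \<alpha>) =
      cst (v ^ n a) * (cst (v ^ (mdeg \<alpha> - n a) * h (Poly_Mapping.lookup (E a) \<alpha>)) * mon \<alpha>)"
      by (simp only: cst_mult mult_ac)
  qed
  finally show ?thesis .
qed

lemma degeneration_scale:
  assumes h: "comm_ring_hom h" and v: "v * v' = 1"
  shows "scale_vars v ` degeneration h 1 = degeneration h v"
proof (rule Set.set_eqI, rule iffI)
  fix f assume "f \<in> scale_vars v ` degeneration h 1"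
  then show "f \<in> degeneration h v" using coordinate_scale[OF h] by (auto simp: degeneration_def)
next
  fix f assume f: "f \<in> degeneration h v"
  have e: "f = scale_vars v (scale_vars v' f)" using v by (simp add: scale_vars_scale_vars)
  have "coordinate h 1 a (scale_vars v' f) = 0" if a: "a < d" for a
  proof -
    have "v ^ n a * coordinate h 1 a (scale_vars v' f) = 0" using coordinate_scale[OF h a, of v "scale_vars v' f"] f a e by (simp add: degeneration_def)
    then have "(v' * v) ^ n a * coordinate h 1 a (scale_vars v' f) = 0" by (simp add: power_mult_distrib mult.assoc)
    then show ?thesis using v by (simp add: mult.commute)
  qed
  then have "scale_vars v' f \<in> degeneration h 1" by (simp add: degeneration_def)
  then show "f \<in> scale_vars v ` degeneration h 1" using e by blast
qed

lemma coordinate_mon_mult_basis_elt: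
  assumes h: "comm_ring_hom h" and "a < d" "b < d"
  shows "coordinate h v b (mon \<alpha> * basis_elt h v a) = v ^ (n b - n a - mdeg \<alpha>) * h (\<kappa> b (mon \<alpha> * E a))"
proof -
  have "coordinate h v b (mon \<alpha> * basis_elt h v a) = (\<Sum>c<d. if c = a then v ^ (n b - n a - mdeg \<alpha>) * h (\<kappa> b (mon \<alpha> * E a)) else 0)"
    unfolding coordinate_mon_mult[OF h assms(3)] by (rule sum.cong) (use assms coordinate_basis_elt[OF h] in auto)
  then show ?thesis using assms by simp
qed

lemma structure_constant_degree:
  assumes "a < d" "b < d" "\<kappa> b (mon \<alpha> * E a) \<noteq> 0"
  shows "n a + mdeg \<alpha> \<le> n b"
  using \<kappa>_ord[OF assms(2) ord_ge_mult[OF ord_ge_mon[of "mdeg \<alpha>" \<alpha>] E_ord[OF assms(1)]]] assms(3) by force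

text \<open>Multiplication by a monomial is self-adjoint for \<open>\<eta>\<close>, and \<open>E (\<sigma> b)\<close> and \<open>E (\<sigma> a)\<close> are dual to \<open>E b\<close> and
\<open>E a\<close> up to \<open>p b\<close> and \<open>p a\<close>.\<close>

lemma structure_constant_sym:
  assumes "a < d" "b < d"
  shows "\<kappa> b (mon \<alpha> * E a) / p a = \<kappa> (\<sigma> a) (mon \<alpha> * E (\<sigma> b)) / p b"
  using assms \<sigma> p by (simp add: \<kappa>_def mult_ac)

text \<open>The weight of \<open>a\<close>: the power of \<open>v\<close> by which the torus multiplies the summand \<open>E a \<otimes> E (\<sigma> a)\<close> of the
quadric.\<close>

definition w where "w a = n a + n (\<sigma> a)"

lemma w_\<sigma>: "a < d \<Longrightarrow> w (\<sigma> a) = w a"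
  by (simp add: w_def \<sigma>)

end

section \<open>Exterior powers of the quadric in the degeneration\<close>

lemma gram_det_scale:
  "length ys = length xs \<Longrightarrow> gram_det (\<lambda>x y. c * M x y) xs ys = c ^ length xs * gram_det M xs ys"
proof -
  assume "length ys = length xs"
  have "mat (length xs) (length xs) (\<lambda>(k, l). c * M (xs ! k) (ys ! l)) =
    c \<cdot>\<^sub>m mat (length xs) (length xs) (\<lambda>(k, l). M (xs ! k) (ys ! l))" by (auto intro!: eq_matI)
  then show ?thesis by (simp add: gram_det_def)
qed

lemma gram_det_repeated_col:
  assumes "length ys = length xs" "a < length ys" "b < length ys" "a \<noteq> b" "ys ! a = ys ! b"
  shows "gram_det M xs ys = 0"
  by (subst gram_det_transpose[OF assms(1)]) (rule gram_det_repeated[OF assms(2-5)])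

lemma pair_prod_update_linear:
  assumes "k < length \<phi>s" "length xs = length \<phi>s" "\<And>a. U z a = U x a + c * U x' a"
  shows "pair_prod U (\<phi>s[k := z]) xs = pair_prod U (\<phi>s[k := x]) xs + c * pair_prod U (\<phi>s[k := x']) xs"
  using assms(2,1)
proof (induction xs \<phi>s arbitrary: k rule: list_induct2)
  case (Cons y xs \<phi> \<phi>s)
  then show ?case by (cases k) (auto simp: assms(3) algebra_simps)
qed simp

lemma pair_prod_map: "pair_prod U (map f \<phi>s) xs = pair_prod (\<lambda>\<phi>. U (f \<phi>)) \<phi>s xs"
  unfolding pair_prod_def by (simp add: zip_map1 case_prod_unfold comp_def)

lemma pair_prod_cong:
  assumes "\<And>\<phi> a. \<phi> \<in> set \<phi>s \<Longrightarrow> a \<in> set xs \<Longrightarrow> U \<phi> a = U' \<phi> a"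
  shows "pair_prod U \<phi>s xs = pair_prod U' \<phi>s xs"
  unfolding pair_prod_def
  by (rule arg_cong[where f = prod_list], rule map_cong) (auto intro!: assms dest: set_zip_leftD set_zip_rightD)

lemma pair_prod_mult:
  "length \<phi>s = length xs \<Longrightarrow> pair_prod (\<lambda>\<phi> a. U \<phi> a * t a) \<phi>s xs = pair_prod U \<phi>s xs * prod_list (map t xs)"
  by (induction \<phi>s xs rule: list_induct2) (auto simp: mult_ac)

lemma prod_list_power: "prod_list (map (\<lambda>a. v ^ f a) xs) = (v :: 'r :: comm_ring_1) ^ sum_list (map f xs)"
  by (induction xs) (auto simp: power_add)

lemma pair_prod_hom:
  assumes "comm_ring_hom g" "length \<phi>s = length xs"
  shows "g (pair_prod U \<phi>s xs) = pair_prod (\<lambda>\<phi> a. g (U \<phi> a)) \<phi>s xs"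
  using assms(2) by (induction \<phi>s xs rule: list_induct2) (auto simp: comm_ring_hom_simps[OF assms(1)])

lemma gram_det_row_scale:
  "length ys = length xs \<Longrightarrow> gram_det (\<lambda>x y. t x * M x y) xs ys = prod_list (map t xs) * gram_det M xs ys"
proof -
  assume l: "length ys = length xs"
  have "row_det (\<lambda>x q. t x * N x q) xs Q = prod_list (map t xs) * row_det N xs Q" for N Q
    by (induction xs arbitrary: Q) (auto simp: sum_distrib_left mult_ac intro!: sum.cong)
  then show ?thesis using l by (simp add: gram_det_eq_row_det)
qed

text \<open>The indices \<open>a < d\<close> are grouped into the blocks \<open>Cs\<close> of equal weight \<open>\<omega>\<close>, by increasing weight.\<close>

locale adapted_blocks = adapted_basis I \<eta> d E n \<sigma> p
  for I :: "('n::finite, 'k::field) mpoly set" and \<eta> d E n \<sigma> p +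
  fixes Cs :: "nat set list" and \<omega> :: "nat set \<Rightarrow> nat"
  assumes Cs_Union: "\<Union>(set Cs) = {..<d}" and Cs_disj: "pairwise disjnt (set Cs)" and Cs_distinct: "distinct Cs"
    and Cs_weight: "\<And>C a. C \<in> set Cs \<Longrightarrow> a \<in> C \<Longrightarrow> n a + n (\<sigma> a) = \<omega> C"
    and Cs_sorted: "sorted_wrt (<) (map \<omega> Cs)"
begin

definition wt where "wt xs = sum_list (map w xs)"

definition minwt where "minwt i = greedy_sum \<omega> Cs i"

definition index_lists where "index_lists i = {xs. length xs = i \<and> set xs \<subseteq> {..<d} \<and> distinct xs}"

text \<open>The quadric of the family is \<open>\<Sum>a. (1 / p a) E a \<otimes> E (\<sigma> a)\<close>, up to powers of \<open>v\<close>. \<open>U\<close> and \<open>Y\<close> are the values of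
the two tensor factors on functionals.\<close>

definition U :: "('k \<Rightarrow> 'r::comm_ring_1) \<Rightarrow> 'r \<Rightarrow> (('n, 'r) mpoly \<Rightarrow> 'r) \<Rightarrow> nat \<Rightarrow> 'r" where
  "U h v \<phi> a = h (1 / p a) * \<phi> (basis_elt h v a)"

definition Y :: "('k \<Rightarrow> 'r::comm_ring_1) \<Rightarrow> 'r \<Rightarrow> nat \<Rightarrow> (('n, 'r) mpoly \<Rightarrow> 'r) \<Rightarrow> 'r" where
  "Y h v a \<psi> = \<psi> (basis_elt h v (\<sigma> a))"

definition block_form :: "('k \<Rightarrow> 'r::comm_ring_1) \<Rightarrow> 'r \<Rightarrow> nat set \<Rightarrow> (('n, 'r) mpoly \<Rightarrow> 'r) \<Rightarrow> (('n, 'r) mpoly \<Rightarrow> 'r) \<Rightarrow> 'r" where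
  "block_form h v C \<phi> \<psi> = (\<Sum>a\<in>C. U h v \<phi> a * Y h v a \<psi>)"

text \<open>The expansion of the \<open>i\<close>-th exterior power of the translated quadric, divided by the power \<open>minwt i\<close> of \<open>v\<close>
that all its terms have in common.\<close>

definition family_form :: "('k \<Rightarrow> 'r::comm_ring_1) \<Rightarrow> 'r \<Rightarrow> nat \<Rightarrow> ('n, 'r) form" where
  "family_form h v i \<phi>s \<psi>s = (\<Sum>xs\<in>index_lists i. v ^ (wt xs - minwt i) * (pair_prod (U h v) \<phi>s xs * gram_det (Y h v) xs \<psi>s))"

lemma finite_index_lists: "finite (index_lists i)"
  by (rule finite_subset[OF _ finite_lists_length_eq[of "{..<d}" i]]) (auto simp: index_lists_def)

lemma finite_C: "C \<in> set Cs \<Longrightarrow> finite C"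
  using Cs_Union by (metis Union_upper finite_lessThan finite_subset)

lemma sum_card_Cs: "sum_list (map card Cs) = d"
proof -
  have "sum_list (map card Cs) = sum card (set Cs)" using Cs_distinct by (simp add: sum_list_distinct_conv_sum_set)
  also have "\<dots> = card (\<Union>(set Cs))"
    using Cs_disj finite_C by (intro card_Union_disjoint[symmetric]) auto
  finally show ?thesis by (simp add: Cs_Union)
qed

lemma minwt_le: "xs \<in> index_lists i \<Longrightarrow> minwt i \<le> wt xs" and
  minwt_eq_iff: "xs \<in> index_lists i \<Longrightarrow> minwt i = wt xs \<longleftrightarrow> greedy Cs xs"
  using greedy_sum_le[of Cs w \<omega> xs] finite_C Cs_weight Cs_sorted Cs_Union
  by (auto simp: index_lists_def minwt_def wt_def w_def)

lemma greedy_index_lists: "{xs. length xs = i \<and> greedy Cs xs} = {xs \<in> index_lists i. wt xs = minwt i}"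
proof -
  have "xs \<in> index_lists i" if "length xs = i" "greedy Cs xs" for xs
    using that greedy_subset[of Cs xs] greedy_distinct[of Cs xs] Cs_Union by (simp add: index_lists_def)
  moreover have "length xs = i" if "xs \<in> index_lists i" for xs using that by (simp add: index_lists_def)
  moreover have "wt xs = minwt i \<longleftrightarrow> greedy Cs xs" if "xs \<in> index_lists i" for xs using minwt_eq_iff[OF that] by auto
  ultimately show ?thesis by blast
qed

lemma greedy_list_exists: "i \<le> d \<Longrightarrow> \<exists>xs\<in>index_lists i. wt xs = minwt i"
  using greedy_exists[of Cs i] finite_C Cs_disj Cs_distinct sum_card_Cs greedy_index_lists by auto

lemma bij_\<sigma>: "bij_betw \<sigma> {..<d} {..<d}"
  by (rule bij_betw_byWitness[where f' = \<sigma>]) (use \<sigma> in auto)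

lemma block_form_sym_gen:
  assumes "bij_betw \<sigma> C C" "C \<subseteq> {..<d}" "\<And>a. a \<in> C \<Longrightarrow> t (\<sigma> a) = t a"
  shows "(\<Sum>a\<in>C. t a * (U h v \<phi> a * Y h v a \<psi>)) = (\<Sum>a\<in>C. t a * (U h v \<psi> a * Y h v a \<phi>))"
proof -
  have "(\<Sum>a\<in>C. t a * (U h v \<phi> a * Y h v a \<psi>)) = (\<Sum>a\<in>C. t (\<sigma> a) * (U h v \<phi> (\<sigma> a) * Y h v (\<sigma> a) \<psi>))"
    by (rule sum.reindex_bij_betw[OF assms(1), symmetric])
  also have "\<dots> = (\<Sum>a\<in>C. t a * (U h v \<psi> a * Y h v a \<phi>))"
    by (rule sum.cong) (use assms(2,3) \<sigma> p in \<open>auto simp: U_def Y_def subset_iff mult_ac\<close>)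
  finally show ?thesis .
qed

lemma family_form_1:
  "family_form h v 1 [\<phi>] [\<psi>] = (\<Sum>a<d. v ^ (w a - minwt 1) * (U h v \<phi> a * Y h v a \<psi>))"
proof -
  have "index_lists 1 = (\<lambda>a. [a]) ` {..<d}" by (auto simp: index_lists_def length_Suc_conv)
  then have "family_form h v 1 [\<phi>] [\<psi>] = (\<Sum>a<d. v ^ (wt [a] - minwt 1) * (pair_prod (U h v) [\<phi>] [a] * gram_det (Y h v) [a] [\<psi>]))"
    by (simp add: family_form_def sum.reindex inj_on_def)
  also have "\<dots> = (\<Sum>a<d. v ^ (w a - minwt 1) * (U h v \<phi> a * Y h v a \<psi>))"
    by (rule sum.cong) (auto simp: wt_def gram_det_def det_single)
  finally show ?thesis .
qed

lemma gram_det_weighted: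
  assumes "length \<phi>s = i" "length \<psi>s = i"
  shows "gram_det (\<lambda>\<phi> \<psi>. \<Sum>a<d. t ^ w a * (U h v \<phi> a * Y h v a \<psi>)) \<phi>s \<psi>s =
    (\<Sum>xs\<in>index_lists i. t ^ wt xs * (pair_prod (U h v) \<phi>s xs * gram_det (Y h v) xs \<psi>s))"
proof -
  have "gram_det (\<lambda>\<phi> \<psi>. \<Sum>a<d. t ^ w a * (U h v \<phi> a * Y h v a \<psi>)) \<phi>s \<psi>s =
    gram_det (\<lambda>\<phi> \<psi>. \<Sum>a<d. (U h v \<phi> a * t ^ w a) * Y h v a \<psi>) \<phi>s \<psi>s"
    by (rule gram_det_cong) (use assms in \<open>auto intro!: sum.cong simp: mult_ac\<close>)
  also have "\<dots> = (\<Sum>xs\<in>index_lists i. pair_prod (\<lambda>\<phi> a. U h v \<phi> a * t ^ w a) \<phi>s xs * gram_det (Y h v) xs \<psi>s)"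
    using assms by (subst gram_det_expand) (auto simp: index_lists_def)
  also have "\<dots> = (\<Sum>xs\<in>index_lists i. t ^ wt xs * (pair_prod (U h v) \<phi>s xs * gram_det (Y h v) xs \<psi>s))"
  proof (rule sum.cong[OF refl])
    fix xs assume "xs \<in> index_lists i"
    then have "pair_prod (\<lambda>\<phi> a. U h v \<phi> a * t ^ w a) \<phi>s xs = pair_prod (U h v) \<phi>s xs * t ^ wt xs"
      using assms by (simp add: index_lists_def pair_prod_mult prod_list_power wt_def)
    then show "pair_prod (\<lambda>\<phi> a. U h v \<phi> a * t ^ w a) \<phi>s xs * gram_det (Y h v) xs \<psi>s =
      t ^ wt xs * (pair_prod (U h v) \<phi>s xs * gram_det (Y h v) xs \<psi>s)" by (simp add: mult_ac)
  qed
  finally show ?thesis .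
qed

lemma family_form_minwt:
  "v ^ minwt i * family_form h v i \<phi>s \<psi>s = (\<Sum>xs\<in>index_lists i. v ^ wt xs * (pair_prod (U h v) \<phi>s xs * gram_det (Y h v) xs \<psi>s))"
  unfolding family_form_def sum_distrib_left
proof (rule sum.cong[OF refl])
  fix xs assume "xs \<in> index_lists i"
  then have "v ^ wt xs = v ^ minwt i * v ^ (wt xs - minwt i)" using minwt_le by (simp flip: power_add)
  then show "v ^ minwt i * (v ^ (wt xs - minwt i) * (pair_prod (U h v) \<phi>s xs * gram_det (Y h v) xs \<psi>s)) =
    v ^ wt xs * (pair_prod (U h v) \<phi>s xs * gram_det (Y h v) xs \<psi>s)" by (simp add: mult.assoc)
qed

text \<open>On the locus where \<open>v\<close> is not a zero divisor this says that the family consists of the exterior powers of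
its first member.\<close>

lemma family_form_ext_pow:
  assumes "length \<phi>s = i" "length \<psi>s = i"
  shows "v ^ minwt i * family_form h v i \<phi>s \<psi>s =
    v ^ (i * minwt 1) * ext_pow i (\<lambda>\<phi> \<psi>. family_form h v 1 [\<phi>] [\<psi>]) \<phi>s \<psi>s"
proof -
  have min1: "minwt 1 \<le> w a" if "a < d" for a
    using minwt_le[of "[a]" 1] that by (auto simp: index_lists_def wt_def)
  have "v ^ (i * minwt 1) * ext_pow i (\<lambda>\<phi> \<psi>. family_form h v 1 [\<phi>] [\<psi>]) \<phi>s \<psi>s =
    gram_det (\<lambda>\<phi> \<psi>. v ^ minwt 1 * family_form h v 1 [\<phi>] [\<psi>]) \<phi>s \<psi>s"
    using assms by (simp add: ext_pow_gram_det gram_det_scale power_mult[symmetric] mult.commute)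
  also have "\<dots> = gram_det (\<lambda>\<phi> \<psi>. \<Sum>a<d. v ^ w a * (U h v \<phi> a * Y h v a \<psi>)) \<phi>s \<psi>s"
  proof (rule gram_det_cong)
    fix \<phi> \<psi>
    show "v ^ minwt 1 * family_form h v 1 [\<phi>] [\<psi>] = (\<Sum>a<d. v ^ w a * (U h v \<phi> a * Y h v a \<psi>))"
      unfolding family_form_1 sum_distrib_left
    proof (rule sum.cong[OF refl])
      fix a assume "a \<in> {..<d}"
      then have "v ^ w a = v ^ minwt 1 * v ^ (w a - minwt 1)" using min1 by (simp flip: power_add)
      then show "v ^ minwt 1 * (v ^ (w a - minwt 1) * (U h v \<phi> a * Y h v a \<psi>)) = v ^ w a * (U h v \<phi> a * Y h v a \<psi>)"
        by (simp add: mult.assoc)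
    qed
  qed (use assms in simp)
  also have "\<dots> = v ^ minwt i * family_form h v i \<phi>s \<psi>s"
    using gram_det_weighted[OF assms] by (simp add: family_form_minwt)
  finally show ?thesis ..
qed

lemma family_form_eq_ext_pow_block_form:
  assumes "length \<phi>s = i" "length \<psi>s = i"
  shows "family_form h 1 i \<phi>s \<psi>s = ext_pow i (block_form h 1 {..<d}) \<phi>s \<psi>s"
proof -
  have "block_form h 1 {..<d} = (\<lambda>\<phi> \<psi>. \<Sum>a<d. U h 1 \<phi> a * Y h 1 a \<psi>)" by (simp add: block_form_def fun_eq_iff)
  then show ?thesis
    using gram_det_weighted[OF assms, of 1 h 1] assms by (simp add: family_form_def ext_pow_gram_det)
qed

text \<open>The form is not visibly symmetric, as \<open>U\<close> and \<open>Y\<close> enter differently, and \<open>v\<close> cannot be cancelled when it is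
a zero divisor. With a polynomial variable in the place of \<open>v\<close> the exterior power is a determinant of
a symmetric form; its coefficients, one for each total weight, are symmetric, and \<open>family_form\<close> is a
combination of them.\<close>

lemma family_form_sym:
  fixes h :: "'k \<Rightarrow> 'r::comm_ring_1"
  assumes "length \<phi>s = i" "length \<psi>s = i"
  shows "family_form h v i \<phi>s \<psi>s = family_form h v i \<psi>s \<phi>s"
proof -
  let ?T = "\<lambda>\<phi>s xs \<psi>s. pair_prod (U h v) \<phi>s xs * gram_det (Y h v) xs \<psi>s"
  let ?D = "\<lambda>\<phi>s \<psi>s. gram_det (\<lambda>\<phi> \<psi>. \<Sum>a<d. Polynomial.monom (U h v \<phi> a) (w a) * [:Y h v a \<psi>:]) \<phi>s \<psi>s"
  have cph: "comm_ring_hom (\<lambda>c :: 'r. [:c:])" by (unfold_locales) (auto simp: one_pCons)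
  have mon: "Polynomial.monom c m = [:c:] * Polynomial.monom 1 m" for c :: 'r and m by (simp add: smult_monom)
  have pm: "pair_prod (\<lambda>\<phi> a. Polynomial.monom (U h v \<phi> a) (w a)) \<phi>s xs = Polynomial.monom (pair_prod (U h v) \<phi>s xs) (wt xs)"
    if "length \<phi>s = length xs" for \<phi>s xs
    using that by (induction \<phi>s xs rule: list_induct2) (auto simp: wt_def mult_monom one_pCons monom_0)
  have D: "?D \<phi>s \<psi>s = (\<Sum>xs\<in>index_lists i. Polynomial.monom (?T \<phi>s xs \<psi>s) (wt xs))"
    if "length \<phi>s = i" "length \<psi>s = i" for \<phi>s \<psi>s
  proof -
    have "?D \<phi>s \<psi>s = (\<Sum>xs\<in>index_lists i. pair_prod (\<lambda>\<phi> a. Polynomial.monom (U h v \<phi> a) (w a)) \<phi>s xs * gram_det (\<lambda>a \<psi>. [:Y h v a \<psi>:]) xs \<psi>s)"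
      using that by (subst gram_det_expand) (auto simp: index_lists_def)
    also have "\<dots> = (\<Sum>xs\<in>index_lists i. Polynomial.monom (?T \<phi>s xs \<psi>s) (wt xs))"
      by (rule sum.cong) (use that in \<open>auto simp: index_lists_def pm gram_det_hom[OF cph, symmetric] smult_monom mult.commute\<close>)
    finally show ?thesis .
  qed
  have Dsym: "?D \<phi>s \<psi>s = ?D \<psi>s \<phi>s"
  proof -
    have e: "(\<Sum>a<d. Polynomial.monom (U h v \<phi> a) (w a) * [:Y h v a \<psi>:]) = (\<Sum>a<d. Polynomial.monom (U h v \<psi> a) (w a) * [:Y h v a \<phi>:])" for \<phi> \<psi>
    proof -
      have "(\<Sum>a<d. Polynomial.monom (U h v \<phi> a) (w a) * [:Y h v a \<psi>:]) =
        (\<Sum>a<d. Polynomial.monom (U h v \<phi> (\<sigma> a)) (w (\<sigma> a)) * [:Y h v (\<sigma> a) \<psi>:])"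
        by (rule sum.reindex_bij_betw[OF bij_\<sigma>, symmetric])
      also have "\<dots> = (\<Sum>a<d. Polynomial.monom (U h v \<psi> a) (w a) * [:Y h v a \<phi>:])"
        by (rule sum.cong) (use \<sigma> p w_\<sigma> in \<open>auto simp: U_def Y_def smult_monom mult_ac\<close>)
      finally show ?thesis .
    qed
    have "?D \<phi>s \<psi>s = gram_det (\<lambda>\<psi> \<phi>. \<Sum>a<d. Polynomial.monom (U h v \<phi> a) (w a) * [:Y h v a \<psi>:]) \<psi>s \<phi>s"
      by (rule gram_det_transpose) (use assms in simp)
    also have "\<dots> = ?D \<psi>s \<phi>s" by (rule gram_det_cong) (use assms e in auto)
    finally show ?thesis .
  qed
  let ?M = "wt ` index_lists i"
  have F: "family_form h v i \<phi>s \<psi>s = (\<Sum>m\<in>?M. v ^ (m - minwt i) * Polynomial.coeff (?D \<phi>s \<psi>s) m)"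
    if "length \<phi>s = i" "length \<psi>s = i" for \<phi>s \<psi>s
  proof -
    have "family_form h v i \<phi>s \<psi>s = (\<Sum>m\<in>?M. \<Sum>xs | xs \<in> index_lists i \<and> wt xs = m. v ^ (wt xs - minwt i) * ?T \<phi>s xs \<psi>s)"
      unfolding family_form_def by (rule sum.image_gen[OF finite_index_lists])
    also have "\<dots> = (\<Sum>m\<in>?M. v ^ (m - minwt i) * Polynomial.coeff (?D \<phi>s \<psi>s) m)"
    proof (rule sum.cong[OF refl])
      fix m
      have "Polynomial.coeff (?D \<phi>s \<psi>s) m = (\<Sum>xs\<in>index_lists i. if wt xs = m then ?T \<phi>s xs \<psi>s else 0)"
        unfolding D[OF that] by (simp add: coeff_sum)
      also have "\<dots> = (\<Sum>xs | xs \<in> index_lists i \<and> wt xs = m. ?T \<phi>s xs \<psi>s)"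
        using finite_index_lists by (simp add: sum.inter_filter)
      finally show "(\<Sum>xs | xs \<in> index_lists i \<and> wt xs = m. v ^ (wt xs - minwt i) * ?T \<phi>s xs \<psi>s) =
        v ^ (m - minwt i) * Polynomial.coeff (?D \<phi>s \<psi>s) m"
        by (simp add: sum_distrib_left)
    qed
    finally show ?thesis .
  qed
  show ?thesis using F[OF assms] F[OF assms(2,1)] Dsym by simp
qed

lemma sym_form_family_form: "sym_form J i (family_form h v i)"
  unfolding sym_form_def
proof (intro ballI conjI allI impI)
  fix \<phi>s \<psi>s assume "\<phi>s \<in> tuples i (dual_space J)" "\<psi>s \<in> tuples i (dual_space J)"
  then have l: "length \<phi>s = i" "length \<psi>s = i" by (auto simp: tuples_def)
  show "family_form h v i \<phi>s \<psi>s = family_form h v i \<psi>s \<phi>s" using family_form_sym l by blast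
  {
    fix k \<phi> \<phi>' c assume "k < i"
    then have "pair_prod (U h v) (\<phi>s[k := \<lambda>f. \<phi> f + c * \<phi>' f]) xs =
      pair_prod (U h v) (\<phi>s[k := \<phi>]) xs + c * pair_prod (U h v) (\<phi>s[k := \<phi>']) xs" if "xs \<in> index_lists i" for xs
      using that l by (intro pair_prod_update_linear) (auto simp: index_lists_def U_def algebra_simps)
    then show "family_form h v i (\<phi>s[k := \<lambda>f. \<phi> f + c * \<phi>' f]) \<psi>s = family_form h v i (\<phi>s[k := \<phi>]) \<psi>s + c * family_form h v i (\<phi>s[k := \<phi>']) \<psi>s"
      unfolding family_form_def sum_distrib_left sum.distrib[symmetric]
      by (intro sum.cong) (auto simp: algebra_simps)
  next
    fix a b assume ab: "a < i" "b < i" "a \<noteq> b \<and> \<phi>s ! a = \<phi>s ! b"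
    have "gram_det (Y h v) xs \<phi>s = 0" if "xs \<in> index_lists i" for xs
      by (rule gram_det_repeated_col[of _ _ a b]) (use ab l that in \<open>auto simp: index_lists_def\<close>)
    then have "family_form h v i \<psi>s \<phi>s = 0" by (simp add: family_form_def)
    then show "family_form h v i \<phi>s \<psi>s = 0" using family_form_sym l by metis
  }
qed

lemma family_form_base_change:
  assumes h: "comm_ring_hom h" and g: "comm_ring_hom g" and "length \<phi>s = i" "length \<psi>s = i"
    and lin: "\<And>\<phi>. \<phi> \<in> set \<phi>s \<union> set \<psi>s \<Longrightarrow> linear_form \<phi>"
  shows "family_form (\<lambda>c. g (h c)) (g v) i (map (extend_functional g) \<phi>s) (map (extend_functional g) \<psi>s) = g (family_form h v i \<phi>s \<psi>s)"
proof -
  have e: "extend_functional g \<phi> (basis_elt (\<lambda>c. g (h c)) (g v) a) = g (\<phi> (basis_elt h v a))" if \<phi>: "\<phi> \<in> set \<phi>s \<union> set \<psi>s" for \<phi> a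
  proof -
    have "extend_functional g \<phi> (Poly_Mapping.map g f) = g (\<phi> f)" for f
    proof (induction f rule: poly_induct)
      case zero then show ?case
        by (simp add: map_hom_simps[OF g] extend_functional_eq linear_form_simps[OF linear_form_lin_ext]
          linear_form_simps[OF lin[OF \<phi>]] comm_ring_hom_simps[OF g])
    next
      case (add f c \<alpha>)
      then show ?case
        by (simp add: map_hom_simps[OF g] extend_functional_eq linear_form_simps[OF linear_form_lin_ext]
          linear_form_simps[OF lin[OF \<phi>]] comm_ring_hom_simps[OF g])
    qed
    then show ?thesis using basis_elt_base_change[OF g, of h v a] by metis
  qed
  show ?thesis
    unfolding family_form_def comm_ring_hom_simps(8)[OF g]
  proof (rule sum.cong[OF refl])
    fix xs assume xs: "xs \<in> index_lists i"
    have 1: "pair_prod (U (\<lambda>c. g (h c)) (g v)) (map (extend_functional g) \<phi>s) xs = g (pair_prod (U h v) \<phi>s xs)"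
      unfolding pair_prod_map
      by (subst pair_prod_hom[OF g]) (use xs assms e in \<open>auto simp: index_lists_def U_def comm_ring_hom_simps[OF g] intro!: pair_prod_cong\<close>)
    have "gram_det (Y (\<lambda>c. g (h c)) (g v)) (map id xs) (map (extend_functional g) \<psi>s) = g (gram_det (Y h v) xs \<psi>s)"
      unfolding gram_det_hom[OF g]
      by (subst gram_det_map) (use xs assms e in \<open>auto simp: index_lists_def Y_def intro!: gram_det_cong\<close>)
    then show "g v ^ (wt xs - minwt i) * (pair_prod (U (\<lambda>c. g (h c)) (g v)) (map (extend_functional g) \<phi>s) xs *
        gram_det (Y (\<lambda>c. g (h c)) (g v)) xs (map (extend_functional g) \<psi>s)) =
      g (v ^ (wt xs - minwt i) * (pair_prod (U h v) \<phi>s xs * gram_det (Y h v) xs \<psi>s))"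
      using 1 by (simp add: comm_ring_hom_simps[OF g])
  qed
qed

text \<open>Under the change of variables \<open>basis_elt h 1 a\<close> becomes \<open>v\<close> to the power \<open>n a\<close> times \<open>basis_elt h v a\<close>. So
\<open>U\<close> and \<open>Y\<close> together contribute \<open>v\<close> to the power \<open>w a\<close> for each index.\<close>

lemma family_form_translate:
  assumes h: "comm_ring_hom h" and l: "length \<phi>s = i" "length \<psi>s = i"
    and lin: "\<And>\<phi>. \<phi> \<in> set \<phi>s \<union> set \<psi>s \<Longrightarrow> linear_form \<phi>"
  shows "family_form h 1 i (map (\<lambda>\<phi>. \<phi> \<circ> scale_vars v) \<phi>s) (map (\<lambda>\<psi>. \<psi> \<circ> scale_vars v) \<psi>s) = v ^ minwt i * family_form h v i \<phi>s \<psi>s"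
proof -
  have e: "\<phi> (scale_vars v (basis_elt h 1 a)) = v ^ n a * \<phi> (basis_elt h v a)" if "\<phi> \<in> set \<phi>s \<union> set \<psi>s" "a < d" for \<phi> a
    unfolding scale_vars_basis_elt[OF that(2)] linear_form_simps(2)[OF lin[OF that(1)]] by (rule refl)
  show ?thesis
    unfolding family_form_minwt unfolding family_form_def
  proof (rule sum.cong[OF refl])
    fix xs assume xs: "xs \<in> index_lists i"
    have sub: "a < d" if "a \<in> set xs" for a using xs that by (auto simp: index_lists_def)
    have lx: "length xs = i" using xs by (simp add: index_lists_def)
    have 1: "pair_prod (U h 1) (map (\<lambda>\<phi>. \<phi> \<circ> scale_vars v) \<phi>s) xs = pair_prod (\<lambda>\<phi> a. U h v \<phi> a * v ^ n a) \<phi>s xs"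
      unfolding pair_prod_map
    proof (rule pair_prod_cong)
      fix \<phi> a assume "\<phi> \<in> set \<phi>s" "a \<in> set xs"
      then show "U h 1 (\<phi> \<circ> scale_vars v) a = U h v \<phi> a * v ^ n a"
        using e[of \<phi> a] sub[of a] by (simp add: U_def mult_ac)
    qed
    have "gram_det (Y h 1) (map id xs) (map (\<lambda>\<psi>. \<psi> \<circ> scale_vars v) \<psi>s) = gram_det (\<lambda>a \<psi>. v ^ n (\<sigma> a) * Y h v a \<psi>) xs \<psi>s"
    proof (subst gram_det_map)
      show "gram_det (\<lambda>x y. Y h 1 (id x) (y \<circ> scale_vars v)) xs \<psi>s = gram_det (\<lambda>a \<psi>. v ^ n (\<sigma> a) * Y h v a \<psi>) xs \<psi>s"
      proof (rule gram_det_cong)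
        fix a \<psi> assume "a \<in> set xs" "\<psi> \<in> set \<psi>s"
        then show "Y h 1 (id a) (\<psi> \<circ> scale_vars v) = v ^ n (\<sigma> a) * Y h v a \<psi>"
          using e[of \<psi> "\<sigma> a"] sub[of a] \<sigma>(1)[of a] by (simp add: Y_def)
      qed (use lx l in simp)
    qed (use lx l in simp)
    then have 2: "gram_det (Y h 1) xs (map (\<lambda>\<psi>. \<psi> \<circ> scale_vars v) \<psi>s) = v ^ sum_list (map (\<lambda>a. n (\<sigma> a)) xs) * gram_det (Y h v) xs \<psi>s"
      using lx l by (simp add: gram_det_row_scale prod_list_power)
    have 3: "wt xs = sum_list (map n xs) + sum_list (map (\<lambda>a. n (\<sigma> a)) xs)"
    proof -
      have "map w xs = map (\<lambda>a. n a + n (\<sigma> a)) xs" by (simp add: w_def)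
      then show ?thesis by (simp only: wt_def sum_list_addf)
    qed
    show "1 ^ (wt xs - minwt i) * (pair_prod (U h 1) (map (\<lambda>\<phi>. \<phi> \<circ> scale_vars v) \<phi>s) xs *
        gram_det (Y h 1) xs (map (\<lambda>\<psi>. \<psi> \<circ> scale_vars v) \<psi>s)) =
      v ^ wt xs * (pair_prod (U h v) \<phi>s xs * gram_det (Y h v) xs \<psi>s)"
    proof -
      have 4: "pair_prod (\<lambda>\<phi> a. U h v \<phi> a * v ^ n a) \<phi>s xs = pair_prod (U h v) \<phi>s xs * v ^ sum_list (map n xs)"
        using lx l by (simp add: pair_prod_mult prod_list_power)
      show ?thesis unfolding 1 2 3 4 by (simp add: power_add mult_ac)
    qed
  qed
qed

text \<open>At \<open>v = 0\<close> a term survives exactly if its exponent \<open>wt xs - minwt i\<close> is \<open>0\<close>, that is, if \<open>xs\<close> is greedy.\<close>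

lemma broken_wedge_family_form:
  assumes "1 \<le> i" "i \<le> d" "length \<phi>s = i" "length \<psi>s = i"
  shows "broken_wedge (map (\<lambda>C. (card C, block_form h 0 C)) Cs) i \<phi>s \<psi>s = family_form h 0 i \<phi>s \<psi>s"
proof -
  have "broken_wedge (map (\<lambda>C. (card C, block_form h 0 C)) Cs) i \<phi>s \<psi>s =
    broken_wedge (map (\<lambda>C. (card C, \<lambda>\<phi> \<psi>. \<Sum>a\<in>C. U h 0 \<phi> a * Y h 0 a \<psi>)) Cs) i \<phi>s \<psi>s"
    unfolding block_form_def ..
  also have "\<dots> = (\<Sum>xs | length xs = i \<and> greedy Cs xs. pair_prod (U h 0) \<phi>s xs * gram_det (Y h 0) xs \<psi>s)"
    by (rule broken_wedge_expand) (use assms finite_C Cs_disj Cs_distinct sum_card_Cs in auto)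
  also have "\<dots> = (\<Sum>xs\<in>index_lists i. if wt xs = minwt i then pair_prod (U h 0) \<phi>s xs * gram_det (Y h 0) xs \<psi>s else 0)"
    unfolding greedy_index_lists using finite_index_lists by (simp add: sum.inter_filter)
  also have "\<dots> = family_form h 0 i \<phi>s \<psi>s"
    unfolding family_form_def
  proof (rule sum.cong[OF refl])
    fix xs assume "xs \<in> index_lists i"
    from minwt_le[OF this] show "(if wt xs = minwt i then pair_prod (U h 0) \<phi>s xs * gram_det (Y h 0) xs \<psi>s else 0) =
      0 ^ (wt xs - minwt i) * (pair_prod (U h 0) \<phi>s xs * gram_det (Y h 0) xs \<psi>s)"
      by (simp add: power_0_left)
  qed
  finally show ?thesis .
qed

text \<open>The symmetry of the structure constants gives the equality up to powers of \<open>v\<close>. The exponents agree because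
the structure constants respect orders: the two sides carry \<open>w a + (n b - n a - mdeg \<alpha>)\<close> and
\<open>w b + (n (\<sigma> a) - n (\<sigma> b) - mdeg \<alpha>)\<close>, and both equal \<open>n b + n (\<sigma> a) - mdeg \<alpha>\<close>, up to the common term \<open>minwt 1\<close>.\<close>

lemma family_form_1_compatible:
  assumes h: "comm_ring_hom h" and \<phi>: "\<phi> \<in> dual_space (degeneration h v)" and \<psi>: "\<psi> \<in> dual_space (degeneration h v)"
  shows "family_form h v 1 [\<lambda>g. \<phi> (f * g)] [\<psi>] = family_form h v 1 [\<phi>] [\<lambda>g. \<psi> (f * g)]"
proof -
  have l: "linear_form \<phi>" "linear_form \<psi>" using \<phi> \<psi> by (auto simp: dual_space_iff)
  have min1: "minwt 1 \<le> w a" if "a < d" for a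
    using minwt_le[of "[a]" 1] that by (auto simp: index_lists_def wt_def)
  have mono: "family_form h v 1 [\<lambda>g. \<phi> (mon \<alpha> * g)] [\<psi>] = family_form h v 1 [\<phi>] [\<lambda>g. \<psi> (mon \<alpha> * g)]" for \<alpha>
  proof -
    let ?L = "\<lambda>a b. v ^ (w a - minwt 1) * h (1 / p a) * (v ^ (n b - n a - mdeg \<alpha>) * h (\<kappa> b (mon \<alpha> * E a)))"
    let ?R = "\<lambda>b c. v ^ (w b - minwt 1) * h (1 / p b) * (v ^ (n c - n (\<sigma> b) - mdeg \<alpha>) * h (\<kappa> c (mon \<alpha> * E (\<sigma> b))))"
    have LR: "?L a b = ?R b (\<sigma> a)" if a: "a < d" and b: "b < d" for a b
    proof -
      have c: "h (1 / p a) * h (\<kappa> b (mon \<alpha> * E a)) = h (1 / p b) * h (\<kappa> (\<sigma> a) (mon \<alpha> * E (\<sigma> b)))"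
        using structure_constant_sym[OF a b, of \<alpha>] by (simp flip: comm_ring_hom_simps(4)[OF h])
      show ?thesis
      proof (cases "\<kappa> b (mon \<alpha> * E a) = 0")
        case True
        then have "\<kappa> (\<sigma> a) (mon \<alpha> * E (\<sigma> b)) = 0" using structure_constant_sym[OF a b, of \<alpha>] p[OF b] by simp
        then show ?thesis using True by (simp add: comm_ring_hom_simps[OF h])
      next
        case False
        then have "\<kappa> (\<sigma> a) (mon \<alpha> * E (\<sigma> b)) \<noteq> 0" using structure_constant_sym[OF a b, of \<alpha>] p[OF a] by auto
        then have "n (\<sigma> b) + mdeg \<alpha> \<le> n (\<sigma> a)" "n a + mdeg \<alpha> \<le> n b"
          using structure_constant_degree[OF \<sigma>(1)[OF b] \<sigma>(1)[OF a]] structure_constant_degree[OF a b False] by auto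
        then have ex: "w a - minwt 1 + (n b - n a - mdeg \<alpha>) = w b - minwt 1 + (n (\<sigma> a) - n (\<sigma> b) - mdeg \<alpha>)"
          using min1[OF a] min1[OF b] by (simp add: w_def)
        have "?L a b = v ^ (w a - minwt 1 + (n b - n a - mdeg \<alpha>)) * (h (1 / p a) * h (\<kappa> b (mon \<alpha> * E a)))"
          by (simp add: power_add mult_ac)
        also have "\<dots> = ?R b (\<sigma> a)" unfolding ex c by (simp add: power_add mult_ac)
        finally show ?thesis .
      qed
    qed
    have e\<phi>: "\<phi> (mon \<alpha> * basis_elt h v a) = (\<Sum>b<d. coordinate h v b (mon \<alpha> * basis_elt h v a) * \<phi> (basis_elt h v b))" for a
      by (rule dual_expand[OF h \<phi>])
    have e\<psi>: "\<psi> (mon \<alpha> * basis_elt h v a) = (\<Sum>b<d. coordinate h v b (mon \<alpha> * basis_elt h v a) * \<psi> (basis_elt h v b))" for a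
      by (rule dual_expand[OF h \<psi>])
    have "family_form h v 1 [\<lambda>g. \<phi> (mon \<alpha> * g)] [\<psi>] =
      (\<Sum>a<d. v ^ (w a - minwt 1) * (h (1 / p a) * (\<Sum>b<d. coordinate h v b (mon \<alpha> * basis_elt h v a) * \<phi> (basis_elt h v b)) * \<psi> (basis_elt h v (\<sigma> a))))"
      unfolding family_form_1 U_def Y_def by (simp only: e\<phi> mult.assoc)
    also have "\<dots> = (\<Sum>a<d. \<Sum>b<d. ?L a b * \<phi> (basis_elt h v b) * \<psi> (basis_elt h v (\<sigma> a)))"
      unfolding sum_distrib_left sum_distrib_right
      by (intro sum.cong refl) (simp add: coordinate_mon_mult_basis_elt[OF h] mult_ac)
    also have "\<dots> = (\<Sum>b<d. \<Sum>a<d. ?R b (\<sigma> a) * \<phi> (basis_elt h v b) * \<psi> (basis_elt h v (\<sigma> a)))"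
      by (subst sum.swap) (intro sum.cong refl, simp only: LR lessThan_iff)
    also have "\<dots> = (\<Sum>b<d. \<Sum>c<d. ?R b c * \<phi> (basis_elt h v b) * \<psi> (basis_elt h v c))"
      by (intro sum.cong refl sum.reindex_bij_betw[OF bij_\<sigma>])
    also have "\<dots> = (\<Sum>b<d. v ^ (w b - minwt 1) * (h (1 / p b) * \<phi> (basis_elt h v b) * (\<Sum>c<d. coordinate h v c (mon \<alpha> * basis_elt h v (\<sigma> b)) * \<psi> (basis_elt h v c))))"
      unfolding sum_distrib_left
      by (intro sum.cong refl) (simp add: coordinate_mon_mult_basis_elt[OF h \<sigma>(1)] mult_ac)
    also have "\<dots> = family_form h v 1 [\<phi>] [\<lambda>g. \<psi> (mon \<alpha> * g)]"
      unfolding family_form_1 U_def Y_def by (simp only: e\<psi> mult.assoc)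
    finally show ?thesis .
  qed
  show ?thesis
  proof (induction f rule: poly_induct)
    case zero
    then show ?case unfolding family_form_1 U_def Y_def by (simp add: linear_form_simps[OF l(1)] linear_form_simps[OF l(2)])
  next
    case (add f c \<alpha>)
    have m: "c * family_form h v 1 [\<lambda>g. \<phi> (mon \<alpha> * g)] [\<psi>] = c * family_form h v 1 [\<phi>] [\<lambda>g. \<psi> (mon \<alpha> * g)]"
      using mono by simp
    have "family_form h v 1 [\<lambda>g. \<phi> ((f + cst c * mon \<alpha>) * g)] [\<psi>] =
        family_form h v 1 [\<lambda>g. \<phi> (f * g)] [\<psi>] + c * family_form h v 1 [\<lambda>g. \<phi> (mon \<alpha> * g)] [\<psi>]"
      unfolding family_form_1 U_def Y_def sum_distrib_left sum.distrib[symmetric]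
      by (intro sum.cong refl) (simp add: distrib_right mult.assoc linear_form_simps[OF l(1)], simp add: algebra_simps)
    moreover have "family_form h v 1 [\<phi>] [\<lambda>g. \<psi> ((f + cst c * mon \<alpha>) * g)] =
        family_form h v 1 [\<phi>] [\<lambda>g. \<psi> (f * g)] + c * family_form h v 1 [\<phi>] [\<lambda>g. \<psi> (mon \<alpha> * g)]"
      unfolding family_form_1 U_def Y_def sum_distrib_left sum.distrib[symmetric]
      by (intro sum.cong refl) (simp add: distrib_right mult.assoc linear_form_simps[OF l(2)], simp add: algebra_simps)
    ultimately show ?case using add m by simp
  qed
qed

text \<open>Evaluation on the dual basis vectors of a list of minimal weight isolates the term of that list.\<close>

lemma family_form_unit_value:
  fixes h :: "'k \<Rightarrow> 'r::comm_ring_1"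
  assumes h: "comm_ring_hom h" and "i \<le> d"
  obtains \<phi>s \<psi>s where "\<phi>s \<in> tuples i (dual_space (degeneration h v))" "\<psi>s \<in> tuples i (dual_space (degeneration h v))"
    "family_form h v i \<phi>s \<psi>s dvd 1"
proof -
  obtain zs where zs: "zs \<in> index_lists i" "wt zs = minwt i" using greedy_list_exists[OF assms(2)] by blast
  have lz: "length zs = i" "distinct zs" "\<And>k. k < i \<Longrightarrow> zs ! k < d" using zs nth_mem by (auto simp: index_lists_def)
  let ?\<phi>s = "map (coordinate h v) zs" and ?\<psi>s = "map (\<lambda>a. coordinate h v (\<sigma> a)) zs"
  have "pair_prod (U h v) ?\<phi>s xs = (if xs = zs then prod_list (map (\<lambda>a. h (1 / p a)) zs) else 0)" if "xs \<in> index_lists i" for xs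
  proof -
    have lx: "length zs = length xs" "set xs \<subseteq> {..<d}" "set zs \<subseteq> {..<d}" using that lz zs by (auto simp: index_lists_def)
    then show ?thesis unfolding pair_prod_map
      by (induction zs xs rule: list_induct2) (auto simp: U_def coordinate_basis_elt[OF h])
  qed
  then have "family_form h v i ?\<phi>s ?\<psi>s = (\<Sum>xs\<in>index_lists i. if xs = zs then v ^ (wt zs - minwt i) *
      (prod_list (map (\<lambda>a. h (1 / p a)) zs) * gram_det (Y h v) zs ?\<psi>s) else 0)"
    unfolding family_form_def by (intro sum.cong) auto
  also have "\<dots> = prod_list (map (\<lambda>a. h (1 / p a)) zs) * gram_det (Y h v) zs ?\<psi>s"
    using finite_index_lists zs by simp
  also have "gram_det (Y h v) zs ?\<psi>s = 1"
  proof -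
    have "mat (length zs) (length zs) (\<lambda>(k, l). Y h v (zs ! k) (?\<psi>s ! l)) = 1\<^sub>m i"
    proof (rule eq_matI)
      fix k l assume "k < dim_row (1\<^sub>m i :: 'r mat)" "l < dim_col (1\<^sub>m i :: 'r mat)"
      then have kl: "k < i" "l < i" by auto
      have inj: "\<sigma> (zs ! l) = \<sigma> (zs ! k) \<longleftrightarrow> k = l"
        using \<sigma>(2)[OF lz(3)[OF kl(1)]] \<sigma>(2)[OF lz(3)[OF kl(2)]] kl lz nth_eq_iff_index_eq by metis
      show "mat (length zs) (length zs) (\<lambda>(k, l). Y h v (zs ! k) (?\<psi>s ! l)) $$ (k, l) = 1\<^sub>m i $$ (k, l)"
        using kl lz inj coordinate_basis_elt[OF h \<sigma>(1)[OF lz(3)[OF kl(2)]] \<sigma>(1)[OF lz(3)[OF kl(1)]]]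
        by (simp add: Y_def)
    qed (use lz in auto)
    then show ?thesis by (simp add: gram_det_def)
  qed
  finally have F: "family_form h v i ?\<phi>s ?\<psi>s = prod_list (map (\<lambda>a. h (1 / p a)) zs)" by simp
  have "prod_list (map (\<lambda>a. h (1 / p a)) zs) dvd 1"
  proof -
    have "set zs \<subseteq> {..<d}" using zs by (auto simp: index_lists_def)
    then show ?thesis
    proof (induction zs)
      case (Cons a zs)
      have "h (1 / p a) * h (p a) = 1" using p Cons.prems by (simp flip: comm_ring_hom_simps(4)[OF h] add: comm_ring_hom_simps[OF h])
      then have "h (1 / p a) dvd 1" by (metis dvd_triv_left)
      then show ?case using Cons by (simp add: is_unit_mult_iff)
    qed simp
  qed
  moreover have "a < d" if "a \<in> set zs" for a using zs that by (auto simp: index_lists_def)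
  then have "?\<phi>s \<in> tuples i (dual_space (degeneration h v))" "?\<psi>s \<in> tuples i (dual_space (degeneration h v))"
    using lz(1) by (auto simp: tuples_def intro!: coordinate_dual \<sigma>(1))
  ultimately show thesis using that[of ?\<phi>s ?\<psi>s] F by simp
qed

lemma iar_family_degeneration:
  fixes h :: "'k \<Rightarrow> 'r::idom"
  assumes h: "comm_ring_hom h" and v: "v \<noteq> 0"
  shows "iar_family d (degeneration h v) (family_form h v)"
  unfolding iar_family_def
proof (intro conjI ballI allI)
  fix i assume i: "i \<in> {1..d}"
  show "proj_point (degeneration h v) i (family_form h v i)"
    unfolding proj_point_def
  proof
    let ?V = "{family_form h v i \<phi>s \<psi>s | \<phi>s \<psi>s. \<phi>s \<in> tuples i (dual_space (degeneration h v)) \<and> \<psi>s \<in> tuples i (dual_space (degeneration h v))}"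
    interpret R: cring "ring_of_type_algebra :: 'r ring" by (rule cring_from_type_algebra)
    obtain \<phi>s \<psi>s where "\<phi>s \<in> tuples i (dual_space (degeneration h v))" "\<psi>s \<in> tuples i (dual_space (degeneration h v))"
      "family_form h v i \<phi>s \<psi>s dvd 1" by (rule family_form_unit_value[OF h, of i v]) (use i in auto)
    then obtain x where x: "x \<in> ?V" "x dvd 1" by blast
    have id: "ideal (Idl\<^bsub>ring_of_type_algebra\<^esub> ?V) (ring_of_type_algebra :: 'r ring)"
      by (rule R.genideal_ideal) (simp add: ring_of_type_algebra_def)
    have "x \<in> Idl\<^bsub>ring_of_type_algebra\<^esub> ?V"
      using R.genideal_self[of ?V] x by (auto simp: ring_of_type_algebra_def)
    then have yx: "y * x \<in> Idl\<^bsub>ring_of_type_algebra\<^esub> ?V" for y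
      using ideal.I_l_closed[OF id, of x y] by (simp add: ring_of_type_algebra_def)
    obtain z where "1 = x * z" using x(2) by (rule dvdE)
    have yz: "y = (y * z) * x" for y
    proof -
      have "y = y * (x * z)" using \<open>1 = x * z\<close> by (metis mult_1_right)
      then show ?thesis by (simp only: mult.assoc mult.commute[of x z])
    qed
    have "y \<in> Idl\<^bsub>ring_of_type_algebra\<^esub> ?V" for y by (subst yz) (rule yx)
    then show "Idl\<^bsub>ring_of_type_algebra\<^esub> ?V = UNIV" by auto
  qed (rule sym_form_family_form)
  show "\<exists>a b. a \<noteq> 0 \<and> b \<noteq> 0 \<and> (\<forall>\<phi>s\<in>tuples i (dual_space (degeneration h v)). \<forall>\<psi>s\<in>tuples i (dual_space (degeneration h v)).
      a * family_form h v i \<phi>s \<psi>s = b * ext_pow i (\<lambda>\<phi> \<psi>. family_form h v 1 [\<phi>] [\<psi>]) \<phi>s \<psi>s)"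
  proof (rule exI[of _ "v ^ minwt i"], rule exI[of _ "v ^ (i * minwt 1)"], intro conjI ballI)
    fix \<phi>s \<psi>s assume "\<phi>s \<in> tuples i (dual_space (degeneration h v))" "\<psi>s \<in> tuples i (dual_space (degeneration h v))"
    then show "v ^ minwt i * family_form h v i \<phi>s \<psi>s =
        v ^ (i * minwt 1) * ext_pow i (\<lambda>\<phi> \<psi>. family_form h v 1 [\<phi>] [\<psi>]) \<phi>s \<psi>s"
      by (intro family_form_ext_pow) (auto simp: tuples_def)
  qed (use v in auto)
qed (use degeneration_ideal[OF h] degeneration_free[OF h] family_form_1_compatible[OF h] in auto)

end

section \<open>The coordinate ring and its graded modules\<close>

lemma additive_class_simps:
  fixes D :: "('n::finite, 'r::comm_ring_1) mpoly set"
  assumes "0 \<in> D" "\<And>f g. f \<in> D \<Longrightarrow> g \<in> D \<Longrightarrow> f - g \<in> D"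
  shows "f \<in> D \<Longrightarrow> - f \<in> D" "f \<in> D \<Longrightarrow> g \<in> D \<Longrightarrow> f + g \<in> D"
proof -
  show neg: "f \<in> D \<Longrightarrow> - f \<in> D" for f using assms(2)[OF assms(1), of f] by simp
  show "f \<in> D \<Longrightarrow> g \<in> D \<Longrightarrow> f + g \<in> D" using assms(2)[of f "- g"] neg[of g] by simp
qed

locale coordinate_quotient =
  fixes I :: "('n::finite, 'k::field) mpoly set"
  assumes ideal_I: "ideal I \<S>"
begin

abbreviation A where "A \<equiv> coord_ring I"

definition proj ("\<pi>") where "\<pi> f = I +>\<^bsub>\<S>\<^esub> f"

sublocale I: ideal I \<S> by (rule ideal_I)
sublocale A: cring A
  unfolding coord_ring_def by (rule I.quotient_is_cring) (rule S.is_cring)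

lemma I_simps: "0 \<in> I" "f \<in> I \<Longrightarrow> g \<in> I \<Longrightarrow> f + g \<in> I" "f \<in> I \<Longrightarrow> g * f \<in> I" "f \<in> I \<Longrightarrow> f * g \<in> I"
  "f \<in> I \<Longrightarrow> - f \<in> I" "f \<in> I \<Longrightarrow> g \<in> I \<Longrightarrow> f - g \<in> I"
proof -
  note * = ideal_I[unfolded ideal_S_iff]
  show "0 \<in> I" and m: "f \<in> I \<Longrightarrow> g * f \<in> I" and a: "f \<in> I \<Longrightarrow> g \<in> I \<Longrightarrow> f + g \<in> I" for f g using * by auto
  show "f \<in> I \<Longrightarrow> f * g \<in> I" for f g using m[of f g] by (simp add: mult.commute)
  show n: "f \<in> I \<Longrightarrow> - f \<in> I" for f using m[of f "- 1"] by simp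
  show "f \<in> I \<Longrightarrow> g \<in> I \<Longrightarrow> f - g \<in> I" using a[of f "- g"] n by simp
qed

lemma \<pi>_eq: "\<pi> f = \<pi> g \<longleftrightarrow> f - g \<in> I"
proof -
  have "\<pi> f = \<pi> g \<longleftrightarrow> f \<in> I +>\<^bsub>\<S>\<^esub> g"
    unfolding proj_def using I.a_repr_independence'[of f g] I.a_rcos_self[of f] by auto
  also have "\<dots> \<longleftrightarrow> f - g \<in> I" by (auto simp: a_r_coset_def' algebra_simps) (metis diff_add_cancel add.commute)
  finally show ?thesis .
qed

lemma carrier_A: "carrier A = range \<pi>"
  by (auto simp: coord_ring_def FactRing_def A_RCOSETS_def' proj_def)

lemma \<pi>_hom: "\<pi> f \<otimes>\<^bsub>A\<^esub> \<pi> g = \<pi> (f * g)" "\<pi> f \<oplus>\<^bsub>A\<^esub> \<pi> g = \<pi> (f + g)" "\<one>\<^bsub>A\<^esub> = \<pi> 1" "\<zero>\<^bsub>A\<^esub> = \<pi> 0"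
proof -
  have *: "((+>\<^bsub>\<S>\<^esub>) I) \<in> Ring.ring_hom \<S> A" unfolding coord_ring_def by (rule I.rcos_ring_hom)
  show "\<pi> f \<otimes>\<^bsub>A\<^esub> \<pi> g = \<pi> (f * g)" "\<pi> f \<oplus>\<^bsub>A\<^esub> \<pi> g = \<pi> (f + g)" "\<one>\<^bsub>A\<^esub> = \<pi> 1"
    using ring_hom_mult[OF *, of f g] ring_hom_add[OF *, of f g] ring_hom_one[OF *] by (simp_all add: proj_def)
  show "\<zero>\<^bsub>A\<^esub> = \<pi> 0"
    using I.a_rcos_const[of 0] I_simps(1) by (simp add: coord_ring_def FactRing_def proj_def)
qed

lemma \<pi>_carrier [simp]: "\<pi> f \<in> carrier A"
  by (simp add: carrier_A)

lemma \<pi>_zero_iff: "\<pi> f = \<zero>\<^bsub>A\<^esub> \<longleftrightarrow> f \<in> I"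
  by (simp add: \<pi>_hom \<pi>_eq)

lemma \<pi>_finsum: "finite B \<Longrightarrow> (\<Oplus>\<^bsub>A\<^esub>j\<in>B. \<pi> (F j)) = \<pi> (\<Sum>j\<in>B. F j)"
  by (induction B rule: finite_induct) (auto simp: \<pi>_hom)

text \<open>Preimages in \<open>S\<close> of additive subgroups of \<open>A\<close>. Elements of \<open>gr(A)\<close> and of its modules are families of cosets
in \<open>A\<close>, whose elements are again cosets; all computations below are done with representatives in \<open>S\<close> and
conditions of this kind.\<close>

definition is_sub where "is_sub D \<longleftrightarrow> I \<subseteq> D \<and> (\<forall>f\<in>D. \<forall>g\<in>D. f - g \<in> D)"

lemma is_sub_simps:
  assumes "is_sub D"
  shows "0 \<in> D" "f \<in> D \<Longrightarrow> g \<in> D \<Longrightarrow> f - g \<in> D" "f \<in> D \<Longrightarrow> - f \<in> D" "f \<in> D \<Longrightarrow> g \<in> D \<Longrightarrow> f + g \<in> D" "f \<in> I \<Longrightarrow> f \<in> D"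
proof -
  show 1: "0 \<in> D" "f \<in> I \<Longrightarrow> f \<in> D" using assms I_simps(1) by (auto simp: is_sub_def)
  show 2: "f \<in> D \<Longrightarrow> g \<in> D \<Longrightarrow> f - g \<in> D" for f g using assms by (auto simp: is_sub_def)
  show "f \<in> D \<Longrightarrow> - f \<in> D" "f \<in> D \<Longrightarrow> g \<in> D \<Longrightarrow> f + g \<in> D"
    using additive_class_simps[OF 1(1) 2] by auto
qed

lemma is_sub_sum: "is_sub D \<Longrightarrow> (\<And>x. x \<in> B \<Longrightarrow> F x \<in> D) \<Longrightarrow> (\<Sum>x\<in>B. F x) \<in> D"
  by (induction B rule: infinite_finite_induct) (auto simp: is_sub_simps)

text \<open>The coset of \<open>\<pi> ` D\<close> that contains \<open>\<pi> f\<close>.\<close>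

definition cls where "cls D f = {\<pi> g | g. g - f \<in> D}"

lemma \<pi>_mem_image: "is_sub D \<Longrightarrow> \<pi> f \<in> \<pi> ` D \<longleftrightarrow> f \<in> D"
proof
  assume D: "is_sub D" and "\<pi> f \<in> \<pi> ` D"
  then obtain g where g: "g \<in> D" "f - g \<in> I" by (auto simp: \<pi>_eq)
  have "(f - g) + g \<in> D" using is_sub_simps(4,5)[OF D] g by blast
  then show "f \<in> D" by simp
qed auto

lemma \<pi>_mem_cls: "is_sub D \<Longrightarrow> \<pi> g \<in> cls D f \<longleftrightarrow> g - f \<in> D"
proof
  assume D: "is_sub D" and "\<pi> g \<in> cls D f"
  then obtain g' where g: "g' - f \<in> D" "g - g' \<in> I" by (auto simp: cls_def \<pi>_eq)
  have "(g - g') + (g' - f) \<in> D" using is_sub_simps(4,5)[OF D] g by blast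
  then show "g - f \<in> D" by simp
qed (auto simp: cls_def)

lemma coset_image: "\<pi> ` D +>\<^bsub>A\<^esub> \<pi> f = cls D f"
proof -
  have "\<pi> ` D +>\<^bsub>A\<^esub> \<pi> f = {\<pi> (d + f) | d. d \<in> D}" by (auto simp: a_r_coset_def' \<pi>_hom)
  also have "\<dots> = cls D f"
  proof
    show "{\<pi> (d + f) | d. d \<in> D} \<subseteq> cls D f" unfolding cls_def by force
    show "cls D f \<subseteq> {\<pi> (d + f) | d. d \<in> D}"
    proof
      fix z assume "z \<in> cls D f"
      then obtain g where "z = \<pi> ((g - f) + f)" "g - f \<in> D" by (auto simp: cls_def)
      then show "z \<in> {\<pi> (d + f) | d. d \<in> D}" by blast
    qed
  qed
  finally show ?thesis .
qed

lemma cls_eq: "is_sub D \<Longrightarrow> cls D f = cls D g \<longleftrightarrow> f - g \<in> D"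
proof
  assume D: "is_sub D" and e: "cls D f = cls D g"
  have "\<pi> f \<in> cls D f" using \<pi>_mem_cls[OF D] is_sub_simps(1)[OF D] by simp
  then show "f - g \<in> D" using e \<pi>_mem_cls[OF D] by simp
next
  assume D: "is_sub D" and fg: "f - g \<in> D"
  have "h - f \<in> D \<longleftrightarrow> h - g \<in> D" for h
    using is_sub_simps(2)[OF D, of "h - g" "f - g"] is_sub_simps(4)[OF D, of "h - f" "f - g"] fg by auto
  then show "cls D f = cls D g" by (simp add: cls_def)
qed

lemma cls_0: "cls D 0 = \<pi> ` D"
  by (auto simp: cls_def)

lemma cls_add:
  assumes D: "is_sub D" shows "cls D f <+>\<^bsub>A\<^esub> cls D g = cls D (f + g)"
proof
  show "cls D f <+>\<^bsub>A\<^esub> cls D g \<subseteq> cls D (f + g)"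
  proof
    fix z assume "z \<in> cls D f <+>\<^bsub>A\<^esub> cls D g"
    then obtain a b where ab: "a - f \<in> D" "b - g \<in> D" "z = \<pi> (a + b)"
      by (auto simp: set_add_def' cls_def \<pi>_hom)
    have "(a - f) + (b - g) \<in> D" using is_sub_simps(4)[OF D] ab by blast
    then show "z \<in> cls D (f + g)" using ab by (auto simp: cls_def algebra_simps)
  qed
  show "cls D (f + g) \<subseteq> cls D f <+>\<^bsub>A\<^esub> cls D g"
  proof
    fix z assume "z \<in> cls D (f + g)"
    then obtain h where h: "z = \<pi> h" "h - (f + g) \<in> D" by (auto simp: cls_def)
    have "\<pi> (h - g) \<in> cls D f" "\<pi> g \<in> cls D g"
      using h \<pi>_mem_cls[OF D] is_sub_simps(1)[OF D] by (auto simp: algebra_simps)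
    moreover have "z = \<pi> (h - g) \<oplus>\<^bsub>A\<^esub> \<pi> g" using h by (simp add: \<pi>_hom)
    ultimately show "z \<in> cls D f <+>\<^bsub>A\<^esub> cls D g" unfolding set_add_def' by blast
  qed
qed

definition psum :: "('n, 'k) mpoly set \<Rightarrow> ('n, 'k) mpoly set \<Rightarrow> ('n, 'k) mpoly set" where "psum N M = {f + g | f g. f \<in> N \<and> g \<in> M}"

lemma psum_image: "\<pi> ` N <+>\<^bsub>A\<^esub> \<pi> ` M = \<pi> ` psum N M"
proof -
  have "\<pi> ` N <+>\<^bsub>A\<^esub> \<pi> ` M = {\<pi> (f + g) | f g. f \<in> N \<and> g \<in> M}"
    by (auto simp: set_add_def' \<pi>_hom)
  then show ?thesis by (auto simp: psum_def image_iff) 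
qed

lemma psum_sub: "is_sub N \<Longrightarrow> is_sub M \<Longrightarrow> is_sub (psum N M)"
proof -
  assume N: "is_sub N" and M: "is_sub M"
  have "f \<in> psum N M" if "f \<in> I" for f
    unfolding psum_def using is_sub_simps(1)[OF M] is_sub_simps(5)[OF N that] by force
  moreover have "f - g \<in> psum N M" if f: "f \<in> psum N M" and g: "g \<in> psum N M" for f g
  proof -
    obtain a b a' b' where *: "f = a + b" "a \<in> N" "b \<in> M" "g = a' + b'" "a' \<in> N" "b' \<in> M"
      using f g by (auto simp: psum_def)
    have "f - g = (a - a') + (b - b')" using * by simp
    moreover have "a - a' \<in> N" "b - b' \<in> M" using * is_sub_simps(2)[OF N] is_sub_simps(2)[OF M] by auto
    ultimately show ?thesis unfolding psum_def by blast
  qed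
  ultimately show ?thesis by (auto simp: is_sub_def)
qed

lemma Int_sub: "is_sub N \<Longrightarrow> is_sub M \<Longrightarrow> is_sub (N \<inter> M)"
  by (auto simp: is_sub_def)

lemma image_Int_sub: "is_sub N \<Longrightarrow> is_sub M \<Longrightarrow> \<pi> ` N \<inter> \<pi> ` M = \<pi> ` (N \<inter> M)"
  by (auto simp: \<pi>_mem_image) (use \<pi>_mem_image in blast)

text \<open>The element of a graded module that has the representatives \<open>F i\<close>.\<close>

definition grc where "grc D F = (\<lambda>i. cls (D i) (F i))"

lemma grc_eq: "(\<And>i. is_sub (D i)) \<Longrightarrow> grc D F = grc D F' \<longleftrightarrow> (\<forall>i. F i - F' i \<in> D i)"
  by (simp add: grc_def fun_eq_iff cls_eq)

lemma grc_add: "(\<And>i. is_sub (D i)) \<Longrightarrow> (\<lambda>i. grc D F i <+>\<^bsub>A\<^esub> grc D F' i) = grc D (\<lambda>i. F i + F' i)"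
  by (simp add: grc_def cls_add)

lemma grc_coset: "(\<lambda>i. \<pi> ` D i +>\<^bsub>A\<^esub> \<pi> (F i)) = grc D F"
  by (simp add: grc_def coset_image)

text \<open>The hypotheses say that the class of a product does not depend on the representatives, so that the union
in the definition of \<open>graded_mult\<close> is over a single coset.\<close>

lemma graded_mult_grc:
  assumes D: "\<And>i. is_sub (D i)" and H: "\<And>i. is_sub (H i)"
    and c1: "\<And>j k x y. x \<in> H j \<Longrightarrow> y - G k \<in> D k \<Longrightarrow> x * y \<in> D (j + k)"
    and c2: "\<And>j k z. z \<in> D k \<Longrightarrow> F j * z \<in> D (j + k)"
  shows "graded_mult A (\<lambda>i. \<pi> ` D i) (grc H F) (grc D G) = grc D (\<lambda>i. \<Sum>j\<le>i. F j * G (i - j))"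
proof
  fix i
  let ?R = "cls (D i) (\<Sum>j\<le>i. F j * G (i - j))"
  have one: "\<pi> ` D i +>\<^bsub>A\<^esub> (\<Oplus>\<^bsub>A\<^esub>j\<in>{..i}. x j \<otimes>\<^bsub>A\<^esub> y (i - j)) = ?R"
    if x: "\<And>j. x j \<in> grc H F j" and y: "\<And>j. y j \<in> grc D G j" for x y
  proof -
    have "\<forall>j. \<exists>g. x j = \<pi> g \<and> g - F j \<in> H j" using x by (auto simp: grc_def cls_def)
    then obtain x' where x': "\<And>j. x j = \<pi> (x' j)" "\<And>j. x' j - F j \<in> H j" by metis
    have "\<forall>j. \<exists>g. y j = \<pi> g \<and> g - G j \<in> D j" using y by (auto simp: grc_def cls_def)
    then obtain y' where y': "\<And>j. y j = \<pi> (y' j)" "\<And>j. y' j - G j \<in> D j" by metis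
    have "(\<Oplus>\<^bsub>A\<^esub>j\<in>{..i}. x j \<otimes>\<^bsub>A\<^esub> y (i - j)) = \<pi> (\<Sum>j\<le>i. x' j * y' (i - j))"
      by (simp add: x' y' \<pi>_hom \<pi>_finsum)
    then have "\<pi> ` D i +>\<^bsub>A\<^esub> (\<Oplus>\<^bsub>A\<^esub>j\<in>{..i}. x j \<otimes>\<^bsub>A\<^esub> y (i - j)) = cls (D i) (\<Sum>j\<le>i. x' j * y' (i - j))"
      by (simp add: coset_image)
    also have "\<dots> = ?R"
    proof (subst cls_eq[OF D])
      have "(\<Sum>j\<le>i. x' j * y' (i - j)) - (\<Sum>j\<le>i. F j * G (i - j)) =
        (\<Sum>j\<le>i. (x' j - F j) * y' (i - j) + F j * (y' (i - j) - G (i - j)))"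
        by (simp add: sum_subtractf[symmetric] algebra_simps)
      also have "\<dots> \<in> D i"
      proof (rule is_sub_sum[OF D])
        fix j assume "j \<in> {..i}"
        then show "(x' j - F j) * y' (i - j) + F j * (y' (i - j) - G (i - j)) \<in> D i"
          using c1[OF x'(2)[of j] y'(2)[of "i - j"]] c2[OF y'(2)[of "i - j"], of j] is_sub_simps(4)[OF D] by simp
      qed
      finally show "(\<Sum>j\<le>i. x' j * y' (i - j)) - (\<Sum>j\<le>i. F j * G (i - j)) \<in> D i" .
    qed
    finally show ?thesis .
  qed
  have ex: "\<pi> (F j) \<in> grc H F j" "\<pi> (G j) \<in> grc D G j" for j
    using \<pi>_mem_cls[OF H] \<pi>_mem_cls[OF D] is_sub_simps(1)[OF H] is_sub_simps(1)[OF D] by (auto simp: grc_def)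
  have "{\<pi> ` D i +>\<^bsub>A\<^esub> (\<Oplus>\<^bsub>A\<^esub>j\<in>{..i}. x j \<otimes>\<^bsub>A\<^esub> y (i - j)) | x y.
      (\<forall>j. x j \<in> grc H F j) \<and> (\<forall>j. y j \<in> grc D G j)} = {?R}"
  proof
    show "{\<pi> ` D i +>\<^bsub>A\<^esub> (\<Oplus>\<^bsub>A\<^esub>j\<in>{..i}. x j \<otimes>\<^bsub>A\<^esub> y (i - j)) | x y.
      (\<forall>j. x j \<in> grc H F j) \<and> (\<forall>j. y j \<in> grc D G j)} \<subseteq> {?R}"
      using one by blast
    have "?R = \<pi> ` D i +>\<^bsub>A\<^esub> (\<Oplus>\<^bsub>A\<^esub>j\<in>{..i}. \<pi> (F j) \<otimes>\<^bsub>A\<^esub> \<pi> (G (i - j)))"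
      using one[of "\<lambda>j. \<pi> (F j)" "\<lambda>j. \<pi> (G j)"] ex by simp
    then show "{?R} \<subseteq> {\<pi> ` D i +>\<^bsub>A\<^esub> (\<Oplus>\<^bsub>A\<^esub>j\<in>{..i}. x j \<otimes>\<^bsub>A\<^esub> y (i - j)) | x y.
      (\<forall>j. x j \<in> grc H F j) \<and> (\<forall>j. y j \<in> grc D G j)}"
      using ex by (simp only: insert_subset empty_subsetI simp_thms mem_Collect_eq)
        (intro exI[of _ "\<lambda>j. \<pi> (F j)"] exI[of _ "\<lambda>j. \<pi> (G j)"] conjI allI; simp)
  qed
  then show "graded_mult A (\<lambda>i. \<pi> ` D i) (grc H F) (grc D G) i = grc D (\<lambda>i. \<Sum>j\<le>i. F j * G (i - j)) i"
    unfolding graded_mult_def by (simp add: grc_def)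
qed

definition mm where "mm = \<pi> ` ord_ge 1"

lemma ord_ge_ideal: "ideal (ord_ge i) \<S>"
  unfolding ideal_S_iff using ord_ge_mult[of _ 0 _ i] by (auto intro: ord_ge_closed)

lemma ideal_image_A:
  assumes "ideal J \<S>" shows "ideal (\<pi> ` J) A"
proof (rule idealI)
  note * = assms[unfolded ideal_S_iff]
  show "ring A" by (rule A.ring_axioms)
  show "subgroup (\<pi> ` J) (add_monoid A)"
  proof (rule A.add.subgroupI)
    show "\<pi> ` J \<noteq> {}" using * by auto
    fix a assume "a \<in> \<pi> ` J"
    then obtain f where f: "f \<in> J" "a = \<pi> f" by auto
    have "\<ominus>\<^bsub>A\<^esub> \<pi> f = \<pi> (- f)" by (rule A.minus_equality) (auto simp: \<pi>_hom)
    moreover have "- f \<in> J" using * f by (metis mult_minus1)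
    ultimately show "\<ominus>\<^bsub>A\<^esub> a \<in> \<pi> ` J" using f by auto
  qed (use * in \<open>auto simp: \<pi>_hom\<close>)
  fix a x assume "a \<in> \<pi> ` J" "x \<in> carrier A"
  then show "x \<otimes>\<^bsub>A\<^esub> a \<in> \<pi> ` J" "a \<otimes>\<^bsub>A\<^esub> x \<in> \<pi> ` J"
    using * by (auto simp: carrier_A \<pi>_hom mult.commute)
qed

text \<open>A monomial of degree \<open>i + 1\<close> is a variable times a monomial of degree \<open>i\<close>.\<close>

lemma ideal_pow_mm: "ideal_pow A mm i = \<pi> ` ord_ge i"
proof -
  interpret M: comm_monoid "ideals_set A" by (rule A.ideals_set_is_comm_monoid)
  have "mm [^]\<^bsub>ideals_set A\<^esub> i = \<pi> ` ord_ge i"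
  proof (induction i)
    case 0
    then show ?case by (simp add: ideals_set_def carrier_A)
  next
    case (Suc i)
    have "mm [^]\<^bsub>ideals_set A\<^esub> Suc i = ideal_prod A (\<pi> ` ord_ge i) (\<pi> ` ord_ge 1)"
      using Suc by (simp add: ideals_set_def mm_def)
    also have "\<dots> = \<pi> ` ord_ge (Suc i)"
    proof
      show "ideal_prod A (\<pi> ` ord_ge i) (\<pi> ` ord_ge 1) \<subseteq> \<pi> ` ord_ge (Suc i)"
      proof
        fix x assume "x \<in> ideal_prod A (\<pi> ` ord_ge i) (\<pi> ` ord_ge 1)"
        then show "x \<in> \<pi> ` ord_ge (Suc i)"
          by induction (use ord_ge_mult[of _ i _ 1] in \<open>auto simp: \<pi>_hom intro!: imageI ord_ge_closed\<close>)
      qed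
      show "\<pi> ` ord_ge (Suc i) \<subseteq> ideal_prod A (\<pi> ` ord_ge i) (\<pi> ` ord_ge 1)"
      proof
        fix x assume "x \<in> \<pi> ` ord_ge (Suc i)"
        then obtain f where f: "f \<in> ord_ge (Suc i)" "x = \<pi> f" by auto
        have zero: "\<pi> 0 \<in> ideal_prod A (\<pi> ` ord_ge i) (\<pi> ` ord_ge 1)"
          using ideal_prod.prod[of "\<pi> 0" "\<pi> ` ord_ge i" "\<pi> 0" "\<pi> ` ord_ge 1" A] by (simp add: \<pi>_hom)
        have trm: "\<pi> (cst c * mon \<alpha>) \<in> ideal_prod A (\<pi> ` ord_ge i) (\<pi> ` ord_ge 1)"
          if deg: "Suc i \<le> mdeg \<alpha>" for c \<alpha>
        proof -
          obtain j where j: "Poly_Mapping.lookup \<alpha> j \<noteq> 0"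
          proof (rule ccontr)
            assume "\<not> thesis"
            then have "\<forall>j. Poly_Mapping.lookup \<alpha> j = 0" using that by blast
            then show False using deg by (simp add: mdeg_def)
          qed
          define \<beta> where "\<beta> = \<alpha> - Poly_Mapping.single j 1"
          have \<alpha>: "\<alpha> = \<beta> + Poly_Mapping.single j 1"
            by (rule poly_mapping_eqI) (use j in \<open>auto simp: \<beta>_def lookup_add lookup_minus lookup_single when_def\<close>)
          have "i \<le> mdeg \<beta>" using deg by (simp add: \<alpha>)
          then have "\<pi> (cst c * mon \<beta>) \<in> \<pi> ` ord_ge i" by (intro imageI ord_ge_closed ord_ge_mon)
          moreover have "\<pi> (mon (Poly_Mapping.single j 1)) \<in> \<pi> ` ord_ge 1" by (intro imageI ord_ge_mon) simp
          ultimately have "\<pi> (cst c * mon \<beta>) \<otimes>\<^bsub>A\<^esub> \<pi> (mon (Poly_Mapping.single j 1)) \<in> ideal_prod A (\<pi> ` ord_ge i) (\<pi> ` ord_ge 1)"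
            by (rule ideal_prod.prod)
          then show ?thesis by (simp add: \<pi>_hom mult.assoc mon_mult \<alpha>)
        qed
        have "\<pi> (\<Sum>\<alpha>\<in>B. cst (Poly_Mapping.lookup f \<alpha>) * mon \<alpha>) \<in> ideal_prod A (\<pi> ` ord_ge i) (\<pi> ` ord_ge 1)"
          if "finite B" "B \<subseteq> Poly_Mapping.keys f" for B
          using that
        proof (induction B)
          case (insert \<alpha> B)
          have "Suc i \<le> mdeg \<alpha>" using insert.prems f(1) by (auto simp: ord_ge_def in_keys_iff not_less[symmetric])
          then show ?case using ideal_prod.sum[OF trm insert.IH] insert by (simp add: \<pi>_hom)
        qed (simp add: zero del: One_nat_def)
        from this[of "Poly_Mapping.keys f"] show "x \<in> ideal_prod A (\<pi> ` ord_ge i) (\<pi> ` ord_ge 1)"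
          using f poly_as_sum[of "Poly_Mapping.keys f" f] by simp
      qed
    qed
    finally show ?case .
  qed
  then show ?thesis by (simp add: ideal_pow_def)
qed

text \<open>\<open>Fl i\<close> and \<open>L e\<close> are the preimages of \<open>\<mm>\<^sup>i\<close> and of \<open>(0 : \<mm>\<^sup>e)\<close>.\<close>

definition Fl where "Fl i = psum (ord_ge i) I"

definition L where "L e = {f. \<forall>g\<in>ord_ge e. f * g \<in> I}"

lemma Fl_iff: "f \<in> Fl i \<longleftrightarrow> (\<exists>g\<in>ord_ge i. f - g \<in> I)"
proof
  assume "f \<in> Fl i"
  then obtain g j where "g \<in> ord_ge i" "j \<in> I" "f = g + j" by (auto simp: Fl_def psum_def)
  then show "\<exists>g\<in>ord_ge i. f - g \<in> I" by (intro bexI[of _ g]) auto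
next
  assume "\<exists>g\<in>ord_ge i. f - g \<in> I"
  then obtain g where "g \<in> ord_ge i" "f - g \<in> I" "f = g + (f - g)" by auto
  then show "f \<in> Fl i" unfolding Fl_def psum_def by blast
qed

lemma Fl_sub: "is_sub (Fl i)"
proof -
  have "f - g \<in> Fl i" if f: "f \<in> Fl i" and g: "g \<in> Fl i" for f g
  proof -
    obtain f' g' where *: "f' \<in> ord_ge i" "f - f' \<in> I" "g' \<in> ord_ge i" "g - g' \<in> I" using f g by (auto simp: Fl_iff)
    have "(f - f') - (g - g') \<in> I" using * I_simps(6) by blast
    moreover have "(f - f') - (g - g') = (f - g) - (f' - g')" by simp
    ultimately show ?thesis using ord_ge_closed(2)[OF *(1,3)] unfolding Fl_iff by auto
  qed
  moreover have "f \<in> Fl i" if "f \<in> I" for f using that by (auto simp: Fl_iff intro!: bexI[of _ 0])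
  ultimately show ?thesis by (auto simp: is_sub_def)
qed

lemma ord_ge_Fl: "f \<in> ord_ge i \<Longrightarrow> f \<in> Fl i"
  using I_simps(1) by (auto simp: Fl_iff intro!: bexI[of _ f])

lemma Fl_image: "\<pi> ` Fl i = \<pi> ` ord_ge i"
proof -
  have "\<pi> f \<in> \<pi> ` ord_ge i" if f: "f \<in> Fl i" for f
  proof -
    obtain g where "g \<in> ord_ge i" "f - g \<in> I" using f by (auto simp: Fl_iff)
    then show ?thesis using \<pi>_eq[of f g] by auto
  qed
  then show ?thesis using ord_ge_Fl by blast
qed

lemma ideal_pow_Fl: "ideal_pow A mm i = \<pi> ` Fl i"
  by (simp add: ideal_pow_mm Fl_image)

lemma Fl_antimono: "i \<le> j \<Longrightarrow> Fl j \<subseteq> Fl i"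
  using ord_ge_antimono[of i j] unfolding subset_iff Fl_iff by blast

lemma Fl_0: "Fl 0 = UNIV"
  using ord_ge_Fl[of _ 0] by auto

lemma Fl_mult: "f \<in> Fl i \<Longrightarrow> g \<in> Fl j \<Longrightarrow> f * g \<in> Fl (i + j)"
proof -
  assume f: "f \<in> Fl i" and g: "g \<in> Fl j"
  obtain f' g' where *: "f' \<in> ord_ge i" "f - f' \<in> I" "g' \<in> ord_ge j" "g - g' \<in> I" using f g by (auto simp: Fl_iff)
  have "(f - f') * g + f' * (g - g') \<in> I" by (intro I_simps(2) I_simps(3)[OF *(4)] I_simps(4)[OF *(2)])
  moreover have "(f - f') * g + f' * (g - g') = f * g - f' * g'" by (simp add: algebra_simps)
  ultimately show ?thesis using ord_ge_mult[OF *(1,3)] unfolding Fl_iff by auto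
qed

lemma L_sub: "is_sub (L e)"
  using I_simps by (auto simp: is_sub_def L_def left_diff_distrib)

lemma L_mono: "e \<le> e' \<Longrightarrow> L e \<subseteq> L e'"
  using ord_ge_antimono[of e e'] by (auto simp: L_def)

lemma L_mult: "f \<in> L (e + j) \<Longrightarrow> g \<in> Fl j \<Longrightarrow> g * f \<in> L e"
proof -
  assume f: "f \<in> L (e + j)" and g: "g \<in> Fl j"
  obtain g' where g': "g' \<in> ord_ge j" "g - g' \<in> I" using g by (auto simp: Fl_iff)
  have "g * f * h \<in> I" if h: "h \<in> ord_ge e" for h
  proof -
    have "f * (h * g') \<in> I" using f ord_ge_mult[OF h g'(1)] by (simp add: L_def)
    moreover have "(g - g') * (f * h) \<in> I" by (rule I_simps(4)[OF g'(2)])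
    ultimately have "f * (h * g') + (g - g') * (f * h) \<in> I" by (rule I_simps(2))
    then show ?thesis by (simp add: algebra_simps)
  qed
  then show ?thesis by (simp add: L_def)
qed

lemma L_0: "L 0 = I"
proof -
  have "f \<in> I" if "f \<in> L 0" for f using that unfolding L_def by (metis (mono_tags, lifting) UNIV_I mem_Collect_eq mult_1_right ord_ge_simps(2))
  then show ?thesis using is_sub_simps(5)[OF L_sub] by blast
qed

lemma annihilator_L: "annihilator A (ideal_pow A mm e) = \<pi> ` L e"
proof -
  have "annihilator A (ideal_pow A mm e) = {\<pi> f | f. \<forall>g\<in>ord_ge e. \<pi> f \<otimes>\<^bsub>A\<^esub> \<pi> g = \<zero>\<^bsub>A\<^esub>}"
    unfolding ideal_pow_mm annihilator_def carrier_A by blast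
  also have "\<dots> = {\<pi> f | f. f \<in> L e}"
    unfolding \<pi>_hom(1) \<pi>_zero_iff L_def by simp
  finally show ?thesis by auto
qed

end

section \<open>The associated graded ring and the ideals \<open>I\<^sub>\<delta>\<close>\<close>

text \<open>The first assumption says that \<open>\<mm>\<^sup>s\<^sup>+\<^sup>1 = 0\<close>. It does not follow from the second one alone, since the maximum
of an infinite set is unspecified.\<close>

locale local_quotient = coordinate_quotient I for I :: "('n::finite, 'k::field) mpoly set" +
  fixes s :: nat
  assumes top: "ord_ge (Suc s) \<subseteq> I" and s_max: "max_power A mm = s"
begin

lemma Fl_top: "s < i \<Longrightarrow> Fl i = I"
proof -
  assume i: "s < i"
  have "f \<in> I" if f: "f \<in> Fl i" for f
  proof -
    obtain g where g: "g \<in> ord_ge i" "f - g \<in> I" using f by (auto simp: Fl_iff)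
    have "g \<in> I" using g top ord_ge_antimono[of "Suc s" i] i by auto
    from I_simps(2)[OF g(2) this] show ?thesis by simp
  qed
  then show ?thesis using is_sub_simps(5)[OF Fl_sub] by blast
qed

abbreviation G where "G \<equiv> gr A mm"

definition \<gamma> where "\<gamma> = gr_proj I mm"

abbreviation D1 where "D1 \<equiv> \<lambda>i. Fl (Suc i)"

lemma \<gamma>_grc: "\<gamma> f = grc D1 (\<lambda>i. hom_comp i f)"
  unfolding \<gamma>_def gr_proj_def grc_def
  by (rule ext) (simp add: ideal_pow_Fl coset_image flip: proj_def)

lemma D1_sub: "is_sub (D1 i)" by (rule Fl_sub)

text \<open>The support of an element is finite because the filtration is: in degrees above \<open>s\<close> all classes vanish.\<close>

lemma carrier_graded_module:
  assumes D: "\<And>i. is_sub (D i)" and N: "\<And>i. s < i \<Longrightarrow> N i \<subseteq> D i"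
  shows "carrier (graded_module A (\<lambda>i. \<pi> ` N i) (\<lambda>i. \<pi> ` D i)) = {grc D F | F. \<forall>i. F i \<in> N i}"
proof -
  have fin: "finite {i. grc D F i \<noteq> \<pi> ` D i}" if F: "\<forall>i. F i \<in> N i" for F
  proof (rule finite_subset[of _ "{..s}"])
    have "grc D F i = \<pi> ` D i" if "s < i" for i
    proof -
      have "F i - 0 \<in> D i" using F N[OF that] by auto
      then have "cls (D i) (F i) = cls (D i) 0" by (simp only: cls_eq[OF D])
      then show ?thesis by (simp only: grc_def cls_0)
    qed
    then show "{i. grc D F i \<noteq> \<pi> ` D i} \<subseteq> {..s}" by (auto simp: not_le[symmetric])
  qed simp
  have ex: "\<exists>F. g = grc D F \<and> (\<forall>i. F i \<in> N i)" if g: "\<forall>i. \<exists>x\<in>\<pi> ` N i. g i = \<pi> ` D i +>\<^bsub>A\<^esub> x" for g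
  proof -
    have "\<forall>i. \<exists>f. f \<in> N i \<and> g i = cls (D i) f" using g by (auto simp: coset_image)
    then obtain F where "\<And>i. F i \<in> N i" "\<And>i. g i = cls (D i) (F i)" by metis
    then show ?thesis by (intro exI[of _ F]) (auto simp: grc_def)
  qed
  show ?thesis
  proof (rule Set.set_eqI, rule iffI)
    fix g assume "g \<in> carrier (graded_module A (\<lambda>i. \<pi> ` N i) (\<lambda>i. \<pi> ` D i))"
    then have "\<forall>i. \<exists>x\<in>\<pi> ` N i. g i = \<pi> ` D i +>\<^bsub>A\<^esub> x" by (simp add: graded_module_def)
    from ex[OF this] show "g \<in> {grc D F | F. \<forall>i. F i \<in> N i}" by blast
  next
    fix g assume "g \<in> {grc D F | F. \<forall>i. F i \<in> N i}"
    then obtain F where F: "g = grc D F" "\<forall>i. F i \<in> N i" by blast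
    have "\<exists>x\<in>\<pi> ` N i. g i = \<pi> ` D i +>\<^bsub>A\<^esub> x" for i
      using F by (auto simp: grc_def coset_image)
    then show "g \<in> carrier (graded_module A (\<lambda>i. \<pi> ` N i) (\<lambda>i. \<pi> ` D i))"
      using fin[OF F(2)] F(1) by (simp add: graded_module_def)
  qed
qed

lemma add_graded_module:
  "(\<And>i. is_sub (D i)) \<Longrightarrow> grc D F \<oplus>\<^bsub>graded_module A N D'\<^esub> grc D F' = grc D (\<lambda>i. F i + F' i)"
  by (simp add: graded_module_def grc_add)

lemma smult_graded_module: "module.smult (graded_module A N D) = graded_mult A D"
  by (simp add: graded_module_def)

lemma gr_simps:
  "carrier G = carrier (graded_module A (\<lambda>i. \<pi> ` Fl i) (\<lambda>i. \<pi> ` D1 i))"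
  "monoid.mult G = graded_mult A (\<lambda>i. \<pi> ` D1 i)"
  "one G = (\<lambda>i. if i = 0 then \<pi> ` D1 0 +>\<^bsub>A\<^esub> \<pi> 1 else \<pi> ` D1 i)"
  "zero G = (\<lambda>i. \<pi> ` D1 i)" "add G = (\<lambda>g h i. g i <+>\<^bsub>A\<^esub> h i)"
  by (auto simp add: gr_def Let_def ideal_pow_Fl[abs_def] \<pi>_hom fun_eq_iff)

lemma hom_comp_Fl: "hom_comp i f \<in> Fl i"
  by (simp add: ord_ge_Fl)

text \<open>A family of representatives \<open>F i\<close> of order at least \<open>i\<close> has the same classes as the polynomial whose part of
degree \<open>i\<close> is that of \<open>F i\<close>.\<close>

lemma carrier_gr: "carrier G = range \<gamma>"
proof -
  have "\<exists>f. grc D1 F = \<gamma> f" if F: "\<forall>i. F i \<in> Fl i" for F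
  proof -
    have "\<forall>i. \<exists>g\<in>ord_ge i. F i - g \<in> I" using F by (simp add: Fl_iff)
    then obtain o' where o': "\<And>i. o' i \<in> ord_ge i" "\<And>i. F i - o' i \<in> I" by metis
    define f where "f = (\<Sum>i\<le>s. hom_comp i (o' i))"
    have hc: "hom_comp i f = (if i \<le> s then hom_comp i (o' i) else 0)" for i
      unfolding f_def by (simp add: hom_comp_sum hom_comp_hom_comp)
    have "F i - hom_comp i f \<in> D1 i" for i
    proof (cases "i \<le> s")
      case True
      have "F i - hom_comp i f = (F i - o' i) + (o' i - hom_comp i (o' i))" using hc True by simp
      then show ?thesis
        using is_sub_simps(4,5)[OF D1_sub] o'(2) ord_ge_Fl[OF diff_hom_comp_ord_ge[OF o'(1)]] by metis
    next
      case False
      then show ?thesis using F[rule_format, of i] Fl_top[of i] Fl_top[of "Suc i"] hc by simp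
    qed
    then have "grc D1 F = \<gamma> f" by (simp add: \<gamma>_grc grc_eq[OF D1_sub])
    then show ?thesis ..
  qed
  moreover have "\<gamma> f \<in> {grc D1 F | F. \<forall>i. F i \<in> Fl i}" for f
    using hom_comp_Fl by (auto simp: \<gamma>_grc)
  ultimately have "{grc D1 F | F. \<forall>i. F i \<in> Fl i} = range \<gamma>" by fast
  then show ?thesis
    unfolding gr_simps by (subst carrier_graded_module) (use D1_sub Fl_top in auto)
qed

lemma \<gamma>_eq: "\<gamma> f = \<gamma> g \<longleftrightarrow> (\<forall>i. hom_comp i (f - g) \<in> D1 i)"
  by (simp add: \<gamma>_grc grc_eq[OF D1_sub])

lemma \<gamma>_smult_grc:
  assumes D: "\<And>i. is_sub (D i)"
    and c1: "\<And>j k x y. x \<in> D1 j \<Longrightarrow> y - H k \<in> D k \<Longrightarrow> x * y \<in> D (j + k)"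
    and c2: "\<And>j k x y. x \<in> Fl j \<Longrightarrow> y \<in> D k \<Longrightarrow> x * y \<in> D (j + k)"
  shows "graded_mult A (\<lambda>i. \<pi> ` D i) (\<gamma> f) (grc D H) = grc D (\<lambda>i. \<Sum>j\<le>i. hom_comp j f * H (i - j))"
  unfolding \<gamma>_grc
proof (rule graded_mult_grc[where H = D1])
  show "hom_comp j f * z \<in> D (j + k)" if "z \<in> D k" for j k z
    by (rule c2[OF hom_comp_Fl that])
qed (fact D D1_sub c1)+

lemma \<gamma>_hom: "\<gamma> f \<oplus>\<^bsub>G\<^esub> \<gamma> g = \<gamma> (f + g)" "\<gamma> f \<otimes>\<^bsub>G\<^esub> \<gamma> g = \<gamma> (f * g)" "\<one>\<^bsub>G\<^esub> = \<gamma> 1" "\<zero>\<^bsub>G\<^esub> = \<gamma> 0"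
proof -
  show "\<gamma> f \<oplus>\<^bsub>G\<^esub> \<gamma> g = \<gamma> (f + g)" by (simp add: gr_simps \<gamma>_grc grc_add D1_sub)
  have "x * y \<in> D1 (j + k)" if "x \<in> D1 j" "y - hom_comp k g \<in> D1 k" for x y j k
  proof -
    have "y - hom_comp k g + hom_comp k g \<in> Fl k"
      using that(2) Fl_antimono[of k "Suc k"] hom_comp_Fl is_sub_simps(4)[OF Fl_sub] by (meson le_SucI order_refl subsetD)
    then show ?thesis using Fl_mult[OF that(1), of y k] by simp
  qed
  moreover have "x * y \<in> D1 (j + k)" if "x \<in> Fl j" "y \<in> D1 k" for x y j k
    using Fl_mult[OF that] by simp
  ultimately have "graded_mult A (\<lambda>i. \<pi> ` D1 i) (\<gamma> f) (grc D1 (\<lambda>i. hom_comp i g)) =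
      grc D1 (\<lambda>i. \<Sum>j\<le>i. hom_comp j f * hom_comp (i - j) g)"
    by (intro \<gamma>_smult_grc D1_sub)
  then show "\<gamma> f \<otimes>\<^bsub>G\<^esub> \<gamma> g = \<gamma> (f * g)"
    by (simp add: gr_simps \<gamma>_grc[of g] \<gamma>_grc[of "f * g"] hom_comp_mult)
  show "\<zero>\<^bsub>G\<^esub> = \<gamma> 0" by (simp add: gr_simps \<gamma>_grc grc_def cls_0)
  have "hom_comp i (1 :: ('n, 'k) mpoly) = (if i = 0 then 1 else 0)" for i
    using hom_comp_simps(5)[of i 0] by (auto simp: mon_0)
  then show "\<one>\<^bsub>G\<^esub> = \<gamma> 1"
    by (intro ext) (auto simp: gr_simps \<gamma>_grc grc_def cls_0 coset_image)
qed

lemma \<gamma>_ring_hom: "\<gamma> \<in> Ring.ring_hom \<S> G"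
  by (rule ring_hom_memI) (auto simp: carrier_gr \<gamma>_hom)

lemma ring_gr: "ring G"
proof -
  have "ring (G \<lparr>carrier := \<gamma> ` carrier \<S>, zero := \<gamma> \<zero>\<^bsub>\<S>\<^esub>\<rparr>)"
    by (rule S.ring_hom_imp_img_ring[OF \<gamma>_ring_hom])
  moreover have "G \<lparr>carrier := \<gamma> ` carrier \<S>, zero := \<gamma> \<zero>\<^bsub>\<S>\<^esub>\<rparr> = G"
    using carrier_gr \<gamma>_hom(4) by simp
  ultimately show ?thesis by simp
qed

lemma ideal_image_gr:
  assumes "ideal J \<S>" shows "ideal (\<gamma> ` J) G"
proof (rule idealI)
  interpret G: ring G by (rule ring_gr)
  note * = assms[unfolded ideal_S_iff]
  show "ring G" by (rule ring_gr)
  show "subgroup (\<gamma> ` J) (add_monoid G)"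
  proof (rule G.add.subgroupI)
    show "\<gamma> ` J \<noteq> {}" using * by auto
    fix a assume "a \<in> \<gamma> ` J"
    then obtain f where f: "f \<in> J" "a = \<gamma> f" by auto
    have "\<ominus>\<^bsub>G\<^esub> \<gamma> f = \<gamma> (- f)" by (rule G.minus_equality) (auto simp: \<gamma>_hom carrier_gr)
    moreover have "- f \<in> J" using * f by (metis mult_minus1)
    ultimately show "\<ominus>\<^bsub>G\<^esub> a \<in> \<gamma> ` J" using f by auto
  qed (use * in \<open>auto simp: \<gamma>_hom carrier_gr\<close>)
  fix a x assume "a \<in> \<gamma> ` J" "x \<in> carrier G"
  then show "x \<otimes>\<^bsub>G\<^esub> a \<in> \<gamma> ` J" "a \<otimes>\<^bsub>G\<^esub> x \<in> \<gamma> ` J"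
    using * by (auto simp: carrier_gr \<gamma>_hom mult.commute)
qed

text \<open>The preimages in \<open>S\<close>, degree by degree, of \<open>numer\<close>, of the numerator of \<open>I_module\<close>, of \<open>I_denom\<close> and of
\<open>Q_denom\<close>.\<close>

definition Nu where "Nu \<delta> i = Fl i \<inter> L (s + 1 - i - \<delta>)"

definition Nh where "Nh \<delta> i = psum (Nu \<delta> i) (Fl (Suc i))"

definition Dn where "Dn \<delta> i = Fl (Suc i) \<inter> L (s + 1 - i - \<delta>)"

definition Qd where "Qd \<delta> i = psum (Dn \<delta> i) (Nu (Suc \<delta>) i)"

text \<open>The preimage of \<open>I\<^sub>\<delta>\<close> in \<open>S\<close>, that is, the ideal of \<open>V(I\<^sub>\<delta>)\<close> as a subscheme of affine space.\<close>

definition limit_ideal where "limit_ideal \<delta> = {f. \<forall>i. hom_comp i f \<in> Nh \<delta> i}"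

lemma subs: "is_sub (Nu \<delta> i)" "is_sub (Nh \<delta> i)" "is_sub (Dn \<delta> i)" "is_sub (Qd \<delta> i)"
proof -
  show 1: "is_sub (Nu \<delta> i)" "is_sub (Dn \<delta> i)" for \<delta> unfolding Nu_def Dn_def by (intro Int_sub Fl_sub L_sub)+
  show "is_sub (Nh \<delta> i)" unfolding Nh_def by (intro psum_sub 1 Fl_sub)
  show "is_sub (Qd \<delta> i)" unfolding Qd_def by (intro psum_sub 1)
qed

lemma images:
  "loewy A mm \<delta> i = \<pi> ` L (s + 1 - i - \<delta>)"
  "numer A mm \<delta> = (\<lambda>i. \<pi> ` Nu \<delta> i)"
  "I_denom A mm \<delta> = (\<lambda>i. \<pi> ` Dn \<delta> i)"
  "Q_denom A mm \<delta> = (\<lambda>i. \<pi> ` Qd \<delta> i)"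
  "I_module A mm \<delta> = graded_module A (\<lambda>i. \<pi> ` Nh \<delta> i) (\<lambda>i. \<pi> ` D1 i)"
proof -
  show l: "loewy A mm \<delta> i = \<pi> ` L (s + 1 - i - \<delta>)" for \<delta> i by (simp add: loewy_def s_max annihilator_L)
  show n: "numer A mm \<delta> = (\<lambda>i. \<pi> ` Nu \<delta> i)" for \<delta>
    by (rule ext) (simp only: numer_def l ideal_pow_Fl image_Int_sub[OF Fl_sub L_sub] Nu_def)
  show d: "I_denom A mm \<delta> = (\<lambda>i. \<pi> ` Dn \<delta> i)"
    by (rule ext) (simp only: I_denom_def l ideal_pow_Fl image_Int_sub[OF Fl_sub L_sub] Dn_def Suc_eq_plus1)
  show "I_module A mm \<delta> = graded_module A (\<lambda>i. \<pi> ` Nh \<delta> i) (\<lambda>i. \<pi> ` D1 i)"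
    unfolding I_module_def n ideal_pow_Fl psum_image Nh_def by simp
  have "s - i - \<delta> = s + 1 - i - Suc \<delta>" for i by simp
  then show "Q_denom A mm \<delta> = (\<lambda>i. \<pi> ` Qd \<delta> i)"
    unfolding Q_denom_def fun_eq_iff
    by (simp only: s_max annihilator_L[unfolded ideal_pow_Fl] ideal_pow_Fl l image_Int_sub[OF Fl_sub L_sub] psum_image Qd_def Dn_def Nu_def Suc_eq_plus1 simp_thms)
qed

lemma Nu_mult: "x \<in> Fl j \<Longrightarrow> y \<in> Nu \<delta> k \<Longrightarrow> x * y \<in> Nu \<delta> (j + k)"
proof -
  assume x: "x \<in> Fl j" and y: "y \<in> Nu \<delta> k"
  have "s + 1 - k - \<delta> \<le> s + 1 - (j + k) - \<delta> + j" by linarith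
  then have "y \<in> L (s + 1 - (j + k) - \<delta> + j)" using y L_mono unfolding Nu_def by blast
  then show ?thesis using L_mult[OF _ x] Fl_mult[OF x] y by (auto simp: Nu_def)
qed

lemma Dn_mult: "x \<in> Fl j \<Longrightarrow> y \<in> Dn \<delta> k \<Longrightarrow> x * y \<in> Dn \<delta> (j + k)"
proof -
  assume x: "x \<in> Fl j" and y: "y \<in> Dn \<delta> k"
  have "s + 1 - k - \<delta> \<le> s + 1 - (j + k) - \<delta> + j" by linarith
  then have "y \<in> L (s + 1 - (j + k) - \<delta> + j)" using y L_mono unfolding Dn_def by blast
  then show ?thesis using L_mult[OF _ x] Fl_mult[OF x, of y "Suc k"] y by (auto simp: Dn_def)
qed

lemma Nu_D1: "x \<in> D1 j \<Longrightarrow> y \<in> Nu \<delta> k \<Longrightarrow> x * y \<in> Dn \<delta> (j + k)"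
proof -
  assume x: "x \<in> D1 j" and y: "y \<in> Nu \<delta> k"
  have xj: "x \<in> Fl j" using x Fl_antimono[of j "Suc j"] by auto
  show ?thesis using Nu_mult[OF xj y] Fl_mult[OF x, of y k] y by (auto simp: Dn_def Nu_def)
qed

lemma psumI: "f \<in> N \<Longrightarrow> g \<in> M \<Longrightarrow> f + g \<in> psum N M" by (auto simp: psum_def)

lemma psum_left: "is_sub M \<Longrightarrow> N \<subseteq> psum N M" and psum_right: "is_sub N \<Longrightarrow> M \<subseteq> psum N M"
  using is_sub_simps(1) by (force simp: psum_def)+

lemma psum_mult:
  "(\<And>y. y \<in> N \<Longrightarrow> x * y \<in> N') \<Longrightarrow> (\<And>y. y \<in> M \<Longrightarrow> x * y \<in> M') \<Longrightarrow> y \<in> psum N M \<Longrightarrow> x * y \<in> psum N' M'"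
proof -
  assume N: "\<And>y. y \<in> N \<Longrightarrow> x * y \<in> N'" and M: "\<And>y. y \<in> M \<Longrightarrow> x * y \<in> M'" and "y \<in> psum N M"
  then obtain f g where fg: "y = f + g" "f \<in> N" "g \<in> M" by (auto simp: psum_def)
  show ?thesis unfolding fg(1) distrib_left by (rule psumI[OF N[OF fg(2)] M[OF fg(3)]])
qed

lemma Nh_mult: "x \<in> Fl j \<Longrightarrow> y \<in> Nh \<delta> k \<Longrightarrow> x * y \<in> Nh \<delta> (j + k)"
  unfolding Nh_def by (rule psum_mult) (auto intro: Nu_mult Fl_mult[of _ _ _ "Suc k", simplified])

lemma Qd_mult: "x \<in> Fl j \<Longrightarrow> y \<in> Qd \<delta> k \<Longrightarrow> x * y \<in> Qd \<delta> (j + k)"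
  unfolding Qd_def by (rule psum_mult) (auto intro: Nu_mult Dn_mult)

lemma Nu_Suc: "Nu (Suc \<delta>) i \<subseteq> Nu \<delta> i"
  unfolding Nu_def by (intro Int_mono order_refl L_mono) simp

lemma Dn_Nu: "Dn \<delta> i \<subseteq> Nu \<delta> i"
  unfolding Nu_def Dn_def using Fl_antimono[of i "Suc i"] by auto

lemma Qd_Nu: "Qd \<delta> i \<subseteq> Nu \<delta> i"
  unfolding Qd_def psum_def using Nu_Suc Dn_Nu is_sub_simps(4)[OF subs(1)] by blast

lemma Nh_Fl: "Nh \<delta> i \<subseteq> Fl i"
  unfolding Nh_def psum_def using Fl_antimono[of i "Suc i"] is_sub_simps(4)[OF Fl_sub] by (auto simp: Nu_def)

lemma Nh_Suc: "Nh (Suc \<delta>) i \<subseteq> Nh \<delta> i"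
  unfolding Nh_def psum_def using Nu_Suc by blast

lemma X_ideal: "ideal (limit_ideal \<delta>) \<S>"
proof -
  have m: "mon \<alpha> * f \<in> limit_ideal \<delta>" if f: "f \<in> limit_ideal \<delta>" for f \<alpha>
  proof -
    have "hom_comp i (mon \<alpha> * f) \<in> Nh \<delta> i" for i
      unfolding hom_comp_mult
    proof (rule is_sub_sum[OF subs(2)])
      fix j assume "j \<in> {..i}"
      then show "hom_comp j (mon \<alpha>) * hom_comp (i - j) f \<in> Nh \<delta> i"
        using Nh_mult[OF hom_comp_Fl[of j "mon \<alpha>"], of "hom_comp (i - j) f" \<delta> "i - j"] f by (simp add: limit_ideal_def)
    qed
    then show ?thesis by (simp add: limit_ideal_def)
  qed
  have c: "cst c * f \<in> Nh \<delta> i" if "f \<in> Nh \<delta> i" for f c i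
    using Nh_mult[of "cst c" 0 f \<delta> i] that by (simp add: Fl_0)
  have z: "0 \<in> limit_ideal \<delta>" and a: "f + g \<in> limit_ideal \<delta>" if "f \<in> limit_ideal \<delta>" "g \<in> limit_ideal \<delta>" for f g
    using is_sub_simps(1,4)[OF subs(2)] that by (auto simp: limit_ideal_def)
  have z: "0 \<in> limit_ideal \<delta>" using is_sub_simps(1)[OF subs(2)] by (auto simp: limit_ideal_def)
  have "g * f \<in> limit_ideal \<delta>" if f: "f \<in> limit_ideal \<delta>" for f g
  proof (induction g rule: poly_induct)
    case (add g b \<alpha>)
    have "cst b * (mon \<alpha> * f) \<in> limit_ideal \<delta>" using m[OF f, of \<alpha>] c by (simp add: limit_ideal_def)
    then show ?case using a[OF add] by (simp add: distrib_right mult.assoc)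
  qed (simp add: z)
  then show ?thesis unfolding ideal_S_iff using z a by blast
qed

lemma lift_to_X:
  assumes F: "\<forall>i. F i \<in> Nh \<delta> i"
  shows "\<exists>f\<in>limit_ideal \<delta>. grc D1 F = \<gamma> f"
proof -
  have "\<forall>i. F i \<in> Fl i" using F Nh_Fl by blast
  then have "grc D1 F \<in> carrier G"
    unfolding gr_simps by (subst carrier_graded_module) (use D1_sub Fl_top in auto)
  then obtain f where f: "grc D1 F = \<gamma> f" by (auto simp: carrier_gr)
  have "hom_comp i f \<in> Nh \<delta> i" for i
  proof -
    have "F i - hom_comp i f \<in> D1 i" using f by (simp add: \<gamma>_grc grc_eq[OF D1_sub])
    then have "F i - hom_comp i f \<in> Nh \<delta> i" using psum_right[OF subs(1)] by (auto simp: Nh_def)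
    then have "F i - (F i - hom_comp i f) \<in> Nh \<delta> i" using F is_sub_simps(2)[OF subs(2)] by blast
    then show ?thesis by simp
  qed
  then show ?thesis using f by (auto simp: limit_ideal_def)
qed

lemma I_delta_X: "I_delta A mm \<delta> = \<gamma> ` limit_ideal \<delta>"
proof -
  have "carrier (I_module A mm \<delta>) = {grc D1 F | F. \<forall>i. F i \<in> Nh \<delta> i}"
    unfolding images by (rule carrier_graded_module[OF D1_sub])
      (use Nh_Fl Fl_top in \<open>metis (no_types, opaque_lifting) less_Suc_eq\<close>)
  also have "\<dots> = \<gamma> ` limit_ideal \<delta>"
  proof
    show "\<gamma> ` limit_ideal \<delta> \<subseteq> {grc D1 F | F. \<forall>i. F i \<in> Nh \<delta> i}" by (auto simp: \<gamma>_grc limit_ideal_def)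
    show "{grc D1 F | F. \<forall>i. F i \<in> Nh \<delta> i} \<subseteq> \<gamma> ` limit_ideal \<delta>" using lift_to_X by fast
  qed
  finally show ?thesis by (simp add: I_delta_def)
qed

lemma ker_X: "\<gamma> f = \<gamma> g \<Longrightarrow> f - g \<in> limit_ideal \<delta>"
  unfolding \<gamma>_eq limit_ideal_def Nh_def using psum_right[OF subs(1)] by blast

lemma X_minus: "f \<in> limit_ideal \<delta> \<Longrightarrow> g \<in> limit_ideal \<delta> \<Longrightarrow> f - g \<in> limit_ideal \<delta>"
  using is_sub_simps(2)[OF subs(2)] by (auto simp: limit_ideal_def)

lemma X_plus: "f \<in> limit_ideal \<delta> \<Longrightarrow> g \<in> limit_ideal \<delta> \<Longrightarrow> f + g \<in> limit_ideal \<delta>"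
  using is_sub_simps(4)[OF subs(2)] by (auto simp: limit_ideal_def)

lemma X_mult: "f \<in> limit_ideal \<delta> \<Longrightarrow> g * f \<in> limit_ideal \<delta>"
  using X_ideal[unfolded ideal_S_iff] by blast

lemma X_0: "0 \<in> limit_ideal \<delta>"
  using X_ideal[unfolded ideal_S_iff] by blast

lemma vimage_I_delta: "\<gamma> -` I_delta A mm \<delta> = limit_ideal \<delta>"
  unfolding I_delta_X
proof (rule Set.set_eqI, rule iffI)
  fix f assume "f \<in> \<gamma> -` \<gamma> ` limit_ideal \<delta>"
  then obtain g where g: "g \<in> limit_ideal \<delta>" "\<gamma> f = \<gamma> g" by auto
  have "(f - g) + g \<in> limit_ideal \<delta>" by (rule X_plus[OF ker_X[OF g(2)] g(1)])
  then show "f \<in> limit_ideal \<delta>" by simp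
qed auto

lemma X_dec: "limit_ideal (Suc \<delta>) \<subseteq> limit_ideal \<delta>"
  unfolding limit_ideal_def using Nh_Suc by blast

lemma I_delta_dec: "I_delta A mm (Suc \<delta>) \<subseteq> I_delta A mm \<delta>"
  unfolding I_delta_X by (rule image_mono[OF X_dec])

lemma X_zero: "limit_ideal 0 = UNIV"
proof -
  have "f \<in> L (s + 1 - i)" if "f \<in> Fl i" for f i
  proof -
    have "f * g \<in> I" if g: "g \<in> ord_ge (s + 1 - i)" for g
      using Fl_mult[OF \<open>f \<in> Fl i\<close> ord_ge_Fl[OF g]] Fl_top[of "i + (s + 1 - i)"] by simp
    then show ?thesis by (simp add: L_def)
  qed
  then have "hom_comp i f \<in> Nu 0 i" for f i using hom_comp_Fl by (simp add: Nu_def)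
  then have "hom_comp i f \<in> Nh 0 i" for f i unfolding Nh_def by (rule psum_left[OF Fl_sub, THEN subsetD])
  then show ?thesis by (auto simp: limit_ideal_def)
qed

lemma X_top: "s < \<delta> \<Longrightarrow> limit_ideal \<delta> = {f. \<gamma> f = \<gamma> 0}"
proof -
  assume d: "s < \<delta>"
  have Nu: "Nu \<delta> i = I" for i using d is_sub_simps(5)[OF Fl_sub] by (auto simp: Nu_def L_0)
  have "Nh \<delta> i = D1 i" for i
  proof
    show "D1 i \<subseteq> Nh \<delta> i" unfolding Nh_def by (rule psum_right[OF subs(1)])
    show "Nh \<delta> i \<subseteq> D1 i"
      unfolding Nh_def Nu psum_def using is_sub_simps(4,5)[OF D1_sub[of i]] by blast
  qed
  then show ?thesis by (simp add: limit_ideal_def \<gamma>_eq)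
qed

lemma I_delta_zero: "I_delta A mm 0 = carrier G"
  by (simp add: I_delta_X X_zero carrier_gr)

lemma I_delta_top: "I_delta A mm (s + 1) = {\<zero>\<^bsub>G\<^esub>}"
proof -
  have "limit_ideal (s + 1) = {f. \<gamma> f = \<gamma> 0}" by (rule X_top) simp
  then show ?thesis unfolding I_delta_X \<gamma>_hom(4) by auto
qed

lemma I_delta_iso:
  "\<exists>f. module_iso G (graded_module A (numer A mm \<delta>) (I_denom A mm \<delta>)) (I_module A mm \<delta>) f \<and>
    (\<forall>x. (\<forall>i. x i \<in> numer A mm \<delta> i) \<longrightarrow>
       f (\<lambda>i. I_denom A mm \<delta> i +>\<^bsub>A\<^esub> x i) = (\<lambda>i. ideal_pow A mm (i + 1) +>\<^bsub>A\<^esub> x i))"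
proof -
  let ?f = "\<lambda>g i. \<pi> ` D1 i <+>\<^bsub>A\<^esub> g i"
  let ?M = "graded_module A (numer A mm \<delta>) (I_denom A mm \<delta>)"
  have f: "?f (grc (Dn \<delta>) F) = grc D1 F" for F
  proof
    fix i
    have "\<pi> ` D1 i <+>\<^bsub>A\<^esub> cls (Dn \<delta> i) (F i) = cls (D1 i) (F i)"
    proof
      show "\<pi> ` D1 i <+>\<^bsub>A\<^esub> cls (Dn \<delta> i) (F i) \<subseteq> cls (D1 i) (F i)"
      proof
        fix z assume "z \<in> \<pi> ` D1 i <+>\<^bsub>A\<^esub> cls (Dn \<delta> i) (F i)"
        then obtain a b where ab: "a \<in> D1 i" "b - F i \<in> Dn \<delta> i" "z = \<pi> (a + b)"
          by (auto simp: set_add_def' cls_def \<pi>_hom)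
        have "a + (b - F i) \<in> D1 i" using ab is_sub_simps(4)[OF D1_sub] by (auto simp: Dn_def)
        then show "z \<in> cls (D1 i) (F i)" using ab by (auto simp: cls_def algebra_simps)
      qed
      show "cls (D1 i) (F i) \<subseteq> \<pi> ` D1 i <+>\<^bsub>A\<^esub> cls (Dn \<delta> i) (F i)"
      proof
        fix z assume "z \<in> cls (D1 i) (F i)"
        then obtain h where h: "z = \<pi> h" "h - F i \<in> D1 i" by (auto simp: cls_def)
        have "z = \<pi> (h - F i) \<oplus>\<^bsub>A\<^esub> \<pi> (F i)" using h by (simp add: \<pi>_hom)
        moreover have "\<pi> (F i) \<in> cls (Dn \<delta> i) (F i)" using is_sub_simps(1)[OF subs(3)] by (auto simp: cls_def)
        ultimately show "z \<in> \<pi> ` D1 i <+>\<^bsub>A\<^esub> cls (Dn \<delta> i) (F i)" using h unfolding set_add_def' by blast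
      qed
    qed
    then show "?f (grc (Dn \<delta>) F) i = grc D1 F i" by (simp add: grc_def)
  qed
  have cM: "carrier ?M = {grc (Dn \<delta>) F | F. \<forall>i. F i \<in> Nu \<delta> i}"
    unfolding images by (rule carrier_graded_module[OF subs(3)]) (auto simp: Nu_def Dn_def Fl_top)
  have cI: "carrier (I_module A mm \<delta>) = {grc D1 F | F. \<forall>i. F i \<in> Nh \<delta> i}"
    unfolding images by (rule carrier_graded_module[OF D1_sub])
      (use Nh_Fl Fl_top in \<open>metis (no_types, opaque_lifting) less_Suc_eq\<close>)
  have inj: "inj_on ?f (carrier ?M)"
  proof (rule inj_onI)
    fix g g' assume g: "g \<in> carrier ?M" and g': "g' \<in> carrier ?M" and e: "?f g = ?f g'"
    obtain F where F: "g = grc (Dn \<delta>) F" "\<forall>i. F i \<in> Nu \<delta> i" using g unfolding cM by blast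
    obtain F' where F': "g' = grc (Dn \<delta>) F'" "\<forall>i. F' i \<in> Nu \<delta> i" using g' unfolding cM by blast
    have "grc D1 F = grc D1 F'" using e unfolding F F' f .
    then have "F i - F' i \<in> Dn \<delta> i" for i
      using F F' is_sub_simps(2)[OF subs(1)[of \<delta> i], of "F i" "F' i"] by (auto simp: grc_eq[OF D1_sub] Dn_def Nu_def)
    then show "g = g'" unfolding F F' by (simp add: grc_eq[OF subs(3)])
  qed
  have img: "?f ` carrier ?M = carrier (I_module A mm \<delta>)"
  proof
    show "?f ` carrier ?M \<subseteq> carrier (I_module A mm \<delta>)"
    proof
      fix g assume "g \<in> ?f ` carrier ?M"
      then obtain F where F: "g = grc D1 F" "\<forall>i. F i \<in> Nu \<delta> i" unfolding cM using f by blast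
      then have "\<forall>i. F i \<in> Nh \<delta> i" unfolding Nh_def using psum_left[OF D1_sub] by blast
      then show "g \<in> carrier (I_module A mm \<delta>)" unfolding cI using F(1) by blast
    qed
    show "carrier (I_module A mm \<delta>) \<subseteq> ?f ` carrier ?M"
    proof
      fix g assume "g \<in> carrier (I_module A mm \<delta>)"
      then obtain F where F: "g = grc D1 F" "\<And>i. F i \<in> Nh \<delta> i" unfolding cI by blast
      have "\<forall>i. \<exists>h. h \<in> Nu \<delta> i \<and> F i - h \<in> D1 i" using F(2) by (force simp: Nh_def psum_def)
      then obtain F' where F': "\<And>i. F' i \<in> Nu \<delta> i" "\<And>i. F i - F' i \<in> D1 i" by metis
      have "g = ?f (grc (Dn \<delta>) F')" unfolding f F using F' by (simp add: grc_eq[OF D1_sub])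
      then show "g \<in> ?f ` carrier ?M" unfolding cM using F' by blast
    qed
  qed
  have "module_iso G ?M (I_module A mm \<delta>) ?f"
    unfolding module_iso_def
  proof (intro conjI ballI)
    show "bij_betw ?f (carrier ?M) (carrier (I_module A mm \<delta>))" using inj img by (simp add: bij_betw_def)
    fix x assume x: "x \<in> carrier ?M"
    then obtain F where F: "x = grc (Dn \<delta>) F" "\<forall>i. F i \<in> Nu \<delta> i" unfolding cM by blast
    {
      fix y assume "y \<in> carrier ?M"
      then obtain F' where F': "y = grc (Dn \<delta>) F'" unfolding cM by blast
      show "?f (x \<oplus>\<^bsub>?M\<^esub> y) = ?f x \<oplus>\<^bsub>I_module A mm \<delta>\<^esub> ?f y"
        unfolding F F' f images add_graded_module[OF subs(3)] add_graded_module[OF D1_sub] ..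
    next
      fix r assume "r \<in> carrier G"
      then obtain h where r: "r = \<gamma> h" by (auto simp: carrier_gr)
      have 1: "graded_mult A (\<lambda>i. \<pi> ` Dn \<delta> i) (\<gamma> h) (grc (Dn \<delta>) F) = grc (Dn \<delta>) (\<lambda>i. \<Sum>j\<le>i. hom_comp j h * F (i - j))"
      proof (rule \<gamma>_smult_grc[OF subs(3)])
        fix j k x y assume xy: "x \<in> D1 j" "y - F k \<in> Dn \<delta> k"
        have "(y - F k) + F k \<in> Nu \<delta> k" using xy F(2) Dn_Nu by (intro is_sub_simps(4)[OF subs(1)]) auto
        then show "x * y \<in> Dn \<delta> (j + k)" using Nu_D1[OF xy(1), of y \<delta> k] by simp
      qed (rule Dn_mult)
      have 2: "graded_mult A (\<lambda>i. \<pi> ` D1 i) (\<gamma> h) (grc D1 F) = grc D1 (\<lambda>i. \<Sum>j\<le>i. hom_comp j h * F (i - j))"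
      proof (rule \<gamma>_smult_grc[OF D1_sub])
        fix j k x y assume xy: "x \<in> D1 j" "y - F k \<in> D1 k"
        have "(y - F k) + F k \<in> Fl k" using xy F(2) Fl_antimono[of k "Suc k"] by (intro is_sub_simps(4)[OF Fl_sub]) (auto simp: Nu_def)
        then show "x * y \<in> D1 (j + k)" using Fl_mult[OF xy(1), of y k] by simp
      next
        fix j k x y assume "x \<in> Fl j" "y \<in> D1 k"
        then show "x * y \<in> D1 (j + k)" using Fl_mult[of x j y "Suc k"] by simp
      qed
      show "?f (r \<odot>\<^bsub>?M\<^esub> x) = r \<odot>\<^bsub>I_module A mm \<delta>\<^esub> ?f x"
        unfolding F(1) r f images smult_graded_module 1 2 ..
    }
  qed
  moreover have "?f (\<lambda>i. I_denom A mm \<delta> i +>\<^bsub>A\<^esub> x i) = (\<lambda>i. ideal_pow A mm (i + 1) +>\<^bsub>A\<^esub> x i)"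
    if x: "\<forall>i. x i \<in> numer A mm \<delta> i" for x
  proof -
    have "\<forall>i. \<exists>h. x i = \<pi> h" using x unfolding images by auto
    then obtain F where F: "\<And>i. x i = \<pi> (F i)" by metis
    have e: "grc (Dn \<delta>) F = (\<lambda>i. I_denom A mm \<delta> i +>\<^bsub>A\<^esub> x i)"
      unfolding F images(3) grc_coset ..
    have e': "grc D1 F = (\<lambda>i. ideal_pow A mm (i + 1) +>\<^bsub>A\<^esub> x i)"
      unfolding F ideal_pow_Fl grc_coset by simp
    show ?thesis using f[of F] unfolding e e' .
  qed
  ultimately show ?thesis by (intro exI[of _ ?f]) blast
qed

end

section \<open>The subquotients of the flag\<close>

definition module_closed :: "('a, 'm) ring_scheme \<Rightarrow> ('a, 'b) module \<Rightarrow> bool" where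
  "module_closed R M \<longleftrightarrow> (\<forall>x\<in>carrier M. \<forall>y\<in>carrier M. x \<oplus>\<^bsub>M\<^esub> y \<in> carrier M) \<and>
     (\<forall>r\<in>carrier R. \<forall>x\<in>carrier M. r \<odot>\<^bsub>M\<^esub> x \<in> carrier M)"

lemma module_isoD:
  assumes "module_iso R M N f"
  shows "bij_betw f (carrier M) (carrier N)"
    "x \<in> carrier M \<Longrightarrow> y \<in> carrier M \<Longrightarrow> f (x \<oplus>\<^bsub>M\<^esub> y) = f x \<oplus>\<^bsub>N\<^esub> f y"
    "r \<in> carrier R \<Longrightarrow> x \<in> carrier M \<Longrightarrow> f (r \<odot>\<^bsub>M\<^esub> x) = r \<odot>\<^bsub>N\<^esub> f x"
  using assms by (auto simp: module_iso_def)

text \<open>Over a quotient of the ring the same map is an isomorphism of modules: functionals on \<open>M\<close> and on \<open>P\<close>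
correspond along \<open>\<theta>\<close>, and every scalar of \<open>R'\<close> comes from \<open>R\<close>.\<close>

lemma transport_quadric:
  fixes \<iota> :: "'k::field \<Rightarrow> 'a"
  assumes \<theta>: "module_iso R P (restrict_scalars \<gamma> M) \<theta>"
    and \<gamma>: "\<gamma> ` carrier R = carrier R'" and \<iota>: "\<And>c. \<iota> c \<in> carrier R" and \<iota>': "\<And>c. \<iota>' c = \<gamma> (\<iota> c)"
    and P: "module_closed R P"
    and q: "module_iso R (dual_module \<iota> P) P q" and sym: "symmetric_map \<iota> P q"
    and q': "q' = (\<lambda>\<phi>. \<theta> (q (\<lambda>Y\<in>carrier P. \<phi> (\<theta> Y))))"
  shows "module_iso R' (dual_module \<iota>' M) M q'" "symmetric_map \<iota>' M q'"
proof -
  have bij: "bij_betw \<theta> (carrier P) (carrier M)"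
    and add: "\<And>x y. x \<in> carrier P \<Longrightarrow> y \<in> carrier P \<Longrightarrow> \<theta> (x \<oplus>\<^bsub>P\<^esub> y) = \<theta> x \<oplus>\<^bsub>M\<^esub> \<theta> y"
    and smult: "\<And>r x. r \<in> carrier R \<Longrightarrow> x \<in> carrier P \<Longrightarrow> \<theta> (r \<odot>\<^bsub>P\<^esub> x) = \<gamma> r \<odot>\<^bsub>M\<^esub> \<theta> x"
    using module_isoD[OF \<theta>] by (auto simp: restrict_scalars_def)
  have \<theta>M: "\<theta> x \<in> carrier M" if "x \<in> carrier P" for x using bij that by (rule bij_betwE[THEN bspec])
  have img: "carrier M = \<theta> ` carrier P" using bij by (simp add: bij_betw_def)
  have inj: "x = y" if "\<theta> x = \<theta> y" "x \<in> carrier P" "y \<in> carrier P" for x y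
    using bij that by (meson bij_betw_def inj_onD)
  have cl: "x \<oplus>\<^bsub>P\<^esub> y \<in> carrier P" if "x \<in> carrier P" "y \<in> carrier P" for x y using P that by (simp add: module_closed_def)
  have cls: "r \<odot>\<^bsub>P\<^esub> x \<in> carrier P" if "r \<in> carrier R" "x \<in> carrier P" for r x using P that by (simp add: module_closed_def)
  let ?D = "dual_module \<iota> P" and ?D' = "dual_module \<iota>' M"
  let ?T = "\<lambda>\<phi>. \<lambda>Y\<in>carrier P. \<phi> (\<theta> Y)"
  have T: "?T \<phi> \<in> carrier ?D" if \<phi>: "\<phi> \<in> carrier ?D'" for \<phi>
    using \<phi> by (auto simp: dual_module_def add smult \<theta>M cl cls \<iota> \<iota>')
  have Tinj: "\<phi> = \<psi>" if \<phi>: "\<phi> \<in> carrier ?D'" and \<psi>: "\<psi> \<in> carrier ?D'" and e: "?T \<phi> = ?T \<psi>" for \<phi> \<psi>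
  proof
    fix y
    show "\<phi> y = \<psi> y"
    proof (cases "y \<in> carrier M")
      case True
      then obtain x where x: "x \<in> carrier P" "y = \<theta> x" using img by auto
      then show ?thesis using fun_cong[OF e, of x] by simp
    next
      case False
      then show ?thesis using \<phi> \<psi> by (auto simp: dual_module_def extensional_def)
    qed
  qed
  have Tsurj: "\<exists>\<phi>\<in>carrier ?D'. ?T \<phi> = \<psi>" if \<psi>: "\<psi> \<in> carrier ?D" for \<psi>
  proof
    let ?\<phi> = "\<lambda>y\<in>carrier M. \<psi> (inv_into (carrier P) \<theta> y)"
    have ev: "?\<phi> (\<theta> x) = \<psi> x" if "x \<in> carrier P" for x
      using that bij \<theta>M by (simp add: bij_betw_inv_into_left)
    show "?T ?\<phi> = \<psi>"
    proof
      fix x show "?T ?\<phi> x = \<psi> x"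
        using ev[of x] \<psi> by (cases "x \<in> carrier P") (auto simp: dual_module_def extensional_def)
    qed
    have "?\<phi> (x \<oplus>\<^bsub>M\<^esub> y) = ?\<phi> x + ?\<phi> y" if xy: "x \<in> carrier M" "y \<in> carrier M" for x y
    proof -
      obtain a b where ab: "a \<in> carrier P" "x = \<theta> a" "b \<in> carrier P" "y = \<theta> b" using xy img by auto
      have "?\<phi> (x \<oplus>\<^bsub>M\<^esub> y) = \<psi> (a \<oplus>\<^bsub>P\<^esub> b)" unfolding ab using ev[OF cl[OF ab(1,3)]] add[OF ab(1,3)] by simp
      also have "\<dots> = \<psi> a + \<psi> b" using \<psi> ab by (simp add: dual_module_def)
      finally show ?thesis unfolding ab using ev[OF ab(1)] ev[OF ab(3)] by simp
    qed
    moreover have "?\<phi> (\<iota>' c \<odot>\<^bsub>M\<^esub> x) = c * ?\<phi> x" if x: "x \<in> carrier M" for x c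
    proof -
      obtain a where a: "a \<in> carrier P" "x = \<theta> a" using x img by auto
      have "?\<phi> (\<iota>' c \<odot>\<^bsub>M\<^esub> x) = \<psi> (\<iota> c \<odot>\<^bsub>P\<^esub> a)" unfolding a using ev[OF cls[OF \<iota> a(1)]] smult[OF \<iota> a(1)] \<iota>' by simp
      also have "\<dots> = c * \<psi> a" using \<psi> a by (simp add: dual_module_def)
      finally show ?thesis unfolding a using ev[OF a(1)] by simp
    qed
    ultimately show "?\<phi> \<in> carrier ?D'" by (simp add: dual_module_def)
  qed
  have Tbij: "bij_betw ?T (carrier ?D') (carrier ?D)"
    unfolding bij_betw_def
  proof
    show "inj_on ?T (carrier ?D')" using Tinj by (rule inj_onI)
    show "?T ` carrier ?D' = carrier ?D"       using T Tsurj by (intro subset_antisym subsetI) (auto simp: image_iff)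
  qed
  have Tadd: "?T (\<phi> \<oplus>\<^bsub>?D'\<^esub> \<psi>) = ?T \<phi> \<oplus>\<^bsub>?D\<^esub> ?T \<psi>" for \<phi> \<psi>
    by (rule ext) (simp add: dual_module_def \<theta>M)
  have Tsm: "?T (\<gamma> r \<odot>\<^bsub>?D'\<^esub> \<phi>) = r \<odot>\<^bsub>?D\<^esub> ?T \<phi>" if r: "r \<in> carrier R" for r \<phi>
    by (rule ext) (simp add: dual_module_def \<theta>M smult[OF r] cls[OF r])
  have qb: "q \<phi> \<in> carrier P" if "\<phi> \<in> carrier ?D" for \<phi>
    using module_isoD(1)[OF q] that by (rule bij_betwE[THEN bspec])
  show "module_iso R' ?D' M q'"
    unfolding module_iso_def
  proof (intro conjI ballI)
    have "bij_betw (\<theta> \<circ> (q \<circ> ?T)) (carrier ?D') (carrier M)"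
      by (rule bij_betw_trans[OF bij_betw_trans[OF Tbij module_isoD(1)[OF q]] bij])
    then show "bij_betw q' (carrier ?D') (carrier M)" by (simp add: q' comp_def)
    fix \<phi> assume \<phi>: "\<phi> \<in> carrier ?D'"
    {
      fix \<psi> assume \<psi>: "\<psi> \<in> carrier ?D'"
      show "q' (\<phi> \<oplus>\<^bsub>?D'\<^esub> \<psi>) = q' \<phi> \<oplus>\<^bsub>M\<^esub> q' \<psi>"
        unfolding q' Tadd module_isoD(2)[OF q T[OF \<phi>] T[OF \<psi>]] by (rule add[OF qb[OF T[OF \<phi>]] qb[OF T[OF \<psi>]]])
    next
      fix r' assume "r' \<in> carrier R'"
      then obtain r where r: "r \<in> carrier R" "r' = \<gamma> r" using \<gamma> by auto
      show "q' (r' \<odot>\<^bsub>?D'\<^esub> \<phi>) = r' \<odot>\<^bsub>M\<^esub> q' \<phi>"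
        unfolding q' r(2) Tsm[OF r(1)] module_isoD(3)[OF q r(1) T[OF \<phi>]] by (rule smult[OF r(1) qb[OF T[OF \<phi>]]])
    }
  qed
  show "symmetric_map \<iota>' M q'"
    unfolding symmetric_map_def
  proof (intro ballI)
    fix \<phi> \<psi> assume \<phi>: "\<phi> \<in> carrier ?D'" and \<psi>: "\<psi> \<in> carrier ?D'"
    have "?T \<psi> (q (?T \<phi>)) = ?T \<phi> (q (?T \<psi>))"
      using sym T[OF \<phi>] T[OF \<psi>] unfolding symmetric_map_def by blast
    then show "\<psi> (q' \<phi>) = \<phi> (q' \<psi>)" using qb[OF T[OF \<phi>]] qb[OF T[OF \<psi>]] by (simp add: q')
  qed
qed

lemma module_iso_inverse:
  assumes f: "module_iso R M N f" and M: "module_closed R M"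
  shows "module_iso R N M (inv_into (carrier M) f)"
proof -
  note b = module_isoD[OF f]
  let ?g = "inv_into (carrier M) f"
  have gb: "bij_betw ?g (carrier N) (carrier M)" by (rule bij_betw_inv_into[OF b(1)])
  have img: "carrier N = f ` carrier M" using b(1) by (simp add: bij_betw_def)
  have gf: "?g (f x) = x" if "x \<in> carrier M" for x using that b(1) by (simp add: bij_betw_inv_into_left)
  show ?thesis
    unfolding module_iso_def
  proof (intro conjI ballI gb)
    fix x assume "x \<in> carrier N"
    then obtain a where a: "a \<in> carrier M" "x = f a" using img by auto
    {
      fix y assume "y \<in> carrier N"
      then obtain c where c: "c \<in> carrier M" "y = f c" using img by auto
      have "a \<oplus>\<^bsub>M\<^esub> c \<in> carrier M" using M a c by (simp add: module_closed_def)
      then show "?g (x \<oplus>\<^bsub>N\<^esub> y) = ?g x \<oplus>\<^bsub>M\<^esub> ?g y"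
        unfolding a(2) c(2) b(2)[OF a(1) c(1), symmetric] using gf a c by simp
    next
      fix r assume r: "r \<in> carrier R"
      have "r \<odot>\<^bsub>M\<^esub> a \<in> carrier M" using M a r by (simp add: module_closed_def)
      then show "?g (r \<odot>\<^bsub>N\<^esub> x) = r \<odot>\<^bsub>M\<^esub> ?g x"
        unfolding a(2) b(3)[OF r a(1), symmetric] using gf a by simp
    }
  qed
qed

context local_quotient
begin

text \<open>\<open>I\<^sub>\<delta> / I\<^sub>\<delta>\<^sub>+\<^sub>1\<close> as a subquotient of \<open>S\<close> and as a subquotient of \<open>gr(A)\<close>, with the cosets \<open>sc\<close> and \<open>qc\<close> of
polynomials; \<open>\<theta>\<close> is the isomorphism between the two.\<close>

definition P where "P \<delta> = subquotient \<S> (limit_ideal \<delta>) (limit_ideal (Suc \<delta>))"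
definition M where "M \<delta> = subquotient G (I_delta A mm \<delta>) (I_delta A mm (Suc \<delta>))"

definition sc where "sc \<delta> f = limit_ideal (Suc \<delta>) +>\<^bsub>\<S>\<^esub> f"
definition qc where "qc \<delta> f = I_delta A mm (Suc \<delta>) +>\<^bsub>G\<^esub> \<gamma> f"

lemma sc_iff: "g \<in> sc \<delta> f \<longleftrightarrow> g - f \<in> limit_ideal (Suc \<delta>)"
proof
  assume "g \<in> sc \<delta> f" then show "g - f \<in> limit_ideal (Suc \<delta>)" by (auto simp: sc_def a_r_coset_def')
next
  assume "g - f \<in> limit_ideal (Suc \<delta>)"
  then show "g \<in> sc \<delta> f" by (auto simp: sc_def a_r_coset_def' intro!: bexI[of _ "g - f"])
qed

lemma qc_eq_set: "qc \<delta> f = {\<gamma> g | g. g - f \<in> limit_ideal (Suc \<delta>)}"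
proof
  show "qc \<delta> f \<subseteq> {\<gamma> g | g. g - f \<in> limit_ideal (Suc \<delta>)}"
  proof
    fix z assume "z \<in> qc \<delta> f"
    then obtain h where "h \<in> limit_ideal (Suc \<delta>)" "z = \<gamma> (h + f)" by (auto simp: qc_def a_r_coset_def' I_delta_X \<gamma>_hom)
    then show "z \<in> {\<gamma> g | g. g - f \<in> limit_ideal (Suc \<delta>)}" by (intro CollectI exI[of _ "h + f"]) auto
  qed
  show "{\<gamma> g | g. g - f \<in> limit_ideal (Suc \<delta>)} \<subseteq> qc \<delta> f"
  proof
    fix z assume "z \<in> {\<gamma> g | g. g - f \<in> limit_ideal (Suc \<delta>)}"
    then obtain g where g: "z = \<gamma> g" "g - f \<in> limit_ideal (Suc \<delta>)" by auto
    have "z = \<gamma> (g - f) \<oplus>\<^bsub>G\<^esub> \<gamma> f" using g by (simp add: \<gamma>_hom)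
    then show "z \<in> qc \<delta> f" unfolding qc_def a_r_coset_def' I_delta_X using g by blast
  qed
qed

lemma sc_eq: "sc \<delta> f = sc \<delta> g \<longleftrightarrow> f - g \<in> limit_ideal (Suc \<delta>)"
proof
  assume e: "sc \<delta> f = sc \<delta> g"
  have "f \<in> sc \<delta> f" using X_0 by (simp add: sc_iff)
  then show "f - g \<in> limit_ideal (Suc \<delta>)" using e by (simp add: sc_iff)
next
  assume fg: "f - g \<in> limit_ideal (Suc \<delta>)"
  have "h - f \<in> limit_ideal (Suc \<delta>) \<longleftrightarrow> h - g \<in> limit_ideal (Suc \<delta>)" for h
    using X_minus[of "h - g" "Suc \<delta>" "f - g"] X_plus[of "h - f" "Suc \<delta>" "f - g"] fg by auto
  then show "sc \<delta> f = sc \<delta> g" by (auto simp: sc_iff)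
qed

lemma qc_eq: "qc \<delta> f = qc \<delta> g \<longleftrightarrow> f - g \<in> limit_ideal (Suc \<delta>)"
proof
  assume e: "qc \<delta> f = qc \<delta> g"
  have "\<gamma> f \<in> qc \<delta> f" using X_0 by (force simp: qc_eq_set)
  then obtain h where h: "\<gamma> f = \<gamma> h" "h - g \<in> limit_ideal (Suc \<delta>)" using e by (auto simp: qc_eq_set)
  have "(f - h) + (h - g) \<in> limit_ideal (Suc \<delta>)" by (rule X_plus[OF ker_X[OF h(1)] h(2)])
  then show "f - g \<in> limit_ideal (Suc \<delta>)" by simp
next
  assume fg: "f - g \<in> limit_ideal (Suc \<delta>)"
  have "h - f \<in> limit_ideal (Suc \<delta>) \<longleftrightarrow> h - g \<in> limit_ideal (Suc \<delta>)" for h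
    using X_minus[of "h - g" "Suc \<delta>" "f - g"] X_plus[of "h - f" "Suc \<delta>" "f - g"] fg by auto
  then show "qc \<delta> f = qc \<delta> g" by (simp add: qc_eq_set)
qed

lemma carrier_P: "carrier (P \<delta>) = sc \<delta> ` limit_ideal \<delta>"
  by (auto simp: P_def subquotient_def sc_def)

lemma carrier_M: "carrier (M \<delta>) = qc \<delta> ` limit_ideal \<delta>"
  by (auto simp: M_def subquotient_def qc_def I_delta_X)

lemma P_add: "sc \<delta> f \<oplus>\<^bsub>P \<delta>\<^esub> sc \<delta> g = sc \<delta> (f + g)"
proof -
  have "h \<in> sc \<delta> f <+>\<^bsub>\<S>\<^esub> sc \<delta> g \<longleftrightarrow> h - (f + g) \<in> limit_ideal (Suc \<delta>)" for h
  proof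
    assume "h \<in> sc \<delta> f <+>\<^bsub>\<S>\<^esub> sc \<delta> g"
    then obtain a b where ab: "h = a + b" "a - f \<in> limit_ideal (Suc \<delta>)" "b - g \<in> limit_ideal (Suc \<delta>)" by (auto simp: set_add_def' sc_iff)
    then show "h - (f + g) \<in> limit_ideal (Suc \<delta>)" using X_plus[OF ab(2,3)] by (simp add: algebra_simps)
  next
    assume "h - (f + g) \<in> limit_ideal (Suc \<delta>)"
    then have m: "h - g \<in> sc \<delta> f" "g \<in> sc \<delta> g" using X_0 by (simp_all add: sc_iff diff_diff_eq add.commute)
    have "(h - g) \<oplus>\<^bsub>\<S>\<^esub> g \<in> sc \<delta> f <+>\<^bsub>\<S>\<^esub> sc \<delta> g"
      unfolding set_add_def' by (intro UN_I[OF m(1)] UN_I[OF m(2)] singletonI)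
    then show "h \<in> sc \<delta> f <+>\<^bsub>\<S>\<^esub> sc \<delta> g" by simp
  qed
  then have "sc \<delta> f <+>\<^bsub>\<S>\<^esub> sc \<delta> g = sc \<delta> (f + g)"
    by (intro Set.set_eqI) (simp only: sc_iff)
  then show ?thesis by (simp add: P_def subquotient_def)
qed

lemma P_smult: "r \<odot>\<^bsub>P \<delta>\<^esub> sc \<delta> f = sc \<delta> (r * f)"
proof -
  have "sc \<delta> (r * g) = sc \<delta> (r * f)" if "g \<in> sc \<delta> f" for g
    using that X_mult[of "g - f" "Suc \<delta>" r] by (simp add: sc_eq sc_iff right_diff_distrib)
  moreover have "f \<in> sc \<delta> f" using X_0 by (simp add: sc_iff)
  ultimately have "(\<Union>g\<in>sc \<delta> f. sc \<delta> (r * g)) = sc \<delta> (r * f)" by blast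
  then show ?thesis by (simp add: P_def subquotient_def sc_def)
qed

lemma M_add: "qc \<delta> f \<oplus>\<^bsub>M \<delta>\<^esub> qc \<delta> g = qc \<delta> (f + g)"
proof -
  have "qc \<delta> f <+>\<^bsub>G\<^esub> qc \<delta> g = qc \<delta> (f + g)"
  proof
    show "qc \<delta> f <+>\<^bsub>G\<^esub> qc \<delta> g \<subseteq> qc \<delta> (f + g)"
    proof
      fix z assume "z \<in> qc \<delta> f <+>\<^bsub>G\<^esub> qc \<delta> g"
      then obtain a b where ab: "z = \<gamma> (a + b)" "a - f \<in> limit_ideal (Suc \<delta>)" "b - g \<in> limit_ideal (Suc \<delta>)"
        by (auto simp: set_add_def' qc_eq_set \<gamma>_hom)
      have "(a + b) - (f + g) \<in> limit_ideal (Suc \<delta>)" using X_plus[OF ab(2,3)] by (simp add: algebra_simps)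
      then show "z \<in> qc \<delta> (f + g)" using ab(1) by (auto simp: qc_eq_set)
    qed
    show "qc \<delta> (f + g) \<subseteq> qc \<delta> f <+>\<^bsub>G\<^esub> qc \<delta> g"
    proof
      fix z assume "z \<in> qc \<delta> (f + g)"
      then obtain h where h: "z = \<gamma> h" "h - (f + g) \<in> limit_ideal (Suc \<delta>)" by (auto simp: qc_eq_set)
      have e: "(h - g) - f = h - (f + g)" by simp
      have "\<gamma> (h - g) \<in> qc \<delta> f" unfolding qc_eq_set
        by (intro CollectI exI[of _ "h - g"] conjI refl) (simp only: e h(2))
      moreover have "\<gamma> g \<in> qc \<delta> g" unfolding qc_eq_set using X_0 by (intro CollectI exI[of _ g]) simp
      moreover have "z = \<gamma> (h - g) \<oplus>\<^bsub>G\<^esub> \<gamma> g" using h by (simp add: \<gamma>_hom)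
      ultimately show "z \<in> qc \<delta> f <+>\<^bsub>G\<^esub> qc \<delta> g" unfolding set_add_def' by blast
    qed
  qed
  then show ?thesis by (simp add: M_def subquotient_def)
qed

lemma M_smult: "\<gamma> r \<odot>\<^bsub>M \<delta>\<^esub> qc \<delta> f = qc \<delta> (r * f)"
proof -
  have e: "qc \<delta> (r * g) = qc \<delta> (r * f)" if "g - f \<in> limit_ideal (Suc \<delta>)" for g
    using that X_mult[of "g - f" "Suc \<delta>" r] by (simp add: qc_eq right_diff_distrib)
  have "\<gamma> r \<odot>\<^bsub>M \<delta>\<^esub> qc \<delta> f = (\<Union>x\<in>qc \<delta> f. I_delta A mm (Suc \<delta>) +>\<^bsub>G\<^esub> (\<gamma> r \<otimes>\<^bsub>G\<^esub> x))"
    by (simp add: M_def subquotient_def)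
  also have "\<dots> = (\<Union>g\<in>{g. g - f \<in> limit_ideal (Suc \<delta>)}. qc \<delta> (r * g))"
    unfolding qc_eq_set[of \<delta> f] by (auto simp: \<gamma>_hom qc_def)
  also have "\<dots> = qc \<delta> (r * f)" proof
    show "(\<Union>g\<in>{g. g - f \<in> limit_ideal (Suc \<delta>)}. qc \<delta> (r * g)) \<subseteq> qc \<delta> (r * f)" using e by blast
    have "f \<in> {g. g - f \<in> limit_ideal (Suc \<delta>)}" using X_0 by simp
    then show "qc \<delta> (r * f) \<subseteq> (\<Union>g\<in>{g. g - f \<in> limit_ideal (Suc \<delta>)}. qc \<delta> (r * g))" by blast
  qed
  finally show ?thesis .
qed

lemma P_closed: "module_closed \<S> (P \<delta>)"
  unfolding module_closed_def carrier_P by (auto simp: P_add P_smult intro!: imageI X_plus X_mult)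

lemma M_closed: "module_closed G (M \<delta>)"
  unfolding module_closed_def carrier_M carrier_gr by (auto simp: M_add M_smult intro!: imageI X_plus X_mult)

definition \<theta> where "\<theta> \<delta> Y = qc \<delta> (SOME f. f \<in> Y)"

lemma some_sc: "(SOME g. g \<in> sc \<delta> f) - f \<in> limit_ideal (Suc \<delta>)"
proof -
  have "f \<in> sc \<delta> f" using X_0 by (simp add: sc_iff)
  then show ?thesis using someI[of "\<lambda>g. g \<in> sc \<delta> f" f] by (simp add: sc_iff)
qed

lemma \<theta>_sc: "\<theta> \<delta> (sc \<delta> f) = qc \<delta> f"
  unfolding \<theta>_def by (simp add: qc_eq some_sc)

lemma \<theta>_iso: "module_iso \<S> (P \<delta>) (restrict_scalars \<gamma> (M \<delta>)) (\<theta> \<delta>)"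
  unfolding module_iso_def
proof (intro conjI ballI)
  show "bij_betw (\<theta> \<delta>) (carrier (P \<delta>)) (carrier (restrict_scalars \<gamma> (M \<delta>)))"
    unfolding bij_betw_def restrict_scalars_def carrier_P
    by (auto simp: inj_on_def \<theta>_sc qc_eq sc_eq carrier_M image_image)
qed (auto simp: restrict_scalars_def carrier_P P_add P_smult \<theta>_sc M_add M_smult)

lemma carrier_Q: "carrier (Q_module A mm \<delta>) = {grc (Qd \<delta>) F | F. \<forall>i. F i \<in> Nu \<delta> i}"
  unfolding Q_module_def images
proof (rule carrier_graded_module[OF subs(4)])
  fix i assume "s < i"
  then have "Nu \<delta> i = Dn \<delta> i" by (simp add: Nu_def Dn_def Fl_top)
  then show "Nu \<delta> i \<subseteq> Qd \<delta> i" unfolding Qd_def using psum_left[OF subs(1)] by simp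
qed

lemma Q_add: "grc (Qd \<delta>) F \<oplus>\<^bsub>Q_module A mm \<delta>\<^esub> grc (Qd \<delta>) F' = grc (Qd \<delta>) (\<lambda>i. F i + F' i)"
  unfolding Q_module_def images by (rule add_graded_module[OF subs(4)])

lemma Q_smult:
  assumes F: "\<forall>i. F i \<in> Nu \<delta> i"
  shows "\<gamma> h \<odot>\<^bsub>Q_module A mm \<delta>\<^esub> grc (Qd \<delta>) F = grc (Qd \<delta>) (\<lambda>i. \<Sum>j\<le>i. hom_comp j h * F (i - j))"
  unfolding Q_module_def images smult_graded_module
proof (rule \<gamma>_smult_grc[OF subs(4)])
  fix j k x y assume xy: "x \<in> D1 j" "y - F k \<in> Qd \<delta> k"
  have "(y - F k) + F k \<in> Nu \<delta> k" using xy F Qd_Nu by (intro is_sub_simps(4)[OF subs(1)]) auto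
  then have "x * y \<in> Dn \<delta> (j + k)" using Nu_D1[OF xy(1), of y \<delta> k] by simp
  then show "x * y \<in> Qd \<delta> (j + k)" unfolding Qd_def using psum_left[OF subs(1)] by blast
qed (rule Qd_mult)

lemma Nu_conv:
  assumes F: "\<forall>i. F i \<in> Nu \<delta> i"
  shows "\<forall>i. (\<Sum>j\<le>i. hom_comp j h * F (i - j)) \<in> Nu \<delta> i"
proof
  fix i show "(\<Sum>j\<le>i. hom_comp j h * F (i - j)) \<in> Nu \<delta> i"
  proof (rule is_sub_sum[OF subs(1)])
    fix j assume "j \<in> {..i}"
    then show "hom_comp j h * F (i - j) \<in> Nu \<delta> i"
      using Nu_mult[OF hom_comp_Fl[of j h], of "F (i - j)" \<delta> "i - j"] F by simp
  qed
qed

lemma Q_closed: "module_closed G (Q_module A mm \<delta>)"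
  unfolding module_closed_def
proof (intro conjI ballI)
  fix x assume "x \<in> carrier (Q_module A mm \<delta>)"
  then obtain F where F: "x = grc (Qd \<delta>) F" "\<forall>i. F i \<in> Nu \<delta> i" unfolding carrier_Q by blast
  {
    fix y assume "y \<in> carrier (Q_module A mm \<delta>)"
    then obtain F' where F': "y = grc (Qd \<delta>) F'" "\<forall>i. F' i \<in> Nu \<delta> i" unfolding carrier_Q by blast
    have "\<forall>i. F i + F' i \<in> Nu \<delta> i" using F F' is_sub_simps(4)[OF subs(1)] by blast
    then show "x \<oplus>\<^bsub>Q_module A mm \<delta>\<^esub> y \<in> carrier (Q_module A mm \<delta>)"
      unfolding F(1) F'(1) Q_add carrier_Q by blast
  next
    fix r assume "r \<in> carrier G"
    then obtain h where h: "r = \<gamma> h" by (auto simp: carrier_gr)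
    show "r \<odot>\<^bsub>Q_module A mm \<delta>\<^esub> x \<in> carrier (Q_module A mm \<delta>)"
      unfolding h F(1) Q_smult[OF F(2)] carrier_Q using Nu_conv[OF F(2)] by blast
  }
qed

definition gq where "gq \<delta> F = I_delta A mm (Suc \<delta>) +>\<^bsub>G\<^esub> grc D1 F"

lemma Nu_Nh: "Nu \<delta> i \<subseteq> Nh \<delta> i"
  unfolding Nh_def by (rule psum_left[OF D1_sub])

lemma gq_lift:
  assumes F: "\<forall>i. F i \<in> Nu \<delta> i"
  obtains f where "f \<in> limit_ideal \<delta>" "grc D1 F = \<gamma> f" "gq \<delta> F = qc \<delta> f" "\<And>i. F i - hom_comp i f \<in> D1 i"
proof -
  have "\<forall>i. F i \<in> Nh \<delta> i" using F Nu_Nh by blast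
  from lift_to_X[OF this] obtain f where f: "f \<in> limit_ideal \<delta>" "grc D1 F = \<gamma> f" by blast
  show thesis
  proof (rule that[OF f])
    show "gq \<delta> F = qc \<delta> f" by (simp add: gq_def qc_def f)
    show "F i - hom_comp i f \<in> D1 i" for i using f(2) by (simp add: \<gamma>_grc grc_eq[OF D1_sub])
  qed
qed

text \<open>A family of representatives in \<open>numer\<close> lies in \<open>I\<^sub>\<delta>\<^sub>+\<^sub>1\<close> modulo higher powers of \<open>\<mm>\<close> exactly if it lies in
\<open>Q_denom\<close>; this is the modular law for \<open>\<mm>\<^sup>i\<^sup>+\<^sup>1\<close> and the two annihilators.\<close>

lemma gq_eq:
  assumes F: "\<forall>i. F i \<in> Nu \<delta> i" and F': "\<forall>i. F' i \<in> Nu \<delta> i"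
  shows "gq \<delta> F = gq \<delta> F' \<longleftrightarrow> grc (Qd \<delta>) F = grc (Qd \<delta>) F'"
proof -
  obtain f where f: "f \<in> limit_ideal \<delta>" "gq \<delta> F = qc \<delta> f" "\<And>i. F i - hom_comp i f \<in> D1 i" by (rule gq_lift[OF F]) (blast intro: that)
  obtain f' where f': "f' \<in> limit_ideal \<delta>" "gq \<delta> F' = qc \<delta> f'" "\<And>i. F' i - hom_comp i f' \<in> D1 i" by (rule gq_lift[OF F']) (blast intro: that)
  have "gq \<delta> F = gq \<delta> F' \<longleftrightarrow> (\<forall>i. hom_comp i f - hom_comp i f' \<in> Nh (Suc \<delta>) i)"
    unfolding f(2) f'(2) qc_eq by (simp add: limit_ideal_def)
  also have "\<dots> \<longleftrightarrow> (\<forall>i. F i - F' i \<in> Qd \<delta> i)"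
  proof (intro iff_allI)
    fix i
    have D: "(F i - hom_comp i f) - (F' i - hom_comp i f') \<in> D1 i" by (rule is_sub_simps(2)[OF D1_sub f(3) f'(3)])
    then have D': "(F i - hom_comp i f) - (F' i - hom_comp i f') \<in> Nh (Suc \<delta>) i"
      unfolding Nh_def using psum_right[OF subs(1)] by blast
    have FN: "F i - F' i \<in> Nu \<delta> i" using F F' is_sub_simps(2)[OF subs(1)] by blast
    have "hom_comp i f - hom_comp i f' \<in> Nh (Suc \<delta>) i \<longleftrightarrow> F i - F' i \<in> Nh (Suc \<delta>) i"
    proof
      assume "hom_comp i f - hom_comp i f' \<in> Nh (Suc \<delta>) i"
      from is_sub_simps(4)[OF subs(2) D' this] show "F i - F' i \<in> Nh (Suc \<delta>) i" by (simp add: algebra_simps)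
    next
      assume "F i - F' i \<in> Nh (Suc \<delta>) i"
      from is_sub_simps(2)[OF subs(2) this D'] show "hom_comp i f - hom_comp i f' \<in> Nh (Suc \<delta>) i" by (simp add: algebra_simps)
    qed
    also have "\<dots> \<longleftrightarrow> F i - F' i \<in> Qd \<delta> i"
    proof
      assume "F i - F' i \<in> Nh (Suc \<delta>) i"
      then obtain a b where ab: "F i - F' i = a + b" "a \<in> Nu (Suc \<delta>) i" "b \<in> D1 i" by (auto simp: Nh_def psum_def)
      have "(F i - F' i) - a \<in> Nu \<delta> i" using is_sub_simps(2)[OF subs(1) FN] ab(2) Nu_Suc by blast
      then have "b \<in> Dn \<delta> i" using ab by (auto simp: Dn_def Nu_def)
      then have "b + a \<in> Qd \<delta> i" unfolding Qd_def by (rule psumI[OF _ ab(2)])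
      then show "F i - F' i \<in> Qd \<delta> i" unfolding ab(1) by (simp add: add.commute)
    next
      assume "F i - F' i \<in> Qd \<delta> i"
      then obtain a b where ab: "F i - F' i = a + b" "a \<in> Dn \<delta> i" "b \<in> Nu (Suc \<delta>) i" by (auto simp: Qd_def psum_def)
      have "b + a \<in> Nh (Suc \<delta>) i" unfolding Nh_def by (rule psumI[OF ab(3)]) (use ab(2) in \<open>simp add: Dn_def\<close>)
      then show "F i - F' i \<in> Nh (Suc \<delta>) i" unfolding ab(1) by (simp add: add.commute)
    qed
    finally show "hom_comp i f - hom_comp i f' \<in> Nh (Suc \<delta>) i \<longleftrightarrow> F i - F' i \<in> Qd \<delta> i" .
  qed
  also have "\<dots> \<longleftrightarrow> grc (Qd \<delta>) F = grc (Qd \<delta>) F'" by (simp add: grc_eq[OF subs(4)])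
  finally show ?thesis .
qed

definition Qmap where "Qmap \<delta> g = gq \<delta> (SOME F. g = grc (Qd \<delta>) F \<and> (\<forall>i. F i \<in> Nu \<delta> i))"

lemma Qmap_grc: "\<forall>i. F i \<in> Nu \<delta> i \<Longrightarrow> Qmap \<delta> (grc (Qd \<delta>) F) = gq \<delta> F"
proof -
  assume F: "\<forall>i. F i \<in> Nu \<delta> i"
  let ?P = "\<lambda>F'. grc (Qd \<delta>) F = grc (Qd \<delta>) F' \<and> (\<forall>i. F' i \<in> Nu \<delta> i)"
  have "?P (SOME F'. ?P F')" by (rule someI[of ?P F]) (use F in simp)
  then show ?thesis unfolding Qmap_def using gq_eq[of "SOME F'. ?P F'" \<delta> F] F by simp
qed

lemma Qmap_iso: "module_iso G (Q_module A mm \<delta>) (M \<delta>) (Qmap \<delta>)"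
  unfolding module_iso_def
proof (intro conjI ballI)
  show "bij_betw (Qmap \<delta>) (carrier (Q_module A mm \<delta>)) (carrier (M \<delta>))"
    unfolding bij_betw_def
  proof
    show "inj_on (Qmap \<delta>) (carrier (Q_module A mm \<delta>))"
      unfolding carrier_Q by (rule inj_onI) (auto simp: Qmap_grc gq_eq)
    show "Qmap \<delta> ` carrier (Q_module A mm \<delta>) = carrier (M \<delta>)"
    proof
      show "Qmap \<delta> ` carrier (Q_module A mm \<delta>) \<subseteq> carrier (M \<delta>)"
      proof
        fix z assume "z \<in> Qmap \<delta> ` carrier (Q_module A mm \<delta>)"
        then obtain F where F: "z = gq \<delta> F" "\<forall>i. F i \<in> Nu \<delta> i" unfolding carrier_Q using Qmap_grc by blast
        obtain f where "f \<in> limit_ideal \<delta>" "gq \<delta> F = qc \<delta> f" by (rule gq_lift[OF F(2)]) (blast intro: that)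
        then show "z \<in> carrier (M \<delta>)" using F(1) by (auto simp: carrier_M)
      qed
      show "carrier (M \<delta>) \<subseteq> Qmap \<delta> ` carrier (Q_module A mm \<delta>)"
      proof
        fix z assume "z \<in> carrier (M \<delta>)"
        then obtain f where f: "f \<in> limit_ideal \<delta>" "z = qc \<delta> f" by (auto simp: carrier_M)
        have "\<forall>i. \<exists>h. h \<in> Nu \<delta> i \<and> hom_comp i f - h \<in> D1 i" using f(1) by (force simp: limit_ideal_def Nh_def psum_def)
        then obtain F where F: "\<And>i. F i \<in> Nu \<delta> i" "\<And>i. hom_comp i f - F i \<in> D1 i" by metis
        have "\<gamma> f = grc D1 F" using F(2) by (simp add: \<gamma>_grc grc_eq[OF D1_sub])
        then have "z = Qmap \<delta> (grc (Qd \<delta>) F)" using f(2) F(1) by (simp add: Qmap_grc gq_def qc_def)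
        then show "z \<in> Qmap \<delta> ` carrier (Q_module A mm \<delta>)" unfolding carrier_Q using F(1) by blast
      qed
    qed
  qed
  fix x assume "x \<in> carrier (Q_module A mm \<delta>)"
  then obtain F where F: "x = grc (Qd \<delta>) F" "\<forall>i. F i \<in> Nu \<delta> i" unfolding carrier_Q by blast
  obtain f where f: "f \<in> limit_ideal \<delta>" "grc D1 F = \<gamma> f" "gq \<delta> F = qc \<delta> f" by (rule gq_lift[OF F(2)]) (blast intro: that)
  {
    fix y assume "y \<in> carrier (Q_module A mm \<delta>)"
    then obtain F' where F': "y = grc (Qd \<delta>) F'" "\<forall>i. F' i \<in> Nu \<delta> i" unfolding carrier_Q by blast
    obtain f' where f': "f' \<in> limit_ideal \<delta>" "grc D1 F' = \<gamma> f'" "gq \<delta> F' = qc \<delta> f'" by (rule gq_lift[OF F'(2)]) (blast intro: that)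
    have N: "\<forall>i. F i + F' i \<in> Nu \<delta> i" using F F' is_sub_simps(4)[OF subs(1)] by blast
    have "grc D1 (\<lambda>i. F i + F' i) = \<gamma> f \<oplus>\<^bsub>G\<^esub> \<gamma> f'"
      unfolding f(2)[symmetric] f'(2)[symmetric] gr_simps(5) by (rule grc_add[OF D1_sub, symmetric])
    then have "gq \<delta> (\<lambda>i. F i + F' i) = qc \<delta> (f + f')" by (simp add: gq_def qc_def \<gamma>_hom)
    then show "Qmap \<delta> (x \<oplus>\<^bsub>Q_module A mm \<delta>\<^esub> y) = Qmap \<delta> x \<oplus>\<^bsub>M \<delta>\<^esub> Qmap \<delta> y"
      unfolding F(1) F'(1) Q_add Qmap_grc[OF N] Qmap_grc[OF F(2)] Qmap_grc[OF F'(2)] f(3) f'(3) M_add .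
  next
    fix r assume "r \<in> carrier G"
    then obtain h where h: "r = \<gamma> h" by (auto simp: carrier_gr)
    have "grc D1 (\<lambda>i. \<Sum>j\<le>i. hom_comp j h * F (i - j)) = graded_mult A (\<lambda>i. \<pi> ` D1 i) (\<gamma> h) (grc D1 F)"
    proof (rule \<gamma>_smult_grc[OF D1_sub, symmetric])
      fix j k x y assume xy: "x \<in> D1 j" "y - F k \<in> D1 k"
      have "(y - F k) + F k \<in> Fl k" using xy F(2) Fl_antimono[of k "Suc k"] by (intro is_sub_simps(4)[OF Fl_sub]) (auto simp: Nu_def)
      then show "x * y \<in> D1 (j + k)" using Fl_mult[OF xy(1), of y k] by simp
    next
      fix j k x y assume "x \<in> Fl j" "y \<in> D1 k"
      then show "x * y \<in> D1 (j + k)" using Fl_mult[of x j y "Suc k"] by simp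
    qed
    also have "\<dots> = \<gamma> (h * f)" using \<gamma>_hom(2)[of h f] by (simp add: f(2) gr_simps(2))
    finally have "gq \<delta> (\<lambda>i. \<Sum>j\<le>i. hom_comp j h * F (i - j)) = qc \<delta> (h * f)" by (simp add: gq_def qc_def)
    then show "Qmap \<delta> (r \<odot>\<^bsub>Q_module A mm \<delta>\<^esub> x) = r \<odot>\<^bsub>M \<delta>\<^esub> Qmap \<delta> x"
      unfolding h F(1) Q_smult[OF F(2)] Qmap_grc[OF Nu_conv[OF F(2)]] Qmap_grc[OF F(2)] f(3) M_smult .
  }
qed

lemma Q_iso:
  "\<exists>f. module_iso G (Q_module A mm \<delta>) (subquotient G (I_delta A mm \<delta>) (I_delta A mm (\<delta> + 1))) f \<and>
    (\<forall>x. (\<forall>i. x i \<in> numer A mm \<delta> i) \<longrightarrow>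
      f (\<lambda>i. Q_denom A mm \<delta> i +>\<^bsub>A\<^esub> x i) =
        I_delta A mm (\<delta> + 1) +>\<^bsub>G\<^esub> (\<lambda>i. ideal_pow A mm (i + 1) +>\<^bsub>A\<^esub> x i))"
proof (intro exI conjI allI impI)
  show "module_iso G (Q_module A mm \<delta>) (subquotient G (I_delta A mm \<delta>) (I_delta A mm (\<delta> + 1))) (Qmap \<delta>)"
    using Qmap_iso by (simp add: M_def)
  fix x assume x: "\<forall>i. x i \<in> numer A mm \<delta> i"
  then have "\<forall>i. \<exists>h. x i = \<pi> h \<and> h \<in> Nu \<delta> i" unfolding images by auto
  then obtain F where F: "\<And>i. x i = \<pi> (F i)" "\<forall>i. F i \<in> Nu \<delta> i" by metis
  have e: "(\<lambda>i. Q_denom A mm \<delta> i +>\<^bsub>A\<^esub> x i) = grc (Qd \<delta>) F" unfolding F(1) images grc_coset ..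
  have e': "(\<lambda>i. ideal_pow A mm (i + 1) +>\<^bsub>A\<^esub> x i) = grc D1 F" unfolding F(1) ideal_pow_Fl grc_coset by simp
  show "Qmap \<delta> (\<lambda>i. Q_denom A mm \<delta> i +>\<^bsub>A\<^esub> x i) =
      I_delta A mm (\<delta> + 1) +>\<^bsub>G\<^esub> (\<lambda>i. ideal_pow A mm (i + 1) +>\<^bsub>A\<^esub> x i)"
    unfolding e e' Qmap_grc[OF F(2)] gq_def by simp
qed

text \<open>Transport along the inverse of the isomorphism from \<open>\<Q>(\<delta>)\<close> to \<open>I\<^sub>\<delta> / I\<^sub>\<delta>\<^sub>+\<^sub>1\<close>.\<close>

lemma self_dual_Q:
  assumes q: "module_iso G (dual_module \<iota> (M \<delta>)) (M \<delta>) q" and sym: "symmetric_map \<iota> (M \<delta>) q"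
    and \<iota>: "\<And>c. \<iota> c \<in> carrier G"
  shows "self_dual G \<iota> (Q_module A mm \<delta>)"
proof -
  let ?g = "inv_into (carrier (Q_module A mm \<delta>)) (Qmap \<delta>)"
  have "module_iso G (M \<delta>) (restrict_scalars (\<lambda>r. r) (Q_module A mm \<delta>)) ?g"
    using module_iso_inverse[OF Qmap_iso Q_closed, of \<delta>] by (simp add: restrict_scalars_def module_iso_def)
  from transport_quadric(1)[OF this _ \<iota> _ M_closed q sym refl, of G \<iota>] show ?thesis
    unfolding self_dual_def by auto
qed

end

section \<open>Adapted bases and the flag\<close>

locale adapted_local = adapted_basis I \<eta> d E n \<sigma> p + local_quotient I s
  for I :: "('n::finite, 'k::field) mpoly set" and \<eta> d E n \<sigma> p s
begin

abbreviation l0 where "l0 \<equiv> coordinate (\<lambda>c. c) (0 :: 'k)"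
abbreviation e0 where "e0 \<equiv> basis_elt (\<lambda>c. c) (0 :: 'k)"

text \<open>At \<open>v = 0\<close> only monomials of degree exactly \<open>n a\<close> have a nonzero \<open>a\<close>-th coordinate.\<close>

lemma l0_eq:
  assumes a: "a < d" shows "l0 a f = \<kappa> a (hom_comp (n a) f)"
proof (rule linear_form_eqI[where \<phi> = "l0 a" and \<psi> = "\<lambda>f. \<kappa> a (hom_comp (n a) f)"])
  show "linear_form (\<lambda>f. \<kappa> a (hom_comp (n a) f))"
    unfolding linear_form_def by (simp add: \<kappa>_simps)
  show "l0 a (mon \<alpha>) = \<kappa> a (hom_comp (n a) (mon \<alpha>))" for \<alpha>
    using \<kappa>_mon[OF a, of \<alpha>] by (cases "n a < mdeg \<alpha>") (auto simp: coordinate_mon \<kappa>_simps power_0_left)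
qed simp

lemma sum_E_\<kappa>: "b < d \<Longrightarrow> B \<subseteq> {..<d} \<Longrightarrow> \<kappa> b (\<Sum>a\<in>B. cst (c a) * E a) = (if b \<in> B then c b else 0)"
proof -
  assume b: "b < d" and B: "B \<subseteq> {..<d}"
  have "\<kappa> b (\<Sum>a\<in>B. cst (c a) * E a) = (\<Sum>a\<in>B. if a = b then c b else 0)"
    unfolding \<kappa>_simps by (rule sum.cong) (use b B \<kappa>_E in auto)
  then show ?thesis using finite_subset[OF B] by simp
qed

text \<open>The coordinates see orders: one implication is the filtration clause for the dual basis, the other one is the
order of the \<open>E a\<close>.\<close>

lemma Fl_\<kappa>: "f \<in> Fl i \<longleftrightarrow> (\<forall>a<d. n a < i \<longrightarrow> \<kappa> a f = 0)"
proof
  assume "f \<in> Fl i"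
  then obtain g where g: "g \<in> ord_ge i" "f - g \<in> I" by (auto simp: Fl_iff)
  show "\<forall>a<d. n a < i \<longrightarrow> \<kappa> a f = 0"
    using g \<kappa>_ord by (auto simp: I_iff \<kappa>_simps(5))
next
  assume *: "\<forall>a<d. n a < i \<longrightarrow> \<kappa> a f = 0"
  have "(\<Sum>a<d. cst (\<kappa> a f) * E a) \<in> ord_ge i"
  proof (rule ord_ge_sum)
    fix a assume a: "a \<in> {..<d}"
    then show "cst (\<kappa> a f) * E a \<in> ord_ge i"
      using * E_ord[of a] ord_ge_antimono[of i "n a"] by (cases "n a < i") (auto intro!: ord_ge_closed(4))
  qed
  then show "f \<in> Fl i" using expand_mod_I[of f] by (auto simp: Fl_iff)
qed

text \<open>\<open>(0 : \<mm>\<^sup>e)\<close> is the orthogonal complement of \<open>\<mm>\<^sup>e\<close>, and \<open>\<sigma>\<close> exchanges an adapted basis with its dual.\<close>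

lemma L_\<kappa>: "f \<in> L e \<longleftrightarrow> (\<forall>a<d. e \<le> n (\<sigma> a) \<longrightarrow> \<kappa> a f = 0)"
proof
  assume f: "f \<in> L e"
  show "\<forall>a<d. e \<le> n (\<sigma> a) \<longrightarrow> \<kappa> a f = 0"
  proof (intro allI impI)
    fix a assume a: "a < d" "e \<le> n (\<sigma> a)"
    have "f * E (\<sigma> a) \<in> I" using f E_ord[OF \<sigma>(1)[OF a(1)]] ord_ge_antimono[OF a(2)] by (auto simp: L_def)
    then have "\<eta> (f * E (\<sigma> a) * 1) = 0" unfolding radical by blast
    then show "\<kappa> a f = 0" by (simp add: \<kappa>_def)
  qed
next
  assume *: "\<forall>a<d. e \<le> n (\<sigma> a) \<longrightarrow> \<kappa> a f = 0"
  note \<eta> = linear_form_simps[OF \<eta>_linear]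
  have pair: "\<eta> (f * g) = 0" if g: "g \<in> ord_ge e" for g
  proof -
    have "\<eta> ((f - (\<Sum>a<d. cst (\<kappa> a f) * E a)) * g) = 0" using expand_mod_I[of f] unfolding radical by blast
    then have "\<eta> (f * g) = \<eta> (\<Sum>a<d. cst (\<kappa> a f) * (E a * g))"
      by (simp add: left_diff_distrib \<eta> sum_distrib_right mult.assoc)
    also have "\<dots> = (\<Sum>a<d. \<kappa> a f * \<eta> (E a * g))" by (simp add: \<eta>)
    also have "\<dots> = 0"
    proof (rule sum.neutral, intro ballI)
      fix a assume "a \<in> {..<d}"
      then have a: "a < d" by simp
      show "\<kappa> a f * \<eta> (E a * g) = 0"
      proof (cases "e \<le> n (\<sigma> a)")
        case False
        then have "\<kappa> (\<sigma> a) g = 0" using \<kappa>_ord[OF \<sigma>(1)[OF a] g] by simp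
        then show ?thesis using a \<sigma> p by (simp add: \<kappa>_def mult.commute)
      qed (use * a in simp)
    qed
    finally show ?thesis .
  qed
  show "f \<in> L e"
    unfolding L_def
  proof (intro CollectI ballI)
    fix g :: "('n, 'k) mpoly" assume g: "g \<in> ord_ge e"
    have "\<eta> (f * g * h) = 0" for h
      using pair[of "g * h"] ord_ge_mult[OF g, of h 0] by (simp add: mult.assoc)
    then show "f * g \<in> I" unfolding radical by blast
  qed
qed

lemma Nh_\<kappa>: "f \<in> Nh \<delta> i \<longleftrightarrow> (\<forall>a<d. n a < i \<or> (n a = i \<and> s + 1 - i - \<delta> \<le> n (\<sigma> a)) \<longrightarrow> \<kappa> a f = 0)"
proof
  assume "f \<in> Nh \<delta> i"
  then obtain u v where uv: "f = u + v" "u \<in> Nu \<delta> i" "v \<in> Fl (Suc i)" by (auto simp: Nh_def psum_def)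
  show "\<forall>a<d. n a < i \<or> (n a = i \<and> s + 1 - i - \<delta> \<le> n (\<sigma> a)) \<longrightarrow> \<kappa> a f = 0"
    using uv(2,3) unfolding uv(1) Nu_def \<kappa>_simps by (auto simp: Fl_\<kappa> L_\<kappa>)
next
  assume *: "\<forall>a<d. n a < i \<or> (n a = i \<and> s + 1 - i - \<delta> \<le> n (\<sigma> a)) \<longrightarrow> \<kappa> a f = 0"
  let ?B = "{a. a < d \<and> n a = i}"
  let ?u = "\<Sum>a\<in>?B. cst (\<kappa> a f) * E a"
  have k: "\<kappa> b ?u = (if b \<in> ?B then \<kappa> b f else 0)" if "b < d" for b by (rule sum_E_\<kappa>[OF that]) auto
  have "?u \<in> Nu \<delta> i" unfolding Nu_def using * by (auto simp: Fl_\<kappa> L_\<kappa> k)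
  moreover have "f - ?u \<in> Fl (Suc i)" unfolding Fl_\<kappa> using * by (auto simp: k \<kappa>_simps(5) less_Suc_eq)
  ultimately have "?u + (f - ?u) \<in> Nh \<delta> i" unfolding Nh_def by (rule psumI)
  then show "f \<in> Nh \<delta> i" by simp
qed

text \<open>So \<open>I\<^sub>\<delta>\<close> is spanned by the classes of the \<open>E a\<close> with \<open>w a \<le> s - \<delta>\<close>: in degree \<open>i = n a\<close> the condition
\<open>s + 1 - i - \<delta> \<le> n (\<sigma> a)\<close> from \<open>(0 : \<mm>\<^sup>s\<^sup>+\<^sup>1\<^sup>-\<^sup>i\<^sup>-\<^sup>\<delta>)\<close> is \<open>w a > s - \<delta>\<close>.\<close>

lemma X_l0: "f \<in> limit_ideal \<delta> \<longleftrightarrow> (\<forall>a<d. s < w a + \<delta> \<longrightarrow> l0 a f = 0)"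
proof -
  have "f \<in> limit_ideal \<delta> \<longleftrightarrow> (\<forall>i. \<forall>a<d. n a = i \<and> s + 1 - i - \<delta> \<le> n (\<sigma> a) \<longrightarrow> \<kappa> a (hom_comp i f) = 0)"
    unfolding limit_ideal_def Nh_\<kappa> using \<kappa>_ord[OF _ ord_ge_simps(3)] by auto
  also have "\<dots> \<longleftrightarrow> (\<forall>a<d. s < w a + \<delta> \<longrightarrow> l0 a f = 0)"
  proof -
    have "s + 1 - n a - \<delta> \<le> n (\<sigma> a) \<longleftrightarrow> s < w a + \<delta>" for a by (auto simp: w_def)
    then show ?thesis by (auto simp: l0_eq)
  qed
  finally show ?thesis .
qed

lemma l0_e0: "a < d \<Longrightarrow> b < d \<Longrightarrow> l0 a (e0 b) = (if a = b then 1 else 0)"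
  by (rule coordinate_basis_elt[OF id_comm_ring_hom])

lemma w_le: "a < d \<Longrightarrow> w a \<le> s"
proof (rule ccontr)
  assume a: "a < d" and "\<not> w a \<le> s"
  moreover have "e0 a \<in> limit_ideal 0" by (simp add: X_zero)
  ultimately have "l0 a (e0 a) = 0" by (simp add: X_l0)
  then show False using l0_e0[OF a a] by simp
qed

lemma e0_X: "a < d \<Longrightarrow> e0 a \<in> limit_ideal \<delta> \<longleftrightarrow> w a + \<delta> \<le> s"
  using l0_e0[of a a] by (auto simp: X_l0 l0_e0 not_less)

lemma degeneration_0: "degeneration (\<lambda>c. c) 0 = limit_ideal (Suc s)"
  by (auto simp: degeneration_def X_l0)

text \<open>The indices of weight \<open>s - \<delta>\<close>, which give a basis of \<open>I\<^sub>\<delta> / I\<^sub>\<delta>\<^sub>+\<^sub>1\<close>.\<close>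

definition weight_block where "weight_block \<delta> = {a. a < d \<and> w a + \<delta> = s}"

lemma weight_block_sub: "weight_block \<delta> \<subseteq> {..<d}" and finite_weight_block: "finite (weight_block \<delta>)"
  by (auto simp: weight_block_def)

lemma \<sigma>_weight_block: "bij_betw \<sigma> (weight_block \<delta>) (weight_block \<delta>)"
  by (rule bij_betw_byWitness[where f' = \<sigma>]) (auto simp: weight_block_def \<sigma> w_\<sigma>)

lemma sum_e0_l0: "b < d \<Longrightarrow> B \<subseteq> {..<d} \<Longrightarrow> l0 b (\<Sum>a\<in>B. cst (c a) * e0 a) = (if b \<in> B then c b else 0)"
proof -
  assume b: "b < d" and B: "B \<subseteq> {..<d}"
  have "l0 b (\<Sum>a\<in>B. cst (c a) * e0 a) = (\<Sum>a\<in>B. if a = b then c b else 0)"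
    unfolding coordinate_simps by (rule sum.cong) (use b B l0_e0 in auto)
  then show ?thesis using finite_subset[OF B] by simp
qed

lemma expand_piece: "f \<in> limit_ideal \<delta> \<Longrightarrow> f - (\<Sum>a\<in>weight_block \<delta>. cst (l0 a f) * e0 a) \<in> limit_ideal (Suc \<delta>)"
  unfolding X_l0[of _ "Suc \<delta>"] coordinate_simps(5)
  using sum_e0_l0[OF _ weight_block_sub[of \<delta>], of _ "\<lambda>a. l0 a f"] by (auto simp: X_l0 weight_block_def)

lemma free_X: "free_of_rank (card {a. a < d \<and> s < w a + \<delta>}) (limit_ideal \<delta>)"
proof -
  let ?B = "{a. a < d \<and> s < w a + \<delta>}"
  obtain b where b: "bij_betw b {..<card ?B} ?B" using ex_bij_betw_nat_finite[of ?B] by (auto simp: lessThan_atLeast0)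
  have re: "(\<Sum>i<card ?B. F (b i)) = (\<Sum>a\<in>?B. F a)" for F :: "nat \<Rightarrow> ('n, 'k) mpoly"
    by (rule sum.reindex_bij_betw[OF b])
  show ?thesis
    unfolding free_of_rank_def
  proof (intro exI[of _ "\<lambda>i. e0 (b i)"] conjI allI impI)
    fix f
    have "?B \<subseteq> {..<d}" by auto
    then have "f - (\<Sum>a\<in>?B. cst (l0 a f) * e0 a) \<in> limit_ideal \<delta>"
      unfolding X_l0 coordinate_simps(5) using sum_e0_l0[of _ ?B "\<lambda>a. l0 a f"] by auto
    then show "\<exists>c. f - (\<Sum>i<card ?B. cst (c i) * e0 (b i)) \<in> limit_ideal \<delta>"
      using re[of "\<lambda>a. cst (l0 a f) * e0 a"] by (intro exI[of _ "\<lambda>i. l0 (b i) f"]) simp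
  next
    fix c i assume *: "(\<Sum>i<card ?B. cst (c i) * e0 (b i)) \<in> limit_ideal \<delta>" and i: "i < card ?B"
    let ?c = "\<lambda>a. c (inv_into {..<card ?B} b a)"
    have "(\<Sum>i<card ?B. cst (c i) * e0 (b i)) = (\<Sum>i<card ?B. cst (?c (b i)) * e0 (b i))"
      by (rule sum.cong) (use b in \<open>auto simp: bij_betw_inv_into_left\<close>)
    also have "\<dots> = (\<Sum>a\<in>?B. cst (?c a) * e0 a)" by (rule re)
    finally have *: "(\<Sum>a\<in>?B. cst (?c a) * e0 a) \<in> limit_ideal \<delta>" using * by simp
    have bi: "b i \<in> ?B" using b i by (auto simp: bij_betw_def)
    have "l0 (b i) (\<Sum>a\<in>?B. cst (?c a) * e0 a) = 0" using * bi by (simp add: X_l0)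
    moreover have "l0 (b i) (\<Sum>a\<in>?B. cst (?c a) * e0 a) = ?c (b i)"
      using sum_e0_l0[of "b i" ?B ?c] bi by auto
    ultimately show "c i = 0" using b i by (simp add: bij_betw_inv_into_left)
  qed
qed

text \<open>The member of the broken quadric for \<open>\<delta>\<close>: it sends the dual basis vector of \<open>e0 a\<close> to \<open>e0 (\<sigma> a) / p a\<close>.\<close>

definition block_quadric where "block_quadric \<delta> \<phi> = sc \<delta> (\<Sum>a\<in>weight_block \<delta>. cst (\<phi> (sc \<delta> (e0 a)) / p a) * e0 (\<sigma> a))"

lemma e0_weight_block: "a \<in> weight_block \<delta> \<Longrightarrow> e0 a \<in> limit_ideal \<delta>" and e0_\<sigma>_weight_block: "a \<in> weight_block \<delta> \<Longrightarrow> e0 (\<sigma> a) \<in> limit_ideal \<delta>"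
  by (auto simp: weight_block_def e0_X \<sigma> w_\<sigma>)

lemma X_cst: "f \<in> limit_ideal \<delta> \<Longrightarrow> cst c * f \<in> limit_ideal \<delta>" by (rule X_mult)

lemma X_sum: "(\<And>a. a \<in> B \<Longrightarrow> F a \<in> limit_ideal \<delta>) \<Longrightarrow> (\<Sum>a\<in>B. F a) \<in> limit_ideal \<delta>"
  by (induction B rule: infinite_finite_induct) (auto intro: X_plus X_0)

lemma dual_P:
  assumes "\<phi> \<in> carrier (dual_module cst (P \<delta>))"
  shows "f \<in> limit_ideal \<delta> \<Longrightarrow> g \<in> limit_ideal \<delta> \<Longrightarrow> \<phi> (sc \<delta> (f + g)) = \<phi> (sc \<delta> f) + \<phi> (sc \<delta> g)"
    "f \<in> limit_ideal \<delta> \<Longrightarrow> \<phi> (sc \<delta> (cst c * f)) = c * \<phi> (sc \<delta> f)"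
    "\<phi> (sc \<delta> 0) = 0"
    "(\<And>a. a \<in> B \<Longrightarrow> F a \<in> limit_ideal \<delta>) \<Longrightarrow> \<phi> (sc \<delta> (\<Sum>a\<in>B. F a)) = (\<Sum>a\<in>B. \<phi> (sc \<delta> (F a)))"
proof -
  show a: "f \<in> limit_ideal \<delta> \<Longrightarrow> g \<in> limit_ideal \<delta> \<Longrightarrow> \<phi> (sc \<delta> (f + g)) = \<phi> (sc \<delta> f) + \<phi> (sc \<delta> g)" for f g
    using assms by (auto simp: dual_module_def carrier_P P_add)
  show c: "f \<in> limit_ideal \<delta> \<Longrightarrow> \<phi> (sc \<delta> (cst c * f)) = c * \<phi> (sc \<delta> f)" for c f
    using assms by (auto simp: dual_module_def carrier_P P_smult)
  show z: "\<phi> (sc \<delta> 0) = 0" using c[OF X_0, of 0] by simp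
  show "(\<And>a. a \<in> B \<Longrightarrow> F a \<in> limit_ideal \<delta>) \<Longrightarrow> \<phi> (sc \<delta> (\<Sum>a\<in>B. F a)) = (\<Sum>a\<in>B. \<phi> (sc \<delta> (F a)))"
    by (induction B rule: infinite_finite_induct) (auto simp: z a X_sum)
qed

lemma dual_P_expand:
  assumes \<phi>: "\<phi> \<in> carrier (dual_module cst (P \<delta>))" and f: "f \<in> limit_ideal \<delta>"
  shows "\<phi> (sc \<delta> f) = (\<Sum>a\<in>weight_block \<delta>. l0 a f * \<phi> (sc \<delta> (e0 a)))"
proof -
  have "sc \<delta> f = sc \<delta> (\<Sum>a\<in>weight_block \<delta>. cst (l0 a f) * e0 a)" using expand_piece[OF f] by (simp add: sc_eq)
  then have "\<phi> (sc \<delta> f) = (\<Sum>a\<in>weight_block \<delta>. \<phi> (sc \<delta> (cst (l0 a f) * e0 a)))"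
    using dual_P(4)[OF \<phi>, of "weight_block \<delta>" "\<lambda>a. cst (l0 a f) * e0 a"] X_cst[OF e0_weight_block] by simp
  also have "\<dots> = (\<Sum>a\<in>weight_block \<delta>. l0 a f * \<phi> (sc \<delta> (e0 a)))"
    by (rule sum.cong[OF refl]) (rule dual_P(2)[OF \<phi> e0_weight_block])
  finally show ?thesis .
qed

lemma dual_P_block_quadric:
  assumes \<phi>: "\<phi> \<in> carrier (dual_module cst (P \<delta>))"
  shows "\<phi> (block_quadric \<delta> \<psi>) = (\<Sum>a\<in>weight_block \<delta>. 1 / p a * \<psi> (sc \<delta> (e0 a)) * \<phi> (sc \<delta> (e0 (\<sigma> a))))"
proof -
  have "\<phi> (block_quadric \<delta> \<psi>) = (\<Sum>a\<in>weight_block \<delta>. \<phi> (sc \<delta> (cst (\<psi> (sc \<delta> (e0 a)) / p a) * e0 (\<sigma> a))))"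
    unfolding block_quadric_def by (rule dual_P(4)[OF \<phi>]) (rule X_cst[OF e0_\<sigma>_weight_block])
  also have "\<dots> = (\<Sum>a\<in>weight_block \<delta>. 1 / p a * \<psi> (sc \<delta> (e0 a)) * \<phi> (sc \<delta> (e0 (\<sigma> a))))"
    by (rule sum.cong[OF refl]) (simp add: dual_P(2)[OF \<phi> e0_\<sigma>_weight_block])
  finally show ?thesis .
qed

lemma block_quadric_symmetric: "symmetric_map cst (P \<delta>) (block_quadric \<delta>)"
  unfolding symmetric_map_def
proof (intro ballI)
  fix \<phi> \<psi> assume \<phi>: "\<phi> \<in> carrier (dual_module cst (P \<delta>))" and \<psi>: "\<psi> \<in> carrier (dual_module cst (P \<delta>))"
  have "(\<Sum>a\<in>weight_block \<delta>. 1 / p a * \<phi> (sc \<delta> (e0 a)) * \<psi> (sc \<delta> (e0 (\<sigma> a)))) =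
    (\<Sum>a\<in>weight_block \<delta>. 1 / p (\<sigma> a) * \<phi> (sc \<delta> (e0 (\<sigma> a))) * \<psi> (sc \<delta> (e0 (\<sigma> (\<sigma> a)))))"
    by (rule sum.reindex_bij_betw[OF \<sigma>_weight_block, symmetric])
  also have "\<dots> = (\<Sum>a\<in>weight_block \<delta>. 1 / p a * \<psi> (sc \<delta> (e0 a)) * \<phi> (sc \<delta> (e0 (\<sigma> a))))"
    by (rule sum.cong) (auto simp: weight_block_def \<sigma> p)
  finally show "\<psi> (block_quadric \<delta> \<phi>) = \<phi> (block_quadric \<delta> \<psi>)" unfolding dual_P_block_quadric[OF \<phi>] dual_P_block_quadric[OF \<psi>] .
qed

lemma l0_\<sigma>_sum:
  assumes b: "b \<in> weight_block \<delta>"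
  shows "l0 (\<sigma> b) (\<Sum>a\<in>weight_block \<delta>. cst (c a) * e0 (\<sigma> a)) = c b"
proof -
  have "(\<Sum>a\<in>weight_block \<delta>. cst (c a) * e0 (\<sigma> a)) = (\<Sum>a\<in>weight_block \<delta>. cst (c (\<sigma> (\<sigma> a))) * e0 (\<sigma> a))"
    by (rule sum.cong) (auto simp: weight_block_def \<sigma>)
  also have "\<dots> = (\<Sum>a\<in>weight_block \<delta>. cst (c (\<sigma> a)) * e0 a)" by (rule sum.reindex_bij_betw[OF \<sigma>_weight_block])
  finally have "l0 (\<sigma> b) (\<Sum>a\<in>weight_block \<delta>. cst (c a) * e0 (\<sigma> a)) = l0 (\<sigma> b) (\<Sum>a\<in>weight_block \<delta>. cst (c (\<sigma> a)) * e0 a)" by simp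
  moreover have "\<sigma> b < d" "\<sigma> b \<in> weight_block \<delta>" using b \<sigma>(1)[of b] w_\<sigma>[of b] by (auto simp: weight_block_def)
  ultimately show ?thesis using sum_e0_l0[OF _ weight_block_sub[of \<delta>], of "\<sigma> b" "\<lambda>a. c (\<sigma> a)"] b \<sigma>(2)[of b] by (auto simp: weight_block_def)
qed

text \<open>The symmetry of the structure constants survives at \<open>v = 0\<close>, because \<open>a\<close> and \<open>b\<close> have the same weight: a
structure constant preserves degrees exactly if its mirror image does.\<close>

lemma piece_structure_constants:
  assumes a: "a \<in> weight_block \<delta>" and b: "b \<in> weight_block \<delta>"
  shows "l0 b (r * e0 a) / p a = l0 (\<sigma> a) (r * e0 (\<sigma> b)) / p b"
proof (induction r rule: poly_induct)
  case zero
  then show ?case by (simp add: coordinate_simps)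
next
  case (add r c \<alpha>)
  have ab: "a < d" "b < d" "w a = w b" using a b by (auto simp: weight_block_def)
  have "n b - n a - mdeg \<alpha> = n (\<sigma> a) - n (\<sigma> b) - mdeg \<alpha>" using ab(3) by (simp add: w_def)
  then have "l0 b (mon \<alpha> * e0 a) / p a = l0 (\<sigma> a) (mon \<alpha> * e0 (\<sigma> b)) / p b"
    using coordinate_mon_mult_basis_elt[OF id_comm_ring_hom ab(1,2), of 0 \<alpha>] coordinate_mon_mult_basis_elt[OF id_comm_ring_hom \<sigma>(1)[OF ab(2)] \<sigma>(1)[OF ab(1)], of 0 \<alpha>]
      structure_constant_sym[OF ab(1,2), of \<alpha>]
    by (simp add: times_divide_eq_right[symmetric] del: times_divide_eq_right)
  then show ?case using add
    by (simp add: distrib_right mult.assoc coordinate_simps add_divide_distrib times_divide_eq_right[symmetric] del: times_divide_eq_right)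
qed

lemma block_quadric_iso: "module_iso \<S> (dual_module cst (P \<delta>)) (P \<delta>) (block_quadric \<delta>)"
  unfolding module_iso_def
proof (intro conjI ballI)
  let ?D = "dual_module cst (P \<delta>)"
  show "bij_betw (block_quadric \<delta>) (carrier ?D) (carrier (P \<delta>))"
    unfolding bij_betw_def
  proof
    show "inj_on (block_quadric \<delta>) (carrier ?D)"
    proof (rule inj_onI)
      fix \<phi> \<psi> assume \<phi>: "\<phi> \<in> carrier ?D" and \<psi>: "\<psi> \<in> carrier ?D" and e: "block_quadric \<delta> \<phi> = block_quadric \<delta> \<psi>"
      let ?s = "\<lambda>\<phi>. \<Sum>a\<in>weight_block \<delta>. cst (\<phi> (sc \<delta> (e0 a)) / p a) * e0 (\<sigma> a)"
      have d: "?s \<phi> - ?s \<psi> \<in> limit_ideal (Suc \<delta>)" using e by (simp add: block_quadric_def sc_eq)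
      have ev: "\<phi> (sc \<delta> (e0 b)) = \<psi> (sc \<delta> (e0 b))" if b: "b \<in> weight_block \<delta>" for b
      proof -
        have "\<sigma> b < d" "s < w (\<sigma> b) + Suc \<delta>" using b \<sigma>(1)[of b] w_\<sigma>[of b] by (auto simp: weight_block_def)
        then have "l0 (\<sigma> b) (?s \<phi> - ?s \<psi>) = 0" using d by (simp add: X_l0)
        then have "\<phi> (sc \<delta> (e0 b)) / p b = \<psi> (sc \<delta> (e0 b)) / p b"
          unfolding coordinate_simps(5) l0_\<sigma>_sum[OF b] by simp
        then show ?thesis using p(1)[of b] b by (simp add: weight_block_def)
      qed
      show "\<phi> = \<psi>"
      proof
        fix Z show "\<phi> Z = \<psi> Z"
        proof (cases "Z \<in> carrier (P \<delta>)")
          case True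
          then obtain f where f: "f \<in> limit_ideal \<delta>" "Z = sc \<delta> f" by (auto simp: carrier_P)
          show ?thesis unfolding f(2) dual_P_expand[OF \<phi> f(1)] dual_P_expand[OF \<psi> f(1)]
            by (rule sum.cong) (auto simp: ev)
        next
          case False then show ?thesis using \<phi> \<psi> by (auto simp: dual_module_def extensional_def)
        qed
      qed
    qed
    show "block_quadric \<delta> ` carrier ?D = carrier (P \<delta>)"
    proof
      show "block_quadric \<delta> ` carrier ?D \<subseteq> carrier (P \<delta>)"
        by (auto simp: block_quadric_def carrier_P intro!: imageI X_sum X_cst e0_\<sigma>_weight_block)
      show "carrier (P \<delta>) \<subseteq> block_quadric \<delta> ` carrier ?D"
      proof
        fix Z assume "Z \<in> carrier (P \<delta>)"
        then obtain f where f: "f \<in> limit_ideal \<delta>" "Z = sc \<delta> f" by (auto simp: carrier_P)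
        define \<phi> where "\<phi> = (\<lambda>Y\<in>carrier (P \<delta>). \<Sum>a\<in>weight_block \<delta>. l0 a (SOME g. g \<in> Y) * (p a * l0 (\<sigma> a) f))"
        have l: "l0 a (SOME h. h \<in> sc \<delta> g) = l0 a g" if "a \<in> weight_block \<delta>" for a g
          using some_sc[of \<delta> g] that by (auto simp: X_l0 weight_block_def coordinate_simps(5))
        have ev: "\<phi> (sc \<delta> g) = (\<Sum>a\<in>weight_block \<delta>. l0 a g * (p a * l0 (\<sigma> a) f))" if "g \<in> limit_ideal \<delta>" for g
          using that by (auto simp: \<phi>_def carrier_P l intro!: sum.cong)
        have \<phi>: "\<phi> \<in> carrier ?D"
        proof -
          have "\<phi> (sc \<delta> (g + h)) = \<phi> (sc \<delta> g) + \<phi> (sc \<delta> h)" if "g \<in> limit_ideal \<delta>" "h \<in> limit_ideal \<delta>" for g h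
            unfolding ev[OF that(1)] ev[OF that(2)] ev[OF X_plus[OF that]] sum.distrib[symmetric]
            by (rule sum.cong) (auto simp: coordinate_simps algebra_simps)
          moreover have "\<phi> (sc \<delta> (cst c * g)) = c * \<phi> (sc \<delta> g)" if "g \<in> limit_ideal \<delta>" for c g
            unfolding ev[OF that] ev[OF X_cst[OF that]] sum_distrib_left
            by (rule sum.cong) (auto simp: coordinate_simps mult.assoc)
          moreover have "\<phi> \<in> extensional (carrier (P \<delta>))" by (simp add: \<phi>_def)
          ultimately show ?thesis unfolding dual_module_def by (auto simp: carrier_P P_add P_smult)
        qed
        have e: "\<phi> (sc \<delta> (e0 b)) = p b * l0 (\<sigma> b) f" if b: "b \<in> weight_block \<delta>" for b
        proof -
          have "\<phi> (sc \<delta> (e0 b)) = (\<Sum>a\<in>weight_block \<delta>. if a = b then p b * l0 (\<sigma> b) f else 0)"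
            unfolding ev[OF e0_weight_block[OF b]] by (rule sum.cong) (use b l0_e0 in \<open>auto simp: weight_block_def\<close>)
          then show ?thesis using b finite_weight_block by simp
        qed
        have "(\<Sum>a\<in>weight_block \<delta>. cst (\<phi> (sc \<delta> (e0 a)) / p a) * e0 (\<sigma> a)) = (\<Sum>a\<in>weight_block \<delta>. cst (l0 (\<sigma> a) f) * e0 (\<sigma> a))"
        proof (rule sum.cong[OF refl])
          fix a assume a: "a \<in> weight_block \<delta>"
          then have "p a \<noteq> 0" using p(1)[of a] by (simp add: weight_block_def)
          then show "cst (\<phi> (sc \<delta> (e0 a)) / p a) * e0 (\<sigma> a) = cst (l0 (\<sigma> a) f) * e0 (\<sigma> a)"
            unfolding e[OF a] by simp
        qed
        also have "\<dots> = (\<Sum>a\<in>weight_block \<delta>. cst (l0 a f) * e0 a)" by (rule sum.reindex_bij_betw[OF \<sigma>_weight_block])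
        finally have "block_quadric \<delta> \<phi> = sc \<delta> (\<Sum>a\<in>weight_block \<delta>. cst (l0 a f) * e0 a)" unfolding block_quadric_def by (rule arg_cong)
        also have "\<dots> = sc \<delta> f" using expand_piece[OF f(1)] by (simp only: sc_eq[symmetric])
        finally have "block_quadric \<delta> \<phi> = sc \<delta> f" .
        then show "Z \<in> block_quadric \<delta> ` carrier ?D" using \<phi> f(2) by blast
      qed
    qed
  qed
  fix \<phi> assume \<phi>: "\<phi> \<in> carrier ?D"
  {
    fix \<psi> assume \<psi>: "\<psi> \<in> carrier ?D"
    have "(\<phi> \<oplus>\<^bsub>?D\<^esub> \<psi>) (sc \<delta> (e0 a)) = \<phi> (sc \<delta> (e0 a)) + \<psi> (sc \<delta> (e0 a))" if "a \<in> weight_block \<delta>" for a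
      using e0_weight_block[OF that] by (auto simp: dual_module_def carrier_P)
    then show "block_quadric \<delta> (\<phi> \<oplus>\<^bsub>?D\<^esub> \<psi>) = block_quadric \<delta> \<phi> \<oplus>\<^bsub>P \<delta>\<^esub> block_quadric \<delta> \<psi>"
      unfolding block_quadric_def P_add sum.distrib[symmetric]
      by (intro arg_cong[where f = "sc \<delta>"] sum.cong) (auto simp: add_divide_distrib cst_add distrib_right)
  next
    fix r :: "('n, 'k) mpoly"
    have r: "(r \<odot>\<^bsub>?D\<^esub> \<phi>) (sc \<delta> (e0 a)) = (\<Sum>b\<in>weight_block \<delta>. l0 b (r * e0 a) * \<phi> (sc \<delta> (e0 b)))" if a: "a \<in> weight_block \<delta>" for a
    proof -
      have "(r \<odot>\<^bsub>?D\<^esub> \<phi>) (sc \<delta> (e0 a)) = \<phi> (sc \<delta> (r * e0 a))"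
        using e0_weight_block[OF a] by (auto simp: dual_module_def carrier_P P_smult)
      then show ?thesis using dual_P_expand[OF \<phi> X_mult[OF e0_weight_block[OF a]]] by simp
    qed
    have "block_quadric \<delta> (r \<odot>\<^bsub>?D\<^esub> \<phi>) = sc \<delta> (\<Sum>a\<in>weight_block \<delta>. \<Sum>b\<in>weight_block \<delta>. cst (l0 b (r * e0 a) / p a * \<phi> (sc \<delta> (e0 b))) * e0 (\<sigma> a))"
      unfolding block_quadric_def
      by (intro arg_cong[where f = "sc \<delta>"] sum.cong refl)
        (simp add: r sum_divide_distrib sum_distrib_right cst_sum)
    also have "\<dots> = sc \<delta> (\<Sum>b\<in>weight_block \<delta>. \<Sum>a\<in>weight_block \<delta>. cst (l0 (\<sigma> a) (r * e0 (\<sigma> b)) / p b * \<phi> (sc \<delta> (e0 b))) * e0 (\<sigma> a))"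
      by (subst sum.swap) (simp add: piece_structure_constants cong: sum.cong)
    also have "\<dots> = sc \<delta> (\<Sum>b\<in>weight_block \<delta>. \<Sum>c\<in>weight_block \<delta>. cst (l0 c (r * e0 (\<sigma> b)) / p b * \<phi> (sc \<delta> (e0 b))) * e0 c)"
      by (intro arg_cong[where f = "sc \<delta>"] sum.cong refl sum.reindex_bij_betw[OF \<sigma>_weight_block])
    also have "\<dots> = sc \<delta> (r * (\<Sum>b\<in>weight_block \<delta>. cst (\<phi> (sc \<delta> (e0 b)) / p b) * e0 (\<sigma> b)))"
    proof (subst sc_eq)
      have "(\<Sum>b\<in>weight_block \<delta>. cst (\<phi> (sc \<delta> (e0 b)) / p b) * (r * e0 (\<sigma> b) - (\<Sum>c\<in>weight_block \<delta>. cst (l0 c (r * e0 (\<sigma> b))) * e0 c))) \<in> limit_ideal (Suc \<delta>)"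
        by (intro X_sum X_cst expand_piece X_mult e0_\<sigma>_weight_block)
      from X_minus[OF X_0 this] have m: "- (\<Sum>b\<in>weight_block \<delta>. cst (\<phi> (sc \<delta> (e0 b)) / p b) * (r * e0 (\<sigma> b) - (\<Sum>c\<in>weight_block \<delta>. cst (l0 c (r * e0 (\<sigma> b))) * e0 c))) \<in> limit_ideal (Suc \<delta>)"
        by (simp only: diff_0)
      have "(\<Sum>b\<in>weight_block \<delta>. \<Sum>c\<in>weight_block \<delta>. cst (l0 c (r * e0 (\<sigma> b)) / p b * \<phi> (sc \<delta> (e0 b))) * e0 c) =
        (\<Sum>b\<in>weight_block \<delta>. cst (\<phi> (sc \<delta> (e0 b)) / p b) * (\<Sum>c\<in>weight_block \<delta>. cst (l0 c (r * e0 (\<sigma> b))) * e0 c))"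
        unfolding sum_distrib_left by (intro sum.cong refl) (simp add: mult.assoc[symmetric] mult.commute[of "\<phi> _"] flip: cst_mult)
      moreover have "r * (\<Sum>b\<in>weight_block \<delta>. cst (\<phi> (sc \<delta> (e0 b)) / p b) * e0 (\<sigma> b)) =
        (\<Sum>b\<in>weight_block \<delta>. cst (\<phi> (sc \<delta> (e0 b)) / p b) * (r * e0 (\<sigma> b)))"
        unfolding sum_distrib_left by (intro sum.cong refl) (simp only: mult.left_commute)
      ultimately show "(\<Sum>b\<in>weight_block \<delta>. \<Sum>c\<in>weight_block \<delta>. cst (l0 c (r * e0 (\<sigma> b)) / p b * \<phi> (sc \<delta> (e0 b))) * e0 c) -
        r * (\<Sum>b\<in>weight_block \<delta>. cst (\<phi> (sc \<delta> (e0 b)) / p b) * e0 (\<sigma> b)) \<in> limit_ideal (Suc \<delta>)"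
        using m by (simp add: right_diff_distrib sum_subtractf)
    qed
    finally show "block_quadric \<delta> (r \<odot>\<^bsub>?D\<^esub> \<phi>) = r \<odot>\<^bsub>P \<delta>\<^esub> block_quadric \<delta> \<phi>" unfolding block_quadric_def P_smult .
  }
qed

end

section \<open>Colength, nilpotency and the limit point\<close>

text \<open>Elimination of one unknown.\<close>

lemma homogeneous_system:
  fixes c :: "'b \<Rightarrow> nat \<Rightarrow> 'k::field"
  assumes "finite B" "d < card B"
  shows "\<exists>y. (\<exists>j\<in>B. y j \<noteq> 0) \<and> (\<forall>i<d. (\<Sum>j\<in>B. y j * c j i) = 0)"
  using assms
proof (induction d arbitrary: B c)
  case 0
  then obtain j where "j \<in> B" by fastforce
  then show ?case by (intro exI[of _ "\<lambda>_. 1"]) auto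
next
  case (Suc d)
  show ?case
  proof (cases "\<forall>j\<in>B. c j d = 0")
    case True
    obtain y where y: "\<exists>j\<in>B. y j \<noteq> 0" "\<forall>i<d. (\<Sum>j\<in>B. y j * c j i) = 0"
      using Suc.IH[of B c] Suc.prems by auto
    have "(\<Sum>j\<in>B. y j * c j d) = 0" using True by (intro sum.neutral) auto
    then show ?thesis using y by (intro exI[of _ y]) (auto simp: less_Suc_eq)
  next
    case False
    then obtain j0 where j0: "j0 \<in> B" "c j0 d \<noteq> 0" by blast
    let ?B = "B - {j0}"
    let ?c = "\<lambda>j i. c j i - c j d / c j0 d * c j0 i"
    have "d < card ?B" using Suc.prems j0 by simp
    then obtain y where y: "\<exists>j\<in>?B. y j \<noteq> 0" "\<forall>i<d. (\<Sum>j\<in>?B. y j * ?c j i) = 0"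
      using Suc.IH[of ?B ?c] Suc.prems by auto
    define y0 where "y0 = - (\<Sum>j\<in>?B. y j * c j d / c j0 d)"
    let ?y = "y(j0 := y0)"
    have e: "(\<Sum>j\<in>B. ?y j * c j i) = (\<Sum>j\<in>?B. y j * ?c j i)" for i
    proof -
      have "(\<Sum>j\<in>B. ?y j * c j i) = y0 * c j0 i + (\<Sum>j\<in>?B. ?y j * c j i)"
        using Suc.prems j0 by (subst sum.remove[of B j0]) auto
      also have "(\<Sum>j\<in>?B. ?y j * c j i) = (\<Sum>j\<in>?B. y j * c j i)" by (rule sum.cong) auto
      also have "y0 * c j0 i = (\<Sum>j\<in>?B. - (y j * c j d / c j0 d * c j0 i))"
        by (simp add: y0_def sum_distrib_right sum_negf)
      also have "\<dots> + (\<Sum>j\<in>?B. y j * c j i) = (\<Sum>j\<in>?B. y j * ?c j i)"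
        unfolding sum.distrib[symmetric] by (rule sum.cong) (auto simp: algebra_simps)
      finally show ?thesis .
    qed
    have "(\<Sum>j\<in>?B. y j * ?c j d) = 0" using j0 by (intro sum.neutral) auto
    then have "\<forall>i<Suc d. (\<Sum>j\<in>B. ?y j * c j i) = 0" unfolding e using y by (auto simp: less_Suc_eq)
    moreover have "\<exists>j\<in>B. ?y j \<noteq> 0" using y by auto
    ultimately show ?thesis by blast
  qed
qed

text \<open>Expressing more than \<open>d\<close> elements by \<open>d\<close> generators gives a homogeneous system with more unknowns than
equations.\<close>

lemma independent_mod_le_rank:
  fixes J :: "('n::finite, 'k::field) mpoly set"
  assumes J: "ideal J \<S>" and d: "free_of_rank d J"
    and ind: "\<And>y. (\<Sum>j<m. cst (y j) * f j) \<in> J \<Longrightarrow> \<forall>j<m. y j = 0"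
  shows "m \<le> d"
proof (rule ccontr)
  assume "\<not> m \<le> d"
  note J = J[unfolded ideal_S_iff]
  have Jsum: "(\<Sum>x\<in>B. F x) \<in> J" if "\<And>x. x \<in> B \<Longrightarrow> F x \<in> J" for B :: "nat set" and F
    using that J by (induction B rule: infinite_finite_induct) auto
  obtain e where e: "\<And>f. \<exists>c. f - (\<Sum>i<d. cst (c i) * e i) \<in> J"
    using d unfolding free_of_rank_def by blast
  have "\<forall>j. \<exists>c. f j - (\<Sum>i<d. cst (c i) * e i) \<in> J" using e by blast
  then obtain c where c: "\<And>j. f j - (\<Sum>i<d. cst (c j i) * e i) \<in> J" by metis
  obtain y where y: "\<exists>j\<in>{..<m}. y j \<noteq> 0" "\<forall>i<d. (\<Sum>j\<in>{..<m}. y j * c j i) = 0"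
    using homogeneous_system[of "{..<m}" d c] \<open>\<not> m \<le> d\<close> by auto
  have "(\<Sum>j<m. cst (y j) * (f j - (\<Sum>i<d. cst (c j i) * e i))) \<in> J"
    using c J by (intro Jsum) blast
  also have "(\<Sum>j<m. cst (y j) * (f j - (\<Sum>i<d. cst (c j i) * e i))) = (\<Sum>j<m. cst (y j) * f j) - (\<Sum>j<m. \<Sum>i<d. cst (y j * c j i) * e i)"
    by (simp add: right_diff_distrib sum_subtractf sum_distrib_left cst_mult mult.assoc)
  also have "(\<Sum>j<m. \<Sum>i<d. cst (y j * c j i) * e i) = (\<Sum>i<d. cst (\<Sum>j<m. y j * c j i) * e i)"
    by (subst sum.swap) (simp add: cst_sum sum_distrib_right)
  also have "\<dots> = 0" using y(2) by (intro sum.neutral) auto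
  finally show False using ind[of y] y(1) by auto
qed

lemma rank_unique:
  fixes J :: "('n::finite, 'k::field) mpoly set"
  assumes "ideal J \<S>" "free_of_rank d J" "free_of_rank d' J"
  shows "d = d'"
proof (rule antisym)
  have le: "d \<le> d'" if d: "free_of_rank d J" and d': "free_of_rank d' J" for d d'
  proof -
    obtain e where "\<forall>c. (\<Sum>i<d. cst (c i) * e i) \<in> J \<longrightarrow> (\<forall>i<d. c i = 0)"
      using d unfolding free_of_rank_def by blast
    then show ?thesis by (intro independent_mod_le_rank[OF assms(1) d', where f = e]) blast
  qed
  from le[OF assms(2,3)] le[OF assms(3,2)] show "d \<le> d'" "d' \<le> d" .
qed

lemma colength_eq: "ideal J \<S> \<Longrightarrow> free_of_rank d J \<Longrightarrow> colength J = d"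
  unfolding colength_def using rank_unique by (intro the_equality) auto

lemma mvar_eq_mon: "mvar j = mon (Poly_Mapping.single j 1)"
  by (simp add: mvar_def mon_def)

lemma mon_split:
  assumes "Poly_Mapping.lookup \<alpha> j \<ge> r"
  shows "mon \<alpha> = mon (\<alpha> - Poly_Mapping.single j r) * mon (Poly_Mapping.single j r)"
proof -
  have "\<alpha> = (\<alpha> - Poly_Mapping.single j r) + Poly_Mapping.single j r"
    by (rule poly_mapping_eqI) (use assms in \<open>auto simp: lookup_add lookup_minus lookup_single when_def\<close>)
  then show ?thesis by (metis mon_mult)
qed

lemma ideal_contains_ord_ge:
  assumes J: "ideal J \<S>" and m: "\<And>\<alpha>. N \<le> mdeg \<alpha> \<Longrightarrow> mon \<alpha> \<in> J"
  shows "ord_ge N \<subseteq> J"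
proof
  fix f :: "('a, 'b) mpoly" assume f: "f \<in> ord_ge N"
  note J = J[unfolded ideal_S_iff]
  have "(\<Sum>\<alpha>\<in>B. cst (Poly_Mapping.lookup f \<alpha>) * mon \<alpha>) \<in> J" if "finite B" "B \<subseteq> Poly_Mapping.keys f" for B
    using that
  proof (induction B)
    case (insert \<alpha> B)
    have "N \<le> mdeg \<alpha>" using f insert.prems by (auto simp: ord_ge_def in_keys_iff not_less[symmetric])
    then have "cst (Poly_Mapping.lookup f \<alpha>) * mon \<alpha> \<in> J" using m J by blast
    then show ?case using insert J by simp
  qed (use J in simp)
  from this[of "Poly_Mapping.keys f"] show "f \<in> J" using poly_as_sum[of "Poly_Mapping.keys f" f] by simp
qed

lemma origin_ideal_eq: "origin_ideal = ord_ge 1"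
proof
  have "range mvar \<subseteq> ord_ge 1" by (auto simp: mvar_eq_mon intro!: ord_ge_mon)
  moreover have "ideal (ord_ge 1 :: ('a, 'b) mpoly set) \<S>"
    unfolding ideal_S_iff using ord_ge_mult[of _ 0 _ 1] by (auto intro: ord_ge_closed)
  ultimately show "origin_ideal \<subseteq> (ord_ge 1 :: ('a, 'b) mpoly set)"
    unfolding origin_ideal_def by (intro S.genideal_minimal)
  have id: "ideal (origin_ideal :: ('a, 'b) mpoly set) \<S>"
    unfolding origin_ideal_def by (rule S.genideal_ideal) simp
  show "(ord_ge 1 :: ('a, 'b) mpoly set) \<subseteq> origin_ideal"
  proof (rule ideal_contains_ord_ge[OF id])
    fix \<alpha> :: "'a \<Rightarrow>\<^sub>0 nat" assume "1 \<le> mdeg \<alpha>"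
    then obtain j where j: "Poly_Mapping.lookup \<alpha> j \<noteq> 0" unfolding mdeg_def by (metis less_one not_le sum.neutral)
    have "mvar j \<in> (origin_ideal :: ('a, 'b) mpoly set)"
      unfolding origin_ideal_def using S.genideal_self[of "range mvar"] by auto
    then have "mon (\<alpha> - Poly_Mapping.single j 1) * mon (Poly_Mapping.single j 1) \<in> (origin_ideal :: ('a, 'b) mpoly set)"
      using id unfolding ideal_S_iff mvar_eq_mon by blast
    moreover have "(mon \<alpha> :: ('a, 'b) mpoly) = mon (\<alpha> - Poly_Mapping.single j 1) * mon (Poly_Mapping.single j 1)"
      by (rule mon_split) (use j in simp)
    ultimately show "(mon \<alpha> :: ('a, 'b) mpoly) \<in> origin_ideal" by simp
  qed
qed

lemma exists_prime_above:
  fixes J :: "('n::finite, 'r::comm_ring_1) mpoly set"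
  assumes J: "ideal J \<S>" "1 \<notin> J"
  obtains Q where "primeideal Q \<S>" "J \<subseteq> Q"
proof -
  let ?A = "{M :: ('n, 'r) mpoly set. ideal M \<S> \<and> J \<subseteq> M \<and> 1 \<notin> M}"
  have "\<exists>M\<in>?A. \<forall>Y\<in>?A. M \<subseteq> Y \<longrightarrow> Y = M"
  proof (rule subset_Zorn_nonempty)
    show "?A \<noteq> {}" using J by auto
    fix C assume C: "C \<noteq> {}" "subset.chain ?A C"
    have CA: "C \<subseteq> ?A" and ch: "\<And>x y. x \<in> C \<Longrightarrow> y \<in> C \<Longrightarrow> x \<subseteq> y \<or> y \<subseteq> x"
      using C by (auto simp: subset.chain_def)
    have "f + g \<in> \<Union>C" if fg: "f \<in> \<Union>C" "g \<in> \<Union>C" for f g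
    proof -
      obtain x y where xy: "x \<in> C" "y \<in> C" "f \<in> x" "g \<in> y" using fg by auto
      then obtain z where "z \<in> C" "f \<in> z" "g \<in> z" using ch[OF xy(1,2)] by blast
      then show ?thesis using CA unfolding ideal_S_iff by blast
    qed
    moreover have "g * f \<in> \<Union>C" if "f \<in> \<Union>C" for f g using that CA unfolding ideal_S_iff by blast
    moreover have "0 \<in> \<Union>C" using C CA unfolding ideal_S_iff by blast
    ultimately have "ideal (\<Union>C) \<S>" unfolding ideal_S_iff by blast
    moreover have "J \<subseteq> \<Union>C" "1 \<notin> \<Union>C" using C CA by auto
    ultimately show "\<Union>C \<in> ?A" by blast
  qed
  then obtain M where M: "ideal M \<S>" "J \<subseteq> M" "1 \<notin> M"
    and mx: "\<And>Y. ideal Y \<S> \<Longrightarrow> J \<subseteq> Y \<Longrightarrow> 1 \<notin> Y \<Longrightarrow> M \<subseteq> Y \<Longrightarrow> Y = M" by auto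
  have "maximalideal M \<S>"
  proof (rule maximalidealI[OF M(1)])
    show "carrier \<S> \<noteq> M" using M(3) by auto
    fix Y :: "('n, 'r) mpoly set" assume Y: "ideal Y \<S>" "M \<subseteq> Y"
    show "Y = M \<or> Y = carrier \<S>"
    proof (cases "1 \<in> Y")
      case True
      then have "g * 1 \<in> Y" for g using Y(1) unfolding ideal_S_iff by blast
      then show ?thesis by auto
    next
      case False
      then show ?thesis using mx[OF Y(1) _ False Y(2)] M(2) Y(2) by blast
    qed
  qed
  then have "primeideal M \<S>" by (rule S.maximalideal_prime)
  then show thesis using that M(2) by blast
qed

text \<open>The ideal generated by \<open>I\<close> and \<open>u\<close> lies in no prime ideal, as the only candidate is the ideal of the origin.\<close>

lemma unit_mod_I:
  fixes I :: "('n::finite, 'k::field) mpoly set"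
  assumes I: "ideal I \<S>" and support: "{P. primeideal P \<S> \<and> I \<subseteq> P} = {origin_ideal}" and u: "u \<notin> ord_ge 1"
  obtains g where "1 - g * u \<in> I"
proof -
  let ?J = "{i + g * u | i g. i \<in> I}"
  note I' = I[unfolded ideal_S_iff]
  have J: "ideal ?J \<S>"
    unfolding ideal_S_iff
  proof (intro conjI ballI allI)
    show "0 \<in> ?J" using I' by (intro CollectI exI[of _ 0]) auto
    fix f assume "f \<in> ?J"
    then obtain i g where f: "f = i + g * u" "i \<in> I" by auto
    {
      fix f' assume "f' \<in> ?J"
      then obtain i' g' where f': "f' = i' + g' * u" "i' \<in> I" by auto
      have "f + f' = (i + i') + (g + g') * u" by (simp add: f f' distrib_right)
      moreover have "i + i' \<in> I" using I' f f' by blast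
      ultimately show "f + f' \<in> ?J" by blast
    next
      fix h
      have "h * f = h * i + (h * g) * u" by (simp add: f distrib_left mult.assoc)
      moreover have "h * i \<in> I" using I' f by blast
      ultimately show "h * f \<in> ?J" by blast
    }
  qed
  have "1 \<in> ?J"
  proof (rule ccontr)
    assume "1 \<notin> ?J"
    then obtain Q where Q: "primeideal Q \<S>" "?J \<subseteq> Q" using exists_prime_above[OF J] by blast
    have IJ: "I \<subseteq> ?J"
    proof
      fix i assume "i \<in> I"
      then show "i \<in> ?J" by (intro CollectI exI[of _ i] exI[of _ 0]) simp
    qed
    have "u \<in> ?J" using I' by (intro CollectI exI[of _ 0] exI[of _ 1]) auto
    moreover have "Q = origin_ideal" using support Q IJ by blast
    ultimately show False using u Q(2) origin_ideal_eq by blast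
  qed
  then obtain i g where ig: "1 = i + g * u" "i \<in> I" by blast
  have "1 - g * u = i" using ig(1) by (metis add_diff_cancel_right')
  then have "1 - g * u \<in> I" using ig(2) by metis
  then show thesis by (rule that)
qed

text \<open>The powers of a variable \<open>x\<close> are linearly dependent modulo \<open>I\<close>. A relation has the form \<open>x\<^sup>r * u\<close> with
\<open>u\<close> not vanishing at the origin, so that \<open>u\<close> is a unit modulo \<open>I\<close> and \<open>x\<^sup>r \<in> I\<close>. A monomial of large degree
contains such a power of some variable.\<close>

lemma local_nilpotent:
  fixes I :: "('n::finite, 'k::field) mpoly set"
  assumes I: "ideal I \<S>" and d: "free_of_rank d I"
    and support: "{P. primeideal P \<S> \<and> I \<subseteq> P} = {origin_ideal}"
  obtains N where "ord_ge N \<subseteq> I"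
proof -
  note I' = I[unfolded ideal_S_iff]
  have "\<exists>r. mon (Poly_Mapping.single j r) \<in> I" for j
  proof -
    let ?x = "\<lambda>i. mon (Poly_Mapping.single j i) :: ('n, 'k) mpoly"
    have "\<not> (\<forall>y. (\<Sum>i<Suc d. cst (y i) * ?x i) \<in> I \<longrightarrow> (\<forall>i<Suc d. y i = 0))"
      using independent_mod_le_rank[OF I d, where m = "Suc d" and f = ?x] by auto
    then obtain y i0 where y: "(\<Sum>i<Suc d. cst (y i) * ?x i) \<in> I" "i0 < Suc d" "y i0 \<noteq> 0" by blast
    define r where "r = (LEAST i. i < Suc d \<and> y i \<noteq> 0)"
    have r: "r < Suc d" "y r \<noteq> 0" unfolding r_def using LeastI[of "\<lambda>i. i < Suc d \<and> y i \<noteq> 0" i0] y by auto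
    have below: "y i = 0" if "i < r" for i using not_less_Least[of i "\<lambda>i. i < Suc d \<and> y i \<noteq> 0"] that r(1) by (auto simp: r_def)
    \<comment> \<open>the relation divided by its lowest power of the variable\<close>
    define u where "u = (\<Sum>i\<in>{r..<Suc d}. cst (y i) * ?x (i - r))"
    have "(\<Sum>i<Suc d. cst (y i) * ?x i) = (\<Sum>i\<in>{r..<Suc d}. cst (y i) * ?x i)"
      by (rule sum.mono_neutral_right) (use below in \<open>auto simp: not_le[symmetric]\<close>)
    also have "\<dots> = ?x r * u"
      unfolding u_def sum_distrib_left
      by (rule sum.cong) (auto simp: mult.left_commute mon_mult single_add[symmetric])
    finally have xu: "?x r * u \<in> I" using y(1) by simp
    have "Poly_Mapping.lookup u 0 = (\<Sum>i\<in>{r..<Suc d}. if i = r then y r else 0)"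
      unfolding u_def lookup_sum
      by (rule sum.cong) (auto simp: mon_def lookup_single when_def single_zero poly_mapping_eq_iff fun_eq_iff split: if_splits)
    also have "\<dots> = y r" using r by simp
    finally have "u \<notin> ord_ge 1" using r(2) by (auto simp: ord_ge_def intro!: exI[of _ 0])
    then obtain g where g: "1 - g * u \<in> I" using unit_mod_I[OF I support] by blast
    have "?x r * (1 - g * u) + g * (?x r * u) \<in> I" using I' g xu by blast
    then have "?x r \<in> I" by (simp add: algebra_simps)
    then show ?thesis ..
  qed
  then obtain r where r: "\<And>j. mon (Poly_Mapping.single j (r j)) \<in> I" by metis
  have "ord_ge (Suc (\<Sum>j\<in>UNIV. r j)) \<subseteq> I"
  proof (rule ideal_contains_ord_ge[OF I])
    fix \<alpha> :: "'n \<Rightarrow>\<^sub>0 nat" assume deg: "Suc (\<Sum>j\<in>UNIV. r j) \<le> mdeg \<alpha>"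
    have "\<exists>j. r j \<le> Poly_Mapping.lookup \<alpha> j"
    proof (rule ccontr)
      assume "\<not> ?thesis"
      then have "mdeg \<alpha> \<le> (\<Sum>j\<in>UNIV. r j)" unfolding mdeg_def by (intro sum_mono) (auto simp: not_le less_imp_le)
      then show False using deg by simp
    qed
    then obtain j where "r j \<le> Poly_Mapping.lookup \<alpha> j" by blast
    then have e: "mon \<alpha> = mon (\<alpha> - Poly_Mapping.single j (r j)) * mon (Poly_Mapping.single j (r j))" by (rule mon_split)
    have "mon (\<alpha> - Poly_Mapping.single j (r j)) * mon (Poly_Mapping.single j (r j)) \<in> I" using r[of j] I' by blast
    then show "mon \<alpha> \<in> I" unfolding e .
  qed
  then show thesis by (rule that)
qed

lemma remdups_adj_descending:
  "remdups_adj (map V (rev [0..<Suc m])) = V m # map V (filter (\<lambda>\<delta>. V \<delta> \<noteq> V (Suc \<delta>)) (rev [0..<m]))"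
proof (induction m)
  case (Suc m)
  have "remdups_adj (map V (rev [0..<Suc (Suc m)])) = remdups_adj (V (Suc m) # map V (rev [0..<Suc m]))" by simp
  also have "\<dots> = (if V (Suc m) = V m then remdups_adj (map V (rev [0..<Suc m]))
      else V (Suc m) # remdups_adj (map V (rev [0..<Suc m])))"
    by (simp add: remdups_adj_Cons')
  finally show ?case using Suc by auto
qed simp

text \<open>The jumps of a descending flag, listed by their smaller members instead of their larger ones.\<close>

lemma descending_shift:
  "V m # map V (filter (\<lambda>\<delta>. V \<delta> \<noteq> V (Suc \<delta>)) (rev [0..<m])) =
    map (\<lambda>\<delta>. V (Suc \<delta>)) (filter (\<lambda>\<delta>. V \<delta> \<noteq> V (Suc \<delta>)) (rev [0..<m])) @ [V 0]"
  by (induction m) auto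

lemma laurent_hom: "comm_ring_hom (Poly_Mapping.single (0 :: int) :: 'k::field \<Rightarrow> 'k laurent)"
  by unfold_locales (auto simp: single_add mult_single)

lemma const_poly_hom: "comm_ring_hom (\<lambda>c :: 'k::field. [:c:])"
  by unfold_locales (auto simp: one_pCons)

lemma eval_0_hom: "comm_ring_hom (\<lambda>f :: 'k::field poly. poly f 0)"
  by unfold_locales auto

lemma poly_to_laurent_superset:
  "Polynomial.degree f \<le> m \<Longrightarrow> poly_to_laurent f = (\<Sum>i\<le>m. Poly_Mapping.single (int i) (Polynomial.coeff f i))"
  unfolding poly_to_laurent_def
  by (rule sum.mono_neutral_left) (auto simp: coeff_eq_0 not_le)

lemma poly_to_laurent_pCons:
  "poly_to_laurent (pCons c f) = Poly_Mapping.single 0 c + Poly_Mapping.single 1 1 * poly_to_laurent f"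
proof -
  have "poly_to_laurent (pCons c f) = (\<Sum>i\<le>Suc (Polynomial.degree f). Poly_Mapping.single (int i) (Polynomial.coeff (pCons c f) i))"
    by (rule poly_to_laurent_superset) (simp add: degree_pCons_le)
  also have "\<dots> = Poly_Mapping.single 0 c + (\<Sum>i\<le>Polynomial.degree f. Poly_Mapping.single (int (Suc i)) (Polynomial.coeff f i))"
    by (subst sum.atMost_Suc_shift) simp
  finally show ?thesis by (simp add: poly_to_laurent_def sum_distrib_left mult_single)
qed

lemma poly_to_laurent_hom: "comm_ring_hom (poly_to_laurent :: 'k::field poly \<Rightarrow> 'k laurent)"
proof -
  have z: "poly_to_laurent (0 :: 'k poly) = 0" by (simp add: poly_to_laurent_def)
  have c: "poly_to_laurent [:c:] = Poly_Mapping.single 0 c" for c :: 'k by (simp add: poly_to_laurent_def)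
  have a: "poly_to_laurent (f + g) = poly_to_laurent f + poly_to_laurent g" for f g :: "'k poly"
  proof -
    let ?m = "max (Polynomial.degree f) (Polynomial.degree g)"
    have "poly_to_laurent (f + g) = (\<Sum>i\<le>?m. Poly_Mapping.single (int i) (Polynomial.coeff (f + g) i))"
      by (rule poly_to_laurent_superset) (rule degree_add_le_max)
    then show ?thesis
      by (simp add: poly_to_laurent_superset[of f ?m] poly_to_laurent_superset[of g ?m] single_add sum.distrib)
  qed
  have s: "poly_to_laurent (smult c f) = Poly_Mapping.single 0 c * poly_to_laurent f" for c and f :: "'k poly"
    by (simp add: poly_to_laurent_superset[of "smult c f" "Polynomial.degree f"] poly_to_laurent_def sum_distrib_left mult_single degree_smult_le)
  have m: "poly_to_laurent (f * g) = poly_to_laurent f * poly_to_laurent g" for f g :: "'k poly"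
  proof (induction f)
    case 0 then show ?case by (simp add: z)
  next
    case (pCons b f)
    have "poly_to_laurent (pCons b f * g) = poly_to_laurent (smult b g) + poly_to_laurent (pCons 0 (f * g))"
      by (simp add: a)
    then show ?case using pCons by (simp add: s poly_to_laurent_pCons distrib_right mult.assoc)
  qed
  show ?thesis
    by unfold_locales (auto simp: z a m c[of 1, simplified one_pCons[symmetric]])
qed

lemma sym_form_scale_cong:
  assumes w: "sym_form J i w"
    and eq: "\<And>\<phi>s \<psi>s. \<phi>s \<in> tuples i (dual_space J) \<Longrightarrow> \<psi>s \<in> tuples i (dual_space J) \<Longrightarrow> w' \<phi>s \<psi>s = c * w \<phi>s \<psi>s"
  shows "sym_form J i w'"
  unfolding sym_form_def
proof (intro ballI conjI allI impI)
  fix \<phi>s \<psi>s assume t: "\<phi>s \<in> tuples i (dual_space J)" "\<psi>s \<in> tuples i (dual_space J)"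
  note W = w[unfolded sym_form_def, rule_format, OF t]
  show "w' \<phi>s \<psi>s = w' \<psi>s \<phi>s" using eq[OF t] eq[OF t(2,1)] W by simp
  {
    fix k \<phi> \<phi>' b assume k: "k < i" and p: "\<phi> \<in> dual_space J" "\<phi>' \<in> dual_space J"
    have "(\<lambda>f. \<phi> f + b * \<phi>' f) \<in> dual_space J" using p by (auto simp: dual_space_iff intro: linear_form_plus)
    then have u: "\<phi>s[k := \<lambda>f. \<phi> f + b * \<phi>' f] \<in> tuples i (dual_space J)" "\<phi>s[k := \<phi>] \<in> tuples i (dual_space J)"
      "\<phi>s[k := \<phi>'] \<in> tuples i (dual_space J)"
      using t(1) p by (auto simp: tuples_def dest!: set_update_subset_insert[THEN subsetD])
    show "w' (\<phi>s[k := \<lambda>f. \<phi> f + b * \<phi>' f]) \<psi>s = w' (\<phi>s[k := \<phi>]) \<psi>s + b * w' (\<phi>s[k := \<phi>']) \<psi>s"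
      using W k p unfolding eq[OF u(1) t(2)] eq[OF u(2) t(2)] eq[OF u(3) t(2)] by (simp add: algebra_simps)
  next
    fix a b assume "a < i" "b < i" "a \<noteq> b \<and> \<phi>s ! a = \<phi>s ! b"
    then have "w \<phi>s \<psi>s = 0" using W by blast
    then show "w' \<phi>s \<psi>s = 0" using eq[OF t] by simp
  }
qed

context adapted_blocks
begin

lemma sym_form_block_form:
  assumes C: "bij_betw \<sigma> C C" "C \<subseteq> {..<d}"
  shows "sym_form J 1 (\<lambda>\<phi>s \<psi>s. block_form h v C (hd \<phi>s) (hd \<psi>s))"
  unfolding sym_form_def
proof (intro ballI conjI allI impI)
  fix \<phi>s \<psi>s assume "\<phi>s \<in> tuples 1 (dual_space J)" "\<psi>s \<in> tuples 1 (dual_space J)"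
  then obtain \<phi>0 where l: "\<phi>s = [\<phi>0]" by (auto simp: tuples_def length_Suc_conv)
  show "block_form h v C (hd \<phi>s) (hd \<psi>s) = block_form h v C (hd \<psi>s) (hd \<phi>s)"
    unfolding block_form_def using block_form_sym_gen[OF C, of "\<lambda>_. 1"] by simp
  {
    fix k \<phi> \<phi>' c assume "k < (1::nat)"
    then show "block_form h v C (hd (\<phi>s[k := \<lambda>f. \<phi> f + c * \<phi>' f])) (hd \<psi>s) =
        block_form h v C (hd (\<phi>s[k := \<phi>])) (hd \<psi>s) + c * block_form h v C (hd (\<phi>s[k := \<phi>'])) (hd \<psi>s)"
      by (simp add: l block_form_def U_def algebra_simps sum.distrib sum_distrib_left)
  next
    fix a b assume "a < (1::nat)" "b < (1::nat)" "a \<noteq> b \<and> \<phi>s ! a = \<phi>s ! b"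
    then show "block_form h v C (hd \<phi>s) (hd \<psi>s) = 0" by simp
  }
qed

lemma base_change_family_form:
  assumes h: "comm_ring_hom h" and g: "comm_ring_hom g"
  shows "base_change d g (degeneration h v, family_form h v) (degeneration (\<lambda>c. g (h c)) (g v), family_form (\<lambda>c. g (h c)) (g v))"
  unfolding base_change_def prod.case degeneration_base_change[OF h g]
proof (intro conjI ballI refl sym_form_family_form)
  fix i
  show "\<exists>c. c dvd 1 \<and> (\<forall>\<phi>s\<in>tuples i (dual_space (degeneration h v)). \<forall>\<psi>s\<in>tuples i (dual_space (degeneration h v)).
      family_form (\<lambda>c. g (h c)) (g v) i (map (extend_functional g) \<phi>s) (map (extend_functional g) \<psi>s) = c * g (family_form h v i \<phi>s \<psi>s))"
  proof (intro exI[of _ 1] conjI ballI)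
    fix \<phi>s \<psi>s assume "\<phi>s \<in> tuples i (dual_space (degeneration h v))" "\<psi>s \<in> tuples i (dual_space (degeneration h v))"
    then show "family_form (\<lambda>c. g (h c)) (g v) i (map (extend_functional g) \<phi>s) (map (extend_functional g) \<psi>s) = 1 * g (family_form h v i \<phi>s \<psi>s)"
      unfolding mult_1_left by (intro family_form_base_change[OF h g]) (auto simp: tuples_def dual_space_iff)
  qed simp
qed

text \<open>The translate of the constant family by a unit \<open>v\<close> is the base change of any family whose parameter becomes
\<open>v\<close>; the \<open>i\<close>-th forms agree up to the unit \<open>v\<close> to the power \<open>minwt i\<close>.\<close>

lemma base_change_translate:
  assumes h: "comm_ring_hom h" and g: "comm_ring_hom g" and gh: "\<And>c. g (h c) = h' c" and v: "g u = v" "v * v' = 1"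
  shows "base_change d g (degeneration h u, family_form h u) (torus_translate v (degeneration h' 1, family_form h' 1))"
  unfolding base_change_def torus_translate_def prod.case
proof (intro conjI ballI)
  have h': "comm_ring_hom h'" using hom_comp_ring[OF h g] by (simp add: gh)
  show J: "scale_vars v ` degeneration h' 1 = Idl\<^bsub>\<S>\<^esub> (Poly_Mapping.map g ` degeneration h u)"
    unfolding degeneration_scale[OF h' v(2)] degeneration_base_change[OF h g] gh v(1) ..
  fix i
  let ?w = "\<lambda>\<phi>s \<psi>s. family_form h' 1 i (map (\<lambda>\<phi>. \<phi> \<circ> scale_vars v) \<phi>s) (map (\<lambda>\<psi>. \<psi> \<circ> scale_vars v) \<psi>s)"
  have w: "?w \<phi>s \<psi>s = v ^ minwt i * family_form h' v i \<phi>s \<psi>s"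
    if "length \<phi>s = i" "length \<psi>s = i" "\<And>\<phi>. \<phi> \<in> set \<phi>s \<union> set \<psi>s \<Longrightarrow> linear_form \<phi>" for \<phi>s \<psi>s
    by (rule family_form_translate[OF h' that])
  show "sym_form (scale_vars v ` degeneration h' 1) i ?w"
    by (rule sym_form_scale_cong[OF sym_form_family_form[of _ _ h' v], where c = "v ^ minwt i"])
      (rule w; auto simp: tuples_def dual_space_iff)
  show "\<exists>c. c dvd 1 \<and> (\<forall>\<phi>s\<in>tuples i (dual_space (degeneration h u)). \<forall>\<psi>s\<in>tuples i (dual_space (degeneration h u)).
      ?w (map (extend_functional g) \<phi>s) (map (extend_functional g) \<psi>s) = c * g (family_form h u i \<phi>s \<psi>s))"
  proof (intro exI[of _ "v ^ minwt i"] conjI ballI)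
    show "v ^ minwt i dvd 1"     proof (rule dvdI)
      show "1 = v ^ minwt i * v' ^ minwt i" using v(2) by (simp flip: power_mult_distrib)
    qed
    fix \<phi>s \<psi>s assume t: "\<phi>s \<in> tuples i (dual_space (degeneration h u))" "\<psi>s \<in> tuples i (dual_space (degeneration h u))"
    have "?w (map (extend_functional g) \<phi>s) (map (extend_functional g) \<psi>s) =
        v ^ minwt i * family_form h' v i (map (extend_functional g) \<phi>s) (map (extend_functional g) \<psi>s)"
      by (rule w) (use t in \<open>auto simp: tuples_def extend_functional_eq\<close>)
    also have "family_form h' v i (map (extend_functional g) \<phi>s) (map (extend_functional g) \<psi>s) = g (family_form h u i \<phi>s \<psi>s)"
      using t unfolding gh[symmetric] v(1)[symmetric]
      by (intro family_form_base_change[OF h g]) (auto simp: tuples_def dual_space_iff)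
    finally show "?w (map (extend_functional g) \<phi>s) (map (extend_functional g) \<psi>s) = v ^ minwt i * g (family_form h u i \<phi>s \<psi>s)" .
  qed
qed

end

context adapted_local
begin

text \<open>The jumps of the flag, listed by increasing weight.\<close>

definition deltas where "deltas = filter (\<lambda>\<delta>. weight_block \<delta> \<noteq> {}) (rev [0..<s + 1])"

lemma deltas_iff: "\<delta> \<in> set deltas \<longleftrightarrow> weight_block \<delta> \<noteq> {}"
  by (auto simp: deltas_def weight_block_def)

lemma distinct_deltas: "distinct deltas"
  by (simp add: deltas_def)

lemma Min_w_weight_block: "weight_block \<delta> \<noteq> {} \<Longrightarrow> Min (w ` weight_block \<delta>) = s - \<delta>"
proof -
  assume "weight_block \<delta> \<noteq> {}"
  then have "w ` weight_block \<delta> = {s - \<delta>}" by (auto simp: weight_block_def)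
  then show ?thesis by simp
qed

sublocale adapted_blocks I \<eta> d E n \<sigma> p "map weight_block deltas" "\<lambda>C. Min (w ` C)"
proof
  show "\<Union>(set (map weight_block deltas)) = {..<d}"
  proof
    show "{..<d} \<subseteq> \<Union>(set (map weight_block deltas))"
    proof
      fix a assume "a \<in> {..<d}"
      then have "a \<in> weight_block (s - w a)" using w_le[of a] by (simp add: weight_block_def)
      then show "a \<in> \<Union>(set (map weight_block deltas))" using deltas_iff by auto
    qed
  qed (auto simp: weight_block_def)
  show "pairwise disjnt (set (map weight_block deltas))"
    by (auto simp: pairwise_def disjnt_def weight_block_def)
  have "inj_on weight_block (set deltas)"
  proof (rule inj_onI)
    fix \<delta> \<delta>' assume "\<delta> \<in> set deltas" and e: "weight_block \<delta> = weight_block \<delta>'"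
    then obtain a where "a \<in> weight_block \<delta>" using deltas_iff by blast
    moreover from this have "a \<in> weight_block \<delta>'" using e by simp
    ultimately show "\<delta> = \<delta>'" unfolding weight_block_def by simp
  qed
  then show "distinct (map weight_block deltas)" using distinct_deltas by (simp add: distinct_map)
  show "n a + n (\<sigma> a) = Min (w ` C)" if C: "C \<in> set (map weight_block deltas)" and a: "a \<in> C" for C a
  proof -
    obtain \<delta> where e: "C = weight_block \<delta>" using C by auto
    then have "Min (w ` C) = s - \<delta>" using a by (intro Min_w_weight_block[of \<delta>, folded e]) auto
    moreover have "w a = s - \<delta>" using a unfolding e weight_block_def by auto
    ultimately show ?thesis by (metis w_def)
  qed
  have "sorted_wrt (>) deltas" unfolding deltas_def
    by (intro sorted_wrt_filter) (simp add: sorted_wrt_rev)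
  then have "sorted_wrt (\<lambda>x y. Min (w ` weight_block x) < Min (w ` weight_block y)) deltas"
  proof (rule sorted_wrt_mono_rel[rotated])
    fix x y assume xy: "x \<in> set deltas" "y \<in> set deltas" "y < x"
    then have "x \<le> s" unfolding deltas_def set_filter set_rev set_upt by auto
    then show "Min (w ` weight_block x) < Min (w ` weight_block y)" using xy by (simp add: Min_w_weight_block deltas_iff)
  qed
  then show "sorted_wrt (<) (map (\<lambda>C. Min (w ` C)) (map weight_block deltas))" by (simp add: sorted_wrt_map)
qed

lemma X_neq_iff: "limit_ideal \<delta> \<noteq> limit_ideal (Suc \<delta>) \<longleftrightarrow> weight_block \<delta> \<noteq> {}"
proof
  assume "limit_ideal \<delta> \<noteq> limit_ideal (Suc \<delta>)"
  then show "weight_block \<delta> \<noteq> {}" by (auto simp: X_l0 weight_block_def less_Suc_eq)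
next
  assume "weight_block \<delta> \<noteq> {}"
  then obtain a where "a < d" "w a + \<delta> = s" by (auto simp: weight_block_def)
  then show "limit_ideal \<delta> \<noteq> limit_ideal (Suc \<delta>)" using e0_X[of a \<delta>] e0_X[of a "Suc \<delta>"] by auto
qed

text \<open>The flag of ideals and the broken quadric of the limit. The ideal for \<open>\<delta>\<close> is \<open>I\<^sub>\<delta>\<^sub>+\<^sub>1\<close>, because the quadric for
\<open>\<delta>\<close> lives on \<open>I\<^sub>\<delta> / I\<^sub>\<delta>\<^sub>+\<^sub>1\<close>.\<close>

definition Js where "Js = map (\<lambda>\<delta>. limit_ideal (Suc \<delta>)) deltas"
definition qs where "qs = map block_quadric deltas"

lemma Js_chain: "Js @ [UNIV] = limit_ideal (Suc s) # map limit_ideal deltas"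
proof -
  have "deltas = filter (\<lambda>\<delta>. limit_ideal \<delta> \<noteq> limit_ideal (Suc \<delta>)) (rev [0..<Suc s])"
    by (simp add: deltas_def X_neq_iff)
  then show ?thesis using descending_shift[of limit_ideal "Suc s"] X_zero by (simp add: Js_def)
qed

lemma next_ideal_Js: "j < length deltas \<Longrightarrow> next_ideal Js j = limit_ideal (deltas ! j)"
  by (simp add: next_ideal_def Js_chain)

lemma piece_Js: "j < length deltas \<Longrightarrow> piece Js j = P (deltas ! j)"
  by (simp add: piece_def next_ideal_Js P_def) (simp add: Js_def)

lemma hd_Js: "deltas \<noteq> [] \<Longrightarrow> hd Js = limit_ideal (Suc s)"
  using Js_chain by (cases Js) (auto simp: Js_def)

lemma d_pos_deltas: "0 < d \<Longrightarrow> deltas \<noteq> []"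
  using Cs_Union by auto

lemma colength_X: "colength (limit_ideal \<delta>) = card {a. a < d \<and> s < w a + \<delta>}"
  by (rule colength_eq[OF X_ideal free_X])

lemma colength_diff: "colength (limit_ideal (Suc \<delta>)) - colength (limit_ideal \<delta>) = card (weight_block \<delta>)"
proof -
  have "{a. a < d \<and> s < w a + Suc \<delta>} = {a. a < d \<and> s < w a + \<delta>} \<union> weight_block \<delta>" by (auto simp: weight_block_def)
  then have "card {a. a < d \<and> s < w a + Suc \<delta>} = card {a. a < d \<and> s < w a + \<delta>} + card (weight_block \<delta>)"
    by (simp add: card_Un_disjoint weight_block_def disjoint_iff)
  then show ?thesis by (simp add: colength_X)
qed

lemma iar_point_limit: "0 < d \<Longrightarrow> iar_point d Js qs"
  unfolding iar_point_def
proof (intro conjI allI impI)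
  assume d: "0 < d"
  show "Js \<noteq> []" "length qs = length Js" using d_pos_deltas[OF d] by (auto simp: Js_def qs_def)
  show "\<forall>J\<in>set Js. ideal J \<S>" using X_ideal by (auto simp: Js_def)
  show "free_of_rank d (hd Js)" unfolding hd_Js[OF d_pos_deltas[OF d]] degeneration_0[symmetric] by (rule degeneration_free[OF id_comm_ring_hom])
  fix j assume "j < length Js"
  then have j: "j < length deltas" by (simp add: Js_def)
  have "limit_ideal (Suc (deltas ! j)) \<noteq> limit_ideal (deltas ! j)" using X_neq_iff[of "deltas ! j"] deltas_iff[of "deltas ! j"] j by auto
  then show "Js ! j \<subset> next_ideal Js j" using X_dec[of "deltas ! j"] j by (simp add: next_ideal_Js) (auto simp: Js_def)
  show "module_iso \<S> (dual_module cst (piece Js j)) (piece Js j) (qs ! j)" "symmetric_map cst (piece Js j) (qs ! j)"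
    using block_quadric_iso block_quadric_symmetric j by (auto simp: piece_Js qs_def)
qed

lemma on_cosets_P:
  assumes "\<phi> \<in> dual_space (limit_ideal (Suc \<delta>))"
  shows "on_cosets (P \<delta>) \<phi> \<in> carrier (dual_module cst (P \<delta>))" "f \<in> limit_ideal \<delta> \<Longrightarrow> on_cosets (P \<delta>) \<phi> (sc \<delta> f) = \<phi> f"
proof -
  have l: "linear_form \<phi>" and z: "\<And>f. f \<in> limit_ideal (Suc \<delta>) \<Longrightarrow> \<phi> f = 0" using assms by (auto simp: dual_space_iff)
  have ev: "on_cosets (P \<delta>) \<phi> (sc \<delta> f) = \<phi> f" if "f \<in> limit_ideal \<delta>" for f
  proof -
    have "sc \<delta> f \<in> carrier (P \<delta>)" using that by (simp add: carrier_P)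
    moreover have "\<phi> (SOME x. x \<in> sc \<delta> f) = \<phi> f" using z[OF some_sc[of \<delta> f]] by (simp add: linear_form_simps(5)[OF l])
    ultimately show ?thesis by (simp add: on_cosets_def)
  qed
  then show "f \<in> limit_ideal \<delta> \<Longrightarrow> on_cosets (P \<delta>) \<phi> (sc \<delta> f) = \<phi> f" .
  have "on_cosets (P \<delta>) \<phi> \<in> extensional (carrier (P \<delta>))" by (simp add: on_cosets_def)
  then show "on_cosets (P \<delta>) \<phi> \<in> carrier (dual_module cst (P \<delta>))"
    unfolding dual_module_def by (auto simp: carrier_P P_add P_smult ev X_plus X_mult linear_form_simps[OF l])
qed

text \<open>The form \<open>block_form\<close> is defined on all functionals on \<open>gr(A)\<close>, whereas the member of the broken quadric
sees only those that vanish on \<open>I\<^sub>\<delta>\<^sub>+\<^sub>1\<close>. So the former is a lift of the latter.\<close>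

lemma quad_form_Js:
  assumes j: "j < length deltas" and \<phi>: "\<phi> \<in> dual_space (Js ! j)" and \<psi>: "\<psi> \<in> dual_space (Js ! j)"
  shows "quad_form Js qs j \<phi> \<psi> = block_form (\<lambda>c. c) 0 (weight_block (deltas ! j)) \<phi> \<psi>"
proof -
  let ?\<delta> = "deltas ! j"
  have Jj: "Js ! j = limit_ideal (Suc ?\<delta>)" using j by (simp add: Js_def)
  note o\<phi> = on_cosets_P[OF \<phi>[unfolded Jj]] and o\<psi> = on_cosets_P[OF \<psi>[unfolded Jj]]
  have "quad_form Js qs j \<phi> \<psi> = on_cosets (P ?\<delta>) \<psi> (block_quadric ?\<delta> (on_cosets (P ?\<delta>) \<phi>))"
    using j by (simp add: quad_form_def piece_Js qs_def)
  also have "\<dots> = (\<Sum>a\<in>weight_block ?\<delta>. 1 / p a * \<phi> (e0 a) * \<psi> (e0 (\<sigma> a)))"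
    unfolding dual_P_block_quadric[OF o\<psi>(1)] by (rule sum.cong) (auto simp: o\<phi>(2)[OF e0_weight_block] o\<psi>(2)[OF e0_\<sigma>_weight_block])
  finally show ?thesis by (simp add: block_form_def U_def Y_def)
qed

lemma iar_coords_limit:
  assumes d: "0 < d"
  shows "iar_coords d Js qs (family_form (\<lambda>c. c) 0)"
  unfolding iar_coords_def
proof (intro exI[of _ "\<lambda>j. block_form (\<lambda>c. c) 0 (weight_block (deltas ! j))"] conjI allI impI ballI)
  fix j assume "j < length Js"
  then have j: "j < length deltas" by (simp add: Js_def)
  show "sym_form (hd Js) 1 (\<lambda>\<phi>s \<psi>s. block_form (\<lambda>c. c) 0 (weight_block (deltas ! j)) (hd \<phi>s) (hd \<psi>s))"
    by (rule sym_form_block_form[OF \<sigma>_weight_block weight_block_sub])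
  fix \<phi> \<psi> assume "\<phi> \<in> dual_space (Js ! j)" "\<psi> \<in> dual_space (Js ! j)"
  then show "block_form (\<lambda>c. c) 0 (weight_block (deltas ! j)) \<phi> \<psi> = quad_form Js qs j \<phi> \<psi>" using quad_form_Js[OF j] by simp
next
  fix i assume i: "i \<in> {1..d}"
  have e: "map (\<lambda>j. (colength (Js ! j) - colength (next_ideal Js j), block_form (\<lambda>c. c) (0 :: 'k) (weight_block (deltas ! j)))) [0..<length Js] =
    map (\<lambda>C. (card C, block_form (\<lambda>c. c) 0 C)) (map weight_block deltas)"
    by (rule nth_equalityI) (auto simp: Js_def next_ideal_Js[unfolded Js_def] colength_diff)
  show "\<exists>c. c \<noteq> 0 \<and> (\<forall>\<phi>s\<in>tuples i (dual_space (hd Js)). \<forall>\<psi>s\<in>tuples i (dual_space (hd Js)).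
      family_form (\<lambda>c. c) 0 i \<phi>s \<psi>s = c * broken_wedge
        (map (\<lambda>j. (colength (Js ! j) - colength (next_ideal Js j), block_form (\<lambda>c. c) 0 (weight_block (deltas ! j)))) [0..<length Js]) i \<phi>s \<psi>s)"
    unfolding e
  proof (intro exI[of _ 1] conjI ballI)
    fix \<phi>s \<psi>s assume "\<phi>s \<in> tuples i (dual_space (hd Js))" "\<psi>s \<in> tuples i (dual_space (hd Js))"
    then show "family_form (\<lambda>c. c) 0 i \<phi>s \<psi>s = 1 * broken_wedge (map (\<lambda>C. (card C, block_form (\<lambda>c. c) 0 C)) (map weight_block deltas)) i \<phi>s \<psi>s"
      using broken_wedge_family_form[of i \<phi>s \<psi>s "\<lambda>c. c"] i by (auto simp: tuples_def simp del: map_map)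
  qed simp
qed

text \<open>The four instances of the degeneration: \<open>I\<close> itself over \<open>k\<close>, the constant family over \<open>k[u, u\<^sup>-\<^sup>1]\<close>, the family
with parameter \<open>u\<close> over \<open>k[u]\<close>, and its fibre at \<open>0\<close>.\<close>

lemma is_torus_limit_adapted:
  assumes d: "0 < d" and pt: "iar_point d [I] [q]"
    and quad: "\<And>\<phi> \<psi>. \<phi> \<in> dual_space I \<Longrightarrow> \<psi> \<in> dual_space I \<Longrightarrow> quad_form [I] [q] 0 \<phi> \<psi> = block_form (\<lambda>c. c) 1 {..<d} \<phi> \<psi>"
  shows "is_torus_limit d [I] [q] Js qs"
proof -
  \<comment> \<open>the coordinate \<open>u\<close> of the affine line, and its image in Laurent polynomials\<close>
  let ?u = "[:0, 1:] :: 'k poly" and ?U = "Poly_Mapping.single 1 1 :: 'k laurent"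
  have rank_I: "free_of_rank d I" using pt by (simp add: iar_point_def)
  have c1: "iar_coords d [I] [q] (family_form (\<lambda>c. c) 1)"
    unfolding iar_coords_def
  proof (intro exI[of _ "\<lambda>_. block_form (\<lambda>c. c) 1 {..<d}"] conjI allI impI ballI)
    show "sym_form (hd [I]) 1 (\<lambda>\<phi>s \<psi>s. block_form (\<lambda>c. c) 1 {..<d} (hd \<phi>s) (hd \<psi>s))"
      by (rule sym_form_block_form[OF bij_\<sigma>]) simp
    fix j \<phi> \<psi> assume "j < length [I]" "\<phi> \<in> dual_space ([I] ! j)" "\<psi> \<in> dual_space ([I] ! j)"
    then show "block_form (\<lambda>c. c) 1 {..<d} \<phi> \<psi> = quad_form [I] [q] j \<phi> \<psi>" using quad by simp
  next
    fix i assume i: "i \<in> {1..d}"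
    have cu: "colength (UNIV :: ('n, 'k) mpoly set) = 0" 
    proof -
      have "{a. a < d \<and> s < w a + 0} = {}" using w_le by (fastforce simp: not_less)
      then show ?thesis using colength_X[of 0] X_zero by simp
    qed
    have e: "map (\<lambda>j. (colength ([I] ! j) - colength (next_ideal [I] j), block_form (\<lambda>c. c) (1 :: 'k) {..<d})) [0..<length [I]] = [(d, block_form (\<lambda>c. c) 1 {..<d})]"
      by (simp add: next_ideal_def cu colength_eq[OF ideal_I rank_I])
    show "\<exists>c. c \<noteq> 0 \<and> (\<forall>\<phi>s\<in>tuples i (dual_space (hd [I])). \<forall>\<psi>s\<in>tuples i (dual_space (hd [I])).
      family_form (\<lambda>c. c) 1 i \<phi>s \<psi>s = c * broken_wedge
        (map (\<lambda>j. (colength ([I] ! j) - colength (next_ideal [I] j), block_form (\<lambda>c. c) 1 {..<d})) [0..<length [I]]) i \<phi>s \<psi>s)"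
      unfolding e using i family_form_eq_ext_pow_block_form by (intro exI[of _ 1]) (auto simp: tuples_def)
  qed
  have b1: "base_change d (Poly_Mapping.single (0 :: int)) (hd [I], family_form (\<lambda>c. c) 1)
      (degeneration (Poly_Mapping.single 0) 1, family_form (Poly_Mapping.single 0) 1)"
    using base_change_family_form[OF id_comm_ring_hom laurent_hom, of 1] by (simp add: degeneration_id)
  have fam: "iar_family d (degeneration (\<lambda>c. [:c:]) ?u) (family_form (\<lambda>c. [:c:]) ?u)"
    by (rule iar_family_degeneration[OF const_poly_hom]) simp
  have b2: "base_change d poly_to_laurent (degeneration (\<lambda>c. [:c:]) ?u, family_form (\<lambda>c. [:c:]) ?u)
      (torus_translate ?U (degeneration (Poly_Mapping.single 0) 1, family_form (Poly_Mapping.single 0) 1))"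
  proof (rule base_change_translate[OF const_poly_hom poly_to_laurent_hom])
    show "poly_to_laurent [:c:] = Poly_Mapping.single 0 c" for c :: 'k by (simp add: poly_to_laurent_def)
    show "poly_to_laurent ?u = ?U" by (simp add: poly_to_laurent_def)
    show "?U * Poly_Mapping.single (- 1) 1 = 1" by (simp add: mult_single)
  qed
  have b3: "base_change d (\<lambda>f. poly f 0) (degeneration (\<lambda>c. [:c:]) ?u, family_form (\<lambda>c. [:c:]) ?u) (hd Js, family_form (\<lambda>c. c) 0)"
    using base_change_family_form[OF const_poly_hom eval_0_hom, of ?u] by (simp add: hd_Js[OF d_pos_deltas[OF d]] degeneration_0)
  show ?thesis
    unfolding is_torus_limit_def
    using pt iar_point_limit[OF d] c1 iar_coords_limit[OF d] b1 fam b2 b3 by blast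
qed

end

section \<open>From an orientation to an adapted basis\<close>

lemma mdeg_eq_0: "mdeg \<alpha> = 0 \<longleftrightarrow> \<alpha> = 0"
  by (auto simp: mdeg_def poly_mapping_eq_iff fun_eq_iff)

context coordinate_quotient
begin

text \<open>An element outside \<open>\<mm>\<close> is a nonzero constant up to an element of \<open>\<mm>\<close>.\<close>

lemma maximal_mm:
  assumes I: "I \<subseteq> ord_ge 1"
  shows "maximalideal mm A"
proof (rule maximalidealI)
  show mm: "ideal mm A" unfolding mm_def by (rule ideal_image_A[OF ord_ge_ideal])
  have sub: "is_sub (ord_ge 1)" using I by (auto simp: is_sub_def ord_ge_def lookup_minus)
  have "(1 :: ('n, 'k) mpoly) \<notin> ord_ge 1"
    by (auto simp: ord_ge_def lookup_one intro!: exI[of _ 0])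
  then have "\<pi> 1 \<notin> mm" unfolding mm_def using \<pi>_mem_image[OF sub] by blast
  then show "carrier A \<noteq> mm" using \<pi>_carrier[of 1] by metis
  fix J assume J: "ideal J A" "mm \<subseteq> J" "J \<subseteq> carrier A"
  interpret J: ideal J A by (rule J(1))
  show "J = mm \<or> J = carrier A"
  proof (rule ccontr)
    assume neg: "\<not> (J = mm \<or> J = carrier A)"
    then obtain x where x: "x \<in> J" "x \<notin> mm" using J(2) by blast
    then obtain f where f: "x = \<pi> f" using J(3) carrier_A by blast
    define c where "c = Poly_Mapping.lookup f 0"
    have "f \<notin> ord_ge 1" using x f by (auto simp: mm_def)
    then have c: "c \<noteq> 0" by (auto simp: ord_ge_def c_def mdeg_eq_0)
    have "cst c - f \<in> ord_ge 1"
      by (auto simp: ord_ge_def c_def lookup_minus cst_def lookup_single mdeg_eq_0)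
    then have "\<pi> (cst c - f) \<in> J" using J(2) by (auto simp: mm_def)
    then have "\<pi> (cst c) \<in> J" using J.a_closed[OF x(1)[unfolded f], of "\<pi> (cst c - f)"] by (simp add: \<pi>_hom)
    then have "\<pi> (cst (1 / c)) \<otimes>\<^bsub>A\<^esub> \<pi> (cst c) \<in> J" by (rule J.I_l_closed) simp
    then have "\<one>\<^bsub>A\<^esub> \<in> J" using c by (simp add: \<pi>_hom flip: cst_mult)
    then show False using J.one_imp_carrier neg by blast
  qed
qed

lemma ord_ge_max_power:
  assumes N: "ord_ge N \<subseteq> I"
  shows "ord_ge (Suc (max_power A mm)) \<subseteq> I"
proof -
  define B where "B = {i. ideal_pow A mm i \<noteq> {\<zero>\<^bsub>A\<^esub>}}"
  have zero: "ideal_pow A mm i = {\<zero>\<^bsub>A\<^esub>} \<longleftrightarrow> ord_ge i \<subseteq> I" for i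
  proof -
    have "ideal_pow A mm i = {\<zero>\<^bsub>A\<^esub>} \<longleftrightarrow> (\<forall>f\<in>ord_ge i. \<pi> f = \<zero>\<^bsub>A\<^esub>)"
      unfolding ideal_pow_mm using ord_ge_simps(1)[of i] by blast
    then show ?thesis by (auto simp: \<pi>_zero_iff)
  qed
  have "B \<subseteq> {..<N}"
  proof
    fix i assume "i \<in> B"
    then have "\<not> ord_ge i \<subseteq> I" by (simp add: B_def zero)
    then show "i \<in> {..<N}" using ord_ge_antimono[of N i] N by (auto simp: not_le[symmetric])
  qed
  then have "finite B" by (rule finite_subset) simp
  then have "Suc (Max B) \<notin> B" by (meson Max_ge not_less_eq_eq order_refl)
  then show ?thesis by (simp add: B_def zero max_power_def)
qed

abbreviation whole where "whole \<equiv> piece [I] 0"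

lemma carrier_whole: "carrier whole = range \<pi>"
  by (auto simp: piece_def next_ideal_def subquotient_def proj_def)

lemma whole_add: "add whole = add A"
  by (simp add: piece_def next_ideal_def subquotient_def coord_ring_def FactRing_def)

lemma whole_smult: "g \<odot>\<^bsub>whole\<^esub> \<pi> f = \<pi> (g * f)"
proof -
  have e: "\<pi> (g * x) = \<pi> (g * f)" if "x \<in> \<pi> f" for x
  proof -
    have "x - f \<in> I" using that by (auto simp: proj_def a_r_coset_def')
    then show ?thesis unfolding \<pi>_eq right_diff_distrib[symmetric] by (rule I_simps(3))
  qed
  have "f \<in> \<pi> f" using I.a_rcos_self[of f] by (simp add: proj_def)
  then have "(\<Union>x\<in>\<pi> f. \<pi> (g * x)) = \<pi> (g * f)" using e by blast
  then show ?thesis by (simp add: piece_def next_ideal_def subquotient_def proj_def)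
qed

lemma dual_whole_iff: "\<phi> \<in> carrier (dual_module cst whole) \<longleftrightarrow>
    \<phi> \<in> extensional (range \<pi>) \<and> linear_form (\<lambda>f. \<phi> (\<pi> f))"
  by (auto simp: dual_module_def carrier_whole whole_add whole_smult \<pi>_hom linear_form_def)

text \<open>The orientation is defined over \<open>A\<close>, a point of the Iarrobino scheme over \<open>S\<close>. The underlying sets of
cosets and of functionals are the same.\<close>

lemma dual_self: "carrier (dual_module (coord_cst I) (self_module A)) = carrier (dual_module cst whole)"
  by (auto simp: dual_module_def self_module_def carrier_A carrier_whole whole_add whole_smult coord_cst_def \<pi>_hom
      simp flip: proj_def)

lemma on_cosets_whole:
  assumes "\<phi> \<in> dual_space I"
  shows "on_cosets whole \<phi> (\<pi> f) = \<phi> f" "on_cosets whole \<phi> \<in> carrier (dual_module cst whole)"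
proof -
  have \<phi>: "linear_form \<phi>" "\<And>f. f \<in> I \<Longrightarrow> \<phi> f = 0" using assms by (auto simp: dual_space_iff)
  have v: "on_cosets whole \<phi> (\<pi> f) = \<phi> f" for f
  proof -
    have "f \<in> \<pi> f" using I.a_rcos_self[of f] by (simp add: proj_def)
    then have "(SOME x. x \<in> \<pi> f) \<in> \<pi> f" by (rule someI)
    then have "(SOME x. x \<in> \<pi> f) - f \<in> I" by (auto simp: proj_def a_r_coset_def')
    then have "\<phi> ((SOME x. x \<in> \<pi> f) - f) = 0" by (rule \<phi>(2))
    then show ?thesis by (simp add: on_cosets_def carrier_whole linear_form_simps[OF \<phi>(1)])
  qed
  then show "on_cosets whole \<phi> (\<pi> f) = \<phi> f" .
  have "on_cosets whole \<phi> \<in> extensional (range \<pi>)" by (simp add: on_cosets_def carrier_whole)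
  then show "on_cosets whole \<phi> \<in> carrier (dual_module cst whole)" using \<phi>(1) by (simp add: dual_whole_iff v)
qed

text \<open>\<open>\<eta>\<close> is the functional that \<open>q\<close> sends to \<open>1\<close>. By linearity \<open>q\<close> sends the multiple \<open>f \<mapsto> \<eta> (g * f)\<close> to the
class of \<open>g\<close>. So every functional has this form, and \<open>q\<close> is symmetric because \<open>\<eta> (g * h) = \<eta> (h * g)\<close>.\<close>

lemma orientation_functional:
  assumes q: "orientation I q"
  obtains \<eta> where "linear_form \<eta>" "\<And>f. f \<in> I \<longleftrightarrow> (\<forall>g. \<eta> (f * g) = 0)"
    and "\<And>\<phi>. \<phi> \<in> carrier (dual_module cst whole) \<Longrightarrow> \<exists>g. q \<phi> = \<pi> g \<and> (\<forall>f. \<phi> (\<pi> f) = \<eta> (g * f))"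
    and "module_iso \<S> (dual_module cst whole) whole q" "symmetric_map cst whole q"
proof -
  let ?D = "dual_module (coord_cst I) (self_module A)"
  have q': "module_iso A ?D (self_module A) q" using q by (simp add: orientation_def)
  note q' = module_isoD[OF this]
  have mS: "add (self_module A) = add A" "module.smult (self_module A) = monoid.mult A"
    by (simp_all add: self_module_def)
  have cS: "carrier (self_module A) = range \<pi>" by (simp add: self_module_def carrier_A)
  have bij: "bij_betw q (carrier ?D) (range \<pi>)" using q'(1) by (simp add: cS)
  have "\<pi> 1 \<in> q ` carrier ?D" unfolding bij_betw_imp_surj_on[OF bij] by (rule rangeI)
  then obtain \<eta>' where \<eta>': "\<pi> 1 = q \<eta>'" "\<eta>' \<in> carrier ?D" by (rule imageE)
  note \<eta>' = \<eta>'(2) \<eta>'(1)[symmetric]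
  define \<eta> where "\<eta> f = \<eta>' (\<pi> f)" for f
  have lin: "linear_form \<eta>" using \<eta>'(1) unfolding dual_self dual_whole_iff \<eta>_def by blast
  let ?t = "\<lambda>g. \<pi> g \<odot>\<^bsub>?D\<^esub> \<eta>'"
  have t: "?t g = (\<lambda>x\<in>range \<pi>. \<eta>' (\<pi> g \<otimes>\<^bsub>A\<^esub> x))" for g
    by (simp add: dual_module_def self_module_def carrier_A)
  have t_val: "?t g (\<pi> f) = \<eta> (g * f)" for f g by (simp add: t \<pi>_hom \<eta>_def)
  have t_mem: "?t g \<in> carrier ?D" for g
    unfolding dual_self dual_whole_iff t_val using linear_form_mult[OF lin] by (simp add: t)
  have q_t: "q (?t g) = \<pi> g" for g
  proof -
    have "q (?t g) = \<pi> g \<otimes>\<^bsub>A\<^esub> \<pi> 1" using q'(3)[OF \<pi>_carrier \<eta>'(1), of g] by (simp add: \<eta>'(2) self_module_def)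
    then show ?thesis by (simp add: \<pi>_hom)
  qed
  have ex: "\<exists>g. q \<phi> = \<pi> g \<and> \<phi> = ?t g" if "\<phi> \<in> carrier ?D" for \<phi>
  proof -
    have "q \<phi> \<in> range \<pi>" using bij that by (auto simp: bij_betw_def)
    then obtain g where g: "q \<phi> = \<pi> g" by blast
    then have "q \<phi> = q (?t g)" by (simp add: q_t)
    then have "\<phi> = ?t g" using bij that t_mem by (auto simp: bij_betw_def dest: inj_onD)
    with g show ?thesis by blast
  qed
  show thesis
  proof (rule that[of \<eta>])
    show "linear_form \<eta>" by (rule lin)
    fix f show "f \<in> I \<longleftrightarrow> (\<forall>g. \<eta> (f * g) = 0)"
    proof (intro iffI allI)
      fix g assume "f \<in> I"
      then have "\<pi> (f * g) = \<pi> 0" unfolding \<pi>_eq using I_simps(4) by simp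
      then show "\<eta> (f * g) = 0" using linear_form_simps(3)[OF lin] by (simp add: \<eta>_def)
    next
      assume z: "\<forall>g. \<eta> (f * g) = 0"
      have "?t f = ?t 0"
      proof (rule extensionalityI[of _ "range \<pi>"])
        fix x assume "x \<in> range \<pi>"
        then show "?t f x = ?t 0 x" using z linear_form_simps(3)[OF lin] by (auto simp: t_val)
      qed (simp_all add: t)
      then have "\<pi> f = \<pi> 0" by (metis q_t)
      then show "f \<in> I" by (simp add: \<pi>_eq)
    qed
  next
    fix \<phi> assume "\<phi> \<in> carrier (dual_module cst whole)"
    then obtain g where "q \<phi> = \<pi> g" "\<phi> = ?t g" using ex unfolding dual_self by blast
    then show "\<exists>g. q \<phi> = \<pi> g \<and> (\<forall>f. \<phi> (\<pi> f) = \<eta> (g * f))" using t_val by blast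
  next
    show "module_iso \<S> (dual_module cst whole) whole q"
      unfolding module_iso_def
    proof (intro conjI ballI)
      show "bij_betw q (carrier (dual_module cst whole)) (carrier whole)"
        using bij by (simp add: dual_self carrier_whole)
      fix \<phi> assume \<phi>: "\<phi> \<in> carrier (dual_module cst whole)"
      {
        fix \<psi> assume "\<psi> \<in> carrier (dual_module cst whole)"
        then have "q (\<phi> \<oplus>\<^bsub>?D\<^esub> \<psi>) = q \<phi> \<oplus>\<^bsub>A\<^esub> q \<psi>" using q'(2)[of \<phi> \<psi>] \<phi> by (simp add: dual_self mS)
        moreover have "\<phi> \<oplus>\<^bsub>?D\<^esub> \<psi> = \<phi> \<oplus>\<^bsub>dual_module cst whole\<^esub> \<psi>"
          by (simp add: dual_module_def self_module_def carrier_A carrier_whole)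
        ultimately show "q (\<phi> \<oplus>\<^bsub>dual_module cst whole\<^esub> \<psi>) = q \<phi> \<oplus>\<^bsub>whole\<^esub> q \<psi>" by (simp add: whole_add)
      next
        fix r :: "('n, 'k) mpoly"
        obtain g where g: "q \<phi> = \<pi> g" using ex \<phi> unfolding dual_self by blast
        have "q (\<pi> r \<odot>\<^bsub>?D\<^esub> \<phi>) = \<pi> r \<otimes>\<^bsub>A\<^esub> q \<phi>" using q'(3)[OF \<pi>_carrier, of \<phi> r] \<phi> by (simp add: dual_self mS)
        moreover have "\<pi> r \<odot>\<^bsub>?D\<^esub> \<phi> = r \<odot>\<^bsub>dual_module cst whole\<^esub> \<phi>"
          by (auto simp: dual_module_def self_module_def carrier_A carrier_whole whole_smult \<pi>_hom fun_eq_iff)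
        ultimately show "q (r \<odot>\<^bsub>dual_module cst whole\<^esub> \<phi>) = r \<odot>\<^bsub>whole\<^esub> q \<phi>" by (simp add: g whole_smult \<pi>_hom)
      }
    qed
    show "symmetric_map cst whole q"
      unfolding symmetric_map_def
    proof (intro ballI)
      fix \<phi> \<psi> assume "\<phi> \<in> carrier (dual_module cst whole)" "\<psi> \<in> carrier (dual_module cst whole)"
      then obtain g h where g: "q \<phi> = \<pi> g" "\<phi> = ?t g" and h: "q \<psi> = \<pi> h" "\<psi> = ?t h"
        using ex unfolding dual_self by metis
      have "\<psi> (\<pi> g) = \<phi> (\<pi> h)" unfolding g(2) h(2) t_val by (simp add: mult.commute)
      then show "\<psi> (q \<phi>) = \<phi> (q \<psi>)" by (simp only: g(1) h(1))
    qed
  qed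
qed

text \<open>Apply \<open>adapted_system_exists\<close> to the pairing on \<open>S\<close>, whose radical is \<open>I\<close>, with the filtration by the preimages
of the powers of \<open>\<mm>\<close>, and replace each vector by a representative modulo \<open>I\<close> of the right order. Vectors
with a dual system are independent modulo \<open>I\<close>; this bounds their number.\<close>

lemma adapted_basis_exists:
  assumes two: "(2 :: 'k) \<noteq> 0" and free: "free_of_rank d I"
    and lin: "linear_form \<eta>" and rad: "\<And>f. f \<in> I \<longleftrightarrow> (\<forall>g. \<eta> (f * g) = 0)" and N: "ord_ge N \<subseteq> I"
  obtains E n \<sigma> p where "adapted_basis I \<eta> d E n \<sigma> p"
proof -
  interpret V: vector_space "\<lambda>c f. cst c * f :: ('n, 'k) mpoly"
    by unfold_locales (simp_all add: distrib_left distrib_right cst_add cst_mult mult.assoc)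
  note lin' = linear_form_simps[OF lin]
  have "\<exists>m e n \<sigma> p. adapted_system (\<lambda>f g. \<eta> (f * g)) Fl m e n \<sigma> p \<and>
      (\<forall>x. (\<forall>a<m. \<eta> (x * e a) = 0) \<longrightarrow> (\<forall>y. \<eta> (x * y) = 0))"
  proof (rule V.adapted_system_exists[of "\<lambda>f g. \<eta> (f * g)" Fl N d])
    show "V.subspace (Fl i)" for i
    proof (rule V.subspaceI)
      fix c and f :: "('n, 'k) mpoly" assume "f \<in> Fl i"
      then show "cst c * f \<in> Fl i" using Fl_mult[of "cst c" 0 f i] Fl_0 by simp
    qed (use is_sub_simps[OF Fl_sub] in auto)
    show "\<eta> (f * g) = 0" if "f \<in> Fl N" for f g
    proof -
      obtain f' where f': "f' \<in> ord_ge N" "f - f' \<in> I" using \<open>f \<in> Fl N\<close> by (auto simp: Fl_iff)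
      have "(f - f') + f' \<in> I" using I_simps(2)[OF f'(2)] f'(1) N by blast
      then show ?thesis using rad[of f] by simp
    qed
    fix m and e f :: "nat \<Rightarrow> ('n, 'k) mpoly"
    assume ef: "\<And>a b. a < m \<Longrightarrow> b < m \<Longrightarrow> \<eta> (e a * f b) = (if a = b then 1 else 0)"
    show "m \<le> d"
    proof (rule independent_mod_le_rank[OF ideal_I free, where f = e])
      fix y assume y: "(\<Sum>j<m. cst (y j) * e j) \<in> I"
      show "\<forall>j<m. y j = 0"
      proof (intro allI impI)
        fix b assume b: "b < m"
        have "0 = \<eta> ((\<Sum>j<m. cst (y j) * e j) * f b)" using rad[of "\<Sum>j<m. cst (y j) * e j"] y by simp
        also have "\<dots> = (\<Sum>j<m. y j * \<eta> (e j * f b))" by (simp add: sum_distrib_right mult.assoc lin')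
        also have "\<dots> = (\<Sum>j<m. if j = b then y b else 0)" by (rule sum.cong) (use ef b in auto)
        finally show "y b = 0" using b by simp
      qed
    qed
  next
    fix m e n \<sigma> p
    assume "adapted_system (\<lambda>f g. \<eta> (f * g)) Fl m e n \<sigma> p"
      and "\<And>x y. (\<And>a. a < m \<Longrightarrow> \<eta> (x * e a) = 0) \<Longrightarrow> \<eta> (x * y) = 0"
    then show ?thesis by blast
  next
    show "\<eta> (f * g) = \<eta> (g * f)" for f g by (simp only: mult.commute)
    show "Fl (Suc i) \<subseteq> Fl i" for i by (rule Fl_antimono) simp
  qed (use two Fl_0 in \<open>auto simp: distrib_right mult.assoc lin'\<close>)
  then obtain m e n \<sigma> p where s: "adapted_system (\<lambda>f g. \<eta> (f * g)) Fl m e n \<sigma> p"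
    and nd: "\<And>x. (\<And>a. a < m \<Longrightarrow> \<eta> (x * e a) = 0) \<Longrightarrow> \<forall>y. \<eta> (x * y) = 0" by blast
  have "\<forall>a. \<exists>f. a < m \<longrightarrow> f \<in> ord_ge (n a) \<and> e a - f \<in> I"
    using s by (auto simp: adapted_system_def Fl_iff)
  then obtain E where E: "\<And>a. a < m \<Longrightarrow> E a \<in> ord_ge (n a)" "\<And>a. a < m \<Longrightarrow> e a - E a \<in> I" by metis
  have eE: "\<eta> (f * e a) = \<eta> (f * E a)" if "a < m" for f a
  proof -
    have "\<eta> ((e a - E a) * f) = 0" using rad E(2)[OF that] by blast
    then show ?thesis by (simp only: mult.commute[of _ f] right_diff_distrib lin' right_minus_eq)
  qed
  have eE': "\<eta> (e a * f) = \<eta> (E a * f)" if "a < m" for f a using eE[OF that] by (simp add: mult.commute)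
  have b: "adapted_basis I \<eta> m E n \<sigma> p"
  proof
    fix a b assume a: "a < m"
    show "\<sigma> a < m" "\<sigma> (\<sigma> a) = a" "p a \<noteq> 0" "p (\<sigma> a) = p a" using s a by (auto simp: adapted_system_def)
    note \<sigma>a = \<open>\<sigma> a < m\<close>
    show "\<eta> (E a * E b) = (if b = \<sigma> a then p a else 0)" if "b < m"
      using s a that unfolding adapted_system_def by (simp add: eE eE')
    show "l \<le> n a" if "f \<in> ord_ge l" "\<eta> (f * E (\<sigma> a)) \<noteq> 0" for f l
      using s a that ord_ge_Fl[OF that(1)] unfolding adapted_system_def by (simp add: eE[OF \<sigma>a, symmetric])
  next
    fix f assume z: "\<And>a. a < m \<Longrightarrow> \<eta> (f * E a) = 0"
    show "f \<in> I" unfolding rad by (rule nd) (simp add: z eE)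
  qed (fact lin rad E)+
  interpret adapted_basis I \<eta> m E n \<sigma> p by (rule b)
  have "free_of_rank m I" using degeneration_free[of "\<lambda>c. c" 1] id_comm_ring_hom by (simp add: degeneration_id)
  then have "m = d" using rank_unique[OF ideal_I _ free] by blast
  with b show thesis by (intro that) simp
qed

end

context adapted_local
begin

text \<open>The inverse Gram matrix of an adapted basis has the entries \<open>1 / p a\<close> at the positions \<open>(a, \<sigma> a)\<close>.\<close>

lemma quad_form_orientation:
  assumes q: "\<And>\<phi>. \<phi> \<in> carrier (dual_module cst whole) \<Longrightarrow> \<exists>g. q \<phi> = \<pi> g \<and> (\<forall>f. \<phi> (\<pi> f) = \<eta> (g * f))"
    and \<phi>: "\<phi> \<in> dual_space I" and \<psi>: "\<psi> \<in> dual_space I"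
  shows "quad_form [I] [q] 0 \<phi> \<psi> = block_form (\<lambda>c. c) 1 {..<d} \<phi> \<psi>"
proof -
  obtain g where g: "q (on_cosets whole \<phi>) = \<pi> g" "\<And>f. on_cosets whole \<phi> (\<pi> f) = \<eta> (g * f)"
    using q[OF on_cosets_whole(2)[OF \<phi>]] by blast
  have \<psi>': "linear_form \<psi>" "\<And>f. f \<in> I \<Longrightarrow> \<psi> f = 0" using \<psi> by (auto simp: dual_space_iff)
  have \<kappa>: "\<kappa> a g = \<phi> (E (\<sigma> a)) / p a" for a
    using g(2)[of "E (\<sigma> a)"] by (simp add: \<kappa>_def on_cosets_whole(1)[OF \<phi>])
  have "quad_form [I] [q] 0 \<phi> \<psi> = \<psi> g" by (simp add: quad_form_def g(1) on_cosets_whole(1)[OF \<psi>])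
  also have "\<dots> = (\<Sum>a<d. \<kappa> a g * \<psi> (E a))"
    using \<psi>'(2)[OF expand_mod_I[of g]] by (simp add: linear_form_simps[OF \<psi>'(1)])
  also have "\<dots> = (\<Sum>a<d. \<phi> (E (\<sigma> a)) / p a * \<psi> (E a))" by (simp add: \<kappa>)
  also have "\<dots> = (\<Sum>a<d. \<phi> (E (\<sigma> (\<sigma> a))) / p (\<sigma> a) * \<psi> (E (\<sigma> a)))"
    by (rule sum.reindex_bij_betw[OF bij_\<sigma>, symmetric])
  also have "\<dots> = block_form (\<lambda>c. c) 1 {..<d} \<phi> \<psi>"
    unfolding block_form_def U_def Y_def basis_elt_id by (rule sum.cong) (auto simp: \<sigma> p)
  finally show ?thesis .
qed

lemma gr_proj_kernel: "a_kernel \<S> G \<gamma> = limit_ideal (Suc s)"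
  by (simp add: a_kernel_def' X_top \<gamma>_hom)

lemma gr_cst_\<gamma>: "gr_cst I mm c = \<gamma> (cst c)"
  by (simp add: gr_cst_def \<gamma>_def)

lemma piece_quadric:
  assumes q': "q' = (\<lambda>\<phi>. \<theta> \<delta> (block_quadric \<delta> (\<lambda>Y\<in>carrier (P \<delta>). \<phi> (\<theta> \<delta> Y))))"
  shows "module_iso G (dual_module (gr_cst I mm) (M \<delta>)) (M \<delta>) q'" "symmetric_map (gr_cst I mm) (M \<delta>) q'"
proof -
  have c: "\<gamma> ` carrier \<S> = carrier G" by (simp add: carrier_gr)
  have u: "cst c \<in> carrier \<S>" for c :: 'k by simp
  note t = transport_quadric[OF \<theta>_iso c u gr_cst_\<gamma> P_closed block_quadric_iso block_quadric_symmetric q']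
  show "module_iso G (dual_module (gr_cst I mm) (M \<delta>)) (M \<delta>) q'" by (rule t(1))
  show "symmetric_map (gr_cst I mm) (M \<delta>) q'" by (rule t(2))
qed

lemma I_delta_neq_iff: "I_delta A mm \<delta> \<noteq> I_delta A mm (\<delta> + 1) \<longleftrightarrow> weight_block \<delta> \<noteq> {}"
  using vimage_I_delta[of \<delta>] vimage_I_delta[of "Suc \<delta>"] I_delta_X[of \<delta>] I_delta_X[of "Suc \<delta>"]
  by (metis Suc_eq_plus1 X_neq_iff)

lemma deltas_I_delta: "filter (\<lambda>\<delta>. I_delta A mm \<delta> \<noteq> I_delta A mm (\<delta> + 1)) (rev [0..<s + 1]) = deltas"
  unfolding I_delta_neq_iff deltas_def ..

lemma Js_flag: "butlast (remdups_adj (map (\<lambda>\<delta>. \<gamma> -` I_delta A mm \<delta>) (rev [0..<s + 2]))) = Js"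
proof -
  have "remdups_adj (map limit_ideal (rev [0..<Suc (Suc s)])) =
      limit_ideal (Suc s) # map limit_ideal (filter (\<lambda>\<delta>. limit_ideal \<delta> \<noteq> limit_ideal (Suc \<delta>)) (rev [0..<Suc s]))"
    by (rule remdups_adj_descending)
  also have "filter (\<lambda>\<delta>. limit_ideal \<delta> \<noteq> limit_ideal (Suc \<delta>)) (rev [0..<Suc s]) = deltas"
    by (simp add: deltas_def X_neq_iff)
  also have "limit_ideal (Suc s) # map limit_ideal deltas = Js @ [UNIV]" by (rule Js_chain[symmetric])
  finally show ?thesis by (simp add: vimage_I_delta)
qed

lemma limit_conclusion:
  assumes d: "0 < d" and pt: "iar_point d [I] [q]"
    and q: "\<And>\<phi>. \<phi> \<in> carrier (dual_module cst whole) \<Longrightarrow> \<exists>g. q \<phi> = \<pi> g \<and> (\<forall>f. \<phi> (\<pi> f) = \<eta> (g * f))"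
    and Fs: "Fs = butlast (remdups_adj (map (\<lambda>\<delta>. gr_proj I mm -` I_delta A mm \<delta>) (rev [0..<s + 2])))"
    and \<delta>s: "\<delta>s = filter (\<lambda>\<delta>. I_delta A mm \<delta> \<noteq> I_delta A mm (\<delta> + 1)) (rev [0..<s + 1])"
  shows "(\<forall>\<delta>. ideal (I_delta A mm \<delta>) G \<and> I_delta A mm (\<delta> + 1) \<subseteq> I_delta A mm \<delta> \<and>
       (\<exists>f. module_iso G (graded_module A (numer A mm \<delta>) (I_denom A mm \<delta>)) (I_module A mm \<delta>) f \<and>
          (\<forall>x. (\<forall>i. x i \<in> numer A mm \<delta> i) \<longrightarrow>
             f (\<lambda>i. I_denom A mm \<delta> i +>\<^bsub>A\<^esub> x i) = (\<lambda>i. ideal_pow A mm (i + 1) +>\<^bsub>A\<^esub> x i)))) \<and>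
    I_delta A mm 0 = carrier G \<and> I_delta A mm (s + 1) = {\<zero>\<^bsub>G\<^esub>} \<and>
    gr_proj I mm \<in> Ring.ring_hom \<S> G \<and> gr_proj I mm ` carrier \<S> = carrier G \<and>
    Fs \<noteq> [] \<and> Fs ! 0 = a_kernel \<S> G (gr_proj I mm) \<and>
    (\<exists>qs. is_torus_limit d [I] [q] Fs qs \<and> length qs = length \<delta>s \<and>
       (\<forall>j<length \<delta>s.
          let \<delta> = \<delta>s ! j;
              M = subquotient G (I_delta A mm \<delta>) (I_delta A mm (\<delta> + 1));
              \<theta> = (\<lambda>Y. I_delta A mm (\<delta> + 1) +>\<^bsub>G\<^esub> gr_proj I mm (SOME f. f \<in> Y));
              q' = (\<lambda>\<phi>. \<theta> ((qs ! j) (\<lambda>Y\<in>carrier (piece Fs j). \<phi> (\<theta> Y))))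
          in module_iso \<S> (piece Fs j) (restrict_scalars (gr_proj I mm) M) \<theta> \<and>
             module_iso G (dual_module (gr_cst I mm) M) M q' \<and>
             symmetric_map (gr_cst I mm) M q')) \<and>
    (\<forall>\<delta>. (\<exists>f. module_iso G (Q_module A mm \<delta>) (subquotient G (I_delta A mm \<delta>) (I_delta A mm (\<delta> + 1))) f \<and>
          (\<forall>x. (\<forall>i. x i \<in> numer A mm \<delta> i) \<longrightarrow>
             f (\<lambda>i. Q_denom A mm \<delta> i +>\<^bsub>A\<^esub> x i) =
               I_delta A mm (\<delta> + 1) +>\<^bsub>G\<^esub> (\<lambda>i. ideal_pow A mm (i + 1) +>\<^bsub>A\<^esub> x i))) \<and>
       self_dual G (gr_cst I mm) (Q_module A mm \<delta>))"
proof -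
  have Fs': "Fs = Js" unfolding Fs using Js_flag by (simp add: \<gamma>_def)
  have ds: "\<delta>s = deltas" unfolding \<delta>s by (rule deltas_I_delta)
  have ne: "deltas \<noteq> []" using d_pos_deltas d by simp
  have Js_ne: "Js \<noteq> []" using ne by (simp add: Js_def)
  have lim: "is_torus_limit d [I] [q] Fs qs"
    unfolding Fs' by (rule is_torus_limit_adapted[OF d pt quad_form_orientation[OF q]])
  show ?thesis unfolding ds
  proof (intro conjI allI exI[of _ qs])
    show "ideal (I_delta A mm \<delta>) G" "I_delta A mm (\<delta> + 1) \<subseteq> I_delta A mm \<delta>" for \<delta>
      using ideal_image_gr[OF X_ideal] I_delta_dec[of \<delta>] by (auto simp: I_delta_X)
  next
    fix \<delta> show "\<exists>f. module_iso G (graded_module A (numer A mm \<delta>) (I_denom A mm \<delta>)) (I_module A mm \<delta>) f \<and>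
      (\<forall>x. (\<forall>i. x i \<in> numer A mm \<delta> i) \<longrightarrow>
        f (\<lambda>i. I_denom A mm \<delta> i +>\<^bsub>A\<^esub> x i) = (\<lambda>i. ideal_pow A mm (i + 1) +>\<^bsub>A\<^esub> x i))"
      by (rule I_delta_iso)
  next
    show "I_delta A mm 0 = carrier G" by (rule I_delta_zero)
    show "I_delta A mm (s + 1) = {\<zero>\<^bsub>G\<^esub>}" by (rule I_delta_top)
    show "gr_proj I mm \<in> Ring.ring_hom \<S> G" using \<gamma>_ring_hom by (simp add: \<gamma>_def)
    show "gr_proj I mm ` carrier \<S> = carrier G" using carrier_gr by (simp add: \<gamma>_def)
    show "Fs \<noteq> []" unfolding Fs' by (rule Js_ne)
    have "Fs ! 0 = limit_ideal (Suc s)" using hd_Js[OF ne] Js_ne by (simp add: Fs' hd_conv_nth)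
    then show "Fs ! 0 = a_kernel \<S> G (gr_proj I mm)" using gr_proj_kernel by (simp add: \<gamma>_def)
    show "is_torus_limit d [I] [q] Fs qs" by (rule lim)
    show "length qs = length deltas" by (simp add: qs_def)
  next
    fix j
    show "j < length deltas \<longrightarrow>
       (let \<delta> = deltas ! j;
              M = subquotient G (I_delta A mm \<delta>) (I_delta A mm (\<delta> + 1));
              \<theta> = (\<lambda>Y. I_delta A mm (\<delta> + 1) +>\<^bsub>G\<^esub> gr_proj I mm (SOME f. f \<in> Y));
              q' = (\<lambda>\<phi>. \<theta> ((qs ! j) (\<lambda>Y\<in>carrier (piece Fs j). \<phi> (\<theta> Y))))
          in module_iso \<S> (piece Fs j) (restrict_scalars (gr_proj I mm) M) \<theta> \<and>
             module_iso G (dual_module (gr_cst I mm) M) M q' \<and>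
             symmetric_map (gr_cst I mm) M q')"
    proof
      assume j: "j < length deltas"
      define \<delta> where "\<delta> = deltas ! j"
      have pc: "piece Fs j = P \<delta>" unfolding Fs' \<delta>_def by (rule piece_Js[OF j])
      have qj: "qs ! j = block_quadric \<delta>" using j by (simp add: qs_def \<delta>_def)
      have th: "I_delta A mm (\<delta> + 1) +>\<^bsub>G\<^esub> gr_proj I mm (SOME f. f \<in> Y) = \<theta> \<delta> Y" for Y
        by (simp add: \<theta>_def qc_def \<gamma>_def)
      have M: "subquotient G (I_delta A mm \<delta>) (I_delta A mm (\<delta> + 1)) = M \<delta>" by (simp add: M_def)
      show "let \<delta> = deltas ! j;
              M = subquotient G (I_delta A mm \<delta>) (I_delta A mm (\<delta> + 1));
              \<theta> = (\<lambda>Y. I_delta A mm (\<delta> + 1) +>\<^bsub>G\<^esub> gr_proj I mm (SOME f. f \<in> Y));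
              q' = (\<lambda>\<phi>. \<theta> ((qs ! j) (\<lambda>Y\<in>carrier (piece Fs j). \<phi> (\<theta> Y))))
          in module_iso \<S> (piece Fs j) (restrict_scalars (gr_proj I mm) M) \<theta> \<and>
             module_iso G (dual_module (gr_cst I mm) M) M q' \<and>
             symmetric_map (gr_cst I mm) M q'"
        unfolding Let_def \<delta>_def[symmetric] th M pc qj
        using \<theta>_iso[of \<delta>] piece_quadric[OF refl, of \<delta>] by (simp add: \<gamma>_def)
    qed
  next
    fix \<delta>
    show "\<exists>f. module_iso G (Q_module A mm \<delta>) (subquotient G (I_delta A mm \<delta>) (I_delta A mm (\<delta> + 1))) f \<and>
      (\<forall>x. (\<forall>i. x i \<in> numer A mm \<delta> i) \<longrightarrow>
        f (\<lambda>i. Q_denom A mm \<delta> i +>\<^bsub>A\<^esub> x i) =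
          I_delta A mm (\<delta> + 1) +>\<^bsub>G\<^esub> (\<lambda>i. ideal_pow A mm (i + 1) +>\<^bsub>A\<^esub> x i))"
      by (rule Q_iso)
    show "self_dual G (gr_cst I mm) (Q_module A mm \<delta>)"
      by (rule self_dual_Q[OF piece_quadric[OF refl]]) (simp add: gr_cst_\<gamma> carrier_gr)
  qed
qed

end

section \<open>The limit of an oriented scheme\<close>

theorem theorem4p23:
  fixes I :: "('n::finite, 'k::field) mpoly set"
    and q :: "('n, 'k) quad"
    and d s :: nat
    and A :: "('n, 'k) mpoly set ring"
    and \<mm> :: "('n, 'k) mpoly set set"
    and G :: "(nat \<Rightarrow> ('n, 'k) mpoly set set) ring"
    and Id :: "nat \<Rightarrow> (nat \<Rightarrow> ('n, 'k) mpoly set set) set"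
    and Js :: "('n, 'k) mpoly set list"
    and \<delta>s :: "nat list"
  assumes char_not_2: "(2 :: 'k) \<noteq> 0"
    and d_pos: "1 \<le> d"
    and ideal_I: "ideal I \<S>"
    and degree: "free_of_rank d I"
    and support: "{P. primeideal P \<S> \<and> I \<subseteq> P} = {origin_ideal}"
    and A: "A = coord_ring I"
    and m: "{M. maximalideal M A} = {\<mm>}"
    and s: "s = max_power A \<mm>"
    and G: "G = gr A \<mm>"
    and Id: "Id = I_delta A \<mm>"
    and orient: "orientation I q"
      \<comment> \<open>the ideals of the schemes \<open>V(I\<^sub>s\<^sub>+\<^sub>1), \<dots>, V(I\<^sub>0)\<close> without repetitions and the empty scheme\<close>
    and Js: "Js = butlast (remdups_adj (map (\<lambda>\<delta>. gr_proj I \<mm> -` Id \<delta>) (rev [0..<s + 2])))"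
    and deltas: "\<delta>s = filter (\<lambda>\<delta>. Id \<delta> \<noteq> Id (\<delta> + 1)) (rev [0..<s + 1])"
  shows "\<comment> \<open>the ideals \<open>I\<^sub>\<delta>\<close> and their second description\<close>
    (\<forall>\<delta>. ideal (Id \<delta>) G \<and> Id (\<delta> + 1) \<subseteq> Id \<delta> \<and>
       (\<exists>f. module_iso G (graded_module A (numer A \<mm> \<delta>) (I_denom A \<mm> \<delta>)) (I_module A \<mm> \<delta>) f \<and>
          (\<forall>x. (\<forall>i. x i \<in> numer A \<mm> \<delta> i) \<longrightarrow>
             f (\<lambda>i. I_denom A \<mm> \<delta> i +>\<^bsub>A\<^esub> x i) = (\<lambda>i. ideal_pow A \<mm> (i + 1) +>\<^bsub>A\<^esub> x i)))) \<and>
    Id 0 = carrier G \<and> Id (s + 1) = {\<zero>\<^bsub>G\<^esub>} \<and>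
    \<comment> \<open>\<open>Spec(gr(A))\<close> as a closed subscheme of affine space, and \<open>Z\<^sub>0 \<simeq> Spec(gr(A))\<close>\<close>
    gr_proj I \<mm> \<in> Ring.ring_hom \<S> G \<and> gr_proj I \<mm> ` carrier \<S> = carrier G \<and>
    Js \<noteq> [] \<and> Js ! 0 = a_kernel \<S> G (gr_proj I \<mm>) \<and>
    \<comment> \<open>the limit\<close>
    (\<exists>qs. is_torus_limit d [I] [q] Js qs \<and> length qs = length \<delta>s \<and>
       (\<forall>j<length \<delta>s.
          let \<delta> = \<delta>s ! j;
              M = subquotient G (Id \<delta>) (Id (\<delta> + 1));
              \<theta> = (\<lambda>Y. Id (\<delta> + 1) +>\<^bsub>G\<^esub> gr_proj I \<mm> (SOME f. f \<in> Y));
              q' = (\<lambda>\<phi>. \<theta> ((qs ! j) (\<lambda>Y\<in>carrier (piece Js j). \<phi> (\<theta> Y))))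
          in module_iso \<S> (piece Js j) (restrict_scalars (gr_proj I \<mm>) M) \<theta> \<and>
             module_iso G (dual_module (gr_cst I \<mm>) M) M q' \<and>
             symmetric_map (gr_cst I \<mm>) M q')) \<and>
    \<comment> \<open>the subquotients\<close>
    (\<forall>\<delta>. (\<exists>f. module_iso G (Q_module A \<mm> \<delta>) (subquotient G (Id \<delta>) (Id (\<delta> + 1))) f \<and>
          (\<forall>x. (\<forall>i. x i \<in> numer A \<mm> \<delta> i) \<longrightarrow>
             f (\<lambda>i. Q_denom A \<mm> \<delta> i +>\<^bsub>A\<^esub> x i) =
               Id (\<delta> + 1) +>\<^bsub>G\<^esub> (\<lambda>i. ideal_pow A \<mm> (i + 1) +>\<^bsub>A\<^esub> x i))) \<and>
       self_dual G (gr_cst I \<mm>) (Q_module A \<mm> \<delta>))"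
proof -
  interpret coordinate_quotient I by (rule coordinate_quotient.intro[OF ideal_I])
  have I1: "I \<subseteq> ord_ge 1" using support by (auto simp: origin_ideal_eq)
  have mm: "\<mm> = mm" using m maximal_mm[OF I1] unfolding A by blast
  \<comment> \<open>this makes the set in the definition of \<open>s\<close> finite\<close>
  obtain N where N: "ord_ge N \<subseteq> I" by (rule local_nilpotent[OF ideal_I degree support])
  interpret local_quotient I s
    by unfold_locales (use ord_ge_max_power[OF N] in \<open>simp_all add: s A mm\<close>)
  obtain \<eta> where \<eta>: "linear_form \<eta>" "\<And>f. f \<in> I \<longleftrightarrow> (\<forall>g. \<eta> (f * g) = 0)"
    and q: "\<And>\<phi>. \<phi> \<in> carrier (dual_module cst whole) \<Longrightarrow> \<exists>g. q \<phi> = \<pi> g \<and> (\<forall>f. \<phi> (\<pi> f) = \<eta> (g * f))"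
    and q_iso: "module_iso \<S> (dual_module cst whole) whole q" and q_sym: "symmetric_map cst whole q"
    by (rule orientation_functional[OF orient]) blast
  obtain E n \<sigma> p where "adapted_basis I \<eta> d E n \<sigma> p"
    by (rule adapted_basis_exists[OF char_not_2 degree \<eta> N])
  then interpret adapted_basis I \<eta> d E n \<sigma> p .
  interpret adapted_local I \<eta> d E n \<sigma> p s ..
  have pt: "iar_point d [I] [q]"
    unfolding iar_point_def
  proof (intro conjI allI impI)
    have "(1 :: ('n, 'k) mpoly) \<notin> ord_ge 1" by (auto simp: ord_ge_def lookup_one intro!: exI[of _ 0])
    then have "I \<noteq> UNIV" using I1 by blast
    moreover fix j assume "j < length [I]"
    ultimately show "[I] ! j \<subset> next_ideal [I] j"
      and "module_iso \<S> (dual_module cst (piece [I] j)) (piece [I] j) ([q] ! j)"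
      and "symmetric_map cst (piece [I] j) ([q] ! j)"
      using q_iso q_sym by (auto simp: next_ideal_def)
  qed (use ideal_I degree in auto)
  show ?thesis
    unfolding G Id A mm
    by (rule limit_conclusion[OF _ pt q]) (use d_pos Js deltas in \<open>simp_all add: Id A mm\<close>)
qed

end
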